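(* If $\mathcal{M}$ is a hyperfinite von Neumann algebra with a tracial state $\tau$, then $\mathfrak{K}_2(\mathcal{M})=0$.
   Context: Tracial states are faithful and normal. Let $\mathcal{M}_k(\mathbb{C})$ be the $k\times k$ complex matrices, $\tau_k=\frac1k Tr$, $\mathcal{U}(k)$ the unitary group, and $\|(A_1,\ldots,A_n)\|_2^2=\sum_j\tau_k(A_j^*A_j)$ on $\mathcal{M}_k(\mathbb{C})^n$; $\|\cdot\|$ is the operator norm. For $R,\epsilon>0$ and $m,k\in\mathbb{N}$, $\Gamma_R(x_1,\ldots,x_n;m,k,\epsilon)$ is the set of $(A_1,\ldots,A_n)\in\mathcal{M}_k(\mathbb{C})^n$ with $\|A_j\|\le R$ for all $j$ and $|\tau_k(A_{i_1}^{\eta_1}\cdots A_{i_q}^{\eta_q})-\tau(x_{i_1}^{\eta_1}\cdots x_{i_q}^{\eta_q})|<\epsilon$ for all $1\le q\le m$, $1\le i_1,\ldots,i_q\le n$, $\eta_1,\ldots,\eta_q\in\{1,*\}$. For $\omega>0$, the $\omega$-orbit-ball $\mathcal{U}(B_1,\ldots,B_n;\omega)$ is the set of $(A_1,\ldots,A_n)\in\mathcal{M}_k(\mathbb{C})^n$ for which there is $W\in\mathcal{U}(k)$ with $\|(A_1,\ldots,A_n)-(WB_1W^*,\ldots,WB_nW^* )\|_2<\omega$. The $\omega$-orbit covering number $\nu(\Gamma_R(x_1,\ldots,x_n;m,k,\epsilon),\omega)$ is the minimal number of $\omega$-orbit-balls with centers in $\Gamma_R(x_1,\ldots,x_n;m,k,\epsilon)$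 that cover this set (by convention $\nu(\emptyset,\omega)=1$, so that the quantities below are $\ge0$ for $0<\omega<1$). Define $$\mathfrak{K}(x_1,\ldots,x_n;\omega,R)=\inf_{m\in\mathbb{N},\epsilon>0}\limsup_{k\to\infty}\frac{\log\nu(\Gamma_R(x_1,\ldots,x_n;m,k,\epsilon),\omega)}{-k^2\log\omega},$$ $\mathfrak{K}(x_1,\ldots,x_n;\omega)=\sup_{R>0}\mathfrak{K}(x_1,\ldots,x_n;\omega,R)$, and $\mathfrak{K}_2(x_1,\ldots,x_n)=\sup_{0<\omega<1}\mathfrak{K}(x_1,\ldots,x_n;\omega)$. For a finitely generated von Neumann algebra $\mathcal{M}$ with tracial state $\tau$, the upper free orbit-dimension $\mathfrak{K}_2(\mathcal{M})$ is the supremum of $\mathfrak{K}_2(x_1,\ldots,x_n)$ over all finite families $x_1,\ldots,x_n$ that generate $\mathcal{M}$ as a von Neumann algebra. Since $\mathfrak{K}_2$ is defined only for finitely generated algebras, any algebra to which it is applied is understood to be finitely generated. *)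

theory Defs
  imports "HOL-Analysis.Analysis" "Jordan_Normal_Form.Schur_Decomposition"
begin

section \<open>Complex Hilbert spaces and bounded operators\<close>

text \<open>The inner product is linear in its first argument; its real part is the inner product of
  the underlying real Hilbert space, so that the norm and the topology are the library ones.\<close>

class complex_hilbert_space = real_inner + complete_space +
  fixes scaleC :: "complex \<Rightarrow> 'a \<Rightarrow> 'a"  (infixr \<open>*\<^sub>C\<close> 75)
    and cinner :: "'a \<Rightarrow> 'a \<Rightarrow> complex"
  assumes scaleC_add_right: "c *\<^sub>C (x + y) = c *\<^sub>C x + c *\<^sub>C y"
    and scaleC_add_left: "(c + d) *\<^sub>C x = c *\<^sub>C x + d *\<^sub>C x"
    and scaleC_scaleC: "c *\<^sub>C (d *\<^sub>C x) = (c * d) *\<^sub>C x"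
    and scaleC_of_real: "complex_of_real r *\<^sub>C x = r *\<^sub>R x"
    and cinner_commute: "cinner x y = cnj (cinner y x)"
    and cinner_add_left: "cinner (x + y) z = cinner x z + cinner y z"
    and cinner_scaleC_left: "cinner (c *\<^sub>C x) y = c * cinner x y"
    and Re_cinner: "Re (cinner x y) = inner x y"

text \<open>Operators are functions on the Hilbert space: the product is \<open>\<circ>\<close>, the unit is \<open>id\<close>,
  and sums and scalar multiples are taken pointwise.\<close>

definition bounded_operator :: "('h::complex_hilbert_space \<Rightarrow> 'h) \<Rightarrow> bool" where
  "bounded_operator a \<longleftrightarrow> bounded_linear a \<and> (\<forall>c x. a (c *\<^sub>C x) = c *\<^sub>C a x)"

definition adj :: "('h::complex_hilbert_space \<Rightarrow> 'h) \<Rightarrow> ('h \<Rightarrow> 'h)" where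
  "adj a = (THE b. bounded_operator b \<and> (\<forall>x y. cinner (a x) y = cinner x (b y)))"

section \<open>Von Neumann algebras\<close>

definition commutant :: "('h::complex_hilbert_space \<Rightarrow> 'h) set \<Rightarrow> ('h \<Rightarrow> 'h) set" where
  "commutant S = {a. bounded_operator a \<and> (\<forall>b\<in>S. a \<circ> b = b \<circ> a)}"

definition von_neumann_algebra :: "('h::complex_hilbert_space \<Rightarrow> 'h) set \<Rightarrow> bool" where
  "von_neumann_algebra M \<longleftrightarrow> (\<forall>a\<in>M. adj a \<in> M) \<and> commutant (commutant M) = M"

definition star_subalgebra :: "('h::complex_hilbert_space \<Rightarrow> 'h) set \<Rightarrow> bool" where
  "star_subalgebra N \<longleftrightarrow>
     (\<forall>a\<in>N. bounded_operator a \<and> adj a \<in> N) \<and> (\<lambda>v. 0) \<in> N \<and>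
     (\<forall>a\<in>N. \<forall>b\<in>N. (\<lambda>v. a v + b v) \<in> N \<and> a \<circ> b \<in> N) \<and>
     (\<forall>a\<in>N. \<forall>c. (\<lambda>v. c *\<^sub>C a v) \<in> N)"

definition finite_dim :: "('h::complex_hilbert_space \<Rightarrow> 'h) set \<Rightarrow> bool" where
  "finite_dim N \<longleftrightarrow> (\<exists>F. finite F \<and> N = {\<lambda>v. \<Sum>b\<in>F. c b *\<^sub>C b v | c. True})"

text \<open>The members of the sequence need not contain the identity; the von Neumann algebra
  generated by their union, i.e.\ the smallest one containing it, always does.\<close>

definition hyperfinite :: "('h::complex_hilbert_space \<Rightarrow> 'h) set \<Rightarrow> bool" where
  "hyperfinite M \<longleftrightarrow>
     (\<exists>N :: nat \<Rightarrow> ('h \<Rightarrow> 'h) set.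
        (\<forall>i. star_subalgebra (N i) \<and> finite_dim (N i) \<and> N i \<subseteq> N (Suc i)) \<and>
        von_neumann_algebra hull (\<Union>i. N i) = M)"

definition generating_family ::
  "('h::complex_hilbert_space \<Rightarrow> 'h) set \<Rightarrow> ('h \<Rightarrow> 'h) list \<Rightarrow> bool" where
  "generating_family M xs \<longleftrightarrow>
     xs \<noteq> [] \<and> set xs \<subseteq> M \<and> von_neumann_algebra hull (set xs) = M"

definition finitely_generated :: "('h::complex_hilbert_space \<Rightarrow> 'h) set \<Rightarrow> bool" where
  "finitely_generated M \<longleftrightarrow> (\<exists>xs. generating_family M xs)"

text \<open>The ultraweak (sigma-weak) topology on the bounded operators is the initial topology for the
  functionals \<open>a \<mapsto> \<Sum>\<^sub>n \<langle>a \<xi>\<^sub>n, \<eta>\<^sub>n\<rangle>\<close> with square-summable sequences \<open>\<xi>\<close> and \<open>\<eta>\<close>.\<close>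

definition ultraweak_topology :: "('h::complex_hilbert_space \<Rightarrow> 'h) topology" where
  "ultraweak_topology = topology_generated_by
     {{a. bounded_operator a \<and> (\<Sum>n. cinner (a (\<xi> n)) (\<eta> n)) \<in> U} | \<xi> \<eta> U.
        summable (\<lambda>n. (norm (\<xi> n))\<^sup>2) \<and> summable (\<lambda>n. (norm (\<eta> n))\<^sup>2) \<and> open U}"

definition normal_functional ::
  "('h::complex_hilbert_space \<Rightarrow> 'h) set \<Rightarrow> (('h \<Rightarrow> 'h) \<Rightarrow> complex) \<Rightarrow> bool" where
  "normal_functional M \<phi> \<longleftrightarrow> continuous_map (subtopology ultraweak_topology M) euclidean \<phi>"

text \<open>Tracial states are faithful and normal by convention. Only the values of \<open>\<tau>\<close> on \<open>M\<close>
  matter.\<close>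

definition tracial_state ::
  "('h::complex_hilbert_space \<Rightarrow> 'h) set \<Rightarrow> (('h \<Rightarrow> 'h) \<Rightarrow> complex) \<Rightarrow> bool" where
  "tracial_state M \<tau> \<longleftrightarrow>
     (\<forall>a\<in>M. \<forall>b\<in>M. \<tau> (\<lambda>v. a v + b v) = \<tau> a + \<tau> b) \<and>
     (\<forall>a\<in>M. \<forall>c. \<tau> (\<lambda>v. c *\<^sub>C a v) = c * \<tau> a) \<and>
     \<tau> id = 1 \<and>
     (\<forall>a\<in>M. \<tau> (adj a \<circ> a) \<in> \<real>\<^sub>\<ge>\<^sub>0) \<and>
     (\<forall>a\<in>M. \<forall>b\<in>M. \<tau> (a \<circ> b) = \<tau> (b \<circ> a)) \<and>
     (\<forall>a\<in>M. \<tau> (adj a \<circ> a) = 0 \<longrightarrow> a = (\<lambda>v. 0)) \<and>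
     normal_functional M \<tau>"

section \<open>Matrices\<close>

definition ntrace :: "complex mat \<Rightarrow> complex" where
  "ntrace A = (\<Sum>i<dim_row A. A $$ (i, i)) / of_nat (dim_row A)"

definition unitary_group :: "nat \<Rightarrow> complex mat set" where
  "unitary_group k =
     {W \<in> carrier_mat k k. W * mat_adjoint W = 1\<^sub>m k \<and> mat_adjoint W * W = 1\<^sub>m k}"

definition vec_norm2 :: "complex vec \<Rightarrow> real" where
  "vec_norm2 v = sqrt (\<Sum>i<dim_vec v. (cmod (vec_index v i))\<^sup>2)"

definition mat_opnorm :: "complex mat \<Rightarrow> real" where
  "mat_opnorm A = (SUP v\<in>{v \<in> carrier_vec (dim_col A). vec_norm2 v \<le> 1}. vec_norm2 (A *\<^sub>v v))"

text \<open>Tuples of matrices are lists.\<close>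

definition tuple_norm2 :: "complex mat list \<Rightarrow> real" where
  "tuple_norm2 As = sqrt (\<Sum>A\<leftarrow>As. Re (ntrace (mat_adjoint A * A)))"

definition mat_tuples :: "nat \<Rightarrow> nat \<Rightarrow> complex mat list set" where
  "mat_tuples n k = {As. length As = n \<and> set As \<subseteq> carrier_mat k k}"

section \<open>Microstates and the upper free orbit-dimension\<close>

text \<open>A word is a list of letters \<open>(i, s)\<close>, standing for the \<open>i\<close>-th variable if \<open>\<not> s\<close> and for its
  adjoint if \<open>s\<close>. Indices start from 0.\<close>

type_synonym word = "(nat \<times> bool) list"

definition words :: "nat \<Rightarrow> nat \<Rightarrow> word set" where
  "words n m = {w. 1 \<le> length w \<and> length w \<le> m \<and> (\<forall>(i, s)\<in>set w. i < n)}"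

definition op_word :: "('h::complex_hilbert_space \<Rightarrow> 'h) list \<Rightarrow> word \<Rightarrow> ('h \<Rightarrow> 'h)" where
  "op_word xs w = foldr (\<lambda>(i, s) b. (if s then adj (xs ! i) else xs ! i) \<circ> b) w id"

definition mat_word :: "nat \<Rightarrow> complex mat list \<Rightarrow> word \<Rightarrow> complex mat" where
  "mat_word k As w =
     foldr (\<lambda>(i, s) B. (if s then mat_adjoint (As ! i) else As ! i) * B) w (1\<^sub>m k)"

definition microstates ::
  "(('h::complex_hilbert_space \<Rightarrow> 'h) \<Rightarrow> complex) \<Rightarrow> real \<Rightarrow> ('h \<Rightarrow> 'h) list \<Rightarrow>
   nat \<Rightarrow> nat \<Rightarrow> real \<Rightarrow> complex mat list set" where
  "microstates \<tau> R xs m k \<epsilon> =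
     {As \<in> mat_tuples (length xs) k.
        (\<forall>A\<in>set As. mat_opnorm A \<le> R) \<and>
        (\<forall>w\<in>words (length xs) m. cmod (ntrace (mat_word k As w) - \<tau> (op_word xs w)) < \<epsilon>)}"

definition orbit_ball :: "nat \<Rightarrow> complex mat list \<Rightarrow> real \<Rightarrow> complex mat list set" where
  "orbit_ball k Bs \<omega> =
     {As \<in> mat_tuples (length Bs) k.
        \<exists>W\<in>unitary_group k.
          tuple_norm2 (map2 (\<lambda>A B. A - W * B * mat_adjoint W) As Bs) < \<omega>}"

text \<open>Sets of microstates are bounded in a finite-dimensional space, so for \<open>\<omega> > 0\<close> the minimum
  below is taken over a nonempty set of natural numbers.\<close>

definition orbit_covering_number :: "nat \<Rightarrow> complex mat list set \<Rightarrow> real \<Rightarrow> nat" where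
  "orbit_covering_number k \<Gamma> \<omega> =
     (if \<Gamma> = {} then 1
      else LEAST N. \<exists>C. C \<subseteq> \<Gamma> \<and> finite C \<and> card C = N \<and> \<Gamma> \<subseteq> (\<Union>B\<in>C. orbit_ball k B \<omega>))"

definition orbit_dim_R ::
  "(('h::complex_hilbert_space \<Rightarrow> 'h) \<Rightarrow> complex) \<Rightarrow> ('h \<Rightarrow> 'h) list \<Rightarrow> real \<Rightarrow> real \<Rightarrow> ereal" where
  "orbit_dim_R \<tau> xs \<omega> R =
     (INF (m, \<epsilon>)\<in>{1..} \<times> {0<..}.
        limsup (\<lambda>k. ereal (ln (real (orbit_covering_number k (microstates \<tau> R xs m k \<epsilon>) \<omega>))
                      / (- (real k)\<^sup>2 * ln \<omega>))))"

definition orbit_dim ::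
  "(('h::complex_hilbert_space \<Rightarrow> 'h) \<Rightarrow> complex) \<Rightarrow> ('h \<Rightarrow> 'h) list \<Rightarrow> real \<Rightarrow> ereal" where
  "orbit_dim \<tau> xs \<omega> = (SUP R\<in>{0<..}. orbit_dim_R \<tau> xs \<omega> R)"

definition upper_orbit_dim ::
  "(('h::complex_hilbert_space \<Rightarrow> 'h) \<Rightarrow> complex) \<Rightarrow> ('h \<Rightarrow> 'h) list \<Rightarrow> ereal" where
  "upper_orbit_dim \<tau> xs = (SUP \<omega>\<in>{0<..<1}. orbit_dim \<tau> xs \<omega>)"

definition upper_free_orbit_dimension ::
  "('h::complex_hilbert_space \<Rightarrow> 'h) set \<Rightarrow> (('h \<Rightarrow> 'h) \<Rightarrow> complex) \<Rightarrow> ereal" where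
  "upper_free_orbit_dimension M \<tau> = (SUP xs\<in>{xs. generating_family M xs}. upper_orbit_dim \<tau> xs)"

end

(*
  Idea.  Given generators x of M and a tolerance, hyperfiniteness and normality of the trace yield a
  finite-dimensional unital *-subalgebra N of M and y_j in N close to x_j in 2-norm.  Choose a basis
  a_1, ..., a_d of N, orthonormal for the trace of the left regular representation L of N, so that
  sum_l a_l a_l* = 1, and polynomials p_l with p_l(x) close to a_l*.  For a microstate A of x the
  column V = sum_l e_l (x) p_l(A) is almost an isometry from C^k to C^d (x) C^k and almost intertwines
  A_j with L(y_j) (x) 1; its polar part is an isometry with the same property.  The range projection P
  of that isometry almost commutes with L(N) (x) 1, hence is close to
  H = sum_s L(a_s) P L(a_s)*, and H commutes with L(N) (x) 1 exactly.

  Every common invariant subspace of H and L(N) (x) 1 contains the orbit L(N)v of an eigenvector v of H,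
  which has dimension at most d.  So a unitary U diagonalizes H and makes all of L(N) (x) 1 banded of
  width d, and rounding the entries of U*HU and of U*(L(y_j) (x) 1)U leaves exp(O(k)) possibilities.
  If two microstates give the same rounded entries, then the unitary between the two models almost maps
  one range projection to the other, and a polar decomposition turns it into a unitary of C^k that
  almost conjugates one microstate into the other.  Thus the covering numbers are exp(O(k)), and
  dividing their logarithms by k^2 gives 0 in the limit.
*)
theory Submission
  imports Defs "Jordan_Normal_Form.Spectral_Radius"
begin

section \<open>Hilbert spaces\<close>

text \<open>The approximants supplied by the density theorem carry no bound on their operator norms,
  and this shapes the estimates. The column \<open>V\<close> is known to be near an isometry only
  through \<open>star V' * V\<close> for a second column \<open>V'\<close> chosen before it, and the
  distance to the polar part is controlled in the 2-norm through a trace. Bounded multipliers are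
  still required for showing that the range projection almost commutes with the algebra: they come
  from a coarser set of polynomials \<open>q\<close> for the basis, fixed in advance, whose operator
  bound on microstates enters the tolerance demanded of \<open>p\<close>. The regular representation
  takes the place of matrix units. It is the same concrete algebra for every microstate, so no exact
  copy of the finite-dimensional algebra has to be lifted to the microstates. The price is a
  multiplicity \<open>d\<close>, harmless because \<open>d\<close> is fixed before the matrix size
  \<open>k\<close>. What the band gains is the count: about \<open>2 * d\<close> entries per row
  leave a number of choices exponential in \<open>k\<close>, whereas rounding full matrices would
  leave one exponential in the square of \<open>k\<close>, which survives the division by that
  square.\<close>

lemma scaleC_one [simp]: "(1::complex) *\<^sub>C x = (x::'a::complex_hilbert_space)"
  using scaleC_of_real[of 1 x] by simp

lemma scaleC_zero_left [simp]: "(0::complex) *\<^sub>C x = (0::'a::complex_hilbert_space)"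
  using scaleC_of_real[of 0 x] by simp

lemma scaleC_zero_right [simp]: "c *\<^sub>C (0::'a::complex_hilbert_space) = 0"
  using scaleC_add_right[of c 0 "0::'a"] by simp

lemma scaleC_minus_right: "c *\<^sub>C (- x) = - (c *\<^sub>C (x::'a::complex_hilbert_space))"
  using scaleC_add_right[of c x "- x"] by (simp add: eq_neg_iff_add_eq_0 add.commute)

lemma scaleC_minus1_left: "(-1) *\<^sub>C x = - (x::'a::complex_hilbert_space)"
  using scaleC_of_real[of "-1" x] by simp

lemma scaleC_diff_right: "c *\<^sub>C (x - y) = c *\<^sub>C x - c *\<^sub>C (y::'a::complex_hilbert_space)"
  using scaleC_add_right[of c x "- y"] by (simp add: scaleC_minus_right)

lemma scaleR_scaleC: "r *\<^sub>R x = complex_of_real r *\<^sub>C (x::'a::complex_hilbert_space)"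
  by (simp add: scaleC_of_real)

lemma cinner_add_right: "cinner x (y + z) = cinner x y + cinner x (z::'a::complex_hilbert_space)"
  by (metis cinner_commute cinner_add_left complex_cnj_add)

lemma cinner_scaleC_right: "cinner x (c *\<^sub>C y) = cnj c * cinner x (y::'a::complex_hilbert_space)"
  by (metis cinner_commute cinner_scaleC_left complex_cnj_mult)

lemma cinner_zero_left [simp]: "cinner 0 (y::'a::complex_hilbert_space) = 0"
  using cinner_scaleC_left[of 0 0 y] by simp

lemma cinner_zero_right [simp]: "cinner (y::'a::complex_hilbert_space) 0 = 0"
  using cinner_scaleC_right[of y 0 0] by simp

lemma cinner_minus_left: "cinner (- x) y = - cinner x (y::'a::complex_hilbert_space)"
  using cinner_scaleC_left[of "-1" x y] by (simp add: scaleC_minus1_left)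

lemma cinner_diff_left: "cinner (x - y) z = cinner x z - cinner y (z::'a::complex_hilbert_space)"
  using cinner_add_left[of x "- y" z] by (simp add: cinner_minus_left)

lemma cinner_self: "cinner x x = complex_of_real ((norm (x::'a::complex_hilbert_space))\<^sup>2)"
proof (rule complex_eqI)
  have "Im (cinner x x) = - Im (cinner x x)"
    using arg_cong[OF cinner_commute[of x x], of Im] by simp
  then show "Im (cinner x x) = Im (complex_of_real ((norm x)\<^sup>2))" by simp
  show "Re (cinner x x) = Re (complex_of_real ((norm x)\<^sup>2))"
    by (simp add: Re_cinner dot_square_norm)
qed

lemma norm_scaleC: "norm (c *\<^sub>C x) = cmod c * norm (x::'a::complex_hilbert_space)"
proof -
  have "complex_of_real ((norm (c *\<^sub>C x))\<^sup>2) = (c * cnj c) * cinner x x"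
    unfolding cinner_self[symmetric] by (simp add: cinner_scaleC_left cinner_scaleC_right mult_ac)
  also have "\<dots> = complex_of_real ((cmod c * norm x)\<^sup>2)"
    unfolding cinner_self complex_norm_square[symmetric] by (simp add: power_mult_distrib)
  finally have "complex_of_real ((norm (c *\<^sub>C x))\<^sup>2) = complex_of_real ((cmod c * norm x)\<^sup>2)" .
  then have "(norm (c *\<^sub>C x))\<^sup>2 = (cmod c * norm x)\<^sup>2"
    using of_real_eq_iff by blast
  then show ?thesis by (simp add: power2_eq_iff_nonneg)
qed

text \<open>The real Cauchy-Schwarz inequality applies once \<open>x\<close> is rotated by a phase
  \<open>u\<close> that makes the inner product real and nonnegative.\<close>

lemma cmod_cinner_le: "cmod (cinner x y) \<le> norm x * norm (y::'a::complex_hilbert_space)"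
proof -
  define c where "c = cinner x y"
  define u where "u = (if c = 0 then 1 else cnj c / cmod c)"
  have u: "cmod u = 1" "u * c = cmod c"
    by (auto simp: u_def norm_divide complex_norm_square[symmetric] mult.commute)
       (simp add: complex_norm_square power2_eq_square)
  have "cmod c = Re (cinner (u *\<^sub>C x) y)"
    using u(2) by (simp add: cinner_scaleC_left c_def)
  also have "\<dots> = inner (u *\<^sub>C x) y" by (rule Re_cinner)
  also have "\<dots> \<le> norm (u *\<^sub>C x) * norm y" by (rule norm_cauchy_schwarz)
  finally show ?thesis by (simp add: norm_scaleC u c_def)
qed

lemma cinner_ext:
  assumes "\<And>z. cinner x z = cinner (y::'a::complex_hilbert_space) z"
  shows "x = y"
proof -
  have "cinner (x - y) (x - y) = 0" by (simp add: cinner_diff_left assms)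
  then show ?thesis by (simp add: cinner_self)
qed

lemma bounded_linear_cinner_left: "bounded_linear (\<lambda>x. cinner x (y::'a::complex_hilbert_space))"
  by (rule bounded_linear_intro[where K = "norm y"])
     (auto simp: cinner_add_left scaleR_scaleC cinner_scaleC_left scaleR_conv_of_real cmod_cinner_le)

lemma bounded_linear_scaleC: "bounded_linear (\<lambda>x::'a::complex_hilbert_space. c *\<^sub>C x)"
  by (rule bounded_linear_intro[where K = "cmod c"])
     (auto simp: scaleC_add_right scaleR_scaleC scaleC_scaleC norm_scaleC mult.commute)

section \<open>Nearest points, orthogonal decomposition and the Riesz representation\<close>

definition csubspace :: "'a::complex_hilbert_space set \<Rightarrow> bool" where
  "csubspace S \<longleftrightarrow> 0 \<in> S \<and> (\<forall>x\<in>S. \<forall>y\<in>S. x + y \<in> S) \<and> (\<forall>x\<in>S. \<forall>c. c *\<^sub>C x \<in> S)"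

lemma csubspaceD:
  assumes "csubspace S"
  shows "0 \<in> S" "x \<in> S \<Longrightarrow> y \<in> S \<Longrightarrow> x + y \<in> S" "x \<in> S \<Longrightarrow> c *\<^sub>C x \<in> S"
    "x \<in> S \<Longrightarrow> y \<in> S \<Longrightarrow> x - y \<in> S" "x \<in> S \<Longrightarrow> r *\<^sub>R x \<in> S"
proof -
  show a: "0 \<in> S" "x \<in> S \<Longrightarrow> y \<in> S \<Longrightarrow> x + y \<in> S" "x \<in> S \<Longrightarrow> c *\<^sub>C x \<in> S" for x y c
    using assms by (auto simp: csubspace_def)
  show "x \<in> S \<Longrightarrow> y \<in> S \<Longrightarrow> x - y \<in> S"
    using a(2)[of x "(-1) *\<^sub>C y"] a(3)[of y "-1"] by (simp add: scaleC_minus1_left)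
  show "x \<in> S \<Longrightarrow> r *\<^sub>R x \<in> S" using a(3)[of x "of_real r"] by (simp add: scaleC_of_real)
qed

text \<open>A minimizing sequence is Cauchy by the parallelogram law: the midpoint of two members
  lies in \<open>S\<close>, hence is no closer to \<open>x\<close> than the infimum. The infimum
  \<open>d\<close> is one of squared distances, which suit that law.\<close>

lemma exists_nearest_point:
  fixes S :: "'a::complex_hilbert_space set"
  assumes S: "csubspace S" "closed S"
  shows "\<exists>y\<in>S. \<forall>z\<in>S. norm (x - y) \<le> norm (x - z)"
proof -
  define d where "d = (INF y\<in>S. (norm (x - y))\<^sup>2)"
  have bdd: "bdd_below ((\<lambda>y. (norm (x - y))\<^sup>2) ` S)" by (rule bdd_belowI[of _ 0]) auto
  have ne: "S \<noteq> {}" using csubspaceD(1)[OF S(1)] by auto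
  have dle: "d \<le> (norm (x - y))\<^sup>2" if "y \<in> S" for y
    unfolding d_def using bdd that by (rule cINF_lower)
  have "\<exists>y\<in>S. (norm (x - y))\<^sup>2 < d + 1 / real (Suc n)" for n
    using cINF_less_iff[OF ne bdd, of "d + 1 / real (Suc n)"] unfolding d_def[symmetric] by simp
  then obtain y where y: "\<And>n. y n \<in> S" "\<And>n. (norm (x - y n))\<^sup>2 < d + 1 / real (Suc n)" by metis
  have par: "(norm (y m - y n))\<^sup>2 \<le> 2 / real (Suc m) + 2 / real (Suc n)" for m n
  proof -
    have "(1/2) *\<^sub>R (y m + y n) \<in> S" by (intro csubspaceD[OF S(1)] y(1))
    then have "d \<le> (norm (x - (1/2) *\<^sub>R (y m + y n)))\<^sup>2" by (rule dle)
    moreover have "(norm (y m - y n))\<^sup>2 = 2 * (norm (x - y m))\<^sup>2 + 2 * (norm (x - y n))\<^sup>2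
        - 4 * (norm (x - (1/2) *\<^sub>R (y m + y n)))\<^sup>2"
    proof -
      define a b where "a = x - y m" and "b = x - y n"
      have "x - (1/2) *\<^sub>R (y m + y n) = (1/2) *\<^sub>R (a + b)"
      proof -
        have "(1/2) *\<^sub>R (a + b) = (1/2) *\<^sub>R ((x + x) - (y m + y n))" by (simp add: a_def b_def)
        also have "\<dots> = (1/2) *\<^sub>R (x + x) - (1/2) *\<^sub>R (y m + y n)" by (rule scaleR_right_diff_distrib)
        finally show ?thesis by simp
      qed
      moreover have "y m - y n = b - a" by (simp add: a_def b_def)
      moreover have "(norm (b - a))\<^sup>2 = 2 * (norm a)\<^sup>2 + 2 * (norm b)\<^sup>2 - 4 * (norm ((1/2) *\<^sub>R (a + b)))\<^sup>2"
        unfolding power2_norm_eq_inner by (simp add: inner_diff inner_add inner_commute[of b a] field_simps)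
      ultimately show ?thesis by (simp add: a_def b_def)
    qed
    moreover have "2 / real (Suc m) = 2 * (1 / real (Suc m))" "2 / real (Suc n) = 2 * (1 / real (Suc n))" by auto
    ultimately show ?thesis using y(2)[of m] y(2)[of n] by linarith
  qed
  have "Cauchy y"
  proof (rule metric_CauchyI)
    fix e :: real assume e: "0 < e"
    obtain N where N: "4 / e\<^sup>2 < real N" using reals_Archimedean2 by blast
    have "dist (y m) (y n) < e" if "m \<ge> N" "n \<ge> N" for m n
    proof -
      have N0: "0 < real N" by (rule less_trans[OF _ N]) (use e in simp)
      have "2 / real (Suc m) \<le> 2 / real (Suc N)" "2 / real (Suc n) \<le> 2 / real (Suc N)"
        using that by (auto simp: frac_le)
      moreover have "2 / real (Suc N) < 2 / real N" using N0 by (simp add: frac_less2)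
      moreover have "4 / real N < e\<^sup>2" using N N0 e by (simp add: field_simps)
      ultimately have "(norm (y m - y n))\<^sup>2 < e\<^sup>2" using par[of m n] by simp
      then show ?thesis using e by (simp add: dist_norm power2_less_imp_less)
    qed
    then show "\<exists>M. \<forall>m\<ge>M. \<forall>n\<ge>M. dist (y m) (y n) < e" by blast
  qed
  then obtain l where l: "y \<longlonglongrightarrow> l" using Cauchy_convergent convergent_def by blast
  have lS: "l \<in> S" using closed_sequentially[OF S(2)] y(1) l by blast
  have "(\<lambda>n. (norm (x - y n))\<^sup>2) \<longlonglongrightarrow> (norm (x - l))\<^sup>2" by (intro tendsto_intros l)
  moreover have "(\<lambda>n. d + 1 / real (Suc n)) \<longlonglongrightarrow> d + 0"
    by (intro tendsto_add tendsto_const LIMSEQ_Suc lim_1_over_n)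
  ultimately have "(norm (x - l))\<^sup>2 \<le> d"
    using LIMSEQ_le[of "\<lambda>n. (norm (x - y n))\<^sup>2" _ "\<lambda>n. d + 1 / real (Suc n)" "d + 0"] y(2)
    by (auto intro: less_imp_le)
  then have "norm (x - l) \<le> norm (x - z)" if "z \<in> S" for z
    using dle[OF that] by (meson order_trans power2_le_imp_le norm_ge_zero)
  then show ?thesis using lS by blast
qed

text \<open>Minimality along the real line through the nearest point in direction \<open>z\<close>
  gives orthogonality for the real inner product. As \<open>S\<close> also contains
  \<open>\<i> *\<^sub>C z\<close>, the imaginary part vanishes as well.\<close>

lemma orthogonal_decomposition:
  fixes S :: "'a::complex_hilbert_space set"
  assumes S: "csubspace S" "closed S"
  shows "\<exists>y\<in>S. \<forall>z\<in>S. cinner (x - y) z = 0"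
proof -
  obtain y where y: "y \<in> S" "\<And>z. z \<in> S \<Longrightarrow> norm (x - y) \<le> norm (x - z)"
    using exists_nearest_point[OF S] by blast
  have o: "inner (x - y) z = 0" if z: "z \<in> S" for z
  proof (cases "z = 0")
    case False
    define u where "u = x - y"
    \<comment> \<open>This \<open>t\<close> minimizes the norm of
      \<open>u - t *\<^sub>R z\<close>.\<close>
    define t where "t = inner u z / (norm z)\<^sup>2"
    have "y + t *\<^sub>R z \<in> S" by (intro csubspaceD[OF S(1)] y(1) z)
    from y(2)[OF this] have "norm u \<le> norm (u - t *\<^sub>R z)" by (simp add: u_def diff_diff_eq)
    then have "(norm u)\<^sup>2 \<le> (norm (u - t *\<^sub>R z))\<^sup>2" by (simp add: power_mono)
    also have "\<dots> = (norm u)\<^sup>2 - 2 * t * inner u z + t\<^sup>2 * (norm z)\<^sup>2"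
      unfolding power2_norm_eq_inner by (simp add: inner_diff inner_commute[of z u] power2_eq_square[of t] right_diff_distrib)
    also have "\<dots> = (norm u)\<^sup>2 - (inner u z)\<^sup>2 / (norm z)\<^sup>2"
      using False by (simp add: t_def field_simps power2_eq_square)
    finally have "(inner u z)\<^sup>2 / (norm z)\<^sup>2 \<le> 0" by simp
    then have "(inner u z)\<^sup>2 \<le> 0" using False by (simp add: divide_le_0_iff)
    then show ?thesis by (simp add: u_def)
  qed auto
  have "cinner (x - y) z = 0" if z: "z \<in> S" for z
  proof (rule complex_eqI)
    show "Re (cinner (x - y) z) = Re 0" using o[OF z] by (simp add: Re_cinner)
    have "Re (cinner (x - y) (\<i> *\<^sub>C z)) = 0"
      using o[OF csubspaceD(3)[OF S(1) z]] by (simp add: Re_cinner)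
    then show "Im (cinner (x - y) z) = Im 0" by (simp add: cinner_scaleC_right)
  qed
  then show ?thesis using y(1) by blast
qed

text \<open>A nonzero functional has a vector \<open>u\<close> orthogonal to its kernel. Every
  \<open>x\<close> differs from a multiple of \<open>u\<close> by an element of the kernel, so
  \<open>f x\<close> and \<open>cinner x u\<close> are proportional.\<close>

lemma riesz:
  fixes f :: "'a::complex_hilbert_space \<Rightarrow> complex"
  assumes f: "bounded_linear f" "\<And>c x. f (c *\<^sub>C x) = c * f x"
  shows "\<exists>z. \<forall>x. f x = cinner x z"
proof (cases "\<forall>x. f x = 0")
  case True
  then show ?thesis by (auto intro!: exI[of _ 0])
next
  case False
  then obtain x0 where x0: "f x0 \<noteq> 0" by auto
  interpret f: bounded_linear f by (rule f)
  define S where "S = {x. f x = 0}"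
  have "csubspace S" by (auto simp: csubspace_def S_def f.add f(2) f.zero)
  moreover have "closed S" unfolding S_def
    by (rule closed_Collect_eq) (auto intro!: continuous_intros f.continuous_on)
  ultimately obtain y where y: "y \<in> S" "\<And>z. z \<in> S \<Longrightarrow> cinner (x0 - y) z = 0"
    using orthogonal_decomposition[of S x0] by blast
  define u where "u = x0 - y"
  have fu: "f u = f x0" using y(1) by (simp add: u_def f.diff S_def)
  then have u0: "u \<noteq> 0" using x0 f.zero by auto
  define z where "z = (cnj (f u) / of_real ((norm u)\<^sup>2)) *\<^sub>C u"
  have "f x = cinner x z" for x
  proof -
    define w where "w = x - (f x / f u) *\<^sub>C u"
    have "w \<in> S" using x0 fu by (simp add: S_def w_def f.diff f(2))
    then have "cinner u w = 0" using y(2) u_def by simp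
    then have "cinner w u = 0" by (metis cinner_commute complex_cnj_zero)
    then have "cinner x u = (f x / f u) * cinner u u"
      by (simp add: w_def cinner_diff_left cinner_scaleC_left)
    then show ?thesis using u0 x0 fu by (simp add: z_def cinner_scaleC_right cinner_self)
  qed
  then show ?thesis by blast
qed

section \<open>Bounded operators and their adjoints\<close>

lemma bounded_operatorI:
  fixes a :: "'h::complex_hilbert_space \<Rightarrow> 'h"
  assumes "\<And>x y. a (x + y) = a x + a y" "\<And>c x. a (c *\<^sub>C x) = c *\<^sub>C a x"
    "\<And>x. norm (a x) \<le> K * norm x"
  shows "bounded_operator a"
  unfolding bounded_operator_def using assms
  by (auto intro!: bounded_linear_intro[where K = K] simp: scaleR_scaleC mult.commute)

lemma bounded_operatorD:
  fixes a :: "'h::complex_hilbert_space \<Rightarrow> 'h"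
  assumes "bounded_operator a"
  shows "bounded_linear a" "a (x + y) = a x + a y" "a (c *\<^sub>C x) = c *\<^sub>C a x" "a 0 = 0"
    "a (x - y) = a x - a y"
  using assms by (auto simp: bounded_operator_def linear_simps)

lemma bounded_operator_bound:
  fixes a :: "'h::complex_hilbert_space \<Rightarrow> 'h"
  assumes "bounded_operator a"
  shows "\<exists>K\<ge>0. \<forall>x. norm (a x) \<le> K * norm x"
  using bounded_linear.nonneg_bounded[OF bounded_operatorD(1)[OF assms]] by (auto simp: mult.commute)

lemma bounded_operator_add:
  "bounded_operator a \<Longrightarrow> bounded_operator b \<Longrightarrow> bounded_operator (\<lambda>v. a v + b v)"
  by (auto simp: bounded_operator_def scaleC_add_right intro: bounded_linear_add)

lemma bounded_operator_scaleC: "bounded_operator a \<Longrightarrow> bounded_operator (\<lambda>v. c *\<^sub>C a v)"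
  by (auto simp: bounded_operator_def scaleC_scaleC mult.commute
      intro: bounded_linear_compose[OF bounded_linear_scaleC])

lemma bounded_operator_comp: "bounded_operator a \<Longrightarrow> bounded_operator b \<Longrightarrow> bounded_operator (a \<circ> b)"
  by (auto simp: bounded_operator_def comp_def intro: bounded_linear_compose)

lemma bounded_operator_id: "bounded_operator id" and bounded_operator_zero: "bounded_operator (\<lambda>v. 0)"
  by (auto simp: bounded_operator_def id_def bounded_linear_ident)

lemma exists_adjoint:
  fixes a :: "'h::complex_hilbert_space \<Rightarrow> 'h"
  assumes a: "bounded_operator a"
  shows "\<exists>b. bounded_operator b \<and> (\<forall>x y. cinner (a x) y = cinner x (b y))"
proof -
  have "\<exists>z. \<forall>x. cinner (a x) y = cinner x z" for y
    by (rule riesz)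
       (auto simp: bounded_operatorD[OF a] cinner_scaleC_left
         intro: bounded_linear_compose[OF bounded_linear_cinner_left] bounded_operatorD(1)[OF a])
  then obtain b where b: "\<And>x y. cinner (a x) y = cinner x (b y)" by metis
  then have b': "cinner (b y) x = cinner y (a x)" for x y
    by (metis cinner_commute)
  obtain K where K: "K \<ge> 0" "\<And>x. norm (a x) \<le> K * norm x" using bounded_operator_bound[OF a] by blast
  have "bounded_operator b"
  proof (rule bounded_operatorI)
    show "b (x + y) = b x + b y" for x y
      by (rule cinner_ext) (simp add: b' cinner_add_left)
    show "b (c *\<^sub>C x) = c *\<^sub>C b x" for x c
      by (rule cinner_ext) (simp add: b' cinner_scaleC_left)
    show "norm (b x) \<le> K * norm x" for x
    proof (cases "b x = 0")
      case False
      have "(norm (b x))\<^sup>2 = cmod (cinner (b x) (b x))" by (simp only: cinner_self norm_of_real) simp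
      also have "\<dots> = cmod (cinner (a (b x)) x)" by (simp add: b)
      also have "\<dots> \<le> norm (a (b x)) * norm x" by (rule cmod_cinner_le)
      also have "\<dots> \<le> (K * norm (b x)) * norm x" by (intro mult_right_mono K) auto
      finally show ?thesis using False by (simp add: power2_eq_square)
    qed (use K in auto)
  qed
  then show ?thesis using b by blast
qed

lemma adjoint_unique:
  fixes a :: "'h::complex_hilbert_space \<Rightarrow> 'h"
  assumes "\<And>x y. cinner (a x) y = cinner x (b y)" "\<And>x y. cinner (a x) y = cinner x (c y)"
  shows "b = c"
proof
  fix y
  have "cinner (b y) z = cinner (c y) z" for z
    using assms[of z y] cinner_commute[of "b y" z] cinner_commute[of "c y" z] by simp
  then show "b y = c y" by (rule cinner_ext)
qed

text \<open>\<open>adj\<close> is a definite description, so existence and uniqueness have to be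
  secured before any property of it is available.\<close>

lemma adj_bounded: "bounded_operator a \<Longrightarrow> bounded_operator (adj a)"
  and cinner_adj: "bounded_operator a \<Longrightarrow> cinner (a x) y = cinner x (adj a y)"
proof -
  assume "bounded_operator a"
  then have "\<exists>!b. bounded_operator b \<and> (\<forall>x y. cinner (a x) y = cinner x (b y))"
    using exists_adjoint adjoint_unique by (metis (no_types, lifting))
  from theI'[OF this] show "bounded_operator (adj a)" "cinner (a x) y = cinner x (adj a y)"
    unfolding adj_def by blast+
qed

lemma cinner_adj': "bounded_operator a \<Longrightarrow> cinner (adj a x) y = cinner x (a y)"
  by (metis cinner_adj cinner_commute)

lemma adj_eqI:
  assumes "bounded_operator a" "\<And>x y. cinner (a x) y = cinner x (b y)"
  shows "adj a = b"
  using cinner_adj[OF assms(1)] assms(2) by (intro adjoint_unique[of a])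

lemma adj_adj: "bounded_operator a \<Longrightarrow> adj (adj a) = a"
  by (rule adj_eqI) (auto simp: adj_bounded cinner_adj')

lemma adj_comp: "bounded_operator a \<Longrightarrow> bounded_operator b \<Longrightarrow> adj (a \<circ> b) = adj b \<circ> adj a"
  by (rule adj_eqI) (auto simp: bounded_operator_comp cinner_adj)

lemma adj_add:
  "bounded_operator a \<Longrightarrow> bounded_operator b \<Longrightarrow> adj (\<lambda>v. a v + b v) = (\<lambda>v. adj a v + adj b v)"
  by (rule adj_eqI) (auto intro: bounded_operator_add simp: cinner_adj cinner_add_left cinner_add_right)

lemma adj_scaleC: "bounded_operator a \<Longrightarrow> adj (\<lambda>v. c *\<^sub>C a v) = (\<lambda>v. cnj c *\<^sub>C adj a v)"
  by (rule adj_eqI) (auto intro: bounded_operator_scaleC simp: cinner_adj cinner_scaleC_left cinner_scaleC_right)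

lemma adj_id: "adj id = (id::'h::complex_hilbert_space \<Rightarrow> 'h)"
  by (rule adj_eqI) (auto simp: bounded_operator_id)

section \<open>Density of a star algebra in its bicommutant, at one vector\<close>

lemma closure_csubspace:
  assumes "csubspace S"
  shows "csubspace (closure S)"
proof -
  have "x + y \<in> closure S" if xy: "x \<in> closure S" "y \<in> closure S" for x y
  proof -
    obtain f g where "\<And>n. f n \<in> S" "f \<longlonglongrightarrow> x" "\<And>n. g n \<in> S" "g \<longlonglongrightarrow> y"
      using xy unfolding closure_sequential by blast
    then show ?thesis unfolding closure_sequential
      by (intro exI[of _ "\<lambda>n. f n + g n"]) (auto intro: tendsto_add csubspaceD[OF assms])
  qed
  moreover have "c *\<^sub>C x \<in> closure S" if x: "x \<in> closure S" for x c
  proof -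
    obtain f where "\<And>n. f n \<in> S" "f \<longlonglongrightarrow> x" using x unfolding closure_sequential by blast
    then show ?thesis unfolding closure_sequential
      by (intro exI[of _ "\<lambda>n. c *\<^sub>C f n"])
         (auto intro: bounded_linear.tendsto[OF bounded_linear_scaleC] csubspaceD[OF assms])
  qed
  ultimately show ?thesis using csubspaceD(1)[OF assms] closure_subset[of S]
    by (auto simp: csubspace_def)
qed

text \<open>Von Neumann's argument: the projection \<open>P\<close> onto the closure of
  \<open>A v\<close> commutes with \<open>A\<close>, because \<open>A\<close> is closed under
  adjoints, so \<open>x\<close> commutes with \<open>P\<close>. The identity in \<open>A\<close>
  puts \<open>v\<close> into the range of \<open>P\<close>, and therefore \<open>x v\<close>
  too.\<close>

lemma bicommutant_vector_density:
  fixes A :: "('h::complex_hilbert_space \<Rightarrow> 'h) set"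
  assumes A: "star_subalgebra A" "id \<in> A" and x: "x \<in> commutant (commutant A)" and e: "e > 0"
  shows "\<exists>p\<in>A. norm (p v - x v) < e"
proof -
  have Ab: "bounded_operator a" "adj a \<in> A" if "a \<in> A" for a
    using A(1) that by (auto simp: star_subalgebra_def)
  define S where "S = (\<lambda>a. a v) ` A"
  define K where "K = closure S"
  have "csubspace S"
    unfolding csubspace_def
  proof (intro conjI ballI allI)
    show "0 \<in> S" using A(1) unfolding S_def star_subalgebra_def by (auto intro!: image_eqI[of _ _ "\<lambda>v. 0"])
    show "y + z \<in> S" if yz: "y \<in> S" "z \<in> S" for y z
    proof -
      obtain a b where ab: "a \<in> A" "b \<in> A" "y = a v" "z = b v" using yz unfolding S_def by blast
      then have "(\<lambda>v. a v + b v) \<in> A" using A(1) unfolding star_subalgebra_def by blast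
      then show ?thesis unfolding S_def ab by (rule rev_image_eqI) simp
    qed
    show "c *\<^sub>C y \<in> S" if yz: "y \<in> S" for y c
    proof -
      obtain a where ab: "a \<in> A" "y = a v" using yz unfolding S_def by blast
      then have "(\<lambda>v. c *\<^sub>C a v) \<in> A" using A(1) unfolding star_subalgebra_def by blast
      then show ?thesis unfolding S_def ab by (rule rev_image_eqI) simp
    qed
  qed
  then have K: "csubspace K" "closed K" by (auto simp: K_def closure_csubspace)
  have inv: "a y \<in> K" if a: "a \<in> A" and y: "y \<in> K" for a y
  proof -
    obtain f where f: "\<And>n. f n \<in> S" "f \<longlonglongrightarrow> y" using y unfolding K_def closure_sequential by blast
    have "a (f n) \<in> S" for n
    proof -
      obtain b where b: "b \<in> A" "f n = b v" using f(1) unfolding S_def by blast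
      then have "a \<circ> b \<in> A" using A(1) a unfolding star_subalgebra_def by blast
      then show ?thesis unfolding S_def b by (rule rev_image_eqI) simp
    qed
    moreover have "(\<lambda>n. a (f n)) \<longlonglongrightarrow> a y"
      using bounded_linear.tendsto[OF bounded_operatorD(1)[OF Ab(1)[OF a]] f(2)] .
    ultimately show ?thesis unfolding K_def closure_sequential by (intro exI[of _ "\<lambda>n. a (f n)"]) simp
  qed
  obtain P where P: "\<And>w. P w \<in> K" "\<And>w z. z \<in> K \<Longrightarrow> cinner (w - P w) z = 0"
    using orthogonal_decomposition[OF K] by metis
  \<comment> \<open>\<open>P w\<close> is characterized by membership in \<open>K\<close> and
    orthogonality of the remainder; linearity of \<open>P\<close> and its commutation with
    \<open>A\<close> are read off from this.\<close>
  have Pu: "P w = y" if "y \<in> K" "\<And>z. z \<in> K \<Longrightarrow> cinner (w - y) z = 0" for w y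
  proof -
    have d: "P w - y \<in> K" by (intro csubspaceD(4)[OF K(1)] P(1) that(1))
    have "cinner (P w - y) (P w - y) = cinner (w - y) (P w - y) - cinner (w - P w) (P w - y)"
      by (simp add: cinner_diff_left)
    also have "\<dots> = 0" using that(2)[OF d] P(2)[OF d] by simp
    finally show ?thesis by (simp add: cinner_self)
  qed
  have "bounded_operator P"
  proof (rule bounded_operatorI[where K = 1])
    show "P (w + z) = P w + P z" for w z
    proof (rule Pu)
      show "P w + P z \<in> K" using csubspaceD(2)[OF K(1)] P(1) by blast
      fix u assume "u \<in> K"
      then have "cinner (w - P w) u + cinner (z - P z) u = 0" using P(2) by simp
      then show "cinner (w + z - (P w + P z)) u = 0" by (simp add: cinner_diff_left cinner_add_left algebra_simps)
    qed
    show "P (c *\<^sub>C w) = c *\<^sub>C P w" for w c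
    proof (rule Pu)
      show "c *\<^sub>C P w \<in> K" using csubspaceD(3)[OF K(1)] P(1) by blast
      fix u assume "u \<in> K"
      then have "cinner (c *\<^sub>C (w - P w)) u = 0" using P(2) by (simp add: cinner_scaleC_left)
      then show "cinner (c *\<^sub>C w - c *\<^sub>C P w) u = 0" by (simp add: scaleC_diff_right)
    qed
    show "norm (P w) \<le> 1 * norm w" for w
    proof -
      have "cinner (w - P w) (P w) = 0" using P by blast
      then have "inner (w - P w) (P w) = 0" by (simp add: Re_cinner[symmetric])
      then have "(norm (P w))\<^sup>2 = inner w (P w)" by (simp add: inner_diff_left power2_norm_eq_inner)
      also have "\<dots> \<le> norm w * norm (P w)" by (rule norm_cauchy_schwarz)
      finally show ?thesis by (cases "P w = 0") (auto simp: power2_eq_square)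
    qed
  qed
  moreover have "P \<circ> a = a \<circ> P" if a: "a \<in> A" for a
  proof
    fix w
    note aop = Ab(1)[OF a]
    have "P (a w) = a (P w)"
    proof (rule Pu)
      show "a (P w) \<in> K" using inv a P(1) by blast
      fix u assume u: "u \<in> K"
      have "cinner (a w - a (P w)) u = cinner (w - P w) (adj a u)"
        using cinner_adj[OF aop, of "w - P w" u] by (simp add: bounded_operatorD[OF aop])
      also have "\<dots> = 0" using inv[OF Ab(2)[OF a] u] P(2) by blast
      finally show "cinner (a w - a (P w)) u = 0" .
    qed
    then show "(P \<circ> a) w = (a \<circ> P) w" by simp
  qed
  ultimately have "P \<in> commutant A" by (simp add: commutant_def)
  then have xP: "x \<circ> P = P \<circ> x" using x by (auto simp: commutant_def)
  have "v \<in> S" unfolding S_def using A(2) by (rule rev_image_eqI) simp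
  then have "v \<in> K" using closure_subset K_def by blast
  then have "P v = v" by (intro Pu) auto
  then have "x v = P (x v)" using fun_cong[OF xP, of v] by simp
  then have "x v \<in> closure S" using P(1)[of "x v"] K_def by simp
  then obtain y where "y \<in> S" "dist y (x v) < e" using e closure_approachable by blast
  then show ?thesis unfolding S_def by (auto simp: dist_norm)
qed

section \<open>Square-summable sequences and amplifications\<close>

text \<open>The space for the amplification trick: a whole square-summable sequence becomes a single
  vector, to which the density at one vector applies.\<close>

typedef (overloaded) 'h ell2 = "{f::nat \<Rightarrow> 'h::complex_hilbert_space. summable (\<lambda>n. (norm (f n))\<^sup>2)}"
  morphisms coord Abs_ell2
  by (rule exI[of _ "\<lambda>n. 0"]) simp

setup_lifting type_definition_ell2

lemma norm_add_power2_le: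
  "(norm (x + y))\<^sup>2 \<le> 2 * (norm x)\<^sup>2 + 2 * (norm (y::'a::real_inner))\<^sup>2"
proof -
  have "0 \<le> (norm (x - y))\<^sup>2" by simp
  then show ?thesis unfolding power2_norm_eq_inner by (simp add: inner_add inner_diff inner_commute)
qed

lemma square_summable_add:
  fixes f g :: "nat \<Rightarrow> 'a::real_inner"
  assumes "summable (\<lambda>n. (norm (f n))\<^sup>2)" "summable (\<lambda>n. (norm (g n))\<^sup>2)"
  shows "summable (\<lambda>n. (norm (f n + g n))\<^sup>2)"
  by (rule summable_comparison_test'[OF summable_add[OF summable_mult[OF assms(1), of 2] summable_mult[OF assms(2), of 2]]])
     (simp add: norm_add_power2_le)

lemma summable_prod_norm:
  fixes f g :: "nat \<Rightarrow> 'a::real_normed_vector"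
  assumes "summable (\<lambda>n. (norm (f n))\<^sup>2)" "summable (\<lambda>n. (norm (g n))\<^sup>2)"
  shows "summable (\<lambda>n. norm (f n) * norm (g n))"
proof (rule summable_comparison_test'[OF summable_add[OF assms]])
  fix n
  have "0 \<le> (norm (f n) - norm (g n))\<^sup>2" by simp
  then have "2 * (norm (f n) * norm (g n)) \<le> (norm (f n))\<^sup>2 + (norm (g n))\<^sup>2" by (simp add: power2_diff)
  moreover have "0 \<le> norm (f n) * norm (g n)" by simp
  ultimately show "norm (norm (f n) * norm (g n)) \<le> (norm (f n))\<^sup>2 + (norm (g n))\<^sup>2"
    unfolding real_norm_def by linarith
qed

lemma summable_inner_square:
  fixes f g :: "nat \<Rightarrow> 'a::real_inner"
  assumes "summable (\<lambda>n. (norm (f n))\<^sup>2)" "summable (\<lambda>n. (norm (g n))\<^sup>2)"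
  shows "summable (\<lambda>n. inner (f n) (g n))"
  by (rule summable_comparison_test'[OF summable_prod_norm[OF assms]]) (simp add: Cauchy_Schwarz_ineq2)

lemma summable_cinner:
  fixes f g :: "nat \<Rightarrow> 'a::complex_hilbert_space"
  assumes "summable (\<lambda>n. (norm (f n))\<^sup>2)" "summable (\<lambda>n. (norm (g n))\<^sup>2)"
  shows "summable (\<lambda>n. cinner (f n) (g n))"
  by (rule summable_comparison_test'[OF summable_prod_norm[OF assms]]) (simp add: cmod_cinner_le)

instantiation ell2 :: (complex_hilbert_space) real_inner
begin

lift_definition zero_ell2 :: "'a ell2" is "\<lambda>n. 0" by simp
lift_definition plus_ell2 :: "'a ell2 \<Rightarrow> 'a ell2 \<Rightarrow> 'a ell2" is "\<lambda>f g n. f n + g n"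
  by (rule square_summable_add)
lift_definition uminus_ell2 :: "'a ell2 \<Rightarrow> 'a ell2" is "\<lambda>f n. - f n" by simp
lift_definition minus_ell2 :: "'a ell2 \<Rightarrow> 'a ell2 \<Rightarrow> 'a ell2" is "\<lambda>f g n. f n - g n"
  subgoal for f g using square_summable_add[of f "\<lambda>n. - g n"] by simp done
lift_definition scaleR_ell2 :: "real \<Rightarrow> 'a ell2 \<Rightarrow> 'a ell2" is "\<lambda>r f n. r *\<^sub>R f n"
  by (simp add: power_mult_distrib summable_mult)
lift_definition inner_ell2 :: "'a ell2 \<Rightarrow> 'a ell2 \<Rightarrow> real" is "\<lambda>f g. \<Sum>n. inner (f n) (g n)" .
definition norm_ell2 :: "'a ell2 \<Rightarrow> real" where "norm_ell2 x = sqrt (inner x x)"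
definition dist_ell2 :: "'a ell2 \<Rightarrow> 'a ell2 \<Rightarrow> real" where "dist_ell2 x y = norm (x - y)"
definition sgn_ell2 :: "'a ell2 \<Rightarrow> 'a ell2" where "sgn_ell2 x = scaleR (inverse (norm x)) x"
definition uniformity_ell2 :: "('a ell2 \<times> 'a ell2) filter" where
  "uniformity_ell2 = (INF e\<in>{0<..}. principal {(x, y). dist x y < e})"
definition open_ell2 :: "'a ell2 set \<Rightarrow> bool" where
  "open_ell2 U = (\<forall>x\<in>U. \<forall>\<^sub>F (x', y) in uniformity. x' = x \<longrightarrow> y \<in> U)"

instance
proof
  fix x y z :: "'a ell2" and r s :: real
  show "x + y + z = x + (y + z)" by transfer (simp add: add.assoc)
  show "x + y = y + x" by transfer (simp add: add.commute)
  show "0 + x = x" by transfer simp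
  show "- x + x = 0" by transfer simp
  show "x - y = x + - y" by transfer simp
  show "r *\<^sub>R (x + y) = r *\<^sub>R x + r *\<^sub>R y" by transfer (simp add: scaleR_right_distrib)
  show "(r + s) *\<^sub>R x = r *\<^sub>R x + s *\<^sub>R x" by transfer (simp add: scaleR_left_distrib)
  show "r *\<^sub>R s *\<^sub>R x = (r * s) *\<^sub>R x" by transfer simp
  show "1 *\<^sub>R x = x" by transfer simp
  show "dist x y = norm (x - y)" by (rule dist_ell2_def)
  show "sgn x = scaleR (inverse (norm x)) x" by (rule sgn_ell2_def)
  show "uniformity = (INF e\<in>{0<..}. principal {(x::'a ell2, y). dist x y < e})" by (rule uniformity_ell2_def)
  show "open U = (\<forall>x\<in>U. \<forall>\<^sub>F (x', y) in uniformity. x' = x \<longrightarrow> y \<in> U)" for U :: "'a ell2 set"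
    by (rule open_ell2_def)
  show "inner x y = inner y x" by transfer (simp add: inner_commute)
  show "inner (x + y) z = inner x z + inner y z"
    by transfer (simp add: inner_add_left suminf_add[OF summable_inner_square summable_inner_square])
  show "inner (r *\<^sub>R x) y = r * inner x y"
    by transfer (simp add: suminf_mult summable_inner_square)
  show "0 \<le> inner x x" by transfer (simp add: dot_square_norm suminf_nonneg)
  show "(inner x x = 0) = (x = 0)"
    by transfer (auto simp: dot_square_norm suminf_eq_zero_iff fun_eq_iff)
  show "norm x = sqrt (inner x x)" by (rule norm_ell2_def)
qed

end

lemma norm_ell2_power2: "(norm x)\<^sup>2 = (\<Sum>n. (norm (coord x n))\<^sup>2)"
  unfolding power2_norm_eq_inner inner_ell2.rep_eq by simp

lemma summable_coord: "summable (\<lambda>n. (norm (coord x n))\<^sup>2)"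
  using coord by auto

lemma sum_coord_le: "finite I \<Longrightarrow> (\<Sum>n\<in>I. (norm (coord x n))\<^sup>2) \<le> (norm x)\<^sup>2"
  unfolding norm_ell2_power2 by (rule sum_le_suminf) (auto simp: summable_coord)

lemma norm_coord_le: "norm (coord x n) \<le> norm x"
  using sum_coord_le[of "{n}" x] by (simp add: power2_le_iff_abs_le)

instance ell2 :: (complex_hilbert_space) complete_space
proof
  fix X :: "nat \<Rightarrow> 'a ell2"
  assume X: "Cauchy X"
  have "Cauchy (\<lambda>m. coord (X m) n)" for n
  proof (rule metric_CauchyI)
    fix e :: real assume "e > 0"
    then obtain M where "\<forall>m\<ge>M. \<forall>k\<ge>M. dist (X m) (X k) < e" using X metric_CauchyD by blast
    moreover have "dist (coord (X m) n) (coord (X k) n) \<le> dist (X m) (X k)" for m k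
      using norm_coord_le[of "X m - X k" n] by (simp add: dist_norm minus_ell2.rep_eq)
    ultimately show "\<exists>M. \<forall>m\<ge>M. \<forall>k\<ge>M. dist (coord (X m) n) (coord (X k) n) < e"
      by (meson le_less_trans)
  qed
  then have "\<exists>l. (\<lambda>m. coord (X m) n) \<longlonglongrightarrow> l" for n using Cauchy_convergent convergent_def by blast
  then obtain L where L: "\<And>n. (\<lambda>m. coord (X m) n) \<longlonglongrightarrow> L n" by metis
  \<comment> \<open>Coordinatewise limits commute with finite sums, so the estimate is proved for
    partial sums with a bound free of \<open>K\<close>; the bound for the full series follows from
    it.\<close>
  have key: "\<exists>M. \<forall>m\<ge>M. \<forall>K. (\<Sum>n<K. (norm (coord (X m) n - L n))\<^sup>2) \<le> e\<^sup>2" if e: "e > 0" for e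
  proof -
    obtain M where M: "\<And>m k. m \<ge> M \<Longrightarrow> k \<ge> M \<Longrightarrow> dist (X m) (X k) < e"
      using X e metric_CauchyD by blast
    have "(\<Sum>n<K. (norm (coord (X m) n - L n))\<^sup>2) \<le> e\<^sup>2" if m: "m \<ge> M" for m K
    proof (rule LIMSEQ_le_const2)
      show "(\<lambda>k. \<Sum>n<K. (norm (coord (X m) n - coord (X k) n))\<^sup>2) \<longlonglongrightarrow> (\<Sum>n<K. (norm (coord (X m) n - L n))\<^sup>2)"
        by (intro tendsto_intros L)
      have "(\<Sum>n<K. (norm (coord (X m) n - coord (X k) n))\<^sup>2) \<le> e\<^sup>2" if "k \<ge> M" for k
      proof -
        have "(\<Sum>n<K. (norm (coord (X m) n - coord (X k) n))\<^sup>2) \<le> (norm (X m - X k))\<^sup>2"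
          using sum_coord_le[of "{..<K}" "X m - X k"] by (simp add: minus_ell2.rep_eq)
        also have "\<dots> \<le> e\<^sup>2" using M[OF m that] by (intro power_mono) (auto simp: dist_norm)
        finally show ?thesis .
      qed
      then show "\<exists>N. \<forall>n\<ge>N. (\<Sum>na<K. (norm (coord (X m) na - coord (X n) na))\<^sup>2) \<le> e\<^sup>2" by blast
    qed
    then show ?thesis by blast
  qed
  obtain M where M: "\<And>K. (\<Sum>n<K. (norm (coord (X M) n - L n))\<^sup>2) \<le> 1\<^sup>2" using key[of 1] by auto
  have s1: "summable (\<lambda>n. (norm (coord (X M) n - L n))\<^sup>2)"
    by (rule summableI_nonneg_bounded[OF _ M]) simp
  have "summable (\<lambda>n. (norm (coord (X M) n + - (coord (X M) n - L n)))\<^sup>2)"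
    by (rule square_summable_add[OF summable_coord]) (use s1 in \<open>simp add: norm_minus_commute\<close>)
  then have cL: "coord (Abs_ell2 L) = L" by (intro Abs_ell2_inverse) simp
  have "X \<longlonglongrightarrow> Abs_ell2 L"
  proof (rule metric_LIMSEQ_I)
    fix e :: real assume e: "e > 0"
    then obtain M where M: "\<And>m K. m \<ge> M \<Longrightarrow> (\<Sum>n<K. (norm (coord (X m) n - L n))\<^sup>2) \<le> (e/2)\<^sup>2"
      using key[of "e/2"] by auto
    have "dist (X m) (Abs_ell2 L) < e" if "m \<ge> M" for m
    proof -
      have "(norm (X m - Abs_ell2 L))\<^sup>2 \<le> (e/2)\<^sup>2"
        unfolding norm_ell2_power2
      proof (rule suminf_le_const[OF summable_coord])
        show "(\<Sum>i<n. (norm (coord (X m - Abs_ell2 L) i))\<^sup>2) \<le> (e/2)\<^sup>2" for n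
          using M[OF that, of n] by (simp add: minus_ell2.rep_eq cL)
      qed
      then have "norm (X m - Abs_ell2 L) \<le> e/2" using e by (meson half_gt_zero less_imp_le power2_le_imp_le)
      then show ?thesis using e by (simp add: dist_norm)
    qed
    then show "\<exists>no. \<forall>n\<ge>no. dist (X n) (Abs_ell2 L) < e" by blast
  qed
  then show "convergent X" unfolding convergent_def by blast
qed

instantiation ell2 :: (complex_hilbert_space) complex_hilbert_space
begin

lift_definition scaleC_ell2 :: "complex \<Rightarrow> 'a ell2 \<Rightarrow> 'a ell2" is "\<lambda>c f n. c *\<^sub>C f n"
  by (simp add: norm_scaleC power_mult_distrib summable_mult)
lift_definition cinner_ell2 :: "'a ell2 \<Rightarrow> 'a ell2 \<Rightarrow> complex" is "\<lambda>f g. \<Sum>n. cinner (f n) (g n)" .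

instance
proof
  fix x y z :: "'a ell2" and r :: real and c d :: complex
  show "c *\<^sub>C (x + y) = c *\<^sub>C x + c *\<^sub>C y" by transfer (simp add: scaleC_add_right)
  show "(c + d) *\<^sub>C x = c *\<^sub>C x + d *\<^sub>C x" by transfer (simp add: scaleC_add_left)
  show "c *\<^sub>C d *\<^sub>C x = (c * d) *\<^sub>C x" by transfer (simp add: scaleC_scaleC)
  show "complex_of_real r *\<^sub>C x = r *\<^sub>R x" by transfer (simp add: scaleC_of_real)
  show "cinner x y = cnj (cinner y x)"
  proof transfer
    fix f g :: "nat \<Rightarrow> 'a"
    assume "summable (\<lambda>n. (norm (f n))\<^sup>2)" "summable (\<lambda>n. (norm (g n))\<^sup>2)"
    then have s: "summable (\<lambda>n. cinner (g n) (f n))" by (rule summable_cinner[rotated])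
    have "(\<Sum>n. cinner (f n) (g n)) = (\<Sum>n. cnj (cinner (g n) (f n)))"
      by (subst cinner_commute) simp
    also have "\<dots> = cnj (\<Sum>n. cinner (g n) (f n))"
      by (rule bounded_linear.suminf[OF bounded_linear_cnj s, symmetric])
    finally show "(\<Sum>n. cinner (f n) (g n)) = cnj (\<Sum>n. cinner (g n) (f n))" .
  qed
  show "cinner (x + y) z = cinner x z + cinner y z"
    by transfer (simp add: cinner_add_left suminf_add[OF summable_cinner summable_cinner])
  show "cinner (c *\<^sub>C x) y = c * cinner x y"
    by transfer (simp add: cinner_scaleC_left suminf_mult summable_cinner)
  show "Re (cinner x y) = inner x y"
  proof transfer
    fix f g :: "nat \<Rightarrow> 'a"
    assume "summable (\<lambda>n. (norm (f n))\<^sup>2)" "summable (\<lambda>n. (norm (g n))\<^sup>2)"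
    then have s: "summable (\<lambda>n. cinner (f n) (g n))" by (rule summable_cinner)
    show "Re (\<Sum>n. cinner (f n) (g n)) = (\<Sum>n. inner (f n) (g n))"
      by (subst bounded_linear.suminf[OF bounded_linear_Re s]) (simp add: Re_cinner)
  qed
qed

end

definition inj_coord :: "nat \<Rightarrow> 'h::complex_hilbert_space \<Rightarrow> 'h ell2" where
  "inj_coord n v = Abs_ell2 (\<lambda>m. if m = n then v else 0)"

lemma coord_inj_coord: "coord (inj_coord n v) = (\<lambda>m. if m = n then v else 0)"
  unfolding inj_coord_def
proof (rule Abs_ell2_inverse, rule CollectI, rule summable_finite[of "{n}"])
qed auto

lemma ell2_eqI: "(\<And>n. coord x n = coord y n) \<Longrightarrow> x = y"
  by (simp add: coord_inject[symmetric] fun_eq_iff)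

lemma coord_sum: "coord (\<Sum>i\<in>I. f i) n = (\<Sum>i\<in>I. coord (f i) n)"
  by (induction I rule: infinite_finite_induct) (auto simp: zero_ell2.rep_eq plus_ell2.rep_eq)

lemma norm_inj_coord: "norm (inj_coord n v) = norm v"
proof -
  have "(norm (inj_coord n v))\<^sup>2 = (\<Sum>m. if m = n then (norm v)\<^sup>2 else 0)"
    unfolding norm_ell2_power2 by (simp add: coord_inj_coord if_distrib[of norm] if_distrib[of "\<lambda>x. x\<^sup>2"] cong: if_cong)
  also have "\<dots> = (norm v)\<^sup>2" using sums_single[of n "\<lambda>m. (norm v)\<^sup>2"] by (simp add: sums_iff)
  finally show ?thesis by (simp add: power2_eq_iff_nonneg)
qed

text \<open>With it, two bounded linear maps on \<open>ell2\<close> agree as soon as they agree on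
  sequences supported at a single index.\<close>

lemma ell2_truncation_tendsto: "(\<lambda>K. \<Sum>n<K. inj_coord n (coord x n)) \<longlonglongrightarrow> x"
proof -
  have c: "coord (\<Sum>n<K. inj_coord n (coord x n)) m = (if m < K then coord x m else 0)" for K m
    by (simp add: coord_sum coord_inj_coord)
  have e: "(norm ((\<Sum>n<K. inj_coord n (coord x n)) - x))\<^sup>2 = (\<Sum>n. (norm (coord x (n + K)))\<^sup>2)" for K
  proof -
    let ?f = "\<lambda>n. (norm (coord ((\<Sum>n<K. inj_coord n (coord x n)) - x) n))\<^sup>2"
    have "(\<Sum>n. ?f n) = (\<Sum>n. ?f (n + K)) + (\<Sum>n<K. ?f n)"
      by (rule suminf_split_initial_segment[OF summable_coord])
    also have "(\<Sum>n<K. ?f n) = 0" by (simp add: minus_ell2.rep_eq c)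
    finally show ?thesis by (simp add: norm_ell2_power2 minus_ell2.rep_eq c)
  qed
  have "(\<lambda>K. \<Sum>n. (norm (coord x (n + K)))\<^sup>2) \<longlonglongrightarrow> 0"
    by (rule suminf_exist_split2[OF summable_coord])
  then have "(\<lambda>K. sqrt ((norm ((\<Sum>n<K. inj_coord n (coord x n)) - x))\<^sup>2)) \<longlonglongrightarrow> sqrt 0"
    unfolding e by (rule tendsto_real_sqrt)
  then have "(\<lambda>K. (\<Sum>n<K. inj_coord n (coord x n)) - x) \<longlonglongrightarrow> 0"
    by (simp add: tendsto_norm_zero_iff)
  then show ?thesis by (rule LIM_zero_cancel)
qed

definition amp :: "('h::complex_hilbert_space \<Rightarrow> 'h) \<Rightarrow> 'h ell2 \<Rightarrow> 'h ell2" where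
  "amp a x = Abs_ell2 (\<lambda>n. a (coord x n))"

lemma amp_summable:
  assumes "bounded_operator a" "summable (\<lambda>n. (norm (f n))\<^sup>2)"
  shows "summable (\<lambda>n. (norm (a (f n)))\<^sup>2)"
proof -
  obtain K where K: "K \<ge> 0" "\<And>x. norm (a x) \<le> K * norm x" using bounded_operator_bound[OF assms(1)] by blast
  show ?thesis
    by (rule summable_comparison_test'[OF summable_mult[OF assms(2), of "K\<^sup>2"]])
       (use power_mono[OF K(2), of _ 2] in \<open>simp add: power_mult_distrib\<close>)
qed

lemma coord_amp: "bounded_operator a \<Longrightarrow> coord (amp a x) = (\<lambda>n. a (coord x n))"
  unfolding amp_def by (intro Abs_ell2_inverse) (simp add: amp_summable summable_coord)

lemma bounded_operator_amp:
  assumes a: "bounded_operator a"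
  shows "bounded_operator (amp a)"
proof -
  obtain K where K: "K \<ge> 0" "\<And>x. norm (a x) \<le> K * norm x" using bounded_operator_bound[OF a] by blast
  show ?thesis
  proof (rule bounded_operatorI)
    show "amp a (x + y) = amp a x + amp a y" for x y
      by (rule ell2_eqI) (simp add: coord_amp[OF a] plus_ell2.rep_eq bounded_operatorD[OF a])
    show "amp a (c *\<^sub>C x) = c *\<^sub>C amp a x" for c x
      by (rule ell2_eqI) (simp add: coord_amp[OF a] scaleC_ell2.rep_eq bounded_operatorD[OF a])
    show "norm (amp a x) \<le> K * norm x" for x
    proof -
      have "(norm (amp a x))\<^sup>2 = (\<Sum>n. (norm (a (coord x n)))\<^sup>2)" by (simp add: norm_ell2_power2 coord_amp[OF a])
      also have "\<dots> \<le> (\<Sum>n. K\<^sup>2 * (norm (coord x n))\<^sup>2)"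
        by (rule suminf_le) (use K power_mono[OF K(2), of _ 2] in \<open>auto simp: power_mult_distrib
            intro: amp_summable[OF a] summable_mult summable_coord\<close>)
      also have "\<dots> = K\<^sup>2 * (norm x)\<^sup>2" unfolding norm_ell2_power2 by (rule suminf_mult[OF summable_coord])
      also have "\<dots> = (K * norm x)\<^sup>2" by (simp add: power_mult_distrib)
      finally show ?thesis using K(1) by (meson mult_nonneg_nonneg norm_ge_zero power2_le_imp_le)
    qed
  qed
qed

lemma adj_amp: "bounded_operator a \<Longrightarrow> adj (amp a) = amp (adj a)"
  by (rule adj_eqI) (auto simp: bounded_operator_amp cinner_ell2.rep_eq coord_amp adj_bounded cinner_adj)

lemma star_subalgebraD:
  assumes "star_subalgebra A"
  shows "a \<in> A \<Longrightarrow> bounded_operator a" "a \<in> A \<Longrightarrow> adj a \<in> A" "(\<lambda>v. 0) \<in> A"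
    "a \<in> A \<Longrightarrow> b \<in> A \<Longrightarrow> (\<lambda>v. a v + b v) \<in> A" "a \<in> A \<Longrightarrow> b \<in> A \<Longrightarrow> a \<circ> b \<in> A"
    "a \<in> A \<Longrightarrow> (\<lambda>v. c *\<^sub>C a v) \<in> A"
  using assms by (auto simp: star_subalgebra_def)

lemma star_subalgebra_amp:
  assumes A: "star_subalgebra A"
  shows "star_subalgebra (amp ` A)"
proof -
  note b = star_subalgebraD(1)[OF A]
  have 1: "bounded_operator t \<and> adj t \<in> amp ` A" if "t \<in> amp ` A" for t
    using that by (auto simp: bounded_operator_amp b adj_amp star_subalgebraD[OF A])
  have 2: "(\<lambda>v. 0) \<in> amp ` A"
  proof (rule image_eqI[of _ _ "\<lambda>v. 0"])
    show "(\<lambda>v. 0) = amp (\<lambda>v::'a. 0)"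
      by (rule ext, rule ell2_eqI) (simp add: coord_amp[OF bounded_operator_zero] zero_ell2.rep_eq)
  qed (rule star_subalgebraD[OF A])
  have 3: "(\<lambda>v. amp a v + amp c v) = amp (\<lambda>v. a v + c v)" "amp a \<circ> amp c = amp (a \<circ> c)"
    if "a \<in> A" "c \<in> A" for a c
    using b[OF that(1)] b[OF that(2)]
    by (auto intro!: ext intro: ell2_eqI simp: coord_amp bounded_operator_add bounded_operator_comp plus_ell2.rep_eq)
  have 4: "(\<lambda>v. c *\<^sub>C amp a v) = amp (\<lambda>v. c *\<^sub>C a v)" if "a \<in> A" for a c
    using b[OF that] by (auto intro!: ext intro: ell2_eqI simp: coord_amp bounded_operator_scaleC scaleC_ell2.rep_eq)
  show ?thesis unfolding star_subalgebra_def
  proof (intro conjI ballI allI)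
    fix s t c assume "s \<in> amp ` A" "t \<in> amp ` A"
    then obtain a c' where ac: "a \<in> A" "c' \<in> A" "s = amp a" "t = amp c'" by blast
    show "(\<lambda>v. s v + t v) \<in> amp ` A" unfolding ac 3(1)[OF ac(1,2)] by (intro imageI star_subalgebraD[OF A] ac)
    show "s \<circ> t \<in> amp ` A" unfolding ac 3(2)[OF ac(1,2)] by (intro imageI star_subalgebraD[OF A] ac)
  next
    fix s c assume "s \<in> amp ` A"
    then obtain a where a: "a \<in> A" "s = amp a" by blast
    show "(\<lambda>v. c *\<^sub>C s v) \<in> amp ` A" unfolding a 4[OF a(1)] by (intro imageI star_subalgebraD[OF A] a)
  qed (use 1 2 in auto)
qed

lemma amp_id: "amp id = id"
  by (rule ext, rule ell2_eqI) (simp add: coord_amp bounded_operator_id)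

lemma commutantD: "a \<in> commutant S \<Longrightarrow> bounded_operator a" "a \<in> commutant S \<Longrightarrow> b \<in> S \<Longrightarrow> a (b v) = b (a v)"
  by (auto simp: commutant_def fun_eq_iff)

text \<open>The matrix entries of an operator \<open>T\<close> that commutes with all amplified
  elements of \<open>A\<close> lie in the commutant of \<open>A\<close>. So \<open>x\<close>
  commutes with every entry, which gives the claim on sequences supported at one index; linearity
  and continuity do the rest.\<close>

lemma amp_bicommutant:
  assumes A: "star_subalgebra A" and x: "x \<in> commutant (commutant A)"
  shows "amp x \<in> commutant (commutant (amp ` A))"
proof -
  have xb: "bounded_operator x" by (rule commutantD(1)[OF x])
  have "amp x \<circ> T = T \<circ> amp x" if T: "T \<in> commutant (amp ` A)" for T
  proof
    fix w
    note Tb = commutantD(1)[OF T]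
    have entry: "(\<lambda>v. coord (T (inj_coord n v)) m) \<in> commutant A" for m n
    proof -
      obtain K where K: "K \<ge> 0" "\<And>x. norm (T x) \<le> K * norm x" using bounded_operator_bound[OF Tb] by blast
      have ia: "inj_coord n (u + v) = inj_coord n u + inj_coord n v" "inj_coord n (c *\<^sub>C v) = c *\<^sub>C inj_coord n v" for u v :: 'a and c
        by (rule ell2_eqI, simp add: coord_inj_coord plus_ell2.rep_eq scaleC_ell2.rep_eq)+
      have "bounded_operator (\<lambda>v. coord (T (inj_coord n v)) m)"
      proof (rule bounded_operatorI)
        show "norm (coord (T (inj_coord n v)) m) \<le> K * norm v" for v
          using norm_coord_le[of "T (inj_coord n v)" m] K(2)[of "inj_coord n v"] by (simp add: norm_inj_coord)
      qed (simp_all add: ia bounded_operatorD[OF Tb] plus_ell2.rep_eq scaleC_ell2.rep_eq)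
      moreover have "coord (T (inj_coord n (a v))) m = a (coord (T (inj_coord n v)) m)" if a: "a \<in> A" for a v
      proof -
        note ab = star_subalgebraD(1)[OF A a]
        have "inj_coord n (a v) = amp a (inj_coord n v)"
          by (rule ell2_eqI) (simp add: coord_inj_coord coord_amp[OF ab] bounded_operatorD[OF ab])
        then show ?thesis using commutantD(2)[OF T imageI[OF a]] by (simp add: coord_amp[OF ab])
      qed
      ultimately show ?thesis by (auto simp: commutant_def fun_eq_iff)
    qed
    have single: "amp x (T (inj_coord n v)) = T (amp x (inj_coord n v))" for n v
    proof (rule ell2_eqI)
      fix m
      have "inj_coord n (x v) = amp x (inj_coord n v)"
        by (rule ell2_eqI) (simp add: coord_inj_coord coord_amp[OF xb] bounded_operatorD[OF xb])
      moreover have "x (coord (T (inj_coord n v)) m) = coord (T (inj_coord n (x v))) m"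
        using commutantD(2)[OF x entry] by simp
      ultimately show "coord (amp x (T (inj_coord n v))) m = coord (T (amp x (inj_coord n v))) m"
        by (simp add: coord_amp[OF xb])
    qed
    have lin: "bounded_linear (\<lambda>w. amp x (T w))" "bounded_linear (\<lambda>w. T (amp x w))"
      using bounded_linear_compose bounded_operatorD(1)[OF Tb] bounded_operatorD(1)[OF bounded_operator_amp[OF xb]]
      by blast+
    have "(\<lambda>K. amp x (T (\<Sum>n<K. inj_coord n (coord w n)))) \<longlonglongrightarrow> amp x (T w)"
      by (rule bounded_linear.tendsto[OF lin(1) ell2_truncation_tendsto])
    moreover have "(\<lambda>K. T (amp x (\<Sum>n<K. inj_coord n (coord w n)))) \<longlonglongrightarrow> T (amp x w)"
      by (rule bounded_linear.tendsto[OF lin(2) ell2_truncation_tendsto])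
    moreover have "amp x (T (\<Sum>n<K. inj_coord n (coord w n))) = T (amp x (\<Sum>n<K. inj_coord n (coord w n)))" for K
      unfolding linear_sum[OF bounded_linear.linear[OF lin(1)]] linear_sum[OF bounded_linear.linear[OF lin(2)]] single ..
    ultimately show "(amp x \<circ> T) w = (T \<circ> amp x) w" using LIMSEQ_unique by simp
  qed
  then show ?thesis using bounded_operator_amp[OF xb] by (auto simp: commutant_def)
qed

text \<open>The amplified algebra sees \<open>\<zeta>\<close> as one vector. Covering all
  square-summable sequences upgrades strong approximation to ultrastrong approximation, the kind to
  which a normal functional responds.\<close>

lemma ultrastrong_density:
  fixes A :: "('h::complex_hilbert_space \<Rightarrow> 'h) set"
  assumes A: "star_subalgebra A" "id \<in> A" and x: "x \<in> commutant (commutant A)"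
    and z: "summable (\<lambda>n. (norm (\<zeta> n))\<^sup>2)" and e: "e > 0"
  shows "\<exists>p\<in>A. (\<Sum>n. (norm (p (\<zeta> n) - x (\<zeta> n)))\<^sup>2) < e"
proof -
  have cz: "coord (Abs_ell2 \<zeta>) = \<zeta>" using z by (simp add: Abs_ell2_inverse)
  have xb: "bounded_operator x" by (rule commutantD(1)[OF x])
  have "id \<in> amp ` A" using A(2) amp_id by (metis imageI)
  then obtain t where t: "t \<in> amp ` A" "norm (t (Abs_ell2 \<zeta>) - amp x (Abs_ell2 \<zeta>)) < sqrt e"
    using bicommutant_vector_density[OF star_subalgebra_amp[OF A(1)] _ amp_bicommutant[OF A(1) x], of "sqrt e" "Abs_ell2 \<zeta>"] e
    by auto
  obtain p where p: "p \<in> A" "t = amp p" using t(1) by blast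
  have pb: "bounded_operator p" by (rule star_subalgebraD(1)[OF A(1) p(1)])
  have "(norm (amp p (Abs_ell2 \<zeta>) - amp x (Abs_ell2 \<zeta>)))\<^sup>2 < (sqrt e)\<^sup>2"
    using t(2) p(2) by (intro power_strict_mono) auto
  then show ?thesis using p(1) e
    by (auto simp: norm_ell2_power2 minus_ell2.rep_eq coord_amp[OF pb] coord_amp[OF xb] cz)
qed

section \<open>Von Neumann algebras and normal states\<close>

lemma commutant_star_subalgebra:
  fixes S :: "('h::complex_hilbert_space \<Rightarrow> 'h) set"
  assumes S: "\<And>b. b \<in> S \<Longrightarrow> bounded_operator b" "\<And>b. b \<in> S \<Longrightarrow> adj b \<in> S"
  shows "star_subalgebra (commutant S)"
proof -
  have "adj a \<circ> b = b \<circ> adj a" if a: "a \<in> commutant S" and b: "b \<in> S" for a b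
  proof -
    note ab = commutantD(1)[OF a] and bb = S(1)[OF b]
    have "adj b \<circ> a = a \<circ> adj b" using a S(2)[OF b] by (simp add: commutant_def)
    then have "adj (adj b \<circ> a) = adj (a \<circ> adj b)" by simp
    then show ?thesis by (simp add: adj_comp ab bb adj_bounded adj_adj)
  qed
  note adj = this
  note SD = bounded_operatorD(2,3,4)[OF S(1)]
  show ?thesis
    unfolding star_subalgebra_def
  proof (intro conjI ballI allI)
    show "(\<lambda>v. 0) \<in> commutant S" by (simp add: commutant_def fun_eq_iff bounded_operator_zero SD)
    fix a assume a: "a \<in> commutant S"
    note aD = commutantD[OF a]
    show "bounded_operator a" by (rule aD)
    show "adj a \<in> commutant S" using adj[OF a] aD(1) by (simp add: commutant_def adj_bounded)
    show "(\<lambda>v. c *\<^sub>C a v) \<in> commutant S" for c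
      using aD by (simp add: commutant_def fun_eq_iff bounded_operator_scaleC SD)
    fix b assume b: "b \<in> commutant S"
    note bD = commutantD[OF b]
    show "(\<lambda>v. a v + b v) \<in> commutant S"
      using aD bD by (simp add: commutant_def fun_eq_iff bounded_operator_add SD)
    show "a \<circ> b \<in> commutant S"
      using aD bD by (simp add: commutant_def fun_eq_iff bounded_operator_comp)
  qed
qed

lemma id_in_commutant: "id \<in> commutant S"
  by (simp add: commutant_def bounded_operator_id)

lemma commutant_antimono: "S \<subseteq> T \<Longrightarrow> commutant T \<subseteq> commutant S"
  by (auto simp: commutant_def)

lemma subset_bicommutant:
  assumes "\<And>b. b \<in> S \<Longrightarrow> bounded_operator b"
  shows "S \<subseteq> commutant (commutant S)"
  using assms by (auto simp: commutant_def)

lemma von_neumann_star_subalgebra: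
  assumes "von_neumann_algebra M"
  shows "star_subalgebra M" "id \<in> M"
proof -
  have M: "commutant (commutant M) = M" "\<And>a. a \<in> M \<Longrightarrow> adj a \<in> M"
    using assms by (auto simp: von_neumann_algebra_def)
  have b: "bounded_operator a" if "a \<in> M" for a using that M(1) commutantD(1) by blast
  have 1: "star_subalgebra (commutant M)" using b M(2) by (rule commutant_star_subalgebra)
  have "star_subalgebra (commutant (commutant M))"
    by (rule commutant_star_subalgebra) (use star_subalgebraD[OF 1] in auto)
  then show "star_subalgebra M" by (simp add: M(1))
  show "id \<in> M" using id_in_commutant[of "commutant M"] by (simp add: M(1))
qed

text \<open>Three commutants amount to one, so the bicommutant of \<open>A\<close> is a von Neumann
  algebra; it contains \<open>S\<close> and hence its hull.\<close>

lemma hull_subset_bicommutant: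
  assumes A: "star_subalgebra A" and S: "S \<subseteq> A"
  shows "von_neumann_algebra hull S \<subseteq> commutant (commutant A)"
proof (rule hull_minimal)
  have b: "bounded_operator a" if "a \<in> A" for a using star_subalgebraD(1)[OF A that] .
  show "S \<subseteq> commutant (commutant A)" using S subset_bicommutant[of A] b by blast
  have 1: "star_subalgebra (commutant A)"
    by (rule commutant_star_subalgebra) (use star_subalgebraD[OF A] in auto)
  have 2: "star_subalgebra (commutant (commutant A))"
    by (rule commutant_star_subalgebra) (use star_subalgebraD[OF 1] in auto)
  have "commutant (commutant (commutant A)) = commutant A"
  proof
    show "commutant A \<subseteq> commutant (commutant (commutant A))"
      by (rule subset_bicommutant) (use star_subalgebraD[OF 1] in auto)
    show "commutant (commutant (commutant A)) \<subseteq> commutant A"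
      by (rule commutant_antimono[OF subset_bicommutant[OF b]])
  qed
  then show "von_neumann_algebra (commutant (commutant A))"
    using star_subalgebraD(2)[OF 2] by (simp add: von_neumann_algebra_def)
qed

text \<open>Interleaving at even and odd indices lets one sequence do the work of two. A finite
  intersection of ultraweak neighbourhoods thereby becomes a condition on a single sequence.\<close>

lemma merge_square_summable:
  fixes \<xi> \<eta> :: "nat \<Rightarrow> 'h::complex_hilbert_space"
  assumes "summable (\<lambda>n. (norm (\<xi> n))\<^sup>2)" "summable (\<lambda>n. (norm (\<eta> n))\<^sup>2)"
  shows "\<exists>\<zeta>. summable (\<lambda>n. (norm (\<zeta> n))\<^sup>2) \<and>
    (\<forall>c. bounded_operator c \<longrightarrow>
      (\<Sum>n. (norm (c (\<zeta> n))::real)\<^sup>2) = (\<Sum>n. (norm (c (\<xi> n)))\<^sup>2) + (\<Sum>n. (norm (c (\<eta> n)))\<^sup>2))"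
proof -
  define \<zeta> where "\<zeta> n = (if even n then \<xi> (n div 2) else \<eta> ((n - 1) div 2))" for n
  have s: "(\<lambda>n. (norm (c (\<zeta> n)))\<^sup>2) sums ((\<Sum>n. (norm (c (\<xi> n)))\<^sup>2) + (\<Sum>n. (norm (c (\<eta> n)))\<^sup>2))"
    if c: "bounded_operator c" for c :: "'h \<Rightarrow> 'h"
  proof -
    have "(\<lambda>n. (norm (c (\<xi> n)))\<^sup>2) sums (\<Sum>n. (norm (c (\<xi> n)))\<^sup>2)"
      "(\<lambda>n. (norm (c (\<eta> n)))\<^sup>2) sums (\<Sum>n. (norm (c (\<eta> n)))\<^sup>2)"
      using amp_summable[OF c] assms by (auto intro: summable_sums)
    from sums_if[OF this(2,1)]
    show ?thesis by (simp add: \<zeta>_def if_distrib[of "\<lambda>x. (norm (c x))\<^sup>2"] add.commute)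
  qed
  have "summable (\<lambda>n. (norm (\<zeta> n))\<^sup>2)"
    using s[OF bounded_operator_id] by (simp add: sums_iff)
  moreover have "(\<Sum>n. (norm (c (\<zeta> n)))\<^sup>2) = (\<Sum>n. (norm (c (\<xi> n)))\<^sup>2) + (\<Sum>n. (norm (c (\<eta> n)))\<^sup>2)"
    if "bounded_operator c" for c using s[OF that] by (simp add: sums_iff)
  ultimately show ?thesis by blast
qed

lemma merge_finite_square_summable:
  fixes Z :: "(nat \<Rightarrow> 'h::complex_hilbert_space) set"
  assumes "finite Z" "\<And>\<xi>. \<xi> \<in> Z \<Longrightarrow> summable (\<lambda>n. (norm (\<xi> n))\<^sup>2)"
  shows "\<exists>\<zeta>. summable (\<lambda>n. (norm (\<zeta> n))\<^sup>2) \<and>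
    (\<forall>\<xi>\<in>Z. \<forall>c. bounded_operator c \<longrightarrow> (\<Sum>n. (norm (c (\<xi> n))::real)\<^sup>2) \<le> (\<Sum>n. (norm (c (\<zeta> n)))\<^sup>2))"
  using assms
proof (induction Z rule: finite_induct)
  case empty
  show ?case by (rule exI[of _ "\<lambda>n. 0"]) simp
next
  case (insert \<eta> Z)
  have sZ: "summable (\<lambda>n. (norm (\<xi> n))\<^sup>2)" if "\<xi> \<in> Z" for \<xi>
    by (rule insert.prems) (use that in simp)
  have e: "summable (\<lambda>n. (norm (\<eta> n))\<^sup>2)" by (rule insert.prems) simp
  have "\<exists>\<zeta>. summable (\<lambda>n. (norm (\<zeta> n))\<^sup>2) \<and>
    (\<forall>\<xi>\<in>Z. \<forall>c. bounded_operator c \<longrightarrow> (\<Sum>n. (norm (c (\<xi> n))::real)\<^sup>2) \<le> (\<Sum>n. (norm (c (\<zeta> n)))\<^sup>2))"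
    by (rule insert.IH) (rule sZ)
  then obtain \<zeta> where z: "summable (\<lambda>n. (norm (\<zeta> n))\<^sup>2)" and
    zle: "\<forall>\<xi>\<in>Z. \<forall>c. bounded_operator c \<longrightarrow> (\<Sum>n. (norm (c (\<xi> n))::real)\<^sup>2) \<le> (\<Sum>n. (norm (c (\<zeta> n)))\<^sup>2)"
    by (elim exE conjE)
  from merge_square_summable[OF z e] obtain \<theta> where t: "summable (\<lambda>n. (norm (\<theta> n))\<^sup>2)" and
    teq: "\<forall>c. bounded_operator c \<longrightarrow>
      (\<Sum>n. (norm (c (\<theta> n))::real)\<^sup>2) = (\<Sum>n. (norm (c (\<zeta> n)))\<^sup>2) + (\<Sum>n. (norm (c (\<eta> n)))\<^sup>2)"
    by (elim exE conjE)
  have "(\<Sum>n. (norm (c (\<xi> n)))\<^sup>2) \<le> (\<Sum>n. (norm (c (\<theta> n)))\<^sup>2)"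
    if x: "\<xi> \<in> insert \<eta> Z" and c: "bounded_operator c" for \<xi> c
  proof -
    have 1: "0 \<le> (\<Sum>n. (norm (c (\<zeta> n)))\<^sup>2)" by (rule suminf_nonneg[OF amp_summable[OF c z]]) simp
    have 2: "0 \<le> (\<Sum>n. (norm (c (\<eta> n)))\<^sup>2)" by (rule suminf_nonneg[OF amp_summable[OF c e]]) simp
    note 3 = teq[rule_format, OF c]
    show ?thesis
    proof (cases "\<xi> = \<eta>")
      case True
      then show ?thesis using 1 3 by simp
    next
      case False
      then have "\<xi> \<in> Z" using x by simp
      from zle[rule_format, OF this c] show ?thesis using 2 3 by linarith
    qed
  qed
  then have "\<forall>\<xi>\<in>insert \<eta> Z. \<forall>c. bounded_operator c \<longrightarrow>
      (\<Sum>n. (norm (c (\<xi> n))::real)\<^sup>2) \<le> (\<Sum>n. (norm (c (\<theta> n)))\<^sup>2)"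
    by (intro ballI allI impI)
  with t show ?case by (intro exI conjI)
qed

text \<open>On elements of the form \<open>adj c \<circ> c\<close> a basic functional has terms
  \<open>cinner (c (\<xi> n)) (c (\<eta> n))\<close>, dominated by the squared norms of both
  vectors. An ultraweak condition thus turns into smallness of \<open>c\<close> on a square-summable
  sequence, which ultrastrong density can provide.\<close>

lemma ultraweak_neighbourhood_of_zero:
  fixes V :: "('h::complex_hilbert_space \<Rightarrow> 'h) set"
  assumes "openin ultraweak_topology V" "(\<lambda>v. 0) \<in> V"
  shows "\<exists>\<zeta> \<delta>. summable (\<lambda>n. (norm (\<zeta> n))\<^sup>2) \<and> \<delta> > 0 \<and>
    (\<forall>c. bounded_operator c \<longrightarrow> (\<Sum>n. (norm (c (\<zeta> n)))\<^sup>2) < \<delta> \<longrightarrow> adj c \<circ> c \<in> V)"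
proof -
  have "generate_topology_on {{a::'h \<Rightarrow> 'h. bounded_operator a \<and> (\<Sum>n. cinner (a (\<xi> n)) (\<eta> n)) \<in> U} | \<xi> \<eta> U.
        summable (\<lambda>n. (norm (\<xi> n))\<^sup>2) \<and> summable (\<lambda>n. (norm (\<eta> n))\<^sup>2) \<and> open U} V"
    using assms(1) unfolding ultraweak_topology_def openin_topology_generated_by_iff .
  then show ?thesis using assms(2)
  proof (induction rule: generate_topology_on.induct)
    case (Int a b)
    obtain \<xi> r where x: "summable (\<lambda>n. (norm (\<xi> n))\<^sup>2)" "r > 0"
      "\<And>c. bounded_operator c \<Longrightarrow> (\<Sum>n. (norm (c (\<xi> n)))\<^sup>2) < r \<Longrightarrow> adj c \<circ> c \<in> a"
      using Int.IH(1) Int.prems by blast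
    obtain \<eta> s where y: "summable (\<lambda>n. (norm (\<eta> n))\<^sup>2)" "s > 0"
      "\<And>c. bounded_operator c \<Longrightarrow> (\<Sum>n. (norm (c (\<eta> n)))\<^sup>2) < s \<Longrightarrow> adj c \<circ> c \<in> b"
      using Int.IH(2) Int.prems by blast
    have "\<exists>\<zeta>. summable (\<lambda>n. (norm (\<zeta> n))\<^sup>2) \<and> (\<forall>\<psi>\<in>{\<xi>, \<eta>}. \<forall>c. bounded_operator c \<longrightarrow>
        (\<Sum>n. (norm (c (\<psi> n))::real)\<^sup>2) \<le> (\<Sum>n. (norm (c (\<zeta> n)))\<^sup>2))"
      by (rule merge_finite_square_summable) (use x y in auto)
    then obtain \<zeta> where z: "summable (\<lambda>n. (norm (\<zeta> n))\<^sup>2)"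
      "\<And>c. bounded_operator c \<Longrightarrow> (\<Sum>n. (norm (c (\<xi> n))::real)\<^sup>2) \<le> (\<Sum>n. (norm (c (\<zeta> n)))\<^sup>2)"
      "\<And>c. bounded_operator c \<Longrightarrow> (\<Sum>n. (norm (c (\<eta> n))::real)\<^sup>2) \<le> (\<Sum>n. (norm (c (\<zeta> n)))\<^sup>2)"
      by blast
    show ?case
    proof (intro exI[of _ \<zeta>] exI[of _ "min r s"] conjI allI impI)
      fix c :: "'h \<Rightarrow> 'h"
      assume c: "bounded_operator c" "(\<Sum>n. (norm (c (\<zeta> n)))\<^sup>2) < min r s"
      have "(\<Sum>n. (norm (c (\<xi> n)))\<^sup>2) < r" "(\<Sum>n. (norm (c (\<eta> n)))\<^sup>2) < s"
        using z(2,3)[OF c(1)] c(2) by linarith+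
      then show "adj c \<circ> c \<in> a \<inter> b" by (intro IntI x(3)[OF c(1)] y(3)[OF c(1)])
    qed (use z x y in auto)
  next
    case (UN K)
    then obtain k where k: "k \<in> K" "(\<lambda>v. 0) \<in> k" by blast
    from UN.IH[OF k] obtain \<zeta> \<delta> where "summable (\<lambda>n. (norm (\<zeta> n))\<^sup>2)" "\<delta> > 0"
      "\<And>c. bounded_operator c \<Longrightarrow> (\<Sum>n. (norm (c (\<zeta> n)))\<^sup>2) < \<delta> \<Longrightarrow> adj c \<circ> c \<in> k" by blast
    then show ?case using k(1) by (intro exI[of _ \<zeta>] exI[of _ \<delta>] conjI allI impI UnionI[OF k(1)]) blast+
  next
    case (Basis s)
    then obtain \<xi> \<eta> :: "nat \<Rightarrow> 'h" and U where s: "s = {a. bounded_operator a \<and> (\<Sum>n. cinner (a (\<xi> n)) (\<eta> n)) \<in> U}"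
      "summable (\<lambda>n. (norm (\<xi> n))\<^sup>2)" "summable (\<lambda>n. (norm (\<eta> n))\<^sup>2)" "open U" by blast
    have "0 \<in> U" using Basis.prems s(1) by simp
    then obtain r where r: "r > 0" "ball 0 r \<subseteq> U" using s(4) open_contains_ball by blast
    obtain \<zeta> where z: "summable (\<lambda>n. (norm (\<zeta> n))\<^sup>2)"
      "\<And>c. bounded_operator c \<Longrightarrow> (\<Sum>n. (norm (c (\<zeta> n))::real)\<^sup>2) = (\<Sum>n. (norm (c (\<xi> n)))\<^sup>2) + (\<Sum>n. (norm (c (\<eta> n)))\<^sup>2)"
      using merge_square_summable[OF s(2,3)] by blast
    show ?case
    proof (intro exI[of _ \<zeta>] exI[of _ r] conjI allI impI)
      fix c :: "'h \<Rightarrow> 'h"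
      assume c: "bounded_operator c" "(\<Sum>n. (norm (c (\<zeta> n)))\<^sup>2) < r"
      note sx = amp_summable[OF c(1) s(2)] and sy = amp_summable[OF c(1) s(3)]
      have e: "cinner ((adj c \<circ> c) u) v = cinner (c u) (c v)" for u v
        using cinner_adj'[OF c(1)] by simp
      have n: "norm (cinner (c (\<xi> n)) (c (\<eta> n))) \<le> (norm (c (\<xi> n)))\<^sup>2 + (norm (c (\<eta> n)))\<^sup>2" for n
      proof -
        have "0 \<le> (norm (c (\<xi> n)) - norm (c (\<eta> n)))\<^sup>2" by simp
        then have "2 * (norm (c (\<xi> n)) * norm (c (\<eta> n))) \<le> (norm (c (\<xi> n)))\<^sup>2 + (norm (c (\<eta> n)))\<^sup>2"
          by (simp add: power2_diff)
        moreover have "0 \<le> norm (c (\<xi> n)) * norm (c (\<eta> n))" by simp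
        ultimately show ?thesis using cmod_cinner_le[of "c (\<xi> n)" "c (\<eta> n)"] by linarith
      qed
      have sn: "summable (\<lambda>n. norm (cinner (c (\<xi> n)) (c (\<eta> n))))"
        by (rule summable_comparison_test'[OF summable_add[OF sx sy]]) (use n in auto)
      have "norm (\<Sum>n. cinner (c (\<xi> n)) (c (\<eta> n))) \<le> (\<Sum>n. norm (cinner (c (\<xi> n)) (c (\<eta> n))))"
        by (rule summable_norm[OF sn])
      also have "\<dots> \<le> (\<Sum>n. (norm (c (\<xi> n)))\<^sup>2 + (norm (c (\<eta> n)))\<^sup>2)"
        by (rule suminf_le[OF n sn summable_add[OF sx sy]])
      also have "\<dots> = (\<Sum>n. (norm (c (\<zeta> n)))\<^sup>2)"
        by (simp add: suminf_add[OF sx sy, symmetric] z(2)[OF c(1)])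
      finally have "(\<Sum>n. cinner (c (\<xi> n)) (c (\<eta> n))) \<in> U" using r(2) c(2) by auto
      then have "(\<Sum>n. cinner ((adj c \<circ> c) (\<xi> n)) (\<eta> n)) \<in> U" unfolding e .
      then show "adj c \<circ> c \<in> s"
        unfolding s(1) by (simp only: mem_Collect_eq bounded_operator_comp[OF adj_bounded[OF c(1)] c(1)])
    qed (use z r in auto)
  qed simp
qed

text \<open>Continuity at zero keeps the value at \<open>adj c \<circ> c\<close> below 1 in modulus
  when the series for \<open>c\<close> is below some \<open>\<delta>\<close>; scaling
  \<open>c\<close> turns this into a linear bound. Normality enters the later arguments in the form
  of this inequality.\<close>

lemma normal_trace_bound:
  fixes M :: "('h::complex_hilbert_space \<Rightarrow> 'h) set"
  assumes M: "star_subalgebra M" and n: "normal_functional M \<tau>"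
    and hom: "\<And>a c. a \<in> M \<Longrightarrow> \<tau> (\<lambda>v. c *\<^sub>C a v) = c * \<tau> a"
  shows "\<exists>\<zeta> K. summable (\<lambda>n. (norm (\<zeta> n))\<^sup>2) \<and> K > 0 \<and>
    (\<forall>c\<in>M. cmod (\<tau> (adj c \<circ> c)) \<le> K * (\<Sum>n. (norm (c (\<zeta> n)))\<^sup>2))"
proof -
  note MD = star_subalgebraD[OF M]
  have Mtop: "M \<subseteq> topspace ultraweak_topology"
  proof
    fix a assume "a \<in> M"
    then have "a \<in> {a. bounded_operator a \<and> (\<Sum>n. cinner (a ((\<lambda>n. 0) n)) ((\<lambda>n. 0) n)) \<in> UNIV}" using MD by simp
    moreover have "openin ultraweak_topology {a::'h \<Rightarrow> 'h. bounded_operator a \<and> (\<Sum>n. cinner (a ((\<lambda>n. 0) n)) ((\<lambda>n. 0) n)) \<in> UNIV}"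
      unfolding ultraweak_topology_def
      by (rule topology_generated_by_Basis, rule CollectI, rule exI[of _ "\<lambda>n. 0"], rule exI[of _ "\<lambda>n. 0"], rule exI[of _ UNIV]) simp
    ultimately show "a \<in> topspace ultraweak_topology" using openin_subset by blast
  qed
  have "openin (subtopology ultraweak_topology M) {a \<in> topspace (subtopology ultraweak_topology M). \<tau> a \<in> ball 0 1}"
  proof -
    have "\<forall>U. openin euclidean U \<longrightarrow> openin (subtopology ultraweak_topology M)
        {a \<in> topspace (subtopology ultraweak_topology M). \<tau> a \<in> U}"
      using n unfolding normal_functional_def continuous_map_def by (rule conjunct2)
    then show ?thesis by (metis open_ball open_openin)
  qed
  then obtain V where V: "openin ultraweak_topology V" "{a \<in> M. \<tau> a \<in> ball 0 1} = V \<inter> M"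
    unfolding openin_subtopology using Mtop by (auto simp: Int_absorb1)
  have "\<tau> (\<lambda>v. 0) = 0" using hom[OF MD(3), of 0] by simp
  then have "(\<lambda>v. 0) \<in> {a \<in> M. \<tau> a \<in> ball 0 1}" using MD(3) by simp
  then have "(\<lambda>v. 0) \<in> V" unfolding V(2) by (rule IntD1)
  from ultraweak_neighbourhood_of_zero[OF V(1) this]
  obtain \<zeta> \<delta> where z: "summable (\<lambda>n. (norm (\<zeta> n))\<^sup>2)" "\<delta> > 0"
    "\<And>c. bounded_operator c \<Longrightarrow> (\<Sum>n. (norm (c (\<zeta> n)))\<^sup>2) < \<delta> \<Longrightarrow> adj c \<circ> c \<in> V" by blast
  have key: "s * cmod (\<tau> (adj c \<circ> c)) < 1"
    if c: "c \<in> M" and s: "s \<ge> 0" "s * (\<Sum>n. (norm (c (\<zeta> n)))\<^sup>2) < \<delta>" for c s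
  proof -
    define b where "b = (\<lambda>v. complex_of_real (sqrt s) *\<^sub>C c v)"
    note cb = MD(1)[OF c]
    have b: "b \<in> M" "bounded_operator b" unfolding b_def using MD(6)[OF c] MD(1) by auto
    have "(\<Sum>n. (norm (b (\<zeta> n)))\<^sup>2) = (\<Sum>n. s * (norm (c (\<zeta> n)))\<^sup>2)"
      using s(1) by (simp add: b_def norm_scaleC power_mult_distrib)
    also have "\<dots> = s * (\<Sum>n. (norm (c (\<zeta> n)))\<^sup>2)" by (rule suminf_mult[OF amp_summable[OF cb z(1)]])
    finally have "adj b \<circ> b \<in> V" using z(3)[OF b(2)] s(2) by simp
    moreover have "adj b \<circ> b \<in> M" using MD b by blast
    ultimately have "\<tau> (adj b \<circ> b) \<in> ball 0 1" using V(2) by blast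
    moreover have "adj b \<circ> b = (\<lambda>v. complex_of_real s *\<^sub>C (adj c \<circ> c) v)"
      unfolding b_def using s(1)
      by (auto simp: adj_scaleC[OF cb] bounded_operatorD[OF adj_bounded[OF cb]] scaleC_scaleC
          simp flip: of_real_mult)
    ultimately show ?thesis using hom[of "adj c \<circ> c" "complex_of_real s"] MD c s(1)
      by (auto simp: norm_mult)
  qed
  have "cmod (\<tau> (adj c \<circ> c)) \<le> 2 / \<delta> * (\<Sum>n. (norm (c (\<zeta> n)))\<^sup>2)" if c: "c \<in> M" for c
  proof -
    let ?t = "\<Sum>n. (norm (c (\<zeta> n)))\<^sup>2"
    have t0: "?t \<ge> 0" by (intro suminf_nonneg amp_summable[OF MD(1)[OF c] z(1)]) auto
    show ?thesis
    proof (cases "?t = 0")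
      case True
      \<comment> \<open>When the series vanishes, \<open>c\<close> may be scaled at will; the scale
        in \<open>key\<close> that normalizes the value of \<open>\<tau>\<close> to modulus 1 is
        contradictory.\<close>
      have "cmod (\<tau> (adj c \<circ> c)) = 0"
      proof (rule ccontr)
        assume ne: "cmod (\<tau> (adj c \<circ> c)) \<noteq> 0"
        show False using key[OF c, of "1 / cmod (\<tau> (adj c \<circ> c))"] True z(2) ne by simp
      qed
      then show ?thesis using True by simp
    next
      case False
      then have t: "?t > 0" using t0 by simp
      \<comment> \<open>Half of the critical scale, since the smallness condition is strict.\<close>
      have "\<delta> / (2 * ?t) * cmod (\<tau> (adj c \<circ> c)) < 1"
        by (rule key[OF c]) (use t z(2) in \<open>auto simp: field_simps\<close>)
      then show ?thesis using t z(2) by (simp add: field_simps)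
    qed
  qed
  then show ?thesis using z(1,2) by (intro exI[of _ \<zeta>] exI[of _ "2 / \<delta>"]) auto
qed

lemma tracial_stateD:
  assumes "tracial_state M \<tau>"
  shows "\<forall>a\<in>M. \<forall>b\<in>M. \<tau> (\<lambda>v. a v + b v) = \<tau> a + \<tau> b"
    and "\<forall>a\<in>M. \<forall>c. \<tau> (\<lambda>v. c *\<^sub>C a v) = c * \<tau> a"
    and "\<tau> id = 1"
    and "\<forall>a\<in>M. \<tau> (adj a \<circ> a) \<in> \<real>\<^sub>\<ge>\<^sub>0"
    and "\<forall>a\<in>M. \<forall>b\<in>M. \<tau> (a \<circ> b) = \<tau> (b \<circ> a)"
    and "\<forall>a\<in>M. \<tau> (adj a \<circ> a) = 0 \<longrightarrow> a = (\<lambda>v. 0)"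
    and "normal_functional M \<tau>"
proof -
  note c = assms[unfolded tracial_state_def]
  show "\<forall>a\<in>M. \<forall>b\<in>M. \<tau> (\<lambda>v. a v + b v) = \<tau> a + \<tau> b"
    using c[THEN conjunct1] .
  show "\<forall>a\<in>M. \<forall>c. \<tau> (\<lambda>v. c *\<^sub>C a v) = c * \<tau> a"
    using c[THEN conjunct2, THEN conjunct1] .
  show "\<tau> id = 1"
    using c[THEN conjunct2, THEN conjunct2, THEN conjunct1] .
  show "\<forall>a\<in>M. \<tau> (adj a \<circ> a) \<in> \<real>\<^sub>\<ge>\<^sub>0"
    using c[THEN conjunct2, THEN conjunct2, THEN conjunct2, THEN conjunct1] .
  show "\<forall>a\<in>M. \<forall>b\<in>M. \<tau> (a \<circ> b) = \<tau> (b \<circ> a)"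
    using c[THEN conjunct2, THEN conjunct2, THEN conjunct2, THEN conjunct2, THEN conjunct1] .
  show "\<forall>a\<in>M. \<tau> (adj a \<circ> a) = 0 \<longrightarrow> a = (\<lambda>v. 0)"
    using c[THEN conjunct2, THEN conjunct2, THEN conjunct2, THEN conjunct2, THEN conjunct2, THEN conjunct1] .
  show "normal_functional M \<tau>"
    using c[THEN conjunct2, THEN conjunct2, THEN conjunct2, THEN conjunct2, THEN conjunct2, THEN conjunct2] .
qed

text \<open>The fixed right factors \<open>d\<close> only change the vectors on which
  \<open>p - a\<close> must be small, and the fixed left factors \<open>b\<close> cost their
  operator norms. So one \<open>p\<close> serves all pairs in \<open>F\<close>, although no bound on
  the norm of \<open>p\<close> is known.\<close>

lemma trace_approximation:
  fixes M :: "('h::complex_hilbert_space \<Rightarrow> 'h) set"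
  assumes M: "star_subalgebra M" and tr: "tracial_state M \<tau>"
    and A: "star_subalgebra A" "id \<in> A" "A \<subseteq> M" and a: "a \<in> M" "a \<in> commutant (commutant A)"
    and F: "finite F" "F \<subseteq> M \<times> M" and e: "e > 0"
  shows "\<exists>p\<in>A. \<forall>(b, d)\<in>F. cmod (\<tau> (adj (b \<circ> (\<lambda>v. p v + (-1) *\<^sub>C a v) \<circ> d) \<circ> (b \<circ> (\<lambda>v. p v + (-1) *\<^sub>C a v) \<circ> d))) < e"
proof -
  note MD = star_subalgebraD[OF M]
  obtain \<zeta> K where z: "summable (\<lambda>n. (norm (\<zeta> n))\<^sup>2)" "K > 0"
    "\<And>c. c \<in> M \<Longrightarrow> cmod (\<tau> (adj c \<circ> c)) \<le> K * (\<Sum>n. (norm (c (\<zeta> n)))\<^sup>2)"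
  proof -
    have "\<exists>\<zeta> K. summable (\<lambda>n. (norm (\<zeta> n))\<^sup>2) \<and> K > 0 \<and>
        (\<forall>c\<in>M. cmod (\<tau> (adj c \<circ> c)) \<le> K * (\<Sum>n. (norm (c (\<zeta> n)))\<^sup>2))"
      by (rule normal_trace_bound[OF M tracial_stateD(7)[OF tr]]) (rule tracial_stateD(2)[OF tr, rule_format])
    then obtain \<zeta> K where "summable (\<lambda>n. (norm (\<zeta> n))\<^sup>2)" "K > 0"
      "\<forall>c\<in>M. cmod (\<tau> (adj c \<circ> c)) \<le> K * (\<Sum>n. (norm (c (\<zeta> n)))\<^sup>2)" by (elim exE conjE)
    note zK = this
    have "cmod (\<tau> (adj c \<circ> c)) \<le> K * (\<Sum>n. (norm (c (\<zeta> n)))\<^sup>2)" if "c \<in> M" for c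
      using bspec[OF zK(3) that] .
    with zK(1,2) show ?thesis by (rule that)
  qed
  \<comment> \<open>The right factors act on the vectors of the normal bound before
    \<open>p - a\<close> does; these finitely many sequences are merged into one.\<close>
  define Z where "Z = (\<lambda>bd n. snd bd (\<zeta> n)) ` F"
  have finZ: "finite Z" unfolding Z_def using F(1) by (rule finite_imageI)
  have sqZ: "summable (\<lambda>n. (norm (\<psi> n))\<^sup>2)" if "\<psi> \<in> Z" for \<psi>
  proof -
    obtain bd where bd: "bd \<in> F" "\<psi> = (\<lambda>n. snd bd (\<zeta> n))" using \<open>\<psi> \<in> Z\<close> unfolding Z_def by (elim imageE)
    have d: "snd bd \<in> M" using F(2) bd(1) by auto
    show ?thesis unfolding bd(2) by (rule amp_summable[OF MD(1)[OF d] z(1)])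
  qed
  have "\<exists>\<zeta>. summable (\<lambda>n. (norm (\<zeta> n))\<^sup>2) \<and>
    (\<forall>\<xi>\<in>Z. \<forall>c. bounded_operator c \<longrightarrow> (\<Sum>n. (norm (c (\<xi> n))::real)\<^sup>2) \<le> (\<Sum>n. (norm (c (\<zeta> n)))\<^sup>2))"
    using finZ by (rule merge_finite_square_summable) (rule sqZ)
  then obtain \<xi> where x1: "summable (\<lambda>n. (norm (\<xi> n))\<^sup>2)" and
    x2: "\<forall>\<psi>\<in>Z. \<forall>c. bounded_operator c \<longrightarrow> (\<Sum>n. (norm (c (\<psi> n))::real)\<^sup>2) \<le> (\<Sum>n. (norm (c (\<xi> n)))\<^sup>2)"
    by (elim exE conjE)
  have x3: "(\<Sum>n. (norm (c (d (\<zeta> n)))::real)\<^sup>2) \<le> (\<Sum>n. (norm (c (\<xi> n)))\<^sup>2)"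
    if "(b, d) \<in> F" "bounded_operator c" for b d c
  proof -
    have "(\<lambda>n. d (\<zeta> n)) \<in> Z" unfolding Z_def by (rule image_eqI[OF _ that(1)]) simp
    from x2[rule_format, OF this that(2)] show ?thesis .
  qed
  note x = x1 x3
  define k :: "('h \<Rightarrow> 'h) \<Rightarrow> ('h \<Rightarrow> 'h) \<Rightarrow> real" where "k b d = onorm b" for b d
  have k: "norm (b x) \<le> k b d * norm x" if "(b, d) \<in> F" for b d x
  proof -
    have "b \<in> M" using F(2) that by auto
    from onorm[OF bounded_operatorD(1)[OF MD(1)[OF this]]] show ?thesis by (simp add: k_def)
  qed
  \<comment> \<open>The summand 1 keeps \<open>L\<close> positive even when all left factors
    vanish.\<close>
  define L where "L = (\<Sum>(b, d)\<in>F. (k b d)\<^sup>2) + 1"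
  have L: "(k b d)\<^sup>2 \<le> L" if "(b, d) \<in> F" for b d
  proof -
    have "(\<lambda>(b, d). (k b d)\<^sup>2) (b, d) \<le> (\<Sum>(b, d)\<in>F. (k b d)\<^sup>2)" by (rule member_le_sum[OF that]) (auto simp: F)
    then show ?thesis by (simp add: L_def)
  qed
  have L0: "L > 0" unfolding L_def by (rule add_nonneg_pos[OF sum_nonneg]) auto
  obtain p where p: "p \<in> A" "(\<Sum>n. (norm (p (\<xi> n) - a (\<xi> n)))\<^sup>2) < e / (K * L)"
    using ultrastrong_density[OF A(1,2) a(2) x(1), of "e / (K * L)"] e z(2) L0 by auto
  define c where "c = (\<lambda>v. p v + (-1) *\<^sub>C a v)"
  have c: "c \<in> M" "bounded_operator c" 
  proof -
    have "(\<lambda>v. p v + (-1) *\<^sub>C a v) \<in> M" by (intro MD(4) MD(6) a(1) subsetD[OF A(3) p(1)])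
    then show "c \<in> M" "bounded_operator c" unfolding c_def using MD(1) by simp_all
  qed
  have "cmod (\<tau> (adj (b \<circ> c \<circ> d) \<circ> (b \<circ> c \<circ> d))) < e" if bd: "(b, d) \<in> F" for b d
  proof -
    have bdM: "b \<in> M" "d \<in> M" using bd F(2) by auto
    have m: "b \<circ> c \<circ> d \<in> M" by (intro MD(5) bdM c(1))
    have sd: "summable (\<lambda>n. (norm (c (d (\<zeta> n))))\<^sup>2)"
      by (intro amp_summable[OF c(2)] amp_summable[OF MD(1)[OF bdM(2)]] z(1))
    have le: "(norm (b (c (d (\<zeta> n)))))\<^sup>2 \<le> (k b d)\<^sup>2 * (norm (c (d (\<zeta> n))))\<^sup>2" for n
      using power_mono[OF k[OF bd, of "c (d (\<zeta> n))"], of 2] by (simp add: power_mult_distrib)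
    have "(\<Sum>n. (norm ((b \<circ> c \<circ> d) (\<zeta> n)))\<^sup>2) \<le> (\<Sum>n. (k b d)\<^sup>2 * (norm (c (d (\<zeta> n))))\<^sup>2)"
      by (rule suminf_le) (use le amp_summable[OF MD(1)[OF m] z(1)] summable_mult[OF sd] in auto)
    also have "\<dots> = (k b d)\<^sup>2 * (\<Sum>n. (norm (c (d (\<zeta> n))))\<^sup>2)" by (rule suminf_mult[OF sd])
    also have "\<dots> \<le> L * (\<Sum>n. (norm (c (\<xi> n)))\<^sup>2)"
      by (intro mult_mono L[OF bd] x(2)[OF bd c(2)] suminf_nonneg[OF sd]) (use L0 in auto)
    also have "\<dots> < L * (e / (K * L))"
      using p(2) L0 unfolding c_def by (intro mult_strict_left_mono) (auto simp: scaleC_minus1_left)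
    finally have "K * (\<Sum>n. (norm ((b \<circ> c \<circ> d) (\<zeta> n)))\<^sup>2) < K * (L * (e / (K * L)))"
      using z(2) by (rule mult_strict_left_mono)
    also have "\<dots> = e" using z(2) L0 by simp
    finally show ?thesis using z(3)[OF m] by linarith
  qed
  then show ?thesis using p(1) unfolding c_def by (intro bexI[of _ p]) auto
qed

section \<open>Complex star algebras and Gram--Schmidt orthogonalization\<close>

text \<open>No unit is required, since the matrices of all sizes below form an algebra without one.
  Unital algebras appear as corners of a projection.\<close>

class complex_star_algebra = ring +
  fixes scl :: "complex \<Rightarrow> 'a \<Rightarrow> 'a"
    and star :: "'a \<Rightarrow> 'a"
  assumes scl_add_right: "scl c (x + y) = scl c x + scl c y"
    and scl_add_left: "scl (c + d) x = scl c x + scl d x"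
    and scl_scl [simp]: "scl c (scl d x) = scl (c * d) x"
    and scl_one [simp]: "scl 1 x = x"
    and scl_mult_left [simp]: "scl c x * y = scl c (x * y)"
    and scl_mult_right [simp]: "x * scl c y = scl c (x * y)"
    and star_star [simp]: "star (star x) = x"
    and star_add: "star (x + y) = star x + star y"
    and star_mult: "star (x * y) = star y * star x"
    and star_scl [simp]: "star (scl c x) = scl (cnj c) (star x)"
begin

lemma scl_zero_right [simp]: "scl c 0 = 0"
  using scl_add_right[of c 0 0] by simp

lemma scl_zero_left [simp]: "scl 0 x = 0"
  using scl_add_left[of 0 0 x] by simp

lemma scl_minus_right: "scl c (- x) = - scl c x"
  using scl_add_right[of c x "- x"] by (simp add: eq_neg_iff_add_eq_0 add.commute)

lemma scl_minus_left: "scl (- c) x = - scl c x"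
  using scl_add_left[of c "- c" x] by (simp add: eq_neg_iff_add_eq_0 add.commute)

lemma scl_diff_right: "scl c (x - y) = scl c x - scl c y"
  using scl_add_right[of c x "- y"] by (simp add: scl_minus_right)

lemma scl_diff_left: "scl (c - d) x = scl c x - scl d x"
  using scl_add_left[of c "- d" x] by (simp add: scl_minus_left)

lemma star_zero [simp]: "star 0 = 0"
  using star_add[of 0 0] by simp

lemma star_minus: "star (- x) = - star x"
  using star_add[of x "- x"] by (simp add: eq_neg_iff_add_eq_0 add.commute)

lemma star_diff: "star (x - y) = star x - star y"
  using star_add[of x "- y"] by (simp add: star_minus)

lemma star_sum: "star (sum f I) = (\<Sum>i\<in>I. star (f i))"
  by (induction I rule: infinite_finite_induct) (auto simp: star_add)

lemma scl_sum_right: "scl c (sum f I) = (\<Sum>i\<in>I. scl c (f i))"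
  by (induction I rule: infinite_finite_induct) (auto simp: scl_add_right)

lemma scl_sum_left: "scl (sum f I) x = (\<Sum>i\<in>I. scl (f i) x)"
  by (induction I rule: infinite_finite_induct) (auto simp: scl_add_left)

text \<open>Closure rules instead of explicit linear combinations: facts about spans follow by
  induction on membership, without families of coefficients.\<close>

inductive_set cspan :: "'a set \<Rightarrow> 'a set" for X where
  cspan_zero: "0 \<in> cspan X"
| cspan_base: "x \<in> X \<Longrightarrow> x \<in> cspan X"
| cspan_add: "x \<in> cspan X \<Longrightarrow> y \<in> cspan X \<Longrightarrow> x + y \<in> cspan X"
| cspan_scl: "x \<in> cspan X \<Longrightarrow> scl c x \<in> cspan X"

lemma cspan_subset: "X \<subseteq> cspan Y \<Longrightarrow> cspan X \<subseteq> cspan Y"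
proof
  fix x assume X: "X \<subseteq> cspan Y" and x: "x \<in> cspan X"
  show "x \<in> cspan Y" using x by induction (use X in \<open>auto intro: cspan.intros\<close>)
qed

lemma cspan_sum: "(\<And>i. i \<in> I \<Longrightarrow> f i \<in> cspan X) \<Longrightarrow> sum f I \<in> cspan X"
  by (induction I rule: infinite_finite_induct) (auto intro: cspan.intros)

lemma cspan_diff: "x \<in> cspan X \<Longrightarrow> y \<in> cspan X \<Longrightarrow> x - y \<in> cspan X"
  using cspan_add[of x X "scl (- 1) y"] cspan_scl[of y X "- 1"] by (simp add: scl_minus_left)

end

text \<open>One Gram-Schmidt process serves three spaces: an algebra with its trace, a
  finite-dimensional algebra with the trace of its regular representation, and the columns of
  matrices.\<close>

locale hermitian_form =
  fixes S :: "'a::complex_star_algebra set" and f :: "'a \<Rightarrow> 'a \<Rightarrow> complex"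
  assumes S_zero: "0 \<in> S"
    and S_add: "x \<in> S \<Longrightarrow> y \<in> S \<Longrightarrow> x + y \<in> S"
    and S_scl: "x \<in> S \<Longrightarrow> scl c x \<in> S"
    and f_add: "x \<in> S \<Longrightarrow> y \<in> S \<Longrightarrow> z \<in> S \<Longrightarrow> f (x + y) z = f x z + f y z"
    and f_scl: "x \<in> S \<Longrightarrow> z \<in> S \<Longrightarrow> f (scl c x) z = c * f x z"
    and f_cnj: "x \<in> S \<Longrightarrow> y \<in> S \<Longrightarrow> f y x = cnj (f x y)"
    and f_nonneg: "x \<in> S \<Longrightarrow> 0 \<le> Re (f x x)"
    and f_faithful: "x \<in> S \<Longrightarrow> f x x = 0 \<Longrightarrow> x = 0"
begin

lemma S_diff: "x \<in> S \<Longrightarrow> y \<in> S \<Longrightarrow> x - y \<in> S"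
  using S_add[of x "scl (- 1) y"] S_scl[of y "- 1"] by (simp add: scl_minus_left)

lemma S_sum: "(\<And>i. i \<in> I \<Longrightarrow> g i \<in> S) \<Longrightarrow> sum g I \<in> S"
  by (induction I rule: infinite_finite_induct) (auto intro: S_zero S_add)

lemma f_zero: "z \<in> S \<Longrightarrow> f 0 z = 0"
  using f_scl[of 0 z 0] S_zero by simp

lemma f_diff: "x \<in> S \<Longrightarrow> y \<in> S \<Longrightarrow> z \<in> S \<Longrightarrow> f (x - y) z = f x z - f y z"
  using f_add[of x "scl (- 1) y" z] f_scl[of y z "- 1"] S_scl[of y "- 1"] by (simp add: scl_minus_left)

lemma f_sum: "(\<And>i. i \<in> I \<Longrightarrow> g i \<in> S) \<Longrightarrow> z \<in> S \<Longrightarrow> f (sum g I) z = (\<Sum>i\<in>I. f (g i) z)"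
  by (induction I rule: infinite_finite_induct) (auto simp: f_zero f_add S_sum)

lemma f_scl_right: "x \<in> S \<Longrightarrow> z \<in> S \<Longrightarrow> f z (scl c x) = cnj c * f z x"
  using f_scl[of x z c] f_cnj[of "scl c x" z] f_cnj[of x z] S_scl by simp

lemma f_real: "x \<in> S \<Longrightarrow> f x x = complex_of_real (Re (f x x))"
  using f_cnj[of x x] by (simp add: complex_eq_iff)

definition orthonormal :: "'a list \<Rightarrow> bool" where
  "orthonormal us \<longleftrightarrow> set us \<subseteq> S \<and>
     (\<forall>i<length us. \<forall>j<length us. f (us ! i) (us ! j) = (if i = j then 1 else 0))"

lemma cspan_S: "X \<subseteq> S \<Longrightarrow> cspan X \<subseteq> S"
proof
  fix x assume X: "X \<subseteq> S" and "x \<in> cspan X"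
  from this(2) show "x \<in> S" by induction (use X in \<open>auto intro: S_zero S_add S_scl\<close>)
qed

lemma orthonormal_expansion:
  assumes us: "orthonormal us" and x: "x \<in> cspan (set us)"
  shows "x = (\<Sum>i<length us. scl (f x (us ! i)) (us ! i))"
  using x
proof induction
  case cspan_zero
  then show ?case using us by (auto simp: orthonormal_def f_zero subset_iff)
next
  case (cspan_base x)
  then obtain j where j: "j < length us" "x = us ! j" by (auto simp: in_set_conv_nth)
  have "(\<Sum>i<length us. scl (f x (us ! i)) (us ! i)) = (\<Sum>i<length us. if i = j then us ! i else 0)"
    using us j by (intro sum.cong) (auto simp: orthonormal_def)
  then show ?case using j by simp
next
  case (cspan_add x y)
  have "x \<in> S" "y \<in> S" "\<And>i. i < length us \<Longrightarrow> us ! i \<in> S"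
    using us cspan_add cspan_S[of "set us"] by (auto simp: orthonormal_def)
  then have "(\<Sum>i<length us. scl (f (x + y) (us ! i)) (us ! i)) =
      (\<Sum>i<length us. scl (f x (us ! i)) (us ! i)) + (\<Sum>i<length us. scl (f y (us ! i)) (us ! i))"
    by (simp add: f_add scl_add_left sum.distrib)
  then show ?case using cspan_add by simp
next
  case (cspan_scl x c)
  have "x \<in> S" "\<And>i. i < length us \<Longrightarrow> us ! i \<in> S"
    using us cspan_scl cspan_S[of "set us"] by (auto simp: orthonormal_def)
  then have "(\<Sum>i<length us. scl (f (scl c x) (us ! i)) (us ! i)) = scl c (\<Sum>i<length us. scl (f x (us ! i)) (us ! i))"
    by (simp add: f_scl scl_sum_right)
  then show ?case using cspan_scl by simp
qed

lemma orthonormal_append1: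
  assumes us: "orthonormal us" and w: "w \<in> S" "w \<noteq> 0" "\<And>i. i < length us \<Longrightarrow> f w (us ! i) = 0"
  shows "\<exists>c. c \<noteq> 0 \<and> orthonormal (us @ [scl c w])"
proof -
  define r where "r = Re (f w w)"
  have fw: "f w w = complex_of_real r" using f_real[OF w(1)] by (simp add: r_def)
  have "r \<noteq> 0" using f_faithful[OF w(1)] w(2) fw by auto
  then have r: "r > 0" using f_nonneg[OF w(1)] r_def by simp
  define c where "c = complex_of_real (1 / sqrt r)"
  define u where "u = scl c w"
  have uS: "u \<in> S" using S_scl w by (simp add: u_def)
  have "f u u = c * cnj c * complex_of_real r" using w(1) S_scl by (simp add: u_def f_scl f_scl_right fw)
  also have "\<dots> = complex_of_real (1 / sqrt r * (1 / sqrt r) * r)"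
    by (simp only: c_def complex_cnj_complex_of_real of_real_mult)
  also have "1 / sqrt r * (1 / sqrt r) * r = 1" using r by (simp add: field_simps)
  finally have uu: "f u u = 1" by simp
  have uo: "f u (us ! i) = 0" "f (us ! i) u = 0" if i: "i < length us" for i
  proof -
    have usi: "us ! i \<in> S" using us i by (auto simp: orthonormal_def)
    show "f u (us ! i) = 0" using w(1,3) usi i by (simp add: u_def f_scl)
    then show "f (us ! i) u = 0" using f_cnj[OF uS usi] by simp
  qed
  have "orthonormal (us @ [u])"
    unfolding orthonormal_def
  proof (intro conjI allI impI)
    show "set (us @ [u]) \<subseteq> S" using us uS by (simp add: orthonormal_def)
    fix i j assume ij: "i < length (us @ [u])" "j < length (us @ [u])"
    show "f ((us @ [u]) ! i) ((us @ [u]) ! j) = (if i = j then 1 else 0)"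
    proof (cases "i < length us"; cases "j < length us")
      assume "i < length us" "j < length us"
      then show ?thesis using us by (simp add: nth_append orthonormal_def)
    next
      assume "i < length us" "\<not> j < length us"
      then show ?thesis using ij uo by (simp add: nth_append)
    next
      assume "\<not> i < length us" "j < length us"
      then show ?thesis using ij uo by (simp add: nth_append)
    next
      assume a: "\<not> i < length us" "\<not> j < length us"
      then have "i = length us" "j = length us" using ij by auto
      then show ?thesis using uu by simp
    qed
  qed
  moreover have "c \<noteq> 0" using r by (simp add: c_def)
  ultimately show ?thesis unfolding u_def by blast
qed

lemma gram_schmidt_step:
  assumes us: "orthonormal us" and v: "v \<in> S" and that: "j < length us"
  shows "f (v - (\<Sum>i<length us. scl (f v (us ! i)) (us ! i))) (us ! j) = 0"
proof -
  have usS: "\<And>i. i < length us \<Longrightarrow> us ! i \<in> S" using us by (auto simp: orthonormal_def)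
  have "f (v - (\<Sum>i<length us. scl (f v (us ! i)) (us ! i))) (us ! j)
      = f v (us ! j) - (\<Sum>i<length us. f (scl (f v (us ! i)) (us ! i)) (us ! j))"
  proof -
    have "f (\<Sum>i<length us. scl (f v (us ! i)) (us ! i)) (us ! j) = (\<Sum>i<length us. f (scl (f v (us ! i)) (us ! i)) (us ! j))"
      by (rule f_sum) (auto intro: S_scl usS that)
    then show ?thesis using v usS that by (subst f_diff) (auto intro!: S_sum S_scl)
  qed
  also have "(\<Sum>i<length us. f (scl (f v (us ! i)) (us ! i)) (us ! j)) = (\<Sum>i<length us. if i = j then f v (us ! j) else 0)"
    using us usS that by (intro sum.cong) (auto simp: f_scl orthonormal_def)
  finally show ?thesis using that by simp
qed

text \<open>A vector that already lies in the span contributes nothing, so \<open>ws\<close> may be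
  shorter than \<open>vs\<close>. The bound on its length later becomes the bandwidth.\<close>

lemma gram_schmidt:
  assumes "orthonormal us" "set vs \<subseteq> S"
  shows "\<exists>ws. orthonormal (us @ ws) \<and> cspan (set (us @ ws)) = cspan (set us \<union> set vs) \<and> length ws \<le> length vs"
  using assms
proof (induction vs rule: rev_induct)
  case Nil
  then show ?case by (intro exI[of _ "[]"]) auto
next
  case (snoc v vs)
  then obtain ws where ws: "orthonormal (us @ ws)" "cspan (set (us @ ws)) = cspan (set us \<union> set vs)"
    "length ws \<le> length vs" by auto
  define xs where "xs = us @ ws"
  define p where "p = (\<Sum>i<length xs. scl (f v (xs ! i)) (xs ! i))"
  define w where "w = v - p"
  have vS: "v \<in> S" using snoc.prems by simp
  have xS: "\<And>i. i < length xs \<Longrightarrow> xs ! i \<in> S"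
    using ws(1) unfolding xs_def[symmetric] by (meson nth_mem orthonormal_def subsetD)
  have wS: "w \<in> S" unfolding w_def p_def using vS xS by (intro S_diff S_sum S_scl) auto
  have pin: "p \<in> cspan (set xs)" unfolding p_def by (intro cspan_sum cspan_scl cspan_base) auto
  have sub: "cspan (set xs) \<subseteq> cspan (set us \<union> set (vs @ [v]))"
    using ws(2) xs_def cspan_subset[of "set us \<union> set vs" "set us \<union> set (vs @ [v])"] by (auto intro: cspan_base)
  show ?case
  proof (cases "w = 0")
    case True
    then have "v \<in> cspan (set xs)" using pin w_def by simp
    moreover have "set us \<union> set vs \<subseteq> cspan (set xs)" using ws(2) xs_def by (auto intro: cspan_base)
    ultimately have "cspan (set us \<union> set (vs @ [v])) \<subseteq> cspan (set xs)" by (intro cspan_subset) auto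
    then show ?thesis using ws sub xs_def by (intro exI[of _ ws]) auto
  next
    case False
    obtain c where c: "c \<noteq> 0" "orthonormal (xs @ [scl c w])"
      using orthonormal_append1[of xs w] ws(1) xs_def wS False gram_schmidt_step[of xs v] vS
      unfolding w_def p_def by auto
    have "cspan (set (xs @ [scl c w])) \<subseteq> cspan (set us \<union> set (vs @ [v]))"
    proof (rule cspan_subset)
      have "scl c w \<in> cspan (set us \<union> set (vs @ [v]))"
        unfolding w_def by (intro cspan_scl cspan_diff cspan_base subsetD[OF sub pin]) auto
      moreover have "set xs \<subseteq> cspan (set us \<union> set (vs @ [v]))" using sub by (auto intro: cspan_base)
      ultimately show "set (xs @ [scl c w]) \<subseteq> cspan (set us \<union> set (vs @ [v]))" by auto
    qed
    moreover have "cspan (set us \<union> set (vs @ [v])) \<subseteq> cspan (set (xs @ [scl c w]))"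
    proof (rule cspan_subset)
      have 1: "cspan (set xs) \<subseteq> cspan (set (xs @ [scl c w]))" by (intro cspan_subset) (auto intro: cspan_base)
      have vq: "v = scl (1 / c) (scl c w) + p" using c(1) by (simp add: w_def)
      have cw: "scl c w \<in> cspan (set (xs @ [scl c w]))" by (rule cspan_base) simp
      have "v \<in> cspan (set (xs @ [scl c w]))"
        by (subst vq) (rule cspan_add[OF cspan_scl[OF cw] subsetD[OF 1 pin]])
      moreover have "set us \<union> set vs \<subseteq> cspan (set xs)" using ws(2) xs_def by (auto intro: cspan_base)
      ultimately show "set us \<union> set (vs @ [v]) \<subseteq> cspan (set (xs @ [scl c w]))" using 1 by auto
    qed
    ultimately show ?thesis using c(2) ws(3) xs_def
      by (intro exI[of _ "ws @ [scl c w]"]) auto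
  qed
qed

lemma orthonormal_basis_exists:
  assumes "set vs \<subseteq> S"
  shows "\<exists>us. orthonormal us \<and> cspan (set us) = cspan (set vs) \<and> length us \<le> length vs"
  using gram_schmidt[of "[]" vs] assms by (auto simp: orthonormal_def)

end

section \<open>Algebras with a faithful trace\<close>

text \<open>What the 2-norm estimates use of a von Neumann algebra with its tracial state. The unit
  is a parameter, because the ambient type need not have one.\<close>

locale tracial_algebra =
  fixes M :: "'a::complex_star_algebra set" and e :: 'a and \<tau> :: "'a \<Rightarrow> complex"
  assumes M_add: "x \<in> M \<Longrightarrow> y \<in> M \<Longrightarrow> x + y \<in> M"
    and M_mult: "x \<in> M \<Longrightarrow> y \<in> M \<Longrightarrow> x * y \<in> M"
    and M_scl: "x \<in> M \<Longrightarrow> scl c x \<in> M"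
    and M_star: "x \<in> M \<Longrightarrow> star x \<in> M"
    and M_one: "e \<in> M"
    and one_left [simp]: "x \<in> M \<Longrightarrow> e * x = x"
    and one_right [simp]: "x \<in> M \<Longrightarrow> x * e = x"
    and \<tau>_add: "x \<in> M \<Longrightarrow> y \<in> M \<Longrightarrow> \<tau> (x + y) = \<tau> x + \<tau> y"
    and \<tau>_scl: "x \<in> M \<Longrightarrow> \<tau> (scl c x) = c * \<tau> x"
    and \<tau>_one: "\<tau> e = 1"
    and \<tau>_nonneg: "x \<in> M \<Longrightarrow> \<tau> (star x * x) \<in> \<real>\<^sub>\<ge>\<^sub>0"
    and \<tau>_comm: "x \<in> M \<Longrightarrow> y \<in> M \<Longrightarrow> \<tau> (x * y) = \<tau> (y * x)"
    and \<tau>_faithful: "x \<in> M \<Longrightarrow> \<tau> (star x * x) = 0 \<Longrightarrow> x = 0"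
begin

lemma M_zero: "0 \<in> M"
  using M_scl[OF M_one, of 0] by simp

lemma star_e [simp]: "star e = e"
proof -
  have "star e * e = star e" using M_star[OF M_one] by simp
  then have "star (star e * e) = star (star e)" by simp
  then have "star e * e = e" by (simp add: star_mult)
  then show ?thesis using M_star[OF M_one] by simp
qed

text \<open>Positivity forces this: \<open>\<tau>\<close> is real at \<open>star y * y\<close> for
  \<open>y = x + scl c e\<close>, and the choices \<open>c = 1\<close> and \<open>c = \<i>\<close>
  settle the imaginary and the real part.\<close>

lemma \<tau>_star: assumes x: "x \<in> M" shows "\<tau> (star x) = cnj (\<tau> x)"
proof -
  have im: "Im (cnj c * \<tau> x + c * \<tau> (star x)) = 0" for c
  proof -
    let ?y = "x + scl c e"
    have "?y \<in> M" using M_add M_scl M_one x by simp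
    have "star ?y * ?y = star x * x + scl (cnj c) x + scl c (star x) + scl (cnj c * c) e"
      using x M_star M_one by (simp add: star_add scl_add_right algebra_simps)
    then have "\<tau> (star ?y * ?y) = \<tau> (star x * x) + cnj c * \<tau> x + c * \<tau> (star x) + cnj c * c"
      using x M_star M_one M_mult M_scl M_add by (simp add: \<tau>_add \<tau>_scl \<tau>_one)
    moreover have "Im (\<tau> (star ?y * ?y)) = 0" "Im (\<tau> (star x * x)) = 0"
      using \<tau>_nonneg[OF \<open>?y \<in> M\<close>] \<tau>_nonneg[OF x] by (auto simp: complex_nonneg_Reals_iff)
    ultimately show ?thesis by simp
  qed
  from im[of 1] im[of \<i>] show ?thesis by (auto simp: complex_eq_iff)
qed

sublocale form: hermitian_form M "\<lambda>a b. \<tau> (star b * a)"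
proof
  show "0 \<in> M" by (rule M_zero)
  fix x y z c assume x: "x \<in> M"
  show "scl c x \<in> M" using M_scl x .
  show "0 \<le> Re (\<tau> (star x * x))" using \<tau>_nonneg[OF x] by (auto simp: complex_nonneg_Reals_iff)
  show "\<tau> (star x * x) = 0 \<Longrightarrow> x = 0" by (rule \<tau>_faithful[OF x])
  show "z \<in> M \<Longrightarrow> \<tau> (star z * scl c x) = c * \<tau> (star z * x)" by (simp add: \<tau>_scl M_mult M_star x)
  assume y: "y \<in> M"
  show "x + y \<in> M" using M_add x y .
  show "\<tau> (star x * y) = cnj (\<tau> (star y * x))"
    using \<tau>_star[of "star y * x"] x y M_mult M_star by (simp add: star_mult)
  show "z \<in> M \<Longrightarrow> \<tau> (star z * (x + y)) = \<tau> (star z * x) + \<tau> (star z * y)"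
    using x y by (simp add: distrib_left \<tau>_add M_mult M_star)
qed

text \<open>The square of the 2-norm. Working with squares spares a norm on \<open>M\<close>; the
  factors 2 in \<open>n2_add_le\<close> replace the triangle inequality.\<close>

definition n2 :: "'a \<Rightarrow> real" where "n2 x = Re (\<tau> (star x * x))"

lemma n2_nonneg: "x \<in> M \<Longrightarrow> 0 \<le> n2 x"
  using form.f_nonneg by (simp add: n2_def)

lemma \<tau>_star_self: "x \<in> M \<Longrightarrow> \<tau> (star x * x) = complex_of_real (n2 x)"
  using form.f_real by (simp add: n2_def)

lemma n2_star: "x \<in> M \<Longrightarrow> n2 (star x) = n2 x"
  using \<tau>_comm[of x "star x"] M_star by (simp add: n2_def)

lemma n2_scl: "x \<in> M \<Longrightarrow> n2 (scl c x) = (cmod c)\<^sup>2 * n2 x"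
proof -
  assume x: "x \<in> M"
  have "\<tau> (star (scl c x) * scl c x) = (c * cnj c) * \<tau> (star x * x)"
    using x by (simp add: \<tau>_scl M_mult M_star M_scl mult_ac)
  also have "\<dots> = complex_of_real ((cmod c)\<^sup>2 * n2 x)"
    using \<tau>_star_self[OF x] by (simp add: complex_norm_square[symmetric])
  finally show ?thesis unfolding n2_def[of "scl c x"] by (simp only: Re_complex_of_real)
qed

lemma n2_zero [simp]: "n2 0 = 0"
  using n2_scl[OF M_one, of 0] by simp

lemma n2_parallelogram:
  assumes "x \<in> M" "y \<in> M"
  shows "n2 (x + y) + n2 (x - y) = 2 * n2 x + 2 * n2 y"
proof -
  have [simp]: "x - y \<in> M" "x + y \<in> M" using assms form.S_diff M_add by auto
  have "\<tau> (star (x + y) * (x + y)) + \<tau> (star (x - y) * (x - y)) = 2 * \<tau> (star x * x) + 2 * \<tau> (star y * y)"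
  proof -
    have m: "star x * x \<in> M" "star x * y \<in> M" "star y * x \<in> M" "star y * y \<in> M"
      using assms by (auto intro: M_mult M_star)
    have "\<tau> (star (x + y) * (x + y)) = \<tau> (star x * x) + \<tau> (star x * y) + (\<tau> (star y * x) + \<tau> (star y * y))"
      using m by (simp add: star_add distrib_left distrib_right \<tau>_add M_add)
    moreover have "\<tau> (star (x - y) * (x - y)) = \<tau> (star x * x) - \<tau> (star x * y) - (\<tau> (star y * x) - \<tau> (star y * y))"
    proof -
      have d: "\<tau> (a - b) = \<tau> a - \<tau> b" if "a \<in> M" "b \<in> M" for a b
        using \<tau>_add[of a "scl (-1) b"] \<tau>_scl[of b "-1"] M_scl[of b "-1"] that by (simp add: scl_minus_left)
      have "star (x - y) * (x - y) = (star x * x - star x * y) - (star y * x - star y * y)"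
        by (simp add: star_diff algebra_simps)
      then show ?thesis using m by (simp add: d form.S_diff)
    qed
    ultimately show ?thesis by simp
  qed
  then show ?thesis unfolding n2_def by (metis Re_complex_of_real plus_complex.sel(1) times_complex.sel(1)
        complex_Re_numeral complex_Im_numeral mult_zero_left diff_zero)
qed

lemma n2_add_le: "x \<in> M \<Longrightarrow> y \<in> M \<Longrightarrow> n2 (x + y) \<le> 2 * n2 x + 2 * n2 y"
  using n2_parallelogram[of x y] n2_nonneg[OF form.S_diff[of x y]] by simp

text \<open>The factor is crude, but it only multiplies quantities that are made small for a fixed
  number of summands.\<close>

lemma n2_sum_le:
  assumes "finite I" "\<And>i. i \<in> I \<Longrightarrow> f i \<in> M"
  shows "n2 (sum f I) \<le> 2 ^ card I * (\<Sum>i\<in>I. n2 (f i))"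
  using assms
proof (induction I rule: finite_induct)
  case empty
  then show ?case by simp
next
  case (insert i I)
  have "n2 (sum f (insert i I)) \<le> 2 * n2 (f i) + 2 * n2 (sum f I)"
    using insert by (simp add: n2_add_le form.S_sum)
  also have "\<dots> \<le> 2 * 2 ^ card I * n2 (f i) + 2 * (2 ^ card I * (\<Sum>i\<in>I. n2 (f i)))"
  proof (rule add_mono)
    have "1 * (2 * n2 (f i)) \<le> 2 ^ card I * (2 * n2 (f i))"
      by (rule mult_right_mono) (use n2_nonneg insert.prems in auto)
    then show "2 * n2 (f i) \<le> 2 * 2 ^ card I * n2 (f i)" by simp
  qed (use insert in auto)
  also have "\<dots> = 2 ^ card (insert i I) * (\<Sum>i\<in>insert i I. n2 (f i))"
    using insert.hyps by (simp add: algebra_simps)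
  finally show ?case .
qed

text \<open>The basis is orthonormal for the form \<open>g\<close> given by the trace of the left
  regular representation. With \<open>z\<close> the sum of the
  \<open>as ! l * star (as ! l)\<close>, traciality turns \<open>g (c * z) e\<close> into the sum of
  the \<open>g (c * as ! l) (as ! l)\<close>, which is again the trace of left multiplication by
  \<open>c\<close>, now computed in the basis \<open>as\<close>. So \<open>z\<close> and the unit
  have the same inner products with all of \<open>N\<close>. The numbers \<open>lam b m s\<close>
  are the matrix entries of left multiplication by \<open>b\<close>.\<close>

lemma regular_basis:
  assumes N: "N = cspan (set vs)" "set vs \<subseteq> M" "e \<in> N"
    and Nm: "\<And>x y. x \<in> N \<Longrightarrow> y \<in> N \<Longrightarrow> x * y \<in> N" and Ns: "\<And>x. x \<in> N \<Longrightarrow> star x \<in> N"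
  obtains as :: "'a list" and lam :: "'a \<Rightarrow> nat \<Rightarrow> nat \<Rightarrow> complex"
  where "N = cspan (set as)"
    and "\<And>b s. b \<in> N \<Longrightarrow> s < length as \<Longrightarrow> b * as ! s = (\<Sum>m<length as. scl (lam b m s) (as ! m))"
    and "\<And>b l. b \<in> N \<Longrightarrow> l < length as \<Longrightarrow> star (as ! l) * b = (\<Sum>m<length as. scl (lam b l m) (star (as ! m)))"
    and "\<And>b c l s. b \<in> N \<Longrightarrow> c \<in> N \<Longrightarrow> l < length as \<Longrightarrow> s < length as \<Longrightarrow>
      lam (b * c) l s = (\<Sum>m<length as. lam b l m * lam c m s)"
    and "\<And>b l m. b \<in> N \<Longrightarrow> l < length as \<Longrightarrow> m < length as \<Longrightarrow> lam (star b) l m = cnj (lam b m l)"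
    and "\<And>b c l m. b \<in> N \<Longrightarrow> c \<in> N \<Longrightarrow> l < length as \<Longrightarrow> m < length as \<Longrightarrow> lam (b + c) l m = lam b l m + lam c l m"
    and "\<And>b c l m. b \<in> N \<Longrightarrow> l < length as \<Longrightarrow> m < length as \<Longrightarrow> lam (scl c b) l m = c * lam b l m"
    and "\<And>l m. l < length as \<Longrightarrow> m < length as \<Longrightarrow> lam e l m = (if l = m then 1 else 0)"
    and "(\<Sum>l<length as. as ! l * star (as ! l)) = e"
proof -
  have NM: "N \<subseteq> M" unfolding N(1) by (rule form.cspan_S[OF N(2)])
  have Nlin: "0 \<in> N" "\<And>x y. x \<in> N \<Longrightarrow> y \<in> N \<Longrightarrow> x + y \<in> N" "\<And>x c. x \<in> N \<Longrightarrow> scl c x \<in> N"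
    unfolding N(1) by (auto intro: cspan.intros)
  obtain us where us: "form.orthonormal us" "cspan (set us) = N"
    using form.orthonormal_basis_exists[OF N(2)] N(1) by auto
  have uN: "us ! i \<in> N" if "i < length us" for i using us(2) that by (auto intro: cspan_base)
  define f where "f a b = \<tau> (star b * a)" for a b
  \<comment> \<open>The trace of left multiplication by \<open>star b * a\<close>, computed in the
    basis \<open>us\<close>, which is orthonormal for \<open>\<tau>\<close>.\<close>
  define g where "g a b = (\<Sum>i<length us. f (a * us ! i) (b * us ! i))" for a b
  have fexp: "x = (\<Sum>i<length us. scl (f x (us ! i)) (us ! i))" if "x \<in> N" for x
    using form.orthonormal_expansion[OF us(1)] that us(2) by (simp add: f_def)
  note fl = form.f_add[folded f_def] form.f_scl[folded f_def] form.f_sum[folded f_def]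
  have fss: "f (\<Sum>j<n. scl (k j) (v j)) w = (\<Sum>j<n. k j * f (v j) w)"
    if "\<And>j. j < n \<Longrightarrow> v j \<in> M" "w \<in> M" for n :: nat and k v w
  proof -
    have "f (\<Sum>j<n. scl (k j) (v j)) w = (\<Sum>j<n. f (scl (k j) (v j)) w)"
      by (rule fl(3)) (use that M_scl in auto)
    then show ?thesis using that by (simp add: fl(2))
  qed
  interpret g: hermitian_form N g
  proof
    show "0 \<in> N" by (rule Nlin)
    fix x y z c assume x: "x \<in> N"
    have xu: "x * us ! i \<in> M" if "i < length us" for i using Nm x uN that NM by blast
    show "scl c x \<in> N" by (auto simp: Nlin x)
    show "z \<in> N \<Longrightarrow> g (scl c x) z = c * g x z"
      unfolding g_def sum_distrib_left using NM Nm uN x by (intro sum.cong) (auto simp: fl subset_iff)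
    have nn: "0 \<le> Re (f (x * us ! i) (x * us ! i))" if "i < length us" for i
      unfolding f_def by (rule form.f_nonneg[OF xu[OF that]])
    show "0 \<le> Re (g x x)" unfolding g_def Re_sum by (rule sum_nonneg) (use nn in auto)
    show "x = 0" if "g x x = 0"
    proof -
      have "Re (g x x) = 0" using that by simp
      then have "\<forall>i\<in>{..<length us}. Re (f (x * us ! i) (x * us ! i)) = 0"
        unfolding g_def Re_sum by (subst (asm) sum_nonneg_eq_0_iff) (use nn in auto)
      then have z: "x * us ! i = 0" if "i < length us" for i
        using form.f_faithful[OF xu[OF that]] form.f_real[OF xu[OF that]] that by (auto simp: f_def)
      \<comment> \<open>Left multiplication by \<open>x\<close> kills the basis, hence all of
        \<open>N\<close>, to which the unit belongs.\<close>
      have "x * y = 0" if "y \<in> N" for y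
        by (subst fexp[OF that]) (simp add: sum_distrib_left z)
      then show ?thesis using one_right x NM N(3) by (metis subsetD)
    qed
    assume y: "y \<in> N"
    show "x + y \<in> N" using Nlin x y by blast
    show "g y x = cnj (g x y)"
      unfolding g_def cnj_sum f_def using NM Nm uN x y by (intro sum.cong form.f_cnj) auto
    show "z \<in> N \<Longrightarrow> g (x + y) z = g x z + g y z"
      unfolding g_def sum.distrib[symmetric] using NM Nm uN x y
      by (intro sum.cong) (auto simp: distrib_right fl subset_iff)
  qed
  have gss: "g (\<Sum>j<n. scl (k j) (v j)) w = (\<Sum>j<n. k j * g (v j) w)"
    if "\<And>j. j < n \<Longrightarrow> v j \<in> N" "w \<in> N" for n :: nat and k v w
  proof -
    have "g (\<Sum>j<n. scl (k j) (v j)) w = (\<Sum>j<n. g (scl (k j) (v j)) w)"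
      by (rule g.f_sum) (use that Nlin in auto)
    then show ?thesis using that by (simp add: g.f_scl)
  qed
  obtain as where as: "g.orthonormal as" "cspan (set as) = N"
    using g.orthonormal_basis_exists[of us] us(2) uN by (auto simp: in_set_conv_nth subset_iff)
  have aN: "as ! l \<in> N" if "l < length as" for l using as(2) that by (auto intro: cspan_base)
  have gexp: "x = (\<Sum>l<length as. scl (g x (as ! l)) (as ! l))" if "x \<in> N" for x
    using g.orthonormal_expansion[OF as(1)] that as(2) by simp
  have gmove: "g (x * y) z = g y (star x * z)" for x y z
    by (simp add: g_def f_def star_mult mult.assoc)
  have gsym: "cnj (g x y) = g y x" if "x \<in> N" "y \<in> N" for x y using g.f_cnj[OF that] by simp
  have uM: "us ! i \<in> M" if "i < length us" for i using uN[OF that] NM by blast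
  define lam where "lam b l m = g (b * as ! m) (as ! l)" for b l m
  define z where "z = (\<Sum>l<length as. as ! l * star (as ! l))"
  have zN: "z \<in> N" unfolding z_def by (rule g.S_sum) (auto intro: Nm Ns aN)
  have ge: "g c e = (\<Sum>i<length us. f (c * us ! i) (us ! i))" for c
    unfolding g_def by (intro sum.cong) (auto simp: uM)
  \<comment> \<open>Cyclicity of a matrix trace, visible in the expansion \<open>E\<close> in the
    basis \<open>us\<close>.\<close>
  have tr: "g (x * y) e = g (y * x) e" if x: "x \<in> N" and y: "y \<in> N" for x y
  proof -
    have E: "g (x * y) e = (\<Sum>i<length us. \<Sum>j<length us. f (y * us ! i) (us ! j) * f (x * us ! j) (us ! i))"
      if x: "x \<in> N" and y: "y \<in> N" for x y
    proof -
      have "f (x * y * us ! i) (us ! i) = (\<Sum>j<length us. f (y * us ! i) (us ! j) * f (x * us ! j) (us ! i))"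
        if i: "i < length us" for i
      proof -
        have "x * y * us ! i = x * (\<Sum>j<length us. scl (f (y * us ! i) (us ! j)) (us ! j))"
          using fexp[OF Nm[OF y uN[OF i]]] by (simp add: mult.assoc)
        also have "\<dots> = (\<Sum>j<length us. scl (f (y * us ! i) (us ! j)) (x * us ! j))" by (simp add: sum_distrib_left)
        finally have *: "x * y * us ! i = (\<Sum>j<length us. scl (f (y * us ! i) (us ! j)) (x * us ! j))" .
        show ?thesis unfolding * by (rule fss) (use x i Nm uN NM in auto)
      qed
      then show ?thesis unfolding ge by (intro sum.cong) auto
    qed
    show ?thesis unfolding E[OF x y] E[OF y x] by (subst sum.swap) (simp add: mult.commute)
  qed
  \<comment> \<open>The trace does not depend on the basis: \<open>us\<close> is orthonormal for
    \<open>f\<close> and \<open>as\<close> for \<open>g\<close>, and each is expanded in the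
    other.\<close>
  have basis: "g c e = (\<Sum>m<length as. g (c * as ! m) (as ! m))" if c: "c \<in> N" for c
  proof -
    have 1: "f (c * us ! i) (us ! i) = (\<Sum>m<length as. g (us ! i) (as ! m) * f (c * as ! m) (us ! i))"
      if i: "i < length us" for i
    proof -
      have "c * us ! i = c * (\<Sum>m<length as. scl (g (us ! i) (as ! m)) (as ! m))"
        using gexp[OF uN[OF i]] by simp
      also have "\<dots> = (\<Sum>m<length as. scl (g (us ! i) (as ! m)) (c * as ! m))" by (simp add: sum_distrib_left)
      finally have *: "c * us ! i = (\<Sum>m<length as. scl (g (us ! i) (as ! m)) (c * as ! m))" .
      show ?thesis unfolding * by (rule fss) (use c i Nm uN aN NM in auto)
    qed
    have 2: "g (c * as ! m) (as ! m) = (\<Sum>i<length us. f (c * as ! m) (us ! i) * g (us ! i) (as ! m))"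
      if m: "m < length as" for m
    proof -
      have "c * as ! m = (\<Sum>i<length us. scl (f (c * as ! m) (us ! i)) (us ! i))"
        by (rule fexp[OF Nm[OF c aN[OF m]]])
      then have "g (c * as ! m) (as ! m) = g (\<Sum>i<length us. scl (f (c * as ! m) (us ! i)) (us ! i)) (as ! m)" by simp
      also have "\<dots> = (\<Sum>i<length us. f (c * as ! m) (us ! i) * g (us ! i) (as ! m))"
        by (rule gss) (use m aN uN in auto)
      finally show ?thesis .
    qed
    have "g c e = (\<Sum>i<length us. \<Sum>m<length as. g (us ! i) (as ! m) * f (c * as ! m) (us ! i))"
      unfolding ge using 1 by (intro sum.cong) auto
    also have "\<dots> = (\<Sum>m<length as. \<Sum>i<length us. f (c * as ! m) (us ! i) * g (us ! i) (as ! m))"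
      by (subst sum.swap) (simp add: mult.commute)
    also have "\<dots> = (\<Sum>m<length as. g (c * as ! m) (as ! m))" using 2 by (intro sum.cong) auto
    finally show ?thesis .
  qed
  have gz: "g (c * z) e = g c e" if c: "c \<in> N" for c
  proof -
    have "g (c * z) e = (\<Sum>l<length as. g (c * as ! l * star (as ! l)) e)"
    proof -
      have "g (\<Sum>l<length as. c * as ! l * star (as ! l)) e = (\<Sum>l<length as. g (c * as ! l * star (as ! l)) e)"
        by (rule g.f_sum) (use c Nm Ns aN N(3) in auto)
      then show ?thesis by (simp add: z_def sum_distrib_left mult.assoc)
    qed
    also have "\<dots> = (\<Sum>l<length as. g (c * as ! l) (as ! l))"
    proof (rule sum.cong)
      fix l assume "l \<in> {..<length as}"
      then have l: "as ! l \<in> N" using aN by simp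
      have "g (c * as ! l * star (as ! l)) e = g (star (as ! l) * (c * as ! l)) e"
        by (rule tr) (use Nm Ns c l in auto)
      also have "\<dots> = g (c * as ! l) (star (star (as ! l)) * e)" by (rule gmove)
      finally show "g (c * as ! l * star (as ! l)) e = g (c * as ! l) (as ! l)" using l NM by auto
    qed simp
    finally show ?thesis using basis[OF c] by simp
  qed
  have "z = e"
  proof -
    have d: "z - e \<in> N" using g.S_diff zN N(3) by blast
    then have s: "star (z - e) \<in> N" by (rule Ns)
    have "g (z - e) (z - e) = g (star (z - e) * (z - e)) e"
      using gmove[of "star (z - e)" "z - e" e] d NM by auto
    also have "star (z - e) * (z - e) = star (z - e) * z - star (z - e)"
      using s NM by (auto simp: right_diff_distrib)
    also have "g (star (z - e) * z - star (z - e)) e = 0"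
      using gz[OF s] by (simp add: g.f_diff Nm s zN N(3))
    finally show ?thesis using g.f_faithful[OF d] by simp
  qed
  show ?thesis
  proof (rule that[of as lam])
    show "N = cspan (set as)" using as(2) by simp
    show "b * as ! s = (\<Sum>m<length as. scl (lam b m s) (as ! m))" if "b \<in> N" "s < length as" for b s
      unfolding lam_def by (rule gexp) (use Nm aN that in auto)
    show "star (as ! l) * b = (\<Sum>m<length as. scl (lam b l m) (star (as ! m)))" if b: "b \<in> N" and l: "l < length as" for b l
    proof -
      have "star b * as ! l = (\<Sum>m<length as. scl (g (star b * as ! l) (as ! m)) (as ! m))"
        by (rule gexp) (use Nm Ns aN b l in auto)
      then have "star (star b * as ! l) = (\<Sum>m<length as. scl (cnj (g (star b * as ! l) (as ! m))) (star (as ! m)))"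
        by (metis (no_types, lifting) star_sum star_scl sum.cong)
      moreover have "cnj (g (star b * as ! l) (as ! m)) = lam b l m" if m: "m < length as" for m
        using gsym[of "star b * as ! l" "as ! m"] gmove[of b "as ! m" "as ! l"] b l m Nm Ns aN
        by (simp add: lam_def)
      ultimately show ?thesis by (simp add: star_mult)
    qed
    show "lam (b * c) l s = (\<Sum>m<length as. lam b l m * lam c m s)"
      if b: "b \<in> N" and c: "c \<in> N" and l: "l < length as" and s: "s < length as" for b c l s
    proof -
      have "b * c * as ! s = b * (\<Sum>m<length as. scl (lam c m s) (as ! m))"
        unfolding lam_def using gexp[OF Nm[OF c aN[OF s]]] by (simp add: mult.assoc)
      also have "\<dots> = (\<Sum>m<length as. scl (lam c m s) (b * as ! m))" by (simp add: sum_distrib_left)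
      finally have "lam (b * c) l s = g (\<Sum>m<length as. scl (lam c m s) (b * as ! m)) (as ! l)" by (simp add: lam_def)
      also have "\<dots> = (\<Sum>m<length as. lam c m s * g (b * as ! m) (as ! l))"
        by (rule gss) (use b l aN Nm in auto)
      finally show ?thesis by (simp add: lam_def mult.commute)
    qed
    show "lam (star b) l m = cnj (lam b m l)" if b: "b \<in> N" and l: "l < length as" and m: "m < length as" for b l m
      using gsym[of "b * as ! l" "as ! m"] gmove[of "star b" "as ! m" "as ! l"] b l m Nm Ns aN by (simp add: lam_def)
    show "lam (b + c) l m = lam b l m + lam c l m"
      if "b \<in> N" "c \<in> N" "l < length as" "m < length as" for b c l m
      using that Nm aN by (simp add: lam_def distrib_right g.f_add)
    show "lam (scl c b) l m = c * lam b l m" if "b \<in> N" "l < length as" "m < length as" for b c l m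
      using that Nm aN by (simp add: lam_def g.f_scl)
    show "lam e l m = (if l = m then 1 else 0)" if "l < length as" "m < length as" for l m
      using that as(1) aN NM by (auto simp: lam_def g.orthonormal_def subset_iff)
    show "(\<Sum>l<length as. as ! l * star (as ! l)) = e" using \<open>z = e\<close> by (simp add: z_def)
  qed
qed

end

section \<open>Approximation in the 2-norm by elements of a dense set\<close>

context tracial_algebra
begin

text \<open>The multipliers belong to the notion because \<open>M\<close> carries no operator norm
  here by which \<open>n2 (b * (p - a) * c)\<close> could be estimated from
  \<open>n2 (p - a)\<close>.\<close>

definition n2_dense :: "'a set \<Rightarrow> bool" where
  "n2_dense A \<longleftrightarrow> A \<subseteq> M \<and>
     (\<forall>a\<in>M. \<forall>F\<subseteq>M \<times> M. \<forall>\<epsilon>>0. finite F \<longrightarrow> (\<exists>p\<in>A. \<forall>(b, c)\<in>F. n2 (b * (p - a) * c) < \<epsilon>))"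

text \<open>Sequences turn finitely many smallness conditions into limits, which are met
  simultaneously at a late index.\<close>

lemma n2_dense_sequence:
  assumes A: "n2_dense A" and a: "a \<in> M" and F: "finite F" "F \<subseteq> M \<times> M"
  shows "\<exists>p. (\<forall>k::nat. p k \<in> A) \<and> (\<forall>(b, c)\<in>F. (\<lambda>k. n2 (b * (p k - a) * c)) \<longlonglongrightarrow> 0)"
proof -
  have "\<exists>p\<in>A. \<forall>(b, c)\<in>F. n2 (b * (p - a) * c) < 1 / real (Suc k)" for k
    using A a F unfolding n2_dense_def by simp
  then obtain p where p: "\<And>k. p k \<in> A" "\<And>k. \<forall>(b, c)\<in>F. n2 (b * (p k - a) * c) < 1 / real (Suc k)"
    by metis
  have "(\<lambda>k. n2 (b * (p k - a) * c)) \<longlonglongrightarrow> 0" if bc: "(b, c) \<in> F" for b c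
  proof (rule tendsto_sandwich[OF _ _ tendsto_const LIMSEQ_Suc[OF lim_1_over_n]])
    have "b \<in> M" "c \<in> M" "\<And>k. p k \<in> M" using bc F(2) p(1) A n2_dense_def by auto
    then have "0 \<le> n2 (b * (p k - a) * c)" for k using a by (intro n2_nonneg M_mult form.S_diff) auto
    then show "\<forall>\<^sub>F k in sequentially. 0 \<le> n2 (b * (p k - a) * c)" by simp
    have "n2 (b * (p k - a) * c) \<le> 1 / real (Suc k)" for k using p(2)[of k] bc by fastforce
    then show "\<forall>\<^sub>F k in sequentially. n2 (b * (p k - a) * c) \<le> 1 / real (Suc k)" by simp
  qed
  then show ?thesis using p(1) by (intro exI[of _ p]) auto
qed

lemma n2_dense_family:
  fixes a :: "nat \<Rightarrow> 'a" and d :: nat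
  assumes A: "n2_dense A" and a: "\<And>l. l < d \<Longrightarrow> a l \<in> M" and F: "finite F" "F \<subseteq> M \<times> M"
  obtains p :: "nat \<Rightarrow> nat \<Rightarrow> 'a" where "\<And>l k. l < d \<Longrightarrow> p l k \<in> A"
    and "\<And>l b c. l < d \<Longrightarrow> (b, c) \<in> F \<Longrightarrow> (\<lambda>k. n2 (b * (p l k - a l) * c)) \<longlonglongrightarrow> 0"
proof -
  have "\<exists>p. (\<forall>k::nat. p k \<in> A) \<and> (\<forall>(b, c)\<in>F. (\<lambda>k. n2 (b * (p k - a l) * c)) \<longlonglongrightarrow> 0)" if "l < d" for l
    by (rule n2_dense_sequence[OF A a[OF that] F])
  then obtain P where P: "\<And>l. l < d \<Longrightarrow> (\<forall>k. P l k \<in> A) \<and> (\<forall>(b, c)\<in>F. (\<lambda>k. n2 (b * (P l k - a l) * c)) \<longlonglongrightarrow> 0)"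
    by metis
  show ?thesis
  proof (rule that[of P])
    show "P l k \<in> A" if "l < d" for l k using P[OF that] by blast
    show "(\<lambda>k. n2 (b * (P l k - a l) * c)) \<longlonglongrightarrow> 0" if "l < d" "(b, c) \<in> F" for l b c
      using bspec[OF conjunct2[OF P[OF that(1)]] that(2)] by simp
  qed
qed

lemma sum_scl_diff_le:
  assumes "\<And>m. m < d \<Longrightarrow> w m \<in> M"
  shows "n2 (\<Sum>m<d. scl (k m) (w m)) \<le> 2 ^ d * (\<Sum>m<d. (cmod (k m))\<^sup>2 * n2 (w m))"
  using n2_sum_le[of "{..<d}" "\<lambda>m. scl (k m) (w m)"] assms by (simp add: M_scl n2_scl)

text \<open>The defect splits into \<open>(p l - star (a l)) * x\<close>,
  \<open>star (a l) * (x - y)\<close> and a combination of the \<open>p m - star (a m)\<close>. Only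
  the middle part survives when each \<open>p m\<close> tends to \<open>star (a m)\<close>; it
  measures how well \<open>y\<close> approximates \<open>x\<close>.\<close>

lemma intertwining_defect_le:
  assumes p: "\<And>m. m < d \<Longrightarrow> p m \<in> M" and a: "\<And>m. m < d \<Longrightarrow> a m \<in> M" and x: "x \<in> M" and y: "y \<in> M"
    and lam: "star (a l) * y = (\<Sum>m<d. scl (L m) (star (a m)))" and l: "l < d"
  shows "n2 (p l * x - (\<Sum>m<d. scl (L m) (p m))) \<le>
    4 * n2 ((p l - star (a l)) * x) + 4 * (n2 (star (a l) * (x - y)))
      + 2 * (2 ^ d * (\<Sum>m<d. (cmod (L m))\<^sup>2 * n2 (p m - star (a m))))"
proof -
  let ?A = "(p l - star (a l)) * x" and ?B = "star (a l) * (x - y)"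
  let ?C = "\<Sum>m<d. scl (- L m) (p m - star (a m))"
  have AB: "?A \<in> M" "?B \<in> M" using p a x y l by (auto intro!: M_mult form.S_diff M_star)
  have C: "?C \<in> M" using p a by (intro form.S_sum M_scl form.S_diff M_star) auto
  have "p l * x - (\<Sum>m<d. scl (L m) (p m)) = (?A + ?B) + ?C"
    using lam by (simp add: scl_diff_right scl_minus_left sum_subtractf sum_negf algebra_simps)
  then have "n2 (p l * x - (\<Sum>m<d. scl (L m) (p m))) \<le> 2 * (2 * n2 ?A + 2 * n2 ?B) + 2 * n2 ?C"
    using n2_add_le[OF M_add[OF AB] C] n2_add_le[OF AB] by simp
  moreover have "n2 ?C \<le> 2 ^ d * (\<Sum>m<d. (cmod (L m))\<^sup>2 * n2 (p m - star (a m)))"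
    using sum_scl_diff_le[of d "\<lambda>m. p m - star (a m)" "\<lambda>m. - L m"] p a by (simp add: form.S_diff M_star)
  ultimately show ?thesis by simp
qed

text \<open>The \<open>q s\<close> stand in for \<open>star (a s)\<close> on the microstates. Both
  estimates are of the kind that \<open>fine_approximation\<close> asks of its pairs
  \<open>x i\<close>, \<open>y i\<close>, so \<open>q s\<close> and its adjoint can be treated there
  like generators.\<close>

lemma coarse_approximation:
  assumes A: "n2_dense A" and N: "N \<subseteq> M" "\<And>l. l < d \<Longrightarrow> a l \<in> N" and d2: "\<delta> > 0"
  obtains q :: "nat \<Rightarrow> 'a" where "\<And>s. s < d \<Longrightarrow> q s \<in> A"
    and "\<And>s. s < d \<Longrightarrow> (\<Sum>m<d. n2 (star (a m) * (q s - star (a s)))) < \<delta>"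
    and "\<And>s. s < d \<Longrightarrow> (\<Sum>m<d. n2 (star (a m) * (star (q s) - a s))) < \<delta>"
proof -
  have aM: "l < d \<Longrightarrow> a l \<in> M" for l using N by blast
  \<comment> \<open>The left multipliers \<open>star (a m)\<close> serve the estimate for
    \<open>q s\<close>, the right multipliers \<open>a m\<close> the one for its adjoint, by
    invariance of \<open>n2\<close> under \<open>star\<close>.\<close>
  define F where "F = (\<lambda>m. (star (a m), e)) ` {..<d} \<union> (\<lambda>m. (e, a m)) ` {..<d}"
  have F: "finite F" "F \<subseteq> M \<times> M" by (auto simp: F_def M_one M_star aM)
  obtain p where p: "\<And>l k. l < d \<Longrightarrow> p l k \<in> A"
    "\<And>l b c. l < d \<Longrightarrow> (b, c) \<in> F \<Longrightarrow> (\<lambda>k. n2 (b * (p l k - star (a l)) * c)) \<longlonglongrightarrow> 0"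
    by (rule n2_dense_family[OF A _ F, of d "\<lambda>l. star (a l)"]) (use aM M_star in auto)
  have pM: "l < d \<Longrightarrow> p l k \<in> M" for l k using p(1) A by (auto simp: n2_dense_def)
  have t1: "(\<lambda>k. n2 (star (a m) * (p s k - star (a s)))) \<longlonglongrightarrow> 0" if "s < d" "m < d" for s m
  proof -
    have "star (a m) * (p s k - star (a s)) * e = star (a m) * (p s k - star (a s))" for k
      by (rule one_right) (use that pM aM in \<open>auto intro!: M_mult form.S_diff M_star\<close>)
    then show ?thesis using p(2)[of s "star (a m)" e] that by (simp add: F_def)
  qed
  have t2: "(\<lambda>k. n2 (star (a m) * (star (p s k) - a s))) \<longlonglongrightarrow> 0" if "s < d" "m < d" for s m
  proof -
    have "n2 (e * (p s k - star (a s)) * a m) = n2 (star (a m) * (star (p s k) - a s))" for k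
    proof -
      have m: "(p s k - star (a s)) * a m \<in> M" using that pM aM by (auto intro!: M_mult form.S_diff M_star)
      have "e * (p s k - star (a s)) * a m = (p s k - star (a s)) * a m"
        using m that pM aM by (simp add: form.S_diff M_star)
      then show ?thesis using n2_star[OF m] by (simp add: star_mult star_diff)
    qed
    then show ?thesis using p(2)[of s e "a m"] that by (simp add: F_def)
  qed
  have "\<forall>\<^sub>F k in sequentially. \<forall>s\<in>{..<d}. (\<Sum>m<d. n2 (star (a m) * (p s k - star (a s)))) < \<delta> \<and>
      (\<Sum>m<d. n2 (star (a m) * (star (p s k) - a s))) < \<delta>"
  proof (subst eventually_ball_finite_distrib; (intro ballI eventually_conj)?)
    fix s assume s: "s \<in> {..<d}"
    have "(\<lambda>k. \<Sum>m<d. n2 (star (a m) * (p s k - star (a s)))) \<longlonglongrightarrow> (\<Sum>m<d. 0)"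
      by (rule tendsto_sum) (use t1 s in auto)
    then show "\<forall>\<^sub>F k in sequentially. (\<Sum>m<d. n2 (star (a m) * (p s k - star (a s)))) < \<delta>"
      using d2 by (intro order_tendstoD(2)) auto
    have "(\<lambda>k. \<Sum>m<d. n2 (star (a m) * (star (p s k) - a s))) \<longlonglongrightarrow> (\<Sum>m<d. 0)"
      by (rule tendsto_sum) (use t2 s in auto)
    then show "\<forall>\<^sub>F k in sequentially. (\<Sum>m<d. n2 (star (a m) * (star (p s k) - a s))) < \<delta>"
      using d2 by (intro order_tendstoD(2)) auto
  qed simp
  then obtain k where "\<forall>s\<in>{..<d}. (\<Sum>m<d. n2 (star (a m) * (p s k - star (a s)))) < \<delta> \<and>
      (\<Sum>m<d. n2 (star (a m) * (star (p s k) - a s))) < \<delta>"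
    using eventually_sequentially by auto
  then show ?thesis using p(1) by (intro that[of "\<lambda>s. p s k"]) auto
qed

text \<open>Choosing \<open>p'\<close> before \<open>p\<close> controls the products \<open>star (p' l) * p l\<close> although the operator
  norms of the approximants are unbounded.\<close>

lemma fine_approximation:
  assumes A: "n2_dense A" and aM: "\<And>l. l < d \<Longrightarrow> a l \<in> M"
    and one: "(\<Sum>l<d. a l * star (a l)) = e"
    and lam: "\<And>i l. i \<in> I \<Longrightarrow> l < d \<Longrightarrow> star (a l) * y i = (\<Sum>m<d. scl (L i l m) (star (a m)))"
    and xy: "\<And>i. i \<in> I \<Longrightarrow> x i \<in> M" "\<And>i. i \<in> I \<Longrightarrow> y i \<in> M" and I: "finite I"
    and bd: "\<And>i. i \<in> I \<Longrightarrow> 4 * (\<Sum>l<d. n2 (star (a l) * (x i - y i))) < \<delta> i" and d4: "\<epsilon> > 0"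
  obtains p p' :: "nat \<Rightarrow> 'a" where "\<And>l. l < d \<Longrightarrow> p l \<in> A" "\<And>l. l < d \<Longrightarrow> p' l \<in> A"
    and "\<And>i. i \<in> I \<Longrightarrow> (\<Sum>l<d. n2 (p l * x i - (\<Sum>m<d. scl (L i l m) (p m)))) < \<delta> i"
    and "(\<Sum>l<d. n2 (p l - p' l)) < \<epsilon>" and "(\<Sum>l<d. n2 (p l)) < 4"
    and "n2 ((\<Sum>l<d. star (p' l) * p l) - e) < \<epsilon>"
proof -
  have AM: "p \<in> A \<Longrightarrow> p \<in> M" for p using A by (auto simp: n2_dense_def)
  \<comment> \<open>The multipliers \<open>a m\<close> serve the second sum in the near-unit
    estimate \<open>E4\<close>.\<close>
  define F' where "F' = insert (e, e) ((\<lambda>m. (a m, e)) ` {..<d})"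
  have F': "finite F'" "F' \<subseteq> M \<times> M" by (auto simp: F'_def M_one aM)
  obtain P' where P': "\<And>l k. l < d \<Longrightarrow> P' l k \<in> A"
    "\<And>l b c. l < d \<Longrightarrow> (b, c) \<in> F' \<Longrightarrow> (\<lambda>k. n2 (b * (P' l k - star (a l)) * c)) \<longlonglongrightarrow> 0"
    by (rule n2_dense_family[OF A _ F', of d "\<lambda>l. star (a l)"]) (use aM M_star in auto)
  have P'M: "l < d \<Longrightarrow> P' l k \<in> M" for l k using P'(1) AM by blast
  have diffM: "l < d \<Longrightarrow> u \<in> M \<Longrightarrow> u - star (a l) \<in> M" for u l by (intro form.S_diff M_star aM)
  have t1: "(\<lambda>k. n2 (P' l k - star (a l))) \<longlonglongrightarrow> 0" if "l < d" for l
    using P'(2)[of l e e] that by (simp add: F'_def diffM P'M)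
  have t2: "(\<lambda>k. n2 (a l * (P' l k - star (a l)))) \<longlonglongrightarrow> 0" if "l < d" for l
    using P'(2)[of l "a l" e] that by (simp add: F'_def diffM P'M aM M_mult)
  have s1: "(\<lambda>k. \<Sum>l<d. n2 (P' l k - star (a l))) \<longlonglongrightarrow> (\<Sum>l<d. 0)"
    by (rule tendsto_sum) (use t1 in auto)
  have s2: "(\<lambda>k. 2 * (2 ^ d * (\<Sum>l<d. n2 (a l * (P' l k - star (a l)))))) \<longlonglongrightarrow> 2 * (2 ^ d * (\<Sum>l<d. 0))"
    by (intro tendsto_mult tendsto_const tendsto_sum) (use t2 in auto)
  have "\<forall>\<^sub>F k in sequentially. (\<Sum>l<d. n2 (P' l k - star (a l))) < \<epsilon> / 4 \<and>
      2 * (2 ^ d * (\<Sum>l<d. n2 (a l * (P' l k - star (a l))))) < \<epsilon> / 2"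
    using d4 by (intro eventually_conj order_tendstoD(2)[OF s1] order_tendstoD(2)[OF s2]) auto
  then obtain k' where k': "(\<Sum>l<d. n2 (P' l k' - star (a l))) < \<epsilon> / 4"
      "2 * (2 ^ d * (\<Sum>l<d. n2 (a l * (P' l k' - star (a l))))) < \<epsilon> / 2"
    using eventually_sequentially by auto
  define p' where "p' l = P' l k'" for l
  have p'A: "l < d \<Longrightarrow> p' l \<in> A" and p'M: "l < d \<Longrightarrow> p' l \<in> M" for l using P'(1) P'M p'_def by auto
  \<comment> \<open>By now \<open>p'\<close> is fixed, so its adjoints may serve as multipliers for
    \<open>p\<close>. The multipliers \<open>x i\<close> are for the intertwining estimate
    \<open>E1\<close>.\<close>
  define F where "F = insert (e, e) ((\<lambda>i. (e, x i)) ` I \<union> (\<lambda>m. (star (p' m), e)) ` {..<d})"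
  have F: "finite F" "F \<subseteq> M \<times> M" using I xy by (auto simp: F_def M_one aM M_star p'M)
  obtain P where P: "\<And>l k. l < d \<Longrightarrow> P l k \<in> A"
    "\<And>l b c. l < d \<Longrightarrow> (b, c) \<in> F \<Longrightarrow> (\<lambda>k. n2 (b * (P l k - star (a l)) * c)) \<longlonglongrightarrow> 0"
    by (rule n2_dense_family[OF A _ F, of d "\<lambda>l. star (a l)"]) (use aM M_star in auto)
  have PM: "l < d \<Longrightarrow> P l k \<in> M" for l k using P(1) AM by blast
  have T1: "(\<lambda>k. n2 (P l k - star (a l))) \<longlonglongrightarrow> 0" if "l < d" for l
    using P(2)[of l e e] that by (simp add: F_def diffM PM)
  have T2: "(\<lambda>k. n2 ((P l k - star (a l)) * x i)) \<longlonglongrightarrow> 0" if "l < d" "i \<in> I" for l i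
    using P(2)[of l e "x i"] that by (simp add: F_def diffM PM)
  have T3: "(\<lambda>k. n2 (star (p' l) * (P l k - star (a l)))) \<longlonglongrightarrow> 0" if "l < d" for l
    using P(2)[of l "star (p' l)" e] that by (simp add: F_def diffM PM p'M M_star M_mult)
  \<comment> \<open>Each summand is \<open>\<tau> (a l * star (a l))\<close>, and these add up to
    the trace of the unit.\<close>
  have na: "(\<Sum>l<d. n2 (star (a l))) = 1"
  proof -
    have "(\<Sum>l<d. complex_of_real (n2 (star (a l)))) = (\<Sum>l<d. \<tau> (a l * star (a l)))"
      by (rule sum.cong) (use \<tau>_star_self[OF M_star[OF aM]] in auto)
    also have "\<dots> = \<tau> (\<Sum>l<d. a l * star (a l))"
    proof -
      have "\<tau> (\<Sum>l<n. a l * star (a l)) = (\<Sum>l<n. \<tau> (a l * star (a l)))" if "n \<le> d" for n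
        using that
      proof (induction n)
        case 0
        show ?case using \<tau>_scl[OF M_one, of 0] by simp
      next
        case (Suc n)
        have "(\<Sum>l<n. a l * star (a l)) \<in> M" using Suc.prems aM by (intro form.S_sum M_mult M_star) auto
        then show ?case using Suc aM by (simp add: \<tau>_add M_mult M_star)
      qed
      then show ?thesis by simp
    qed
    also have "\<dots> = 1" by (simp add: one \<tau>_one)
    finally show ?thesis by (metis of_real_sum of_real_eq_1_iff)
  qed
  have E1: "\<forall>\<^sub>F k in sequentially. \<forall>i\<in>I. (\<Sum>l<d. n2 (P l k * x i - (\<Sum>m<d. scl (L i l m) (P m k)))) < \<delta> i"
  proof (subst eventually_ball_finite_distrib[OF I], intro ballI)
    fix i assume i: "i \<in> I"
    let ?B = "\<lambda>k. \<Sum>l<d. (4 * n2 ((P l k - star (a l)) * x i) + 4 * (n2 (star (a l) * (x i - y i)))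
      + 2 * (2 ^ d * (\<Sum>m<d. (cmod (L i l m))\<^sup>2 * n2 (P m k - star (a m)))))"
    \<comment> \<open>In the limit only the distance from \<open>x i\<close> to \<open>y i\<close>
      remains, which the hypothesis keeps below \<open>\<delta> i\<close>.\<close>
    have "?B \<longlonglongrightarrow> (\<Sum>l<d. (4 * 0 + 4 * (n2 (star (a l) * (x i - y i)))
      + 2 * (2 ^ d * (\<Sum>m<d. (cmod (L i l m))\<^sup>2 * 0))))"
      by (intro tendsto_sum tendsto_add tendsto_mult tendsto_const T2 T1) (use i in auto)
    then have "\<forall>\<^sub>F k in sequentially. ?B k < \<delta> i"
      using bd[OF i] by (intro order_tendstoD(2)) (auto simp: sum_distrib_left)
    then show "\<forall>\<^sub>F k in sequentially. (\<Sum>l<d. n2 (P l k * x i - (\<Sum>m<d. scl (L i l m) (P m k)))) < \<delta> i"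
    proof eventually_elim
      case (elim k)
      have "(\<Sum>l<d. n2 (P l k * x i - (\<Sum>m<d. scl (L i l m) (P m k)))) \<le> ?B k"
        using i by (intro sum_mono intertwining_defect_le) (use PM aM xy lam in auto)
      then show ?case using elim by simp
    qed
  qed
  have E2: "\<forall>\<^sub>F k in sequentially. (\<Sum>l<d. n2 (P l k - p' l)) < \<epsilon>"
  proof -
    let ?B = "\<lambda>k. \<Sum>l<d. (2 * n2 (P l k - star (a l)) + 2 * n2 (p' l - star (a l)))"
    have "?B \<longlonglongrightarrow> (\<Sum>l<d. (2 * 0 + 2 * n2 (p' l - star (a l))))"
      by (intro tendsto_sum tendsto_add tendsto_mult tendsto_const T1) auto
    moreover have "(\<Sum>l<d. (2 * 0 + 2 * n2 (p' l - star (a l)))) < \<epsilon>"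
      using k'(1) d4 by (simp add: p'_def sum_distrib_left[symmetric])
    ultimately have "\<forall>\<^sub>F k in sequentially. ?B k < \<epsilon>" by (intro order_tendstoD(2))
    then show ?thesis
    proof eventually_elim
      case (elim k)
      have "n2 (P l k - p' l) \<le> 2 * n2 (P l k - star (a l)) + 2 * n2 (p' l - star (a l))" if "l < d" for l
      proof -
        have m: "P l k - star (a l) \<in> M" "star (a l) - p' l \<in> M" using that by (auto intro!: form.S_diff M_star aM PM p'M)
        have "n2 (star (a l) - p' l) = n2 (p' l - star (a l))"
          using n2_scl[OF m(2), of "-1"] by (simp add: scl_minus_left)
        then show ?thesis using n2_add_le[OF m] by simp
      qed
      then have "(\<Sum>l<d. n2 (P l k - p' l)) \<le> ?B k" by (intro sum_mono) auto
      then show ?case using elim by simp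
    qed
  qed
  have E3: "\<forall>\<^sub>F k in sequentially. (\<Sum>l<d. n2 (P l k)) < 4"
  proof -
    let ?B = "\<lambda>k. \<Sum>l<d. (2 * n2 (P l k - star (a l)) + 2 * n2 (star (a l)))"
    have "?B \<longlonglongrightarrow> (\<Sum>l<d. (2 * 0 + 2 * n2 (star (a l))))"
      by (intro tendsto_sum tendsto_add tendsto_mult tendsto_const T1) auto
    \<comment> \<open>The limit is 2, by \<open>na\<close>.\<close>
    moreover have "(\<Sum>l<d. (2 * 0 + 2 * n2 (star (a l)))) < 4"
      using na by (simp add: sum_distrib_left[symmetric])
    ultimately have "\<forall>\<^sub>F k in sequentially. ?B k < 4" by (intro order_tendstoD(2))
    then show ?thesis
    proof eventually_elim
      case (elim k)
      have "n2 (P l k) \<le> 2 * n2 (P l k - star (a l)) + 2 * n2 (star (a l))" if "l < d" for l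
        using n2_add_le[of "P l k - star (a l)" "star (a l)"] that diffM PM aM M_star by simp
      then have "(\<Sum>l<d. n2 (P l k)) \<le> ?B k" by (intro sum_mono) auto
      then show ?case using elim by simp
    qed
  qed
  have E4: "\<forall>\<^sub>F k in sequentially. n2 ((\<Sum>l<d. star (p' l) * P l k) - e) < \<epsilon>"
  proof -
    let ?B = "\<lambda>k. 2 * (2 ^ d * (\<Sum>l<d. n2 (star (p' l) * (P l k - star (a l))))) +
      2 * (2 ^ d * (\<Sum>l<d. n2 (a l * (p' l - star (a l)))))"
    have "?B \<longlonglongrightarrow> 2 * (2 ^ d * (\<Sum>l<d. 0)) + 2 * (2 ^ d * (\<Sum>l<d. n2 (a l * (p' l - star (a l)))))"
      by (intro tendsto_sum tendsto_add tendsto_mult tendsto_const T3) auto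
    moreover have "2 * (2 ^ d * (\<Sum>l<d. 0)) + 2 * (2 ^ d * (\<Sum>l<d. n2 (a l * (p' l - star (a l))))) < \<epsilon>"
      using k'(2) d4 by (simp add: p'_def)
    ultimately have "\<forall>\<^sub>F k in sequentially. ?B k < \<epsilon>" by (intro order_tendstoD(2))
    then show ?thesis
    proof eventually_elim
      case (elim k)
      \<comment> \<open>\<open>star (p' l) * p l - a l * star (a l)\<close> is
        \<open>star (p' l) * (p l - star (a l))\<close> plus the adjoint of
        \<open>a l * (p' l - star (a l))\<close>. One is small because \<open>p\<close> is chosen
        after \<open>p'\<close>, the other by the choice of \<open>p'\<close>.\<close>
      let ?X = "\<Sum>l<d. star (p' l) * (P l k - star (a l))" and ?Y = "\<Sum>l<d. star (a l * (p' l - star (a l)))"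
      have XM: "?X \<in> M" by (intro form.S_sum M_mult M_star diffM p'M PM) auto
      have YM: "?Y \<in> M" by (intro form.S_sum M_mult M_star diffM p'M aM) auto
      have "(\<Sum>l<d. star (p' l) * P l k) - e = ?X + ?Y"
        unfolding one[symmetric]
        by (simp add: star_mult star_diff sum_subtractf sum.distrib algebra_simps)
      then have "n2 ((\<Sum>l<d. star (p' l) * P l k) - e) \<le> 2 * n2 ?X + 2 * n2 ?Y"
        using n2_add_le[OF XM YM] by simp
      moreover have "n2 ?X \<le> 2 ^ d * (\<Sum>l<d. n2 (star (p' l) * (P l k - star (a l))))"
        using n2_sum_le[of "{..<d}" "\<lambda>l. star (p' l) * (P l k - star (a l))"]
        by (simp add: M_mult M_star diffM p'M PM)
      moreover have "n2 ?Y \<le> 2 ^ d * (\<Sum>l<d. n2 (a l * (p' l - star (a l))))"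
      proof -
        have "n2 ?Y \<le> 2 ^ card {..<d} * (\<Sum>l<d. n2 (star (a l * (p' l - star (a l)))))"
          by (rule n2_sum_le) (auto intro!: M_mult M_star diffM p'M aM)
        also have "(\<Sum>l<d. n2 (star (a l * (p' l - star (a l))))) = (\<Sum>l<d. n2 (a l * (p' l - star (a l))))"
          by (intro sum.cong n2_star) (auto intro!: M_mult diffM p'M aM)
        finally show ?thesis by simp
      qed
      ultimately show ?case using elim by simp
    qed
  qed
  from eventually_conj[OF E1 eventually_conj[OF E2 eventually_conj[OF E3 E4]]]
  obtain k where k: "\<forall>i\<in>I. (\<Sum>l<d. n2 (P l k * x i - (\<Sum>m<d. scl (L i l m) (P m k)))) < \<delta> i"
    "(\<Sum>l<d. n2 (P l k - p' l)) < \<epsilon>" "(\<Sum>l<d. n2 (P l k)) < 4"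
    "n2 ((\<Sum>l<d. star (p' l) * P l k) - e) < \<epsilon>"
    unfolding eventually_sequentially by blast
  show ?thesis by (rule that[of "\<lambda>l. P l k" p']) (use P(1) p'A k in auto)
qed

end

section \<open>Finitely supported matrices with the Hilbert--Schmidt norm\<close>

text \<open>Matrices of all sizes share one type: the \<open>I \<times> I\<close> matrices are those \<open>A\<close> with
  \<open>one_on I * A = A = A * one_on I\<close>.\<close>

typedef 'i fmat = "{A :: 'i \<Rightarrow> 'i \<Rightarrow> complex. finite {(i, j). A i j \<noteq> 0}}"
  morphisms ent Abs_fmat
  by (rule exI[of _ "\<lambda>i j. 0"]) simp

setup_lifting type_definition_fmat

lemma fmat_eqI: "(\<And>i j. ent A i j = ent B i j) \<Longrightarrow> A = B"
  by (simp add: ent_inject[symmetric] fun_eq_iff)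

text \<open>The index type may be infinite, so all sums run over this finite set or a finite set
  containing it.\<close>

definition idx :: "'i fmat \<Rightarrow> 'i set" where
  "idx A = {j. \<exists>i. ent A i j \<noteq> 0 \<or> ent A j i \<noteq> 0}"

lemma finite_support: "finite {(i, j). ent A i j \<noteq> 0}"
  using ent by auto

lemma finite_idx [simp]: "finite (idx A)"
proof -
  have "idx A \<subseteq> fst ` {(i, j). ent A i j \<noteq> 0} \<union> snd ` {(i, j). ent A i j \<noteq> 0}"
    by (force simp: idx_def)
  then show ?thesis using finite_support[of A] by (meson finite_UnI finite_imageI finite_subset)
qed

lemma ent_idx: "ent A i j \<noteq> 0 \<Longrightarrow> i \<in> idx A" "ent A i j \<noteq> 0 \<Longrightarrow> j \<in> idx A"
  by (auto simp: idx_def)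

lemma finite_support_subset:
  assumes "finite I" "\<And>i j. A i j \<noteq> 0 \<Longrightarrow> i \<in> I \<and> j \<in> I"
  shows "finite {(i, j). A i j \<noteq> 0}"
  by (rule finite_subset[of _ "I \<times> I"]) (use assms in auto)

instantiation fmat :: (type) complex_star_algebra
begin

lift_definition zero_fmat :: "'a fmat" is "\<lambda>i j. 0" by simp
lift_definition plus_fmat :: "'a fmat \<Rightarrow> 'a fmat \<Rightarrow> 'a fmat" is "\<lambda>A B i j. A i j + B i j"
  subgoal for A B by (rule finite_subset[of _ "{(i, j). A i j \<noteq> 0} \<union> {(i, j). B i j \<noteq> 0}"]) auto done
lift_definition uminus_fmat :: "'a fmat \<Rightarrow> 'a fmat" is "\<lambda>A i j. - A i j" by simp
lift_definition minus_fmat :: "'a fmat \<Rightarrow> 'a fmat \<Rightarrow> 'a fmat" is "\<lambda>A B i j. A i j - B i j"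
  subgoal for A B by (rule finite_subset[of _ "{(i, j). A i j \<noteq> 0} \<union> {(i, j). B i j \<noteq> 0}"]) auto done
lift_definition scl_fmat :: "complex \<Rightarrow> 'a fmat \<Rightarrow> 'a fmat" is "\<lambda>c A i j. c * A i j"
  subgoal for c A by (rule finite_subset[of _ "{(i, j). A i j \<noteq> 0}"]) auto done
lift_definition star_fmat :: "'a fmat \<Rightarrow> 'a fmat" is "\<lambda>A i j. cnj (A j i)"
  subgoal for A by (rule finite_subset[of _ "prod.swap ` {(i, j). A i j \<noteq> 0}"]) auto done
definition times_fmat :: "'a fmat \<Rightarrow> 'a fmat \<Rightarrow> 'a fmat" where
  "A * B = Abs_fmat (\<lambda>i j. \<Sum>k\<in>idx A. ent A i k * ent B k j)"

lemma ent_times0: "ent (A * B) i j = (\<Sum>k\<in>idx A. ent A i k * ent B k j)"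
proof -
  have "finite {(i, j). (\<Sum>k\<in>idx A. ent A i k * ent B k j) \<noteq> 0}"
  proof (rule finite_support_subset[of "idx A \<union> idx B"])
    fix i j assume "(\<Sum>k\<in>idx A. ent A i k * ent B k j) \<noteq> 0"
    then obtain k where "ent A i k * ent B k j \<noteq> 0" by (meson sum.neutral)
    then show "i \<in> idx A \<union> idx B \<and> j \<in> idx A \<union> idx B" by (auto dest: ent_idx)
  qed simp
  then show ?thesis unfolding times_fmat_def by (subst Abs_fmat_inverse) auto
qed

lemma ent_times:
  assumes "finite I" "idx A \<subseteq> I \<or> idx B \<subseteq> I"
  shows "ent (A * B) i j = (\<Sum>k\<in>I. ent A i k * ent B k j)"
proof -
  have "(\<Sum>k\<in>idx A. ent A i k * ent B k j) = (\<Sum>k\<in>idx A \<union> I. ent A i k * ent B k j)"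
    by (rule sum.mono_neutral_left) (use assms in \<open>auto dest: ent_idx\<close>)
  also have "\<dots> = (\<Sum>k\<in>I. ent A i k * ent B k j)"
    by (rule sum.mono_neutral_right) (use assms in \<open>auto dest: ent_idx\<close>)
  finally show ?thesis by (simp add: ent_times0)
qed

instance
proof
  fix A B C :: "'a fmat" and c d :: complex
  show "A + B + C = A + (B + C)" by transfer (simp add: add.assoc)
  show "A + B = B + A" by transfer (simp add: add.commute)
  show "0 + A = A" by transfer simp
  show "- A + A = 0" by transfer simp
  show "A - B = A + - B" by transfer simp
  show "scl c (A + B) = scl c A + scl c B" by transfer (simp add: distrib_left)
  show "scl (c + d) A = scl c A + scl d A" by transfer (simp add: distrib_right)
  show "scl c (scl d A) = scl (c * d) A" by transfer (simp add: mult.assoc)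
  show "scl 1 A = A" by transfer simp
  show "star (star A) = A" by transfer simp
  show "star (A + B) = star A + star B" by transfer simp
  show "star (scl c A) = scl (cnj c) (star A)" by transfer simp
  define I where "I = idx A \<union> idx B \<union> idx C"
  have I: "finite I" "idx A \<subseteq> I" "idx B \<subseteq> I" "idx C \<subseteq> I" by (auto simp: I_def)
  note et = ent_times[OF I(1)]
  show "A * B * C = A * (B * C)"
    by (rule fmat_eqI)
       (simp add: et I sum_distrib_left sum_distrib_right mult.assoc, rule sum.swap)
  show "(A + B) * C = A * C + B * C"
    by (rule fmat_eqI) (simp add: et I plus_fmat.rep_eq distrib_right sum.distrib)
  show "A * (B + C) = A * B + A * C"
    by (rule fmat_eqI) (simp add: et I plus_fmat.rep_eq distrib_left sum.distrib)
  show "scl c A * B = scl c (A * B)"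
    by (rule fmat_eqI) (simp add: et I scl_fmat.rep_eq sum_distrib_left mult.assoc)
  show "A * scl c B = scl c (A * B)"
    by (rule fmat_eqI) (simp add: et I scl_fmat.rep_eq sum_distrib_left mult.left_commute)
  have "idx (star A) = idx A" by (auto simp: idx_def star_fmat.rep_eq)
  then show "star (A * B) = star B * star A"
    by (intro fmat_eqI) (simp add: et I star_fmat.rep_eq mult.commute)
qed

end

lemmas ent_simps [simp] = zero_fmat.rep_eq plus_fmat.rep_eq uminus_fmat.rep_eq minus_fmat.rep_eq
  scl_fmat.rep_eq star_fmat.rep_eq

lemma ent_sum [simp]: "ent (sum f I) i j = (\<Sum>x\<in>I. ent (f x) i j)"
  by (induction I rule: infinite_finite_induct) auto

section \<open>The trace and the Hilbert-Schmidt inner product\<close>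

definition tr :: "'i fmat \<Rightarrow> complex" where "tr A = (\<Sum>i\<in>idx A. ent A i i)"

lemma tr_eq:
  assumes "finite I" "\<And>i. ent A i i \<noteq> 0 \<Longrightarrow> i \<in> I"
  shows "tr A = (\<Sum>i\<in>I. ent A i i)"
proof -
  have "tr A = (\<Sum>i\<in>idx A \<union> I. ent A i i)" unfolding tr_def
    by (rule sum.mono_neutral_left) (use assms(1) in \<open>auto dest: ent_idx\<close>)
  also have "\<dots> = (\<Sum>i\<in>I. ent A i i)" by (rule sum.mono_neutral_right) (use assms in auto)
  finally show ?thesis .
qed

lemma tr_add: "tr (A + B) = tr A + tr B"
proof -
  define I where "I = idx A \<union> idx B"
  have I: "finite I" "\<And>i. ent A i i \<noteq> 0 \<Longrightarrow> i \<in> I" "\<And>i. ent B i i \<noteq> 0 \<Longrightarrow> i \<in> I"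
    "\<And>i. ent (A + B) i i \<noteq> 0 \<Longrightarrow> i \<in> I"
    by (auto simp: I_def dest: ent_idx) (metis add.left_neutral ent_idx(1))
  have "tr A = (\<Sum>i\<in>I. ent A i i)" "tr B = (\<Sum>i\<in>I. ent B i i)" "tr (A + B) = (\<Sum>i\<in>I. ent (A + B) i i)"
    by (rule tr_eq[OF I(1)], erule I)+
  then show ?thesis by (simp add: sum.distrib)
qed

lemma tr_scl: "tr (scl c A) = c * tr A"
proof -
  have "tr (scl c A) = (\<Sum>i\<in>idx A. ent (scl c A) i i)" by (rule tr_eq) (auto dest: ent_idx)
  then show ?thesis by (simp add: tr_def sum_distrib_left)
qed

lemma tr_zero [simp]: "tr 0 = 0" using tr_scl[of 0 0] by simp

lemma tr_diff: "tr (A - B) = tr A - tr B"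
  using tr_add[of A "- B"] tr_scl[of "-1" B] by (simp add: scl_minus_left)

lemma tr_sum: "tr (sum f I) = (\<Sum>i\<in>I. tr (f i))"
  by (induction I rule: infinite_finite_induct) (auto simp: tr_add)

lemma tr_star: "tr (star A) = cnj (tr A)"
proof -
  have "tr (star A) = (\<Sum>i\<in>idx A. ent (star A) i i)" by (rule tr_eq) (auto dest: ent_idx)
  then show ?thesis by (simp add: tr_def)
qed

lemma tr_times:
  assumes I: "finite I" "idx A \<subseteq> I" "idx B \<subseteq> I"
  shows "tr (A * B) = (\<Sum>i\<in>I. \<Sum>k\<in>I. ent A i k * ent B k i)"
proof -
  have "tr (A * B) = (\<Sum>i\<in>I. ent (A * B) i i)"
  proof (rule tr_eq[OF I(1)])
    fix i assume "ent (A * B) i i \<noteq> 0"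
    then obtain k where "ent A i k * ent B k i \<noteq> 0" unfolding ent_times[OF I(1) disjI1[OF I(2)]] by (meson sum.neutral)
    then show "i \<in> I" using I by (auto dest: ent_idx)
  qed
  then show ?thesis using I by (simp add: ent_times)
qed

lemma tr_comm: "tr (A * B) = tr (B * A)"
proof -
  have I: "finite (idx A \<union> idx B)" "idx A \<subseteq> idx A \<union> idx B" "idx B \<subseteq> idx A \<union> idx B" by auto
  show ?thesis unfolding tr_times[OF I] tr_times[OF I(1,3,2)]
    by (subst sum.swap) (simp add: mult.commute)
qed

lemma idx_star [simp]: "idx (star A) = idx A"
  by (auto simp: idx_def)

lemma tr_star_times:
  assumes I: "finite I" "idx A \<subseteq> I" "idx B \<subseteq> I"
  shows "tr (star B * A) = (\<Sum>i\<in>I. \<Sum>j\<in>I. ent A i j * cnj (ent B i j))"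
  using tr_times[of I "star B" A] I by (subst sum.swap) (simp add: mult.commute)

instantiation fmat :: (type) real_inner
begin

definition scaleR_fmat :: "real \<Rightarrow> 'a fmat \<Rightarrow> 'a fmat" where "scaleR_fmat r A = scl (complex_of_real r) A"
definition inner_fmat :: "'a fmat \<Rightarrow> 'a fmat \<Rightarrow> real" where "inner_fmat A B = Re (tr (star B * A))"
definition norm_fmat :: "'a fmat \<Rightarrow> real" where "norm_fmat x = sqrt (inner x x)"
definition dist_fmat :: "'a fmat \<Rightarrow> 'a fmat \<Rightarrow> real" where "dist_fmat x y = norm (x - y)"
definition sgn_fmat :: "'a fmat \<Rightarrow> 'a fmat" where "sgn_fmat x = scaleR (inverse (norm x)) x"
definition uniformity_fmat :: "('a fmat \<times> 'a fmat) filter" where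
  "uniformity_fmat = (INF e\<in>{0<..}. principal {(x, y). dist x y < e})"
definition open_fmat :: "'a fmat set \<Rightarrow> bool" where
  "open_fmat U = (\<forall>x\<in>U. \<forall>\<^sub>F (x', y) in uniformity. x' = x \<longrightarrow> y \<in> U)"

lemma inner_fmat_self: "inner A A = (\<Sum>i\<in>idx A. \<Sum>j\<in>idx A. (cmod (ent A i j))\<^sup>2)"
  unfolding inner_fmat_def by (subst tr_star_times[of "idx A"]) (auto simp: complex_norm_square[symmetric] simp flip: of_real_power)

instance
proof
  fix x y z :: "'a fmat" and r s :: real
  show "r *\<^sub>R (x + y) = r *\<^sub>R x + r *\<^sub>R y" "(r + s) *\<^sub>R x = r *\<^sub>R x + s *\<^sub>R x"
    "r *\<^sub>R s *\<^sub>R x = (r * s) *\<^sub>R x" "1 *\<^sub>R x = x"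
    by (simp_all add: scaleR_fmat_def scl_add_right scl_add_left)
  show "dist x y = norm (x - y)" by (rule dist_fmat_def)
  show "sgn x = scaleR (inverse (norm x)) x" by (rule sgn_fmat_def)
  show "uniformity = (INF e\<in>{0<..}. principal {(x::'a fmat, y). dist x y < e})" by (rule uniformity_fmat_def)
  show "open U = (\<forall>x\<in>U. \<forall>\<^sub>F (x', y) in uniformity. x' = x \<longrightarrow> y \<in> U)" for U :: "'a fmat set"
    by (rule open_fmat_def)
  show "inner x y = inner y x"
    using tr_star[of "star y * x"] by (simp add: inner_fmat_def star_mult)
  show "inner (x + y) z = inner x z + inner y z" by (simp add: inner_fmat_def distrib_left tr_add)
  show "inner (r *\<^sub>R x) y = r * inner x y" by (simp add: inner_fmat_def scaleR_fmat_def tr_scl)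
  show "0 \<le> inner x x" unfolding inner_fmat_self by (intro sum_nonneg) auto
  show "(inner x x = 0) = (x = 0)"
  proof
    assume "inner x x = 0"
    then have "\<forall>i\<in>idx x. \<forall>j\<in>idx x. ent x i j = 0"
      unfolding inner_fmat_self by (subst (asm) sum_nonneg_eq_0_iff; auto simp: sum_nonneg sum_nonneg_eq_0_iff)
    then show "x = 0" by (intro fmat_eqI) (metis ent_idx zero_fmat.rep_eq)
  qed (simp add: inner_fmat_def)
  show "norm x = sqrt (inner x x)" by (rule norm_fmat_def)
qed

end

lemma norm2_tr: "(norm (A::'i fmat))\<^sup>2 = Re (tr (star A * A))"
  by (simp add: power2_norm_eq_inner inner_fmat_def)

lemma tr_star_self: "tr (star A * A) = complex_of_real ((norm A)\<^sup>2)"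
  using tr_star[of "star A * A"] by (simp add: norm2_tr complex_eq_iff star_mult)

lemma norm2_ent:
  assumes "finite I" "idx A \<subseteq> I"
  shows "(norm A)\<^sup>2 = (\<Sum>i\<in>I. \<Sum>j\<in>I. (cmod (ent A i j))\<^sup>2)"
proof -
  have "tr (star A * A) = (\<Sum>i\<in>I. \<Sum>j\<in>I. complex_of_real ((cmod (ent A i j))\<^sup>2))"
    using assms by (subst tr_star_times[of I]) (auto simp: complex_norm_square simp del: of_real_power)
  then show ?thesis unfolding norm2_tr by (simp del: of_real_power)
qed

lemma norm_star [simp]: "norm (star A) = norm (A::'i fmat)"
proof -
  have "(norm (star A))\<^sup>2 = (norm A)\<^sup>2" unfolding norm2_tr by (simp add: tr_comm)
  then show ?thesis by (simp add: power2_eq_iff_nonneg)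
qed

lemma norm_scl: "norm (scl c A) = cmod c * norm (A::'i fmat)"
proof -
  have "tr (star (scl c A) * scl c A) = (c * cnj c) * tr (star A * A)" by (simp add: tr_scl mult_ac)
  also have "\<dots> = complex_of_real ((cmod c * norm A)\<^sup>2)"
    unfolding tr_star_self complex_norm_square[symmetric] by (simp add: power_mult_distrib)
  finally have "(norm (scl c A))\<^sup>2 = (cmod c * norm A)\<^sup>2" unfolding norm2_tr by (simp only: Re_complex_of_real)
  then show ?thesis by (simp add: power2_eq_iff_nonneg)
qed

lemma cmod_tr_le: "cmod (tr (star B * A)) \<le> norm A * norm (B::'i fmat)"
proof -
  define c where "c = tr (star B * A)"
  define u where "u = (if c = 0 then 1 else cnj c / cmod c)"
  have u: "cmod u = 1" "u * c = cmod c"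
    by (auto simp: u_def norm_divide complex_norm_square[symmetric] mult.commute)
       (simp add: complex_norm_square power2_eq_square)
  have "cmod c = inner (scl u A) B"
    using u(2) by (simp add: inner_fmat_def tr_scl c_def)
  also have "\<dots> \<le> norm (scl u A) * norm B" by (rule norm_cauchy_schwarz)
  finally show ?thesis by (simp add: norm_scl u c_def)
qed

text \<open>\<open>opb c A\<close> expresses that the operator norm of \<open>A\<close> is at most \<open>c\<close>.\<close>

definition opb :: "real \<Rightarrow> 'i fmat \<Rightarrow> bool" where
  "opb c A \<longleftrightarrow> 0 \<le> c \<and> (\<forall>X. norm (A * X) \<le> c * norm X)"

lemma opbD: "opb c A \<Longrightarrow> 0 \<le> c" "opb c A \<Longrightarrow> norm (A * X) \<le> c * norm X"
  by (auto simp: opb_def)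

text \<open>The squared norm of \<open>star A * X\<close> is an inner product of \<open>X\<close>
  with \<open>A * (star A * X)\<close>; the bound for \<open>A\<close> then allows one factor to be
  cancelled. Bounds for right multiplication follow by taking adjoints.\<close>

lemma opb_star:
  assumes A: "opb c A" shows "opb c (star A)"
  unfolding opb_def
proof (intro conjI allI)
  show "0 \<le> c" using A by (rule opbD)
  fix X
  have "(norm (star A * X))\<^sup>2 = Re (tr (star X * (A * (star A * X))))"
    by (simp add: norm2_tr star_mult mult.assoc)
  also have "\<dots> \<le> norm (A * (star A * X)) * norm X"
    using cmod_tr_le[of X "A * (star A * X)"] by (meson complex_Re_le_cmod order_trans)
  also have "\<dots> \<le> c * norm (star A * X) * norm X" by (intro mult_right_mono opbD(2)[OF A]) auto
  finally show "norm (star A * X) \<le> c * norm X"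
    using opbD(1)[OF A] by (cases "norm (star A * X) = 0") (auto simp: power2_eq_square)
qed

lemma opb_right:
  assumes A: "opb c A" shows "norm (X * A) \<le> c * norm X"
proof -
  have "norm (X * A) = norm (star A * star X)" by (metis norm_star star_mult)
  also have "\<dots> \<le> c * norm X" using opbD(2)[OF opb_star[OF A], of "star X"] by simp
  finally show ?thesis .
qed

lemma opb_mono: "opb c A \<Longrightarrow> c \<le> d \<Longrightarrow> opb d A"
  unfolding opb_def by (meson mult_right_mono norm_ge_zero order_trans)

lemma opb_mult: "opb c A \<Longrightarrow> opb d B \<Longrightarrow> opb (c * d) (A * B)"
  unfolding opb_def
proof (intro conjI allI)
  fix X assume a: "0 \<le> c \<and> (\<forall>X. norm (A * X) \<le> c * norm X)" and b: "0 \<le> d \<and> (\<forall>X. norm (B * X) \<le> d * norm X)"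
  then show "0 \<le> c * d" by simp
  have "norm (A * (B * X)) \<le> c * norm (B * X)" using a by blast
  also have "\<dots> \<le> c * (d * norm X)" using a b by (intro mult_left_mono) auto
  finally show "norm (A * B * X) \<le> c * d * norm X" by (simp add: mult.assoc)
qed

lemma opb_add: "opb c A \<Longrightarrow> opb d B \<Longrightarrow> opb (c + d) (A + B)"
  unfolding opb_def distrib_right by (meson add_mono add_nonneg_nonneg norm_triangle_le)

lemma opb_zero: "opb 0 0" by (simp add: opb_def)

lemma opb_scl: "opb c A \<Longrightarrow> opb (cmod k * c) (scl k A)"
  by (auto simp: opb_def norm_scl mult.assoc intro: mult_left_mono)

lemma opb_sum: "(\<And>i. i \<in> I \<Longrightarrow> opb (c i) (A i)) \<Longrightarrow> opb (sum c I) (sum A I)"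
  by (induction I rule: infinite_finite_induct) (auto simp: opb_zero opb_add)

section \<open>Projections, matrix units and tensor products\<close>

definition eproj :: "'i fmat \<Rightarrow> bool" where "eproj p \<longleftrightarrow> p * p = p \<and> star p = p"

lemma norm_eproj_le:
  assumes p: "eproj p" shows "norm (p * X) \<le> norm X"
proof -
  have "(norm (p * X))\<^sup>2 = Re (tr (star X * (p * X)))"
    using p by (simp add: norm2_tr star_mult eproj_def) (metis mult.assoc)
  also have "\<dots> \<le> norm (p * X) * norm X"
    using cmod_tr_le[of X "p * X"] by (meson complex_Re_le_cmod order_trans)
  finally show ?thesis by (cases "norm (p * X) = 0") (auto simp: power2_eq_square)
qed

lemma opb_eproj: "eproj p \<Longrightarrow> opb 1 p"
  by (simp add: opb_def norm_eproj_le)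

lemma opb_partial_isometry:
  assumes "eproj (star W * W)" shows "opb 1 W"
  unfolding opb_def
proof (intro conjI allI)
  fix X
  have "(norm (W * X))\<^sup>2 = Re (tr (star X * ((star W * W) * X)))"
    by (simp add: norm2_tr star_mult mult.assoc)
  also have "\<dots> \<le> norm ((star W * W) * X) * norm X"
    using cmod_tr_le[of X "(star W * W) * X"] by (meson complex_Re_le_cmod order_trans)
  also have "\<dots> \<le> norm X * norm X" by (intro mult_right_mono norm_eproj_le assms) auto
  finally have "(norm (W * X))\<^sup>2 \<le> (norm X)\<^sup>2" by (simp add: power2_eq_square)
  then show "norm (W * X) \<le> 1 * norm X" by (simp add: abs_le_square_iff[symmetric])
qed simp

lift_definition emat :: "'i \<Rightarrow> 'i \<Rightarrow> 'i fmat" is "\<lambda>a b i j. if i = a \<and> j = b then 1 else 0"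
  by (rule finite_subset[of _ "{(a, b)}" for a b]) (auto split: if_splits)

lemma ent_emat [simp]: "ent (emat a b) i j = (if i = a \<and> j = b then 1 else 0)"
  by transfer simp

lemma idx_emat: "idx (emat a b) \<subseteq> {a, b}"
  by (auto simp: idx_def split: if_splits)

lemma star_emat [simp]: "star (emat a b) = emat b a"
  by (rule fmat_eqI) auto

lemma ent_emat_left: "ent (emat a b * A) i j = (if i = a then ent A b j else 0)"
proof -
  have "ent (emat a b * A) i j = (\<Sum>k\<in>{a, b}. ent (emat a b) i k * ent A k j)"
    by (rule ent_times) (use idx_emat[of a b] in auto)
  also have "\<dots> = (\<Sum>k\<in>{a, b}. if k = b then (if i = a then ent A b j else 0) else 0)"
    by (rule sum.cong) auto
  also have "\<dots> = (if i = a then ent A b j else 0)" by (subst sum.delta) auto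
  finally show ?thesis .
qed

lemma ent_emat_right: "ent (A * emat a b) i j = (if j = b then ent A i a else 0)"
proof -
  have "ent (A * emat a b) i j = (\<Sum>k\<in>{a, b}. ent A i k * ent (emat a b) k j)"
    by (rule ent_times) (use idx_emat[of a b] in auto)
  also have "\<dots> = (\<Sum>k\<in>{a, b}. if k = a then (if j = b then ent A i a else 0) else 0)"
    by (rule sum.cong) auto
  also have "\<dots> = (if j = b then ent A i a else 0)" by (subst sum.delta) auto
  finally show ?thesis .
qed

lemma emat_times: "emat a b * emat c d = (if b = c then emat a d else 0)"
  by (rule fmat_eqI) (simp add: ent_emat_left)

lemma emat_sandwich: "emat a b * A * emat c d = scl (ent A b c) (emat a d)"
  by (rule fmat_eqI) (simp add: ent_emat_right ent_emat_left)

lemma tr_emat: "tr (emat a b) = (if a = b then 1 else 0)"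
  by (subst tr_eq[of "{a}"]) (auto split: if_splits)

lemma norm_emat [simp]: "norm (emat a b) = 1"
proof -
  have "(norm (emat a b))\<^sup>2 = 1\<^sup>2" unfolding norm2_tr by (simp add: emat_times tr_emat)
  then show ?thesis by (metis norm_ge_zero power2_eq_iff_nonneg zero_le_one)
qed

lemma cmod_ent_le_norm: "cmod (ent A i j) \<le> norm A"
proof -
  have "tr (star (emat i j) * A) = ent A i j"
    by (subst tr_eq[of "{j}"]) (auto simp: ent_emat_left split: if_splits)
  then show ?thesis using cmod_tr_le[of "emat i j" A] by simp
qed

lemma cmod_ent_le: "opb c A \<Longrightarrow> cmod (ent A i j) \<le> c"
  using cmod_ent_le_norm[of "A * emat j j" i j] opbD(2)[of c A "emat j j"] by (simp add: ent_emat_right)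

definition one_on :: "'i set \<Rightarrow> 'i fmat" where "one_on I = (\<Sum>i\<in>I. emat i i)"

lemma ent_one_on: "finite I \<Longrightarrow> ent (one_on I) i j = (if i = j \<and> i \<in> I then 1 else 0)"
proof -
  assume I: "finite I"
  have "ent (one_on I) i j = (\<Sum>k\<in>I. if k = i then (if i = j then 1 else 0) else 0)"
    unfolding one_on_def ent_sum by (rule sum.cong) auto
  then show ?thesis using I by (simp add: sum.delta)
qed

lemma ent_one_on_left: "finite I \<Longrightarrow> ent (one_on I * A) i j = (if i \<in> I then ent A i j else 0)"
  by (simp add: one_on_def sum_distrib_right ent_emat_left)

lemma ent_one_on_right: "finite I \<Longrightarrow> ent (A * one_on I) i j = (if j \<in> I then ent A i j else 0)"
  by (simp add: one_on_def sum_distrib_left ent_emat_right)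

lemma star_one_on [simp]: "star (one_on I) = one_on I"
  by (simp add: one_on_def star_sum)

lemma one_on_idem: "finite I \<Longrightarrow> one_on I * one_on I = one_on I"
  by (rule fmat_eqI) (simp add: ent_one_on_left ent_one_on)

lemma eproj_one_on: "finite I \<Longrightarrow> eproj (one_on I)"
  by (simp add: eproj_def one_on_idem)

lemma tr_one_on: "finite I \<Longrightarrow> tr (one_on I) = of_nat (card I)"
  by (simp add: one_on_def tr_sum tr_emat)

lemma norm2_one_on: "finite I \<Longrightarrow> (norm (one_on I))\<^sup>2 = real (card I)"
  by (simp add: norm2_tr one_on_idem tr_one_on)

definition tens :: "'i fmat \<Rightarrow> 'j fmat \<Rightarrow> ('i \<times> 'j) fmat" where
  "tens A B = Abs_fmat (\<lambda>x y. ent A (fst x) (fst y) * ent B (snd x) (snd y))"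

lemma ent_tens [simp]: "ent (tens A B) x y = ent A (fst x) (fst y) * ent B (snd x) (snd y)"
proof -
  have "finite {(x, y). ent A (fst x) (fst y) * ent B (snd x) (snd y) \<noteq> 0}"
    by (rule finite_support_subset[of "idx A \<times> idx B"]) (auto dest: ent_idx)
  then show ?thesis unfolding tens_def by (subst Abs_fmat_inverse) auto
qed

lemma idx_tens: "idx (tens A B) \<subseteq> idx A \<times> idx B"
  by (auto simp: idx_def)

lemma tens_mult: "tens A B * tens C D = tens (A * C) (B * D)"
proof (rule fmat_eqI)
  fix x y
  have "ent (tens A B * tens C D) x y = (\<Sum>z\<in>idx A \<times> idx B. ent (tens A B) x z * ent (tens C D) z y)"
    by (rule ent_times) (auto simp: idx_tens)
  also have "\<dots> = (\<Sum>k\<in>idx A. \<Sum>l\<in>idx B. (ent A (fst x) k * ent C k (fst y)) * (ent B (snd x) l * ent D l (snd y)))"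
    by (simp add: sum.cartesian_product case_prod_beta mult_ac)
  also have "\<dots> = ent (tens (A * C) (B * D)) x y"
    by (simp add: ent_times0 sum_product)
  finally show "ent (tens A B * tens C D) x y = ent (tens (A * C) (B * D)) x y" .
qed

lemma tens_star: "star (tens A B) = tens (star A) (star B)"
  by (rule fmat_eqI) simp

lemma tens_add_left: "tens (A + B) C = tens A C + tens B C"
  and tens_add_right: "tens A (C + D) = tens A C + tens A D"
  and tens_diff_right: "tens A (C - D) = tens A C - tens A D"
  by (auto intro!: fmat_eqI simp: algebra_simps)

lemma tens_scl_left: "tens (scl c A) B = scl c (tens A B)"
  and tens_scl_right: "tens A (scl c B) = scl c (tens A B)"
  by (auto intro!: fmat_eqI simp: algebra_simps)

lemma tens_zero [simp]: "tens 0 B = 0" "tens A 0 = 0"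
  by (auto intro!: fmat_eqI)

lemma tens_sum_left: "tens (sum f I) B = (\<Sum>i\<in>I. tens (f i) B)"
  and tens_sum_right: "tens A (sum g I) = (\<Sum>i\<in>I. tens A (g i))"
  by (auto intro!: fmat_eqI simp: sum_distrib_left sum_distrib_right)

lemma tr_tens: "tr (tens A B) = tr A * tr B"
proof -
  have "tr (tens A B) = (\<Sum>x\<in>idx A \<times> idx B. ent (tens A B) x x)"
    by (rule tr_eq) (auto dest: ent_idx)
  then show ?thesis by (simp add: tr_def sum_product sum.cartesian_product case_prod_beta)
qed

lemma norm_tens: "norm (tens A B) = norm A * norm B"
proof -
  have "tr (star (tens A B) * tens A B) = complex_of_real ((norm A)\<^sup>2 * (norm B)\<^sup>2)"
    by (simp add: tens_star tens_mult tr_tens tr_star_self)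
  then have "(norm (tens A B))\<^sup>2 = (norm A * norm B)\<^sup>2"
    unfolding norm2_tr[of "tens A B"] by (simp only: Re_complex_of_real power_mult_distrib)
  then show ?thesis by (simp add: power2_eq_iff_nonneg)
qed

lemma one_on_times: "tens (one_on I) (one_on J) = one_on (I \<times> J)" if "finite I" "finite J"
  using that by (intro fmat_eqI) (auto simp: ent_one_on)

section \<open>Simultaneous block diagonalization and polar decomposition\<close>

text \<open>Vectors of \<open>\<complex>\<^sup>I\<close> are encoded as matrices with a single nonzero column, in position \<open>c\<close>.\<close>

definition cols :: "'i set \<Rightarrow> 'i \<Rightarrow> 'i fmat set" where
  "cols I c = {v. one_on I * v = v \<and> v * emat c c = v}"

interpretation col: hermitian_form "cols I c" "\<lambda>v w. tr (star w * v)" for I c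
proof
  fix x y z :: "'a fmat" and k
  show "0 \<in> cols I c" by (simp add: cols_def)
  show "x \<in> cols I c \<Longrightarrow> y \<in> cols I c \<Longrightarrow> x + y \<in> cols I c" by (simp add: cols_def distrib_left distrib_right)
  show "x \<in> cols I c \<Longrightarrow> scl k x \<in> cols I c" by (simp add: cols_def)
  show "tr (star z * (x + y)) = tr (star z * x) + tr (star z * y)" by (simp add: distrib_left tr_add)
  show "tr (star z * scl k x) = k * tr (star z * x)" by (simp add: tr_scl)
  show "tr (star x * y) = cnj (tr (star y * x))" using tr_star[of "star y * x"] by (simp add: star_mult)
  show "0 \<le> Re (tr (star x * x))" by (simp add: tr_star_self)
  show "tr (star x * x) = 0 \<Longrightarrow> x = 0" by (simp add: tr_star_self)
qed

lemma cols_inner: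
  assumes "v \<in> cols I c" "w \<in> cols I c"
  shows "star w * v = scl (tr (star w * v)) (emat c c)"
proof -
  have "star w = emat c c * star w" using assms(2) unfolding cols_def mem_Collect_eq by (metis star_emat star_mult)
  moreover have "v = v * emat c c" using assms(1) by (simp add: cols_def)
  ultimately have "star w * v = emat c c * (star w * v) * emat c c" by (metis mult.assoc)
  then have "star w * v = scl (ent (star w * v) c c) (emat c c)" by (simp add: emat_sandwich)
  moreover from this have "tr (star w * v) = ent (star w * v) c c" by (metis mult_cancel_left1 tr_emat tr_scl)
  ultimately show ?thesis by simp
qed

lemma cols_mult: "v \<in> cols I c \<Longrightarrow> one_on I * B = B \<Longrightarrow> B * v \<in> cols I c"
  by (simp add: cols_def mult.assoc[symmetric]) (simp add: mult.assoc)

lemma emat_cols: "finite I \<Longrightarrow> i \<in> I \<Longrightarrow> emat i c \<in> cols I c"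
  by (simp add: cols_def emat_times) (rule fmat_eqI, simp add: ent_one_on_left)

definition proj_of :: "'i fmat list \<Rightarrow> 'i fmat" where
  "proj_of us = (\<Sum>i<length us. us ! i * star (us ! i))"

lemma orthonormal_cols:
  assumes "col.orthonormal I c us" "i < length us"
  shows "us ! i \<in> cols I c" "one_on I * us ! i = us ! i" "us ! i * emat c c = us ! i"
    "j < length us \<Longrightarrow> star (us ! j) * us ! i = (if i = j then emat c c else 0)"
proof -
  show v: "us ! i \<in> cols I c" using assms by (auto simp: col.orthonormal_def)
  then show "one_on I * us ! i = us ! i" "us ! i * emat c c = us ! i" by (auto simp: cols_def)
  assume j: "j < length us"
  have w: "us ! j \<in> cols I c" using assms j by (auto simp: col.orthonormal_def)
  show "star (us ! j) * us ! i = (if i = j then emat c c else 0)"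
    using cols_inner[OF v w] assms j by (simp add: col.orthonormal_def)
qed

lemma proj_of_apply:
  assumes us: "col.orthonormal I c us" and v: "v \<in> cols I c"
  shows "proj_of us * v = (\<Sum>i<length us. scl (tr (star (us ! i) * v)) (us ! i))"
  unfolding proj_of_def sum_distrib_right
proof (rule sum.cong)
  fix i assume "i \<in> {..<length us}"
  then have i: "i < length us" by simp
  have "us ! i * star (us ! i) * v = us ! i * scl (tr (star (us ! i) * v)) (emat c c)"
    using cols_inner[OF v orthonormal_cols(1)[OF us i]] by (simp add: mult.assoc)
  then show "us ! i * star (us ! i) * v = scl (tr (star (us ! i) * v)) (us ! i)"
    using orthonormal_cols(3)[OF us i] by simp
qed simp

lemma proj_of_nth:
  assumes us: "col.orthonormal I c us" and i: "i < length us"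
  shows "proj_of us * us ! i = us ! i"
proof -
  have "proj_of us * us ! i = (\<Sum>j<length us. if j = i then us ! i else 0)"
    unfolding proj_of_apply[OF us orthonormal_cols(1)[OF us i]]
    by (rule sum.cong) (use us i in \<open>auto simp: col.orthonormal_def\<close>)
  then show ?thesis using i by simp
qed

lemma proj_of_cspan:
  assumes us: "col.orthonormal I c us" and v: "v \<in> cspan (set us)"
  shows "proj_of us * v = v"
  using v
  by induction (auto simp: in_set_conv_nth proj_of_nth[OF us] distrib_left)

lemma star_proj_of [simp]: "star (proj_of us) = proj_of us"
  by (simp add: proj_of_def star_sum star_mult)

lemma eproj_proj_of:
  assumes us: "col.orthonormal I c us"
  shows "eproj (proj_of us)" "one_on I * proj_of us = proj_of us" "tr (proj_of us) = of_nat (length us)"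
proof -
  have "proj_of us * proj_of us = (\<Sum>i<length us. (proj_of us * us ! i) * star (us ! i))"
    by (subst (2) proj_of_def) (simp add: sum_distrib_left mult.assoc)
  also have "\<dots> = proj_of us" unfolding proj_of_def[of us] by (rule sum.cong) (use proj_of_nth[OF us] in \<open>auto simp: proj_of_def\<close>)
  finally show "eproj (proj_of us)" by (simp add: eproj_def)
  show "one_on I * proj_of us = proj_of us"
    unfolding proj_of_def sum_distrib_left
    by (rule sum.cong) (use orthonormal_cols(2)[OF us] in \<open>auto simp: mult.assoc[symmetric]\<close>)
  have "tr (us ! i * star (us ! i)) = 1" if "i < length us" for i
    using us that by (subst tr_comm) (simp add: col.orthonormal_def)
  then show "tr (proj_of us) = of_nat (length us)" by (simp add: proj_of_def tr_sum)
qed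

text \<open>The difference is a projection, and a projection of trace zero has norm zero.\<close>

lemma eproj_eqI:
  assumes p: "eproj p" and q: "eproj q" and "p * q = q" "tr p = tr q"
  shows "p = q"
proof -
  have qp: "q * p = q" using p q assms(3) unfolding eproj_def by (metis star_mult)
  have "star (p - q) * (p - q) = p - q" using p q assms(3) qp by (simp add: eproj_def star_diff algebra_simps)
  then have "complex_of_real ((norm (p - q))\<^sup>2) = 0" unfolding tr_star_self[symmetric] by (simp add: tr_diff assms(4))
  then show ?thesis by simp
qed

lemma tr_eproj: "eproj p \<Longrightarrow> tr p = complex_of_real ((norm p)\<^sup>2)"
  using tr_star_self[of p] by (simp add: eproj_def)

lemma cols_expansion:
  assumes I: "finite I" and v: "v \<in> cols I c"
  shows "v = (\<Sum>i\<in>I. scl (ent v i c) (emat i c))"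
proof -
  have "v = one_on I * v * emat c c" using v by (simp add: cols_def)
  also have "\<dots> = (\<Sum>i\<in>I. scl (ent v i c) (emat i c))"
    by (simp add: one_on_def sum_distrib_right emat_sandwich)
  finally show ?thesis .
qed

text \<open>The columns of \<open>Q\<close>, moved to position \<open>c\<close>, span its range, and
  Gram-Schmidt makes a basis of them.\<close>

lemma eproj_basis:
  assumes I: "finite I" and Q: "eproj Q" "one_on I * Q = Q"
  shows "\<exists>us. col.orthonormal I c us \<and> proj_of us = Q \<and> (\<forall>v\<in>cols I c. Q * v = v \<longrightarrow> v \<in> cspan (set us))"
proof -
  obtain ks where ks: "set ks = I" using finite_list[OF I] by blast
  define vs where "vs = map (\<lambda>i. Q * emat i c) ks"
  have vsc: "set vs \<subseteq> cols I c" unfolding vs_def using ks cols_mult[OF emat_cols[OF I] Q(2)] by auto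
  obtain us where us: "col.orthonormal I c us" "cspan (set us) = cspan (set vs)"
    using col.orthonormal_basis_exists[OF vsc] by blast
  have sp: "v \<in> cspan (set us)" if v: "v \<in> cols I c" "Q * v = v" for v
  proof -
    have "Q * v = (\<Sum>i\<in>I. scl (ent v i c) (Q * emat i c))"
      by (subst cols_expansion[OF I v(1)]) (simp add: sum_distrib_left)
    also have "\<dots> \<in> cspan (set vs)" using ks by (intro cspan_sum cspan_scl cspan_base) (auto simp: vs_def)
    finally show ?thesis using v us by simp
  qed
  have "Q * x = x" if "x \<in> cspan (set vs)" for x
    using that by induction (use Q in \<open>auto simp: vs_def eproj_def distrib_left mult.assoc[symmetric]\<close>)
  then have Qu: "Q * us ! i = us ! i" if "i < length us" for i
    using us(2) that by (metis cspan_base nth_mem)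
  have Qp: "Q * proj_of us = proj_of us"
    unfolding proj_of_def sum_distrib_left by (rule sum.cong) (use Qu in \<open>auto simp: mult.assoc[symmetric]\<close>)
  have "proj_of us * Q = Q"
  proof (rule fmat_eqI)
    fix i j
    have QK: "Q * one_on I = Q" using Q unfolding eproj_def by (metis star_mult star_one_on)
    have c0: "proj_of us * Q * emat j c = Q * emat j c" if "j \<in> I" for j
    proof -
      have "Q * emat j c \<in> cspan (set us)" using that ks us(2) by (auto simp: vs_def intro: cspan_base)
      then show ?thesis using proj_of_cspan[OF us(1)] by (simp add: mult.assoc)
    qed
    show "ent (proj_of us * Q) i j = ent Q i j"
    proof (cases "j \<in> I")
      case True
      then show ?thesis using arg_cong[OF c0[OF True], of "\<lambda>A. ent A i c"] by (simp add: ent_emat_right)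
    next
      case False
      have "ent (proj_of us * Q * one_on I) i j = 0" "ent (Q * one_on I) i j = 0"
        using False by (auto simp: ent_one_on_right[OF I])
      then show ?thesis by (simp add: QK mult.assoc)
    qed
  qed
  then have "Q = proj_of us" using Qp eproj_proj_of(1)[OF us(1)] Q(1) unfolding eproj_def by (metis star_mult)
  then show ?thesis using us(1) sp by auto
qed

text \<open>In an orthonormal basis of the range of \<open>Q\<close> the compression of
  \<open>H\<close> is a complex matrix of positive size, so it has an eigenvector. Since
  \<open>H\<close> commutes with \<open>Q\<close>, it maps the range into itself and the eigenvector
  belongs to \<open>H\<close>.\<close>

lemma eigenvector_in_range:
  assumes I: "finite I" and Q: "eproj Q" "one_on I * Q = Q" "Q \<noteq> 0"
    and H: "one_on I * H = H" "H * Q = Q * H"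
  shows "\<exists>v h. v \<in> cols I c \<and> v \<noteq> 0 \<and> Q * v = v \<and> H * v = scl h v"
proof -
  obtain us where us: "col.orthonormal I c us" "proj_of us = Q"
    "\<And>v. v \<in> cols I c \<Longrightarrow> Q * v = v \<Longrightarrow> v \<in> cspan (set us)"
    using eproj_basis[OF I Q(1,2)] by blast
  define n where "n = length us"
  have n0: "n > 0" using us(2) Q(3) by (auto simp: proj_of_def n_def)
  note uc = orthonormal_cols[OF us(1)]
  have Qu: "Q * us ! i = us ! i" if "i < n" for i using proj_of_nth[OF us(1)] that us(2) by (simp add: n_def)
  define A where "A = mat n n (\<lambda>(i, j). tr (star (us ! i) * (H * us ! j)))"
  have A: "A \<in> carrier_mat n n" by (simp add: A_def)
  obtain h w where w: "eigenvector A w h"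
    using spectrum_non_empty[OF A] n0 unfolding spectrum_def eigenvalue_def by auto
  have w': "w \<in> carrier_vec n" "w \<noteq> 0\<^sub>v n" "A *\<^sub>v w = h \<cdot>\<^sub>v w" using w A by (auto simp: eigenvector_def)
  define v where "v = (\<Sum>j<n. scl (vec_index w j) (us ! j))"
  have vc: "v \<in> cols I c" unfolding v_def by (intro col.S_sum col.S_scl) (auto simp: n_def uc(1))
  have Qv: "Q * v = v" unfolding v_def sum_distrib_left by (rule sum.cong) (auto simp: Qu)
  have "H * v = scl h v"
  proof -
    have e: "H * us ! j = (\<Sum>i<n. scl (A $$ (i, j)) (us ! i))" if j: "j < n" for j
    proof -
      have hc: "H * us ! j \<in> cols I c" using j by (intro cols_mult uc(1) H(1)) (simp add: n_def)
      have "H * us ! j = H * (Q * us ! j)" using Qu[OF j] by simp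
      also have "\<dots> = Q * (H * us ! j)" using H(2) by (simp add: mult.assoc[symmetric])
      also have "\<dots> = (\<Sum>i<n. scl (tr (star (us ! i) * (H * us ! j))) (us ! i))"
        using proj_of_apply[OF us(1) hc] us(2) by (simp add: n_def)
      also have "\<dots> = (\<Sum>i<n. scl (A $$ (i, j)) (us ! i))"
        by (rule sum.cong) (use j in \<open>auto simp: A_def\<close>)
      finally show ?thesis .
    qed
    have "H * v = (\<Sum>j<n. scl (vec_index w j) (H * us ! j))" by (simp add: v_def sum_distrib_left)
    also have "\<dots> = (\<Sum>j<n. \<Sum>i<n. scl (A $$ (i, j) * vec_index w j) (us ! i))"
      by (rule sum.cong) (auto simp: e scl_sum_right mult.commute)
    also have "\<dots> = (\<Sum>i<n. scl (\<Sum>j<n. A $$ (i, j) * vec_index w j) (us ! i))"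
      by (subst sum.swap) (simp add: scl_sum_left)
    also have "\<dots> = (\<Sum>i<n. scl (h * vec_index w i) (us ! i))"
    proof (rule sum.cong)
      fix i assume "i \<in> {..<n}"
      then have i: "i < n" by simp
      have "vec_index (A *\<^sub>v w) i = (\<Sum>j<n. A $$ (i, j) * vec_index w j)"
        using A w'(1) i by (auto simp: scalar_prod_def atLeast0LessThan)
      then show "scl (\<Sum>j<n. A $$ (i, j) * vec_index w j) (us ! i) = scl (h * vec_index w i) (us ! i)"
        using w' i by simp
    qed simp
    also have "\<dots> = scl h v" by (simp add: v_def scl_sum_right)
    finally show ?thesis .
  qed
  moreover have "v \<noteq> 0"
  proof
    assume v0: "v = 0"
    have "vec_index w i = 0" if i: "i < n" for i
    proof -
      have "tr (star (us ! i) * v) = (\<Sum>j<n. vec_index w j * tr (star (us ! i) * us ! j))"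
        by (simp add: v_def sum_distrib_left tr_sum tr_scl)
      also have "\<dots> = (\<Sum>j<n. if j = i then vec_index w i else 0)"
        by (rule sum.cong) (use us(1) i in \<open>auto simp: col.orthonormal_def n_def\<close>)
      also have "\<dots> = vec_index w i" using i by simp
      finally show ?thesis by (simp add: v0)
    qed
    then show False using w'(1,2) by (metis carrier_vecD eq_vecI index_zero_vec)
  qed
  ultimately show ?thesis using vc Qv by blast
qed

section \<open>Bases adapted to a hermitian matrix and a star algebra commuting with it\<close>

locale star_module =
  fixes I :: "'i set" and c :: 'i and Bs :: "'i fmat list" and H :: "'i fmat"
  assumes I: "finite I"
    and B_corner: "\<And>B. B \<in> set Bs \<Longrightarrow> one_on I * B = B"
    and B_mult: "\<And>B C. B \<in> set Bs \<Longrightarrow> C \<in> set Bs \<Longrightarrow> B * C \<in> cspan (set Bs)"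
    and B_star: "\<And>B. B \<in> set Bs \<Longrightarrow> star B \<in> cspan (set Bs)"
    and B_one: "one_on I \<in> cspan (set Bs)"
    and H_corner: "one_on I * H = H" and H_star: "star H = H"
    and H_comm: "\<And>B. B \<in> set Bs \<Longrightarrow> H * B = B * H"
begin

text \<open>The bandwidth is \<open>length Bs\<close> because the cyclic subspace generated by one eigenvector of \<open>H\<close>
  has at most that dimension.\<close>

definition adapted :: "'i fmat list \<Rightarrow> bool" where
  "adapted us \<longleftrightarrow> col.orthonormal I c us \<and> (\<forall>B\<in>set Bs. B * proj_of us = proj_of us * B) \<and>
     H * proj_of us = proj_of us * H \<and>
     (\<forall>i<length us. \<exists>h. H * us ! i = scl h (us ! i)) \<and>
     (\<forall>B\<in>set Bs. \<forall>i<length us. \<forall>j<length us. int (length Bs) \<le> \<bar>int i - int j\<bar> \<longrightarrow>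
        tr (star (us ! i) * (B * us ! j)) = 0)"

lemma proj_of_append:
  fixes us :: "'j fmat list"
  shows "proj_of (us @ ws) = proj_of us + proj_of ws"
proof -
  have s: "(\<Sum>i<m + n. f i) = (\<Sum>i<m. f i) + (\<Sum>i<n. f (m + i))" for f :: "nat \<Rightarrow> 'j fmat" and m n
    by (induction n) (simp_all add: add.assoc)
  show ?thesis unfolding proj_of_def length_append by (subst s) (simp add: nth_append)
qed

text \<open>An eigenvector \<open>v\<close> of \<open>H\<close> orthogonal to the old vectors
  generates a space that the algebra leaves invariant and on which \<open>H\<close> is scalar.
  Entries between old and new vectors vanish because both spans are invariant, and new vectors have
  positions less than \<open>length Bs\<close> apart, so nothing appears outside the band.\<close>

lemma adapted_extend:
  assumes us: "adapted us" and len: "length us < card I"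
  shows "\<exists>ws. ws \<noteq> [] \<and> adapted (us @ ws)"
proof -
  define K P Q where "K = one_on I" and "P = proj_of us" and "Q = K - P"
  have on: "col.orthonormal I c us" using us by (simp add: adapted_def)
  have PB: "B * P = P * B" if "B \<in> set Bs" for B using us that by (simp add: adapted_def P_def)
  have PH: "H * P = P * H" using us by (simp add: adapted_def P_def)
  have K: "K * K = K" "star K = K" by (simp_all add: K_def one_on_idem[OF I])
  have KP: "K * P = P" using eproj_proj_of(2)[OF on] by (simp add: K_def P_def)
  have P: "P * P = P" "star P = P" using eproj_proj_of(1)[OF on] by (simp_all add: eproj_def P_def)
  have PK: "P * K = P" using KP P K by (metis star_mult)
  have Q: "eproj Q" "K * Q = Q" using K P KP PK by (simp_all add: eproj_def Q_def star_diff algebra_simps)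
  \<comment> \<open>Traces of projections count dimensions, and fewer than \<open>card I\<close>
    vectors leave room.\<close>
  have Q0: "Q \<noteq> 0"
  proof
    assume "Q = 0"
    then have "tr K = tr P" by (simp add: Q_def)
    then have "(of_nat (card I) :: complex) = of_nat (length us)"
      using tr_one_on[OF I] eproj_proj_of(3)[OF on] by (simp add: K_def P_def)
    then show False using len by simp
  qed
  have HK: "K * H = H" "H * K = H" using H_corner H_star K by (simp add: K_def, metis star_mult K_def)
  have HQ: "H * Q = Q * H" using HK PH by (simp add: Q_def algebra_simps)
  obtain v h where v: "v \<in> cols I c" "v \<noteq> 0" "Q * v = v" "H * v = scl h v"
    using eigenvector_in_range[OF I Q(1) _ Q0 _ HQ] Q(2) HK(1) unfolding K_def by blast
  have BK: "B * K = B" if "B \<in> set Bs" for B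
  proof -
    have "star B \<in> cspan (set Bs)" using B_star that by blast
    moreover have "K * C = C" if "C \<in> cspan (set Bs)" for C
      using that by induction (use B_corner in \<open>auto simp: K_def distrib_left\<close>)
    ultimately have "star (K * star B) = star (star B)" by simp
    then show ?thesis using K by (simp add: star_mult)
  qed
  have BQ: "B * Q = Q * B" if "B \<in> set Bs" for B
    using BK[OF that] B_corner[OF that] PB[OF that] by (simp add: Q_def K_def algebra_simps)
  define vs where "vs = map (\<lambda>B. B * v) Bs"
  have vsc: "set vs \<subseteq> cols I c" unfolding vs_def using cols_mult[OF v(1)] B_corner by auto
  obtain ws where ws: "col.orthonormal I c ws" "cspan (set ws) = cspan (set vs)" "length ws \<le> length vs"
    using col.orthonormal_basis_exists[OF vsc] by blast
  define R where "R = proj_of ws"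
  have span_v: "C * v \<in> cspan (set vs)" if "C \<in> cspan (set Bs)" for C
    using that by induction (auto simp: vs_def distrib_right intro: cspan.intros)
  have Kv: "K * v = v" using v(1) by (simp add: cols_def K_def)
  then have vin: "v \<in> cspan (set ws)" using span_v[OF B_one] ws(2) by (simp add: K_def)
  have wne: "ws \<noteq> []"
  proof
    assume "ws = []"
    moreover have "x = 0" if "x \<in> cspan {}" for x :: "'i fmat" using that by induction auto
    ultimately show False using vin v(2) by simp
  qed
  have Hs: "H * x = scl h x" if "x \<in> cspan (set vs)" for x
    using that
  proof induction
    case (cspan_base x)
    then obtain B where B: "B \<in> set Bs" "x = B * v" by (auto simp: vs_def)
    have "H * (B * v) = B * (H * v)" using H_comm[OF B(1)] by (simp add: mult.assoc[symmetric])
    then show ?case using B v(4) by simp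
  qed (auto simp: distrib_left scl_add_right mult.commute)
  have Qs: "Q * x = x" if "x \<in> cspan (set vs)" for x
    using that
  proof induction
    case (cspan_base x)
    then obtain B where B: "B \<in> set Bs" "x = B * v" by (auto simp: vs_def)
    have "Q * (B * v) = B * (Q * v)" using BQ[OF B(1)] by (simp add: mult.assoc[symmetric])
    then show ?case using B v(3) by simp
  qed (auto simp: distrib_left)
  have Bs: "B * x \<in> cspan (set vs)" if "x \<in> cspan (set vs)" "B \<in> set Bs" for x B
    using that(1)
  proof induction
    case (cspan_base x)
    then obtain C where C: "C \<in> set Bs" "x = C * v" by (auto simp: vs_def)
    then show ?case using span_v[OF B_mult[OF that(2) C(1)]] by (simp add: mult.assoc)
  qed (auto simp: distrib_left intro: cspan.intros)
  have Bsp: "C * x \<in> cspan (set vs)" if x: "x \<in> cspan (set vs)" and C: "C \<in> cspan (set Bs)" for x C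
    using C by induction (auto simp: distrib_right intro: cspan.intros Bs[OF x])
  have win: "ws ! i \<in> cspan (set vs)" if "i < length ws" for i using ws(2) that by (metis cspan_base nth_mem)
  have R: "R * R = R" "star R = R" using eproj_proj_of(1)[OF ws(1)] by (simp_all add: eproj_def R_def)
  have CR: "C * R = R * C * R" if "C \<in> cspan (set Bs)" for C
  proof -
    have "C * R = (\<Sum>i<length ws. (C * ws ! i) * star (ws ! i))" by (simp add: R_def proj_of_def sum_distrib_left mult.assoc)
    also have "\<dots> = (\<Sum>i<length ws. R * (C * ws ! i) * star (ws ! i))"
    proof (rule sum.cong)
      fix i assume "i \<in> {..<length ws}"
      then have "C * ws ! i \<in> cspan (set ws)" using Bsp[OF win that] ws(2) by simp
      from proj_of_cspan[OF ws(1) this]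
      show "C * ws ! i * star (ws ! i) = R * (C * ws ! i) * star (ws ! i)" by (simp add: R_def)
    qed simp
    also have "\<dots> = R * C * R" by (simp add: R_def proj_of_def[of ws] sum_distrib_left mult.assoc)
    finally show ?thesis .
  qed
  \<comment> \<open>For an algebra closed under adjoints an invariant subspace is reducing: the
    adjoint of \<open>CR\<close> at \<open>star B\<close> supplies the other half.\<close>
  have BR: "B * R = R * B" if "B \<in> set Bs" for B
  proof -
    have "star (star B * R) = star (R * star B * R)" using CR[OF B_star[OF that]] by simp
    then have "R * B = R * B * R" using R by (simp add: star_mult mult.assoc)
    then show ?thesis using CR[OF cspan_base[OF that]] by simp
  qed
  have HR: "H * R = scl h R"
    using Hs[OF win] by (simp add: R_def proj_of_def sum_distrib_left scl_sum_right mult.assoc[symmetric])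
  then have "star (H * R) = scl (cnj h) R" using R by simp
  then have RH: "R * H = scl (cnj h) R" using R H_star by (simp add: star_mult)
  \<comment> \<open>The eigenvalue is real: evaluate \<open>R * H * R\<close> from either
    side.\<close>
  have hreal: "scl (cnj h) R = scl h R"
  proof -
    have "R * (H * R) = (R * H) * R" by (simp add: mult.assoc)
    then show ?thesis using HR RH R(1) by simp
  qed
  have uw: "star (us ! i) * x = 0" if i: "i < length us" and x: "Q * x = x" for i x
  proof -
    have "P * us ! i = us ! i" using proj_of_nth[OF on i] by (simp add: P_def)
    then have "star (us ! i) = star (us ! i) * P" using P by (metis star_mult)
    then have "star (us ! i) * x = star (us ! i) * (P * (Q * x))" using x by (metis mult.assoc)
    also have "P * (Q * x) = 0" using P PK by (simp add: Q_def mult.assoc[symmetric] right_diff_distrib)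
    finally show ?thesis by simp
  qed
  have wu: "star x * us ! i = 0" if "i < length us" "Q * x = x" for i x
    using uw[OF that] by (metis star_mult star_star star_zero)
  have onw: "col.orthonormal I c (us @ ws)"
    unfolding col.orthonormal_def
  proof (intro conjI allI impI)
    show "set (us @ ws) \<subseteq> cols I c" using on ws(1) by (auto simp: col.orthonormal_def)
    fix i j assume ij: "i < length (us @ ws)" "j < length (us @ ws)"
    have w: "\<And>k. k < length (us @ ws) \<Longrightarrow> \<not> k < length us \<Longrightarrow> Q * ws ! (k - length us) = ws ! (k - length us)"
      by (rule Qs[OF win]) auto
    show "tr (star ((us @ ws) ! j) * (us @ ws) ! i) = (if i = j then 1 else 0)"
    proof (cases "i < length us"; cases "j < length us")
      assume "i < length us" "j < length us"
      then show ?thesis using on by (simp add: nth_append col.orthonormal_def)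
    next
      assume "i < length us" "\<not> j < length us"
      then show ?thesis using wu[OF _ w[OF ij(2)]] by (auto simp: nth_append)
    next
      assume "\<not> i < length us" "j < length us"
      then show ?thesis using uw[OF _ w[OF ij(1)]] by (auto simp: nth_append)
    next
      assume a: "\<not> i < length us" "\<not> j < length us"
      then have "i - length us = j - length us \<longleftrightarrow> i = j" by auto
      then show ?thesis using a ij ws(1) by (simp add: nth_append col.orthonormal_def)
    qed
  qed
  have "adapted (us @ ws)"
    unfolding adapted_def proj_of_append P_def[symmetric] R_def[symmetric]
  proof (intro conjI ballI allI impI)
    show "col.orthonormal I c (us @ ws)" by (rule onw)
    show "B * (P + R) = (P + R) * B" if "B \<in> set Bs" for B
      using PB[OF that] BR[OF that] by (simp add: distrib_left distrib_right)
    show "H * (P + R) = (P + R) * H" using PH HR RH hreal by (simp add: distrib_left distrib_right)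
    show "\<exists>h. H * (us @ ws) ! i = scl h ((us @ ws) ! i)" if "i < length (us @ ws)" for i
    proof (cases "i < length us")
      case True
      then show ?thesis using us by (simp add: adapted_def nth_append)
    next
      case False
      then show ?thesis using Hs[OF win, of "i - length us"] that by (auto simp: nth_append)
    qed
    fix B i j
    assume B: "B \<in> set Bs" and ij: "i < length (us @ ws)" "j < length (us @ ws)"
      and d: "int (length Bs) \<le> \<bar>int i - int j\<bar>"
    have QB: "Q * (B * x) = B * x" if "Q * x = x" for x
      using BQ[OF B] that by (metis mult.assoc)
    show "tr (star ((us @ ws) ! i) * (B * (us @ ws) ! j)) = 0"
    proof (cases "i < length us"; cases "j < length us")
      assume "i < length us" "j < length us"
      then show ?thesis using us B d by (simp add: adapted_def nth_append)
    next
      assume a: "i < length us" "\<not> j < length us"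
      have "Q * ws ! (j - length us) = ws ! (j - length us)" by (rule Qs[OF win]) (use a ij in auto)
      then show ?thesis using uw[OF a(1) QB] a by (simp add: nth_append)
    next
      assume a: "\<not> i < length us" "j < length us"
      have q: "Q * ws ! (i - length us) = ws ! (i - length us)" by (rule Qs[OF win]) (use a ij in auto)
      have "P * us ! j = us ! j" using proj_of_nth[OF on a(2)] by (simp add: P_def)
      then have "B * us ! j = P * (B * us ! j)" using PB[OF B] by (metis mult.assoc)
      moreover have "star (ws ! (i - length us)) * P = 0"
      proof -
        have "P * ws ! (i - length us) = P * Q * ws ! (i - length us)" using q by (simp add: mult.assoc)
        also have "P * Q = 0" using P PK by (simp add: Q_def right_diff_distrib)
        finally have "star (P * ws ! (i - length us)) = 0" by simp
        then show ?thesis using P by (simp add: star_mult)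
      qed
      ultimately have "star (ws ! (i - length us)) * (B * us ! j) = 0" by (metis mult.assoc mult_zero_left)
      then show ?thesis using a by (simp add: nth_append)
    next
      assume a: "\<not> i < length us" "\<not> j < length us"
      have "length ws \<le> length Bs" using ws(3) by (simp add: vs_def)
      then show ?thesis using a ij d by auto
    qed
  qed
  then show ?thesis using wne by blast
qed

lemma adapted_complete: "\<exists>us. adapted us \<and> length us = card I"
proof -
  have le: "length us \<le> card I" if "adapted us" for us
  proof -
    have on: "col.orthonormal I c us" using that by (simp add: adapted_def)
    note e = eproj_proj_of[OF on]
    have "proj_of us * one_on I = proj_of us" using e(1,2) unfolding eproj_def by (metis star_mult star_one_on)
    then have "norm (proj_of us) \<le> norm (one_on I)" using norm_eproj_le[OF e(1), of "one_on I"] by simp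
    then have "(norm (proj_of us))\<^sup>2 \<le> (norm (one_on I))\<^sup>2" by (simp add: power_mono)
    also have "\<dots> = real (card I)" by (rule norm2_one_on[OF I])
    finally have "(norm (proj_of us))\<^sup>2 \<le> real (card I)" .
    moreover have "complex_of_real ((norm (proj_of us))\<^sup>2) = complex_of_real (real (length us))"
      using tr_eproj[OF e(1)] e(3) by simp
    then have "(norm (proj_of us))\<^sup>2 = real (length us)" by (simp only: of_real_eq_iff)
    ultimately show ?thesis by simp
  qed
  have "\<exists>us'. adapted us' \<and> length us' = card I" if "adapted us" for us
    using that
  proof (induction "card I - length us" arbitrary: us rule: less_induct)
    case less
    show ?case
    proof (cases "length us < card I")
      case True
      then obtain ws where "ws \<noteq> []" "adapted (us @ ws)" using adapted_extend less.prems by blast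
      then show ?thesis using less.hyps[of "us @ ws"] True by (cases ws) auto
    next
      case False
      then show ?thesis using le[OF less.prems] less.prems by (intro exI[of _ us]) simp
    qed
  qed
  moreover have "adapted []" by (simp add: adapted_def col.orthonormal_def proj_of_def)
  ultimately show ?thesis by blast
qed

end

section \<open>Diagonal matrices, block diagonalization and the polar decomposition\<close>

definition dgm :: "'i set \<Rightarrow> ('i \<Rightarrow> complex) \<Rightarrow> 'i fmat" where
  "dgm I k = (\<Sum>i\<in>I. scl (k i) (emat i i))"

lemma ent_dgm: "finite I \<Longrightarrow> ent (dgm I k) i j = (if i = j \<and> i \<in> I then k i else 0)"
proof -
  assume I: "finite I"
  have "ent (dgm I k) i j = (\<Sum>l\<in>I. if l = i then (if i = j then k i else 0) else 0)"
    unfolding dgm_def ent_sum by (rule sum.cong) auto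
  then show ?thesis using I by (simp add: sum.delta)
qed

lemma dgm_mult: "finite I \<Longrightarrow> dgm I j * dgm I k = dgm I (\<lambda>i. j i * k i)"
proof (rule fmat_eqI)
  fix a b
  assume I: "finite I"
  have ix: "idx (dgm I j) \<subseteq> I" using I by (auto simp: idx_def ent_dgm split: if_splits)
  have "ent (dgm I j * dgm I k) a b = (\<Sum>l\<in>I. if l = a then (if a = b then j a * k a else 0) else 0)"
    unfolding ent_times[OF I disjI1[OF ix]] by (rule sum.cong) (auto simp: ent_dgm[OF I])
  then show "ent (dgm I j * dgm I k) a b = ent (dgm I (\<lambda>i. j i * k i)) a b" using I by (simp add: sum.delta ent_dgm)
qed

lemma star_dgm: "star (dgm I k) = dgm I (\<lambda>i. cnj (k i))"
  by (simp add: dgm_def star_sum)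

lemma tr_dgm: "tr (dgm I k) = (\<Sum>i\<in>I. k i)"
  by (simp add: dgm_def tr_sum tr_scl tr_emat)

lemma dgm_one: "dgm I (\<lambda>i. 1) = one_on I"
  by (simp add: dgm_def one_on_def)

lemma dgm_diff: "dgm I (\<lambda>i. j i - k i) = dgm I j - dgm I k"
  by (simp add: dgm_def scl_diff_left sum_subtractf)

lemma dgm_cong: "(\<And>i. i \<in> I \<Longrightarrow> j i = k i) \<Longrightarrow> dgm I j = dgm I k"
  by (simp add: dgm_def)

context star_module
begin

text \<open>\<open>g\<close> lists \<open>I\<close> in the order of the adapted vectors, so the band
  is measured through \<open>g\<close>: the unitary \<open>U\<close> takes the basis vector at
  \<open>i\<close> to the adapted vector number \<open>g i\<close>.\<close>

lemma block_diagonalization: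
  assumes c: "c \<in> I" and g: "bij_betw g I {..<card I}"
  shows "\<exists>U h. star U * U = one_on I \<and> U * star U = one_on I \<and> one_on I * U = U \<and> U * one_on I = U \<and>
    star U * H * U = dgm I h \<and>
    (\<forall>B\<in>cspan (set Bs). \<forall>i\<in>I. \<forall>j\<in>I. int (length Bs) \<le> \<bar>int (g i) - int (g j)\<bar> \<longrightarrow> ent (star U * B * U) i j = 0)"
proof -
  obtain us where us: "adapted us" "length us = card I" using adapted_complete by blast
  have on: "col.orthonormal I c us" using us(1) by (simp add: adapted_def)
  note oc = orthonormal_cols[OF on, unfolded us(2)]
  have gI: "g i < card I" if "i \<in> I" for i using bij_betwE[OF g] that by auto
  have ginj: "g i = g j \<longleftrightarrow> i = j" if "i \<in> I" "j \<in> I" for i j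
    using g that by (meson bij_betw_def inj_on_eq_iff)
  define u where "u i = us ! g i" for i
  have u1: "one_on I * u i = u i" "u i * emat c c = u i" if "i \<in> I" for i
    using oc(2,3)[OF gI[OF that]] by (simp_all add: u_def)
  have uu: "star (u j) * u i = (if i = j then emat c c else 0)" if "i \<in> I" "j \<in> I" for i j
    using oc(4)[OF gI[OF that(1)] gI[OF that(2)]] that by (simp add: u_def ginj)
  have su: "emat c c * star (u i) = star (u i)" if "i \<in> I" for i
    using arg_cong[OF u1(2)[OF that], of star] by (simp add: star_mult)
  \<comment> \<open>The vectors are stored in column \<open>c\<close>; \<open>emat c i\<close> moves
    each to the column of its own index.\<close>
  define U where "U = (\<Sum>i\<in>I. u i * emat c i)"
  have sU: "star U = (\<Sum>i\<in>I. emat i c * star (u i))" by (simp add: U_def star_sum star_mult)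
  have "star U * U = (\<Sum>j\<in>I. \<Sum>i\<in>I. emat j c * (star (u j) * u i) * emat c i)"
    unfolding sU unfolding U_def by (simp add: sum_product mult.assoc)
  also have "\<dots> = (\<Sum>j\<in>I. \<Sum>i\<in>I. if i = j then emat j j else 0)"
    by (intro sum.cong) (auto simp: uu emat_times)
  also have "\<dots> = one_on I" using I by (simp add: one_on_def)
  finally have UU: "star U * U = one_on I" .
  have KU: "one_on I * U = U" unfolding U_def sum_distrib_left
    by (rule sum.cong) (auto simp: u1 mult.assoc[symmetric])
  have UK: "U * one_on I = U"
  proof -
    have "emat c i * one_on I = emat c i" if "i \<in> I" for i
      using that by (intro fmat_eqI) (auto simp: ent_one_on_right[OF I])
    then show ?thesis unfolding U_def sum_distrib_right by (intro sum.cong) (auto simp: mult.assoc)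
  qed
  \<comment> \<open>An isometry between spaces of equal finite dimension is onto; the dimensions are
    compared as traces.\<close>
  have "U * star U = one_on I"
  proof (rule eproj_eqI[symmetric])
    show "eproj (one_on I)" by (rule eproj_one_on[OF I])
    have "U * star U * (U * star U) = U * (star U * U) * star U" by (simp only: mult.assoc)
    then show "eproj (U * star U)" by (simp add: eproj_def star_mult UU UK)
    show "one_on I * (U * star U) = U * star U" by (simp add: mult.assoc[symmetric] KU)
    show "tr (one_on I) = tr (U * star U)" by (simp add: UU[symmetric] tr_comm)
  qed
  have entU: "ent (star U * B * U) j i = tr (star (u j) * (B * u i))" if "i \<in> I" "j \<in> I" for B i j
  proof -
    have "emat j j * star U = emat j c * star (u j)"
      unfolding sU sum_distrib_left using that I
      by (subst sum.cong[OF refl, of _ _ "\<lambda>i. if i = j then emat j c * star (u j) else 0"])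
         (auto simp: mult.assoc[symmetric] emat_times)
    moreover have "U * emat i i = u i * emat c i"
      unfolding U_def sum_distrib_right using that I
      by (subst sum.cong[OF refl, of _ _ "\<lambda>k. if k = i then u i * emat c i else 0"])
         (auto simp: mult.assoc emat_times)
    ultimately have e: "emat j j * (star U * B * U) * emat i i = emat j c * (star (u j) * (B * u i)) * emat c i"
      by (metis mult.assoc)
    have "ent (star U * B * U) j i = ent (emat j j * (star U * B * U) * emat i i) j i"
      by (simp add: emat_sandwich)
    also have "\<dots> = ent (star (u j) * (B * u i)) c c" unfolding e by (simp add: emat_sandwich)
    also have "\<dots> = tr (star (u j) * (B * u i))"
    proof -
      have "star (u j) * (B * u i) = emat c c * (star (u j) * (B * u i)) * emat c c"
        using su[OF that(2)] u1(2)[OF that(1)] by (metis mult.assoc)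
      then have "star (u j) * (B * u i) = scl (ent (star (u j) * (B * u i)) c c) (emat c c)" by (simp add: emat_sandwich)
      from arg_cong[OF this, of tr] show ?thesis by (simp add: tr_scl tr_emat)
    qed
    finally show ?thesis .
  qed
  have "\<exists>h. \<forall>i\<in>I. H * u i = scl (h i) (u i)"
  proof -
    have "\<forall>i<length us. \<exists>h. H * us ! i = scl h (us ! i)" using us(1) unfolding adapted_def by (elim conjE)
    then obtain h where "\<And>i. i < length us \<Longrightarrow> H * us ! i = scl (h i) (us ! i)" by metis
    then show ?thesis using gI us(2) by (intro exI[of _ "\<lambda>i. h (g i)"]) (simp add: u_def)
  qed
  then obtain h where h: "\<And>i. i \<in> I \<Longrightarrow> H * u i = scl (h i) (u i)" by blast
  have corner: "ent (star U * B * U) i j = 0" if "i \<notin> I \<or> j \<notin> I" for B i j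
  proof -
    have "star U * B * U = one_on I * (star U * B * U) * one_on I"
    proof -
      have "one_on I * star U = star U" using arg_cong[OF UK, of star] by (simp add: star_mult)
      moreover have "one_on I * (star U * B * U) * one_on I = (one_on I * star U) * B * (U * one_on I)"
        by (simp only: mult.assoc)
      ultimately show ?thesis by (simp only: UK)
    qed
    then have "ent (star U * B * U) i j = ent (one_on I * (star U * B * U) * one_on I) i j" by simp
    then show ?thesis using that by (auto simp: ent_one_on_right[OF I] ent_one_on_left[OF I])
  qed
  have "star U * H * U = dgm I h"
  proof (rule fmat_eqI)
    fix i j
    show "ent (star U * H * U) i j = ent (dgm I h) i j"
      using corner[of i j H] entU[of j i H] uu[of j i] h[of j]
      by (cases "i \<in> I"; cases "j \<in> I") (auto simp: ent_dgm[OF I] tr_scl tr_emat)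
  qed
  moreover have "ent (star U * B * U) i j = 0"
    if "B \<in> cspan (set Bs)" "i \<in> I" "j \<in> I" "int (length Bs) \<le> \<bar>int (g i) - int (g j)\<bar>" for B i j
    using that(1)
  proof induction
    case (cspan_base B)
    have "tr (star (us ! g i) * (B * us ! g j)) = 0"
      using us cspan_base that(4) gI[OF that(2)] gI[OF that(3)] unfolding adapted_def by simp
    then show ?case using entU[OF that(3,2)] by (simp add: u_def)
  qed (simp_all add: distrib_left distrib_right)
  ultimately show ?thesis using UU KU UK \<open>U * star U = one_on I\<close> by blast
qed

end

text \<open>With only the scalars as algebra, block diagonalization is the spectral theorem for
  \<open>H\<close>, in which form the polar decomposition uses it.\<close>

lemma star_module_one:
  assumes "finite I" "one_on I * H = H" "star H = H"
  shows "star_module I [one_on I] H"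
proof
  have "H * one_on I = H" using assms(2,3) by (metis star_mult star_one_on)
  then show "H * B = B * H" if "B \<in> set [one_on I]" for B using that assms(2) by simp
qed (use assms in \<open>auto simp: one_on_idem intro: cspan_base\<close>)

lemma bij_betw_card: "finite I \<Longrightarrow> \<exists>g. bij_betw g I {..<card I}"
  using ex_bij_betw_finite_nat[of I] by (simp add: atLeast0LessThan)

text \<open>The partial isometry of the polar decomposition of \<open>T\<close> is completed on the
  orthogonal complements, where \<open>card I \<le> card J\<close> leaves enough room. With
  \<open>G\<close> the sign of \<open>star T * T - one_on I\<close>, the error reduces to the scalar
  inequality that \<open>(s - 1)\<^sup>2\<close> is at most the modulus of
  \<open>s\<^sup>2 - 1\<close> for \<open>s \<ge> 0\<close>. An estimate through a trace suits
  columns that are nearly isometric in the 2-norm only.\<close>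

lemma polar_isometry:
  fixes T :: "'i fmat"
  assumes I: "finite I" "I \<noteq> {}" and J: "finite J" and card: "card I \<le> card J"
    and T: "one_on J * T = T" "T * one_on I = T"
  shows "\<exists>W G. one_on J * W = W \<and> star W * W = one_on I \<and> opb 1 G \<and>
    (norm (T - W))\<^sup>2 \<le> Re (tr (G * (star T * T - one_on I)))"
proof -
  obtain c where c: "c \<in> I" using I(2) by blast
  obtain g where g: "bij_betw g I {..<card I}" using bij_betw_card[OF I(1)] by blast
  let ?H = "star T * T"
  have K0: "one_on I * star T = star T" using arg_cong[OF T(2), of star] by (simp add: star_mult)
  have Hc: "one_on I * ?H = ?H" by (simp add: mult.assoc[symmetric] K0)
  interpret sm: star_module I c "[one_on I]" ?H
    by (rule star_module_one) (use I Hc in \<open>auto simp: star_mult\<close>)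
  obtain U h where U: "star U * U = one_on I" "U * star U = one_on I" "one_on I * U = U" "U * one_on I = U"
    "star U * ?H * U = dgm I h"
    using sm.block_diagonalization[OF c g] by blast
  have KU': "one_on I * star U = star U" using arg_cong[OF U(4), of star] by (simp add: star_mult)
  have UK': "star U * one_on I = star U" using arg_cong[OF U(3), of star] by (simp add: star_mult)
  define t where "t i = Re (h i)" for i
  have t0: "t i \<ge> 0" and ht: "h i = complex_of_real (t i)" if i: "i \<in> I" for i
  proof -
    have "h i = ent (star U * ?H * U) i i" unfolding U(5) using i by (simp add: ent_dgm I)
    also have "star U * ?H * U = star (T * U) * (T * U)" by (simp add: star_mult mult.assoc)
    also have "ent (star (T * U) * (T * U)) i i = tr (star (T * U * emat i i) * (T * U * emat i i))"
    proof -
      have "star (T * U * emat i i) * (T * U * emat i i) = emat i i * (star (T * U) * (T * U)) * emat i i"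
        by (simp add: star_mult mult.assoc)
      then show ?thesis by (simp add: emat_sandwich tr_scl tr_emat)
    qed
    finally have "h i = complex_of_real ((norm (T * U * emat i i))\<^sup>2)" by (simp add: tr_star_self)
    then show "t i \<ge> 0" "h i = complex_of_real (t i)" by (simp_all add: t_def)
  qed
  \<comment> \<open>\<open>D k\<close> is the functional calculus of \<open>star T * T\<close>, with
    the value \<open>k i\<close> at the eigenvalue \<open>t i\<close>.\<close>
  define D where "D k = U * dgm I k * star U" for k
  have DD: "D j * D k = D (\<lambda>i. j i * k i)" for j k
  proof -
    have "D j * D k = U * (dgm I j * (star U * U) * dgm I k) * star U" by (simp only: D_def mult.assoc)
    moreover have "dgm I j * one_on I = dgm I j" by (simp add: dgm_one[symmetric] dgm_mult[OF I(1)])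
    ultimately show ?thesis by (simp add: U(1) dgm_mult[OF I(1)] D_def)
  qed
  have Ds: "star (D k) = D (\<lambda>i. cnj (k i))" for k by (simp add: D_def star_mult star_dgm mult.assoc)
  have Dt: "tr (D k) = (\<Sum>i\<in>I. k i)" for k
  proof -
    have "tr (D k) = tr (star U * U * dgm I k)" unfolding D_def by (subst tr_comm) (simp add: mult.assoc)
    also have "star U * U * dgm I k = dgm I k" by (simp add: U(1) dgm_one[symmetric] dgm_mult[OF I(1)])
    finally show ?thesis by (simp add: tr_dgm)
  qed
  have D1: "D (\<lambda>i. 1) = one_on I" by (simp add: D_def dgm_one U)
  have Dc: "D j = D k" if "\<And>i. i \<in> I \<Longrightarrow> j i = k i" for j k unfolding D_def using dgm_cong[of I j k] that by simp
  have Dm: "D (\<lambda>i. j i - k i) = D j - D k" for j k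
    by (simp add: D_def dgm_diff left_diff_distrib right_diff_distrib)
  have DH: "?H = D (\<lambda>i. complex_of_real (t i))"
  proof -
    have "?H = (U * star U) * ?H * (U * star U)" using Hc T(2) by (simp add: U(2) mult.assoc)
    also have "\<dots> = U * (star U * ?H * U) * star U" by (simp only: mult.assoc)
    also have "\<dots> = D h" by (simp add: U(5) D_def)
    finally show ?thesis using Dc[of h] ht by simp
  qed
  \<comment> \<open>\<open>G0\<close> inverts the modulus of \<open>T\<close> off the kernel and is
    0 on it, \<open>S\<close> is the modulus, and \<open>E0\<close> projects onto the orthogonal
    complement of the kernel.\<close>
  define G0 where "G0 = D (\<lambda>i. if t i = 0 then 0 else complex_of_real (1 / sqrt (t i)))"
  define S where "S = D (\<lambda>i. complex_of_real (sqrt (t i)))"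
  define E0 where "E0 = D (\<lambda>i. if t i = 0 then 0 else 1)"
  define W0 where "W0 = T * G0"
  have E0: "eproj E0"
    unfolding eproj_def E0_def DD Ds by (auto intro!: Dc)
  have W0W0: "star W0 * W0 = E0"
  proof -
    have "star W0 * W0 = star G0 * (?H * G0)" by (simp add: W0_def star_mult mult.assoc)
    also have "\<dots> = E0" unfolding G0_def DH Ds DD E0_def
      by (rule Dc) (use t0 in \<open>auto simp flip: of_real_mult\<close>)
    finally show ?thesis .
  qed
  have W0E0: "W0 * E0 = W0"
    unfolding W0_def mult.assoc G0_def E0_def DD by (rule arg_cong[where f = "\<lambda>x. T * x"], rule Dc) auto
  have W0T: "star W0 * T = S"
  proof -
    have "star W0 * T = star G0 * ?H" by (simp add: W0_def star_mult mult.assoc)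
    also have "\<dots> = S" unfolding G0_def DH Ds DD S_def
    proof (rule Dc)
      fix i assume "i \<in> I"
      then have "t i / sqrt (t i) = sqrt (t i)" using t0 real_div_sqrt by blast
      from arg_cong[OF this, of complex_of_real]
      show "cnj (if t i = 0 then 0 else complex_of_real (1 / sqrt (t i))) * complex_of_real (t i) = complex_of_real (sqrt (t i))"
        by simp
    qed
    finally show ?thesis .
  qed
  have TW0: "T = W0 * S"
  proof -
    have e: "W0 * S = T * E0" unfolding W0_def G0_def S_def E0_def mult.assoc DD
      by (rule arg_cong[where f = "\<lambda>x. T * x"], rule Dc) (use t0 in \<open>auto simp flip: of_real_mult\<close>)
    have "star (T - T * E0) * (T - T * E0) = ?H - ?H * E0 - (star E0 * ?H - star E0 * ?H * E0)"
      by (simp add: star_diff star_mult algebra_simps)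
    also have "\<dots> = D (\<lambda>i. 0)" unfolding DH E0_def Ds DD Dm[symmetric] by (rule Dc) auto
    also have "\<dots> = 0" by (simp add: D_def dgm_def)
    finally have "complex_of_real ((norm (T - T * E0))\<^sup>2) = 0" unfolding tr_star_self[symmetric] by simp
    then show ?thesis using e by simp
  qed
  define F0 where "F0 = W0 * star W0"
  have F0W0: "F0 * W0 = W0" by (simp add: F0_def mult.assoc W0W0 W0E0)
  have F0: "eproj F0" unfolding eproj_def
    by (simp add: F0_def star_mult) (metis F0W0 F0_def mult.assoc)
  have JW0: "one_on J * W0 = W0" by (simp add: W0_def mult.assoc[symmetric] T(1))
  have JF0: "one_on J * F0 = F0" by (simp add: F0_def mult.assoc[symmetric] JW0)
  have F0J: "F0 * one_on J = F0" using JF0 F0 unfolding eproj_def by (metis star_mult star_one_on)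
  have IE0: "one_on I * E0 = E0" "E0 * one_on I = E0" unfolding D1[symmetric] E0_def DD by (auto intro: Dc)
  have compI: "eproj (one_on I - E0)" "one_on I * (one_on I - E0) = one_on I - E0"
    using E0 IE0 by (simp_all add: eproj_def algebra_simps one_on_idem[OF I(1)] star_diff)
  have compJ: "eproj (one_on J - F0)" "one_on J * (one_on J - F0) = one_on J - F0"
    using F0 JF0 F0J by (simp_all add: eproj_def algebra_simps one_on_idem[OF J] star_diff)
  obtain es where es: "col.orthonormal I c es" "proj_of es = one_on I - E0"
    using eproj_basis[OF I(1) compI] by blast
  obtain fs where fs: "col.orthonormal J c fs" "proj_of fs = one_on J - F0"
    using eproj_basis[OF J compJ] by blast
  \<comment> \<open>Both complements fall short of their spaces by the same rank, so the order of
    the dimensions is inherited.\<close>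
  have len: "length es \<le> length fs"
  proof -
    have "tr F0 = tr E0" unfolding F0_def W0W0[symmetric] by (rule tr_comm)
    then have "complex_of_real (real (length fs) - real (card J)) = complex_of_real (real (length es) - real (card I))"
    proof -
      have "(of_nat (length es) :: complex) = of_nat (card I) - tr E0"
        using eproj_proj_of(3)[OF es(1)] es(2) by (simp add: tr_diff tr_one_on I)
      moreover have "(of_nat (length fs) :: complex) = of_nat (card J) - tr E0"
        using eproj_proj_of(3)[OF fs(1)] fs(2) \<open>tr F0 = tr E0\<close> by (simp add: tr_diff tr_one_on J)
      ultimately show ?thesis by simp
    qed
    then have "real (length fs) - real (card J) = real (length es) - real (card I)" using of_real_eq_iff by blast
    then show ?thesis using card by linarith
  qed
  define W1 where "W1 = (\<Sum>i<length es. fs ! i * star (es ! i))"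
  define W where "W = W0 + W1"
  have ee: "E0 * es ! i = 0" if "i < length es" for i
  proof -
    have "(one_on I - E0) * es ! i = es ! i" using proj_of_nth[OF es(1) that] es(2) by simp
    then show ?thesis using orthonormal_cols(2)[OF es(1) that] by (simp add: left_diff_distrib)
  qed
  have ff: "F0 * fs ! i = 0" if "i < length es" for i
  proof -
    have l: "i < length fs" using that len by simp
    have "(one_on J - F0) * fs ! i = fs ! i" using proj_of_nth[OF fs(1) l] fs(2) by simp
    then show ?thesis using orthonormal_cols(2)[OF fs(1) l] by (simp add: left_diff_distrib)
  qed
  have W1W1: "star W1 * W1 = one_on I - E0"
  proof -
    have "star W1 * W1 = (\<Sum>i<length es. \<Sum>j<length es. es ! i * (star (fs ! i) * fs ! j) * star (es ! j))"
      by (simp add: W1_def star_sum star_mult sum_product mult.assoc)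
    also have "\<dots> = (\<Sum>i<length es. \<Sum>j<length es. if j = i then es ! i * star (es ! i) else 0)"
    proof (intro sum.cong refl)
      fix i j assume "i \<in> {..<length es}" "j \<in> {..<length es}"
      then have l: "i < length es" "j < length es" "i < length fs" "j < length fs" using len by auto
      show "es ! i * (star (fs ! i) * fs ! j) * star (es ! j) = (if j = i then es ! i * star (es ! i) else 0)"
        using orthonormal_cols(4)[OF fs(1) l(4,3)] orthonormal_cols(3)[OF es(1) l(1)] by auto
    qed
    also have "\<dots> = proj_of es" by (simp add: proj_of_def)
    finally show ?thesis using es(2) by simp
  qed
  have W1T: "star W1 * W0 = 0"
  proof -
    have "star (fs ! i) * W0 = 0" if "i < length es" for i
    proof -
      have "star (fs ! i) * W0 = star (fs ! i) * (star F0 * W0)" using F0 F0W0 by (simp add: eproj_def)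
      also have "\<dots> = star (F0 * fs ! i) * W0" by (simp add: star_mult mult.assoc)
      finally show ?thesis using ff[OF that] by simp
    qed
    then show ?thesis by (simp add: W1_def star_sum star_mult sum_distrib_right mult.assoc)
  qed
  then have W0W1: "star W0 * W1 = 0" by (metis star_mult star_star star_zero)
  have WW: "star W * W = one_on I"
    by (simp add: W_def star_add distrib_left distrib_right W0W0 W1W1 W1T W0W1)
  have JW: "one_on J * W = W"
  proof -
    have "one_on J * fs ! i = fs ! i" if "i < length es" for i using orthonormal_cols(2)[OF fs(1)] that len by simp
    then have "one_on J * W1 = W1" unfolding W1_def sum_distrib_left
      by (intro sum.cong) (auto simp: mult.assoc[symmetric])
    then show ?thesis by (simp add: W_def distrib_left JW0)
  qed
  have WT: "star W * T = S"
  proof -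
    have "star W1 * T = 0" by (subst TW0) (simp add: mult.assoc[symmetric] W1T)
    then show ?thesis by (simp add: W_def star_add distrib_right W0T)
  qed
  \<comment> \<open>Since \<open>sgn 0 = 0\<close>, this is in general only a partial isometry,
    which is enough for \<open>opb 1 G\<close>.\<close>
  define G where "G = D (\<lambda>i. complex_of_real (sgn (t i - 1)))"
  have "opb 1 G"
  proof (rule opb_partial_isometry)
    show "eproj (star G * G)" unfolding eproj_def G_def Ds DD
      by (auto intro!: Dc simp: sgn_if)
  qed
  moreover have "(norm (T - W))\<^sup>2 \<le> Re (tr (G * (?H - one_on I)))"
  proof -
    have TW: "star T * W = S"
      using arg_cong[OF WT, of star] by (simp add: star_mult S_def Ds)
    have "star (T - W) * (T - W) = ?H - S - (S - one_on I)"
      by (simp add: star_diff algebra_simps WT TW WW)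
    also have "\<dots> = D (\<lambda>i. complex_of_real ((sqrt (t i) - 1)\<^sup>2))"
      unfolding DH S_def D1[symmetric] Dm[symmetric]
    proof (rule Dc)
      fix i assume "i \<in> I"
      then have "(sqrt (t i) - 1)\<^sup>2 = t i - sqrt (t i) - (sqrt (t i) - 1)" using t0 by (simp add: power2_diff)
      from arg_cong[OF this, of complex_of_real]
      show "complex_of_real (t i) - complex_of_real (sqrt (t i)) - (complex_of_real (sqrt (t i)) - 1) =
        complex_of_real ((sqrt (t i) - 1)\<^sup>2)" by simp
    qed
    finally have "(norm (T - W))\<^sup>2 = (\<Sum>i\<in>I. (sqrt (t i) - 1)\<^sup>2)"
      unfolding norm2_tr by (simp add: Dt)
    also have "\<dots> \<le> (\<Sum>i\<in>I. sgn (t i - 1) * (t i - 1))"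
    proof (rule sum_mono)
      fix i assume "i \<in> I"
      then have t: "t i \<ge> 0" by (rule t0)
      have "0 \<le> sqrt (t i)" using t by simp
      then have le: "\<bar>sqrt (t i) - 1\<bar> \<le> \<bar>sqrt (t i) + 1\<bar>" by linarith
      have "(sqrt (t i) - 1)\<^sup>2 \<le> \<bar>sqrt (t i) - 1\<bar> * \<bar>sqrt (t i) + 1\<bar>"
        unfolding power2_eq_square abs_mult_self_eq[symmetric, of "sqrt (t i) - 1"]
        by (intro mult_left_mono le) auto
      also have "\<dots> = \<bar>t i - 1\<bar>"
      proof -
        have "(sqrt (t i) - 1) * (sqrt (t i) + 1) = t i - 1" using t by (simp add: algebra_simps)
        then show ?thesis by (metis abs_mult)
      qed
      also have "\<dots> = sgn (t i - 1) * (t i - 1)" by (simp add: abs_sgn mult.commute)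
      finally show "(sqrt (t i) - 1)\<^sup>2 \<le> sgn (t i - 1) * (t i - 1)" .
    qed
    also have "\<dots> = Re (tr (G * (?H - one_on I)))"
      unfolding DH D1[symmetric] Dm[symmetric] G_def DD Dt by (simp flip: of_real_diff of_real_mult)
    finally show ?thesis .
  qed
  ultimately show ?thesis using WW JW by blast
qed

section \<open>Approximate intertwiners into the regular representation\<close>

text \<open>A crude substitute for the operator norm of matrices over the regular representation: it
  bounds \<open>tens B k\<close> for every projection \<open>k\<close>, hence uniformly in the size
  of the microstates.\<close>

definition norm1 :: "'i fmat \<Rightarrow> real" where
  "norm1 B = (\<Sum>i\<in>idx B. \<Sum>j\<in>idx B. cmod (ent B i j))"

lemma norm1_nonneg: "0 \<le> norm1 B"
  by (simp add: norm1_def sum_nonneg)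

lemma fmat_expansion: "B = (\<Sum>i\<in>idx B. \<Sum>j\<in>idx B. scl (ent B i j) (emat i j))"
proof -
  have "A = (\<Sum>i\<in>I. \<Sum>j\<in>I. scl (ent A i j) (emat i j))" if I: "finite I" "idx A \<subseteq> I" for A :: "'i fmat" and I
  proof (rule fmat_eqI)
    fix a b
    have "(\<Sum>i\<in>I. \<Sum>j\<in>I. ent (scl (ent A i j) (emat i j)) a b) = (\<Sum>i\<in>I. \<Sum>j\<in>I. if j = b then (if i = a then ent A a b else 0) else 0)"
      by (intro sum.cong) auto
    also have "\<dots> = (\<Sum>i\<in>I. if i = a then (if b \<in> I then ent A a b else 0) else 0)"
      using I(1) by (intro sum.cong) (auto simp: sum.delta)
    also have "\<dots> = (if a \<in> I \<and> b \<in> I then ent A a b else 0)" using I(1) by (simp add: sum.delta)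
    also have "\<dots> = ent A a b" using I(2) ent_idx[of A a b] by auto
    finally show "ent A a b = ent (\<Sum>i\<in>I. \<Sum>j\<in>I. scl (ent A i j) (emat i j)) a b" by simp
  qed
  from this[of "idx B" B] show ?thesis by simp
qed

lemma opb_tens:
  assumes k: "eproj k" shows "opb (norm1 B) (tens B k)"
proof -
  have "opb 1 (tens (emat i j) k)" for i j
    by (rule opb_partial_isometry) (use k in \<open>simp add: eproj_def tens_star tens_mult emat_times\<close>)
  then have "opb (norm1 B) (\<Sum>i\<in>idx B. \<Sum>j\<in>idx B. scl (ent B i j) (tens (emat i j) k))"
    unfolding norm1_def by (intro opb_sum opb_scl[where c = 1, simplified])
  also have "(\<Sum>i\<in>idx B. \<Sum>j\<in>idx B. scl (ent B i j) (tens (emat i j) k)) = tens B k"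
    by (subst (5) fmat_expansion) (simp add: tens_sum_left tens_scl_left)
  finally show ?thesis .
qed

lemma norm_column_combination:
  assumes "finite I"
  shows "(norm (\<Sum>k\<in>I. scl (f k) (emat k z)))\<^sup>2 = (\<Sum>k\<in>I. (cmod (f k))\<^sup>2)"
proof -
  have "star (\<Sum>k\<in>I. scl (f k) (emat k z)) * (\<Sum>k\<in>I. scl (f k) (emat k z)) =
      (\<Sum>j\<in>I. \<Sum>k\<in>I. scl (cnj (f j) * f k) (emat z j * emat k z))"
    by (simp add: star_sum sum_product mult.commute)
  also have "\<dots> = (\<Sum>j\<in>I. \<Sum>k\<in>I. if k = j then scl (f j * cnj (f j)) (emat z z) else 0)"
    by (intro sum.cong) (auto simp: emat_times mult.commute)
  also have "\<dots> = (\<Sum>j\<in>I. scl (complex_of_real ((cmod (f j))\<^sup>2)) (emat z z))"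
    using assms by (simp add: complex_norm_square[symmetric] del: of_real_power)
  finally have "complex_of_real ((norm (\<Sum>k\<in>I. scl (f k) (emat k z)))\<^sup>2) = complex_of_real (\<Sum>j\<in>I. (cmod (f j))\<^sup>2)"
    unfolding tr_star_self[symmetric] by (simp add: tr_sum tr_scl tr_emat)
  then show ?thesis using of_real_eq_iff by blast
qed

text \<open>At a matrix with a single nonzero column, \<open>opb\<close> is the bound for
  vectors.\<close>

lemma opb_column:
  assumes y: "opb c y" and I: "finite I" "idx y \<subseteq> I"
  shows "(\<Sum>i\<in>I. (cmod (\<Sum>k\<in>I. ent y i k * f k))\<^sup>2) \<le> c\<^sup>2 * (\<Sum>k\<in>I. (cmod (f k))\<^sup>2)"
proof -
  have e: "y * (\<Sum>k\<in>I. scl (f k) (emat k z)) = (\<Sum>i\<in>I. scl (\<Sum>k\<in>I. ent y i k * f k) (emat i z))" for z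
  proof (rule fmat_eqI)
    fix a b
    have "ent (y * (\<Sum>k\<in>I. scl (f k) (emat k z))) a b = (\<Sum>k\<in>I. if b = z then ent y a k * f k else 0)"
      by (simp add: sum_distrib_left ent_emat_right) (rule sum.cong, auto)
    moreover have "(\<Sum>i\<in>I. ent (scl (\<Sum>k\<in>I. ent y i k * f k) (emat i z)) a b) =
        (\<Sum>i\<in>I. if i = a then (if b = z then \<Sum>k\<in>I. ent y a k * f k else 0) else 0)"
      by (rule sum.cong) auto
    moreover have "ent y a k = 0" if "a \<notin> I" for k using that I(2) ent_idx(1)[of y a k] by auto
    ultimately show "ent (y * (\<Sum>k\<in>I. scl (f k) (emat k z))) a b = ent (\<Sum>i\<in>I. scl (\<Sum>k\<in>I. ent y i k * f k) (emat i z)) a b"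
      using I(1) by (auto simp: sum.delta)
  qed
  \<comment> \<open>The position of the column is immaterial, hence
    \<open>undefined\<close>.\<close>
  have "(norm (y * (\<Sum>k\<in>I. scl (f k) (emat k undefined))))\<^sup>2 \<le> (c * norm (\<Sum>k\<in>I. scl (f k) (emat k undefined)))\<^sup>2"
    by (rule power_mono[OF opbD(2)[OF y]]) simp
  then show ?thesis unfolding e power_mult_distrib norm_column_combination[OF I(1)] .
qed

lemma sum_singleton_times: "(\<Sum>t\<in>{a} \<times> S. f t) = (\<Sum>k\<in>S. f (a, k))"
  by (rule sum.reindex_cong[of "Pair a"]) (auto simp: inj_on_def)

text \<open>The matrices \<open>Z\<close> to be tested are indexed by pairs and need not be tensors,
  so the bound for \<open>y\<close> is carried over to each of their columns separately.\<close>

lemma opb_tens_emat: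
  assumes y: "opb c y"
  shows "opb c (tens (emat a a) y)"
  unfolding opb_def
proof (intro conjI allI)
  show c0: "0 \<le> c" using y by (rule opbD)
  fix Z
  define J where "J = {a} \<times> idx y \<union> idx Z"
  have J: "finite J" "idx Z \<subseteq> J" by (auto simp: J_def)
  have sub: "{a} \<times> idx y \<subseteq> J" by (auto simp: J_def)
  have it: "idx (tens (emat a a) y) \<subseteq> {a} \<times> idx y" using idx_tens[of "emat a a" y] idx_emat[of a a] by auto
  have eT: "ent (tens (emat a a) y * Z) (x, i) b = (if x = a then \<Sum>k\<in>idx y. ent y i k * ent Z (a, k) b else 0)" for x i b
  proof -
    have "ent (tens (emat a a) y * Z) (x, i) b = (\<Sum>t\<in>{a} \<times> idx y. ent (tens (emat a a) y) (x, i) t * ent Z t b)"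
      by (rule ent_times) (use it in auto)
    also have "\<dots> = (\<Sum>k\<in>idx y. ent (tens (emat a a) y) (x, i) (a, k) * ent Z (a, k) b)"
      by (rule sum_singleton_times)
    finally show ?thesis by simp
  qed
  have iT: "idx (tens (emat a a) y * Z) \<subseteq> J"
  proof
    fix t assume "t \<in> idx (tens (emat a a) y * Z)"
    then obtain s where s: "ent (tens (emat a a) y * Z) s t \<noteq> 0 \<or> ent (tens (emat a a) y * Z) t s \<noteq> 0" by (auto simp: idx_def)
    have z: "ent (tens (emat a a) y * Z) s t \<noteq> 0 \<Longrightarrow> s \<in> {a} \<times> idx y \<and> t \<in> idx Z" for s t
    proof -
      assume n: "ent (tens (emat a a) y * Z) s t \<noteq> 0"
      obtain x i where si: "s = (x, i)" by (cases s)
      have xa: "x = a" "(\<Sum>k\<in>idx y. ent y i k * ent Z (a, k) t) \<noteq> 0" using n unfolding si eT by (auto split: if_splits)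
      then obtain k where "ent y i k * ent Z (a, k) t \<noteq> 0" by (meson sum.neutral)
      then show ?thesis using xa(1) si by (auto dest: ent_idx)
    qed
    from s show "t \<in> J" using z[of s t] z[of t s] J(2) sub by auto
  qed
  have "(norm (tens (emat a a) y * Z))\<^sup>2 = (\<Sum>b\<in>J. \<Sum>t\<in>J. (cmod (ent (tens (emat a a) y * Z) t b))\<^sup>2)"
    unfolding norm2_ent[OF J(1) iT] by (rule sum.swap)
  also have "\<dots> \<le> (\<Sum>b\<in>J. c\<^sup>2 * (\<Sum>t\<in>J. (cmod (ent Z t b))\<^sup>2))"
  proof (rule sum_mono)
    fix b
    have "(\<Sum>t\<in>J. (cmod (ent (tens (emat a a) y * Z) t b))\<^sup>2) = (\<Sum>t\<in>{a} \<times> idx y. (cmod (ent (tens (emat a a) y * Z) t b))\<^sup>2)"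
    proof (rule sum.mono_neutral_right[OF J(1) sub], rule ballI)
      fix t assume t: "t \<in> J - {a} \<times> idx y"
      obtain x i where ti: "t = (x, i)" by (cases t)
      have "ent y i k = 0" if "x = a" for k using t that ti ent_idx(1)[of y i k] by auto
      then show "(cmod (ent (tens (emat a a) y * Z) t b))\<^sup>2 = 0" by (simp add: ti eT)
    qed
    also have "\<dots> = (\<Sum>i\<in>idx y. (cmod (\<Sum>k\<in>idx y. ent y i k * ent Z (a, k) b))\<^sup>2)"
      by (simp add: sum_singleton_times eT)
    also have "\<dots> \<le> c\<^sup>2 * (\<Sum>k\<in>idx y. (cmod (ent Z (a, k) b))\<^sup>2)"
      by (rule opb_column[OF y]) auto
    also have "(\<Sum>k\<in>idx y. (cmod (ent Z (a, k) b))\<^sup>2) = (\<Sum>t\<in>{a} \<times> idx y. (cmod (ent Z t b))\<^sup>2)"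
      by (simp add: sum_singleton_times)
    also have "\<dots> \<le> (\<Sum>t\<in>J. (cmod (ent Z t b))\<^sup>2)" by (rule sum_mono2[OF J(1) sub]) simp
    finally show "(\<Sum>t\<in>J. (cmod (ent (tens (emat a a) y * Z) t b))\<^sup>2) \<le> c\<^sup>2 * (\<Sum>t\<in>J. (cmod (ent Z t b))\<^sup>2)"
      by (simp add: mult_left_mono)
  qed
  also have "\<dots> = c\<^sup>2 * (\<Sum>b\<in>J. \<Sum>t\<in>J. (cmod (ent Z t b))\<^sup>2)" by (simp add: sum_distrib_left)
  also have "(\<Sum>b\<in>J. \<Sum>t\<in>J. (cmod (ent Z t b))\<^sup>2) = (norm Z)\<^sup>2" unfolding norm2_ent[OF J] by (rule sum.swap)
  finally have "(norm (tens (emat a a) y * Z))\<^sup>2 \<le> (c * norm Z)\<^sup>2" by (simp add: power_mult_distrib)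
  then show "norm (tens (emat a a) y * Z) \<le> c * norm Z" using c0 by (simp add: power2_le_iff_abs_le)
qed

text \<open>\<open>e\<close> and \<open>K\<close> are the units of the source and of the target of the isometry \<open>V\<close>, and \<open>U\<close> is a
  unitary of the target.\<close>

definition approximate_model ::
  "'i fmat \<Rightarrow> 'i fmat \<Rightarrow> nat \<Rightarrow> (nat \<Rightarrow> 'i fmat) \<Rightarrow> (nat \<Rightarrow> 'i fmat) \<Rightarrow> real \<Rightarrow> real \<Rightarrow>
   'i fmat \<Rightarrow> 'i fmat \<Rightarrow> 'i fmat \<Rightarrow> bool" where
  "approximate_model K e n X Y \<gamma> \<eta> V H U \<longleftrightarrow>
     star V * V = e \<and> K * V = V \<and>
     (\<forall>j<n. norm (V * X j - Y j * V) \<le> \<gamma> \<and> norm (V * star (X j) - star (Y j) * V) \<le> \<gamma>) \<and>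
     norm (H - V * star V) \<le> \<eta> \<and> K * H = H \<and> H * K = H \<and>
     star U * U = K \<and> U * star U = K \<and> K * U = U \<and> U * K = U"

section \<open>Comparison of two models with nearly equal data\<close>

lemma norm_add3_le:
  fixes t :: "'b::real_normed_vector"
  assumes "t = x + (y + z)" "norm x \<le> a" "norm y \<le> b" "norm z \<le> c" "a + (b + c) \<le> r"
  shows "norm t \<le> r"
  using norm_triangle_ineq[of x "y + z"] norm_triangle_ineq[of y z] assms by simp

lemma isometry_mult_right:
  assumes V: "star V * V = e" and e: "eproj e"
  shows "V * e = V"
proof -
  have "star (V * e - V) * (V * e - V) = star e * e * e - star e * e - (e * e - e)"
    using V by (simp add: star_diff star_mult algebra_simps) (metis V mult.assoc)
  also have "\<dots> = 0" using e by (simp add: eproj_def)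
  finally have "complex_of_real ((norm (V * e - V))\<^sup>2) = 0" unfolding tr_star_self[symmetric] by simp
  then show ?thesis by simp
qed

text \<open>\<open>Z = U' * star U\<close> compares the two models and almost intertwines
  \<open>H\<close> with \<open>H'\<close> and each \<open>Y j\<close> with itself. Hence
  \<open>T = star V' * Z * V\<close> is almost a unitary of the corner of \<open>e\<close> and
  almost intertwines \<open>X j\<close> with \<open>X' j\<close>; its polar part \<open>W\<close> is
  an exact unitary. The factor \<open>norm e\<close> comes from Cauchy-Schwarz, when the trace in
  \<open>polar_isometry\<close> is bounded by the 2-norm of \<open>star T * T - e\<close>.\<close>

lemma approximate_models_conjugate:
  fixes e K :: "'i fmat"
  assumes K: "eproj K" and I: "finite I" "I \<noteq> {}" and e: "e = one_on I"
    and A: "approximate_model K e n X Y \<gamma> \<eta> V H U"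
    and B: "approximate_model K e n X' Y \<gamma> \<eta> V' H' U'"
    and Xe: "\<And>j. j < n \<Longrightarrow> e * X j = X j \<and> X j * e = X j \<and> e * X' j = X' j \<and> X' j * e = X' j"
    and XR: "\<And>j. j < n \<Longrightarrow> opb R (X j) \<and> opb R (X' j)"
    and KY: "\<And>j. j < n \<Longrightarrow> K * Y j = Y j \<and> Y j * K = Y j"
    and HH: "norm (star U * H * U - star U' * H' * U') \<le> \<sigma>"
    and YY: "\<And>j. j < n \<Longrightarrow> norm (star U * Y j * U - star U' * Y j * U') \<le> \<sigma>"
  shows "\<exists>W. e * W = W \<and> W * e = W \<and> star W * W = e \<and> W * star W = e \<and>
    (\<forall>j<n. norm (X j - star W * X' j * W) \<le> 2 * \<gamma> + \<sigma> + 2 * R * sqrt (norm e * (2 * \<eta> + \<sigma>)))"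
proof -
  note Ad = A[unfolded approximate_model_def] and Bd = B[unfolded approximate_model_def]
  have V: "star V * V = e" "K * V = V" "star V' * V' = e" "K * V' = V'" using Ad Bd by auto
  have U: "star U * U = K" "U * star U = K" "K * U = U" "U * K = U"
    "star U' * U' = K" "U' * star U' = K" "K * U' = U'" "U' * K = U'" using Ad Bd by auto
  have H: "K * H = H" "H * K = H" "K * H' = H'" "H' * K = H'" using Ad Bd by auto
  have ee: "eproj e" unfolding e by (rule eproj_one_on[OF I(1)])
  have Ve: "V * e = V" "V' * e = V'" using isometry_mult_right[OF V(1) ee] isometry_mult_right[OF V(3) ee] by auto
  have o1: "opb 1 V" "opb 1 V'" "opb 1 U" "opb 1 U'"
    by (auto intro!: opb_partial_isometry simp: V U ee K)
  note o1s = o1 o1[THEN opb_star]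
  have b1: "norm (C * Z) \<le> norm Z" "norm (Z * C) \<le> norm Z" if "opb 1 C" for C Z :: "'i fmat"
    using opbD(2)[OF that, of Z] opb_right[OF that, of Z] by auto
  define Z where "Z = U' * star U"
  have ZZ: "star Z * Z = K"
  proof -
    have "star Z * Z = U * (star U' * U') * star U" by (simp add: Z_def star_mult mult.assoc)
    then show ?thesis by (simp add: U)
  qed
  have oZ: "opb 1 Z" "opb 1 (star Z)" using ZZ K by (auto intro: opb_star opb_partial_isometry)
  have sUK: "K * star U = star U" "star U * K = star U"
    using arg_cong[OF U(4), of star] arg_cong[OF U(3), of star] K by (auto simp: star_mult eproj_def)
  have ZK: "Z * K = Z" "K * Z = Z" by (simp_all add: Z_def mult.assoc sUK) (simp add: mult.assoc[symmetric] U)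
  have move: "norm (Z * C - C' * Z) \<le> norm (star U * C * U - star U' * C' * U')"
    if "C * K = C" "K * C' = C'" for C C'
  proof -
    have "U' * (star U * C * U - star U' * C' * U') * star U =
        U' * star U * C * (U * star U) - (U' * star U') * C' * (U' * star U)"
      by (simp add: algebra_simps)
    also have "\<dots> = Z * C - C' * Z" using that by (simp add: U Z_def mult.assoc)
    finally have "Z * C - C' * Z = U' * (star U * C * U - star U' * C' * U') * star U" by simp
    then show ?thesis
      using b1(1)[OF o1(4), of "(star U * C * U - star U' * C' * U') * star U"]
        b1(2)[OF o1s(7), of "star U * C * U - star U' * C' * U'"] by (simp add: mult.assoc)
  qed
  have ZH: "norm (Z * H - H' * Z) \<le> \<sigma>" using move[OF H(2,3)] HH by linarith
  have ZY: "norm (Z * Y j - Y j * Z) \<le> \<sigma>" if "j < n" for j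
    using move[of "Y j" "Y j"] KY[OF that] YY[OF that] by fastforce
  define T where "T = star V' * Z * V"
  have sV': "e * star V' = star V'" using arg_cong[OF Ve(2), of star] ee by (simp add: star_mult eproj_def)
  have eT: "e * T = T" "T * e = T"
    by (simp_all add: T_def mult.assoc Ve) (simp add: mult.assoc[symmetric] sV')
  have TT: "norm (star T * T - e) \<le> 2 * \<eta> + \<sigma>"
  proof -
    define P P' where "P = V * star V" and "P' = V' * star V'"
    have e1: "star V * P * V = e"
    proof -
      have "star V * P * V = (star V * V) * (star V * V)" by (simp add: P_def mult.assoc)
      then show ?thesis using V ee by (simp add: eproj_def)
    qed
    have "star T * T - e = star V * (star Z * P' * Z - P) * V"
      by (simp add: T_def star_mult P'_def right_diff_distrib left_diff_distrib e1[symmetric] mult.assoc)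
    then have "norm (star T * T - e) \<le> norm (star Z * P' * Z - P)"
      using b1(1)[OF o1s(5), of "(star Z * P' * Z - P) * V"] b1(2)[OF o1(1), of "star Z * P' * Z - P"]
      by (simp add: mult.assoc)
    \<comment> \<open>\<open>H\<close> and \<open>H'\<close> replace the range projections at cost
      \<open>\<eta>\<close> each, and \<open>Z\<close> carries one to the other at cost
      \<open>\<sigma>\<close>.\<close>
    moreover have "star Z * P' * Z - P = star Z * (P' - H') * Z + (star Z * (H' * Z - Z * H) + (H - P))"
      using H(1) by (simp add: algebra_simps) (simp add: mult.assoc[symmetric] ZZ)
    moreover have "norm (star Z * (P' - H') * Z) \<le> \<eta>"
      using b1(1)[OF oZ(2), of "(P' - H') * Z"] b1(2)[OF oZ(1), of "P' - H'"] Bd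
      by (simp add: P'_def mult.assoc norm_minus_commute)
    moreover have "norm (star Z * (H' * Z - Z * H)) \<le> \<sigma>"
      using b1(1)[OF oZ(2), of "H' * Z - Z * H"] ZH by (simp add: norm_minus_commute)
    moreover have "norm (H - P) \<le> \<eta>" using Ad by (simp add: P_def)
    ultimately show ?thesis
      by - (rule order_trans, assumption, rule norm_add3_le, assumption, assumption, assumption, assumption, simp)
  qed
  obtain W G where W: "one_on I * W = W" "star W * W = one_on I" "opb 1 G"
    "(norm (T - W))\<^sup>2 \<le> Re (tr (G * (star T * T - one_on I)))"
    using polar_isometry[OF I I(1) order_refl, of T] eT unfolding e by blast
  have We: "e * W = W" "star W * W = e" "W * e = W"
    using W isometry_mult_right[of W e] ee by (auto simp: e)
  \<comment> \<open>Source and target have equal dimension, so the isometry is a unitary.\<close>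
  have WW: "W * star W = e"
  proof (rule eproj_eqI[symmetric])
    have "W * star W * (W * star W) = W * (star W * W) * star W" by (simp only: mult.assoc)
    then show "eproj (W * star W)" by (simp add: eproj_def star_mult We)
    show "e * (W * star W) = W * star W" by (simp add: mult.assoc[symmetric] We)
    show "tr e = tr (W * star W)" by (simp add: We(2)[symmetric] tr_comm)
  qed (rule ee)
  have TW: "norm (T - W) \<le> sqrt (norm e * (2 * \<eta> + \<sigma>))"
  proof (rule real_le_rsqrt)
    have "G * (star T * T - e) = G * (star T * T - e) * e"
      using eT ee by (simp add: left_diff_distrib mult.assoc eproj_def)
    then have "tr (G * (star T * T - e)) = tr (star (star (e * G)) * (star T * T - e))"
      by (metis tr_comm mult.assoc star_star)
    then have "cmod (tr (G * (star T * T - e))) \<le> norm (star T * T - e) * norm (star (e * G))"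
      using cmod_tr_le by metis
    also have "norm (star (e * G)) \<le> norm e" using opb_right[OF W(3), of e] by simp
    then have "norm (star T * T - e) * norm (star (e * G)) \<le> (2 * \<eta> + \<sigma>) * norm e"
      using TT by (intro mult_mono) (auto intro: order_trans[OF norm_ge_zero])
    finally have "Re (tr (G * (star T * T - e))) \<le> (2 * \<eta> + \<sigma>) * norm e"
      using complex_Re_le_cmod order_trans by blast
    then show "(norm (T - W))\<^sup>2 \<le> norm e * (2 * \<eta> + \<sigma>)" using W(4) by (simp add: e mult.commute)
  qed
  have "norm (X j - star W * X' j * W) \<le> 2 * \<gamma> + \<sigma> + 2 * R * sqrt (norm e * (2 * \<eta> + \<sigma>))" if j: "j < n" for j
  proof -
    note Xj = Xe[OF j]
    have oX: "opb R (X j)" "opb R (X' j)" using XR[OF j] by auto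
    have g1: "norm (V * X j - Y j * V) \<le> \<gamma>" "norm (V' * star (X' j) - star (Y j) * V') \<le> \<gamma>" using Ad Bd j by auto
    have "norm (star V' * Z * (V * X j - Y j * V)) \<le> \<gamma>"
      using b1(1)[OF o1s(6), of "Z * (V * X j - Y j * V)"] b1(1)[OF oZ(1), of "V * X j - Y j * V"] g1 by (simp add: mult.assoc)
    moreover have "norm (star V' * (Z * Y j - Y j * Z) * V) \<le> \<sigma>"
      using b1(1)[OF o1s(6), of "(Z * Y j - Y j * Z) * V"] b1(2)[OF o1(1), of "Z * Y j - Y j * Z"] ZY[OF j] by (simp add: mult.assoc)
    moreover have "norm (star (star (Y j) * V' - V' * star (X' j)) * Z * V) \<le> \<gamma>"
    proof -
      have "norm (star (star (Y j) * V' - V' * star (X' j)) * (Z * V)) \<le> norm (star (star (Y j) * V' - V' * star (X' j)))"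
        using b1(2)[OF o1(1), of "star (star (Y j) * V' - V' * star (X' j)) * Z"]
          b1(2)[OF oZ(1), of "star (star (Y j) * V' - V' * star (X' j))"] by (simp add: mult.assoc)
      then show ?thesis using g1(2) by (simp add: mult.assoc norm_minus_commute)
    qed
    \<comment> \<open>The last term is the intertwining by \<open>V'\<close> read through adjoints;
      for its sake a model also controls \<open>star (X j)\<close>.\<close>
    moreover have "T * X j - X' j * T = star V' * Z * (V * X j - Y j * V) + (star V' * (Z * Y j - Y j * Z) * V
        + star (star (Y j) * V' - V' * star (X' j)) * Z * V)"
      by (simp add: T_def star_diff star_mult algebra_simps)
    ultimately have TX: "norm (T * X j - X' j * T) \<le> 2 * \<gamma> + \<sigma>"
      by - (rule norm_add3_le, assumption, assumption, assumption, assumption, simp)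
    have "norm (W * X j - X' j * W) \<le> 2 * \<gamma> + \<sigma> + 2 * R * norm (T - W)"
    proof -
      have "norm ((W - T) * X j) \<le> R * norm (T - W)" "norm (X' j * (T - W)) \<le> R * norm (T - W)"
        using opb_right[OF oX(1), of "W - T"] opbD(2)[OF oX(2), of "T - W"] by (auto simp: norm_minus_commute)
      moreover have "W * X j - X' j * W = (W - T) * X j + ((T * X j - X' j * T) + X' j * (T - W))"
        by (simp add: algebra_simps)
      ultimately show ?thesis using TX
        by - (rule norm_add3_le, assumption, assumption, assumption, assumption, simp)
    qed
    also have "\<dots> \<le> 2 * \<gamma> + \<sigma> + 2 * R * sqrt (norm e * (2 * \<eta> + \<sigma>))"
      using TW opbD(1)[OF oX(1)] by (intro add_left_mono mult_left_mono) auto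
    finally have 1: "norm (W * X j - X' j * W) \<le> 2 * \<gamma> + \<sigma> + 2 * R * sqrt (norm e * (2 * \<eta> + \<sigma>))" .
    have "opb 1 (star W)" using We(2) ee by (auto intro: opb_star opb_partial_isometry)
    from b1(1)[OF this, of "W * X j - X' j * W"] 1
    show ?thesis using Xj by (simp add: right_diff_distrib mult.assoc[symmetric] We(2))
  qed
  then show ?thesis using We WW by blast
qed

text \<open>The matrices \<open>\<Lambda> s\<close> of left multiplication by the elements of a basis of a \<open>d\<close>-dimensional algebra
  with respect to that basis: the structure constants in \<open>\<Lambda>_mult\<close> are their own entries. The
  assumption \<open>\<Lambda>_casimir\<close> comes from orthonormality for the trace of the regular representation.\<close>

locale regular_matrices =
  fixes d :: nat and \<Lambda> :: "nat \<Rightarrow> nat fmat"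
  assumes d0: "d > 0"
    and \<Lambda>_corner: "\<And>s. s < d \<Longrightarrow> one_on {..<d} * \<Lambda> s = \<Lambda> s"
    and \<Lambda>_mult: "\<And>r s. r < d \<Longrightarrow> s < d \<Longrightarrow> \<Lambda> r * \<Lambda> s = (\<Sum>m<d. scl (ent (\<Lambda> r) m s) (\<Lambda> m))"
    and \<Lambda>_star: "\<And>s. s < d \<Longrightarrow> star (\<Lambda> s) \<in> cspan (\<Lambda> ` {..<d})"
    and \<Lambda>_one: "one_on {..<d} \<in> cspan (\<Lambda> ` {..<d})"
    and \<Lambda>_casimir: "(\<Sum>s<d. \<Lambda> s * star (\<Lambda> s)) = one_on {..<d}"
begin

definition alg where "alg = cspan (\<Lambda> ` {..<d})"

text \<open>By linearity from \<open>\<Lambda>_mult\<close>. The algebra acts on its own basis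
  through its entries, which is what makes the representation regular.\<close>

lemma alg_times: "B \<in> alg \<Longrightarrow> s < d \<Longrightarrow> B * \<Lambda> s = (\<Sum>m<d. scl (ent B m s) (\<Lambda> m))"
  unfolding alg_def
  by (induction rule: cspan.induct) (auto simp: \<Lambda>_mult distrib_right sum.distrib scl_add_left scl_sum_right)

lemma alg_star: "B \<in> alg \<Longrightarrow> star B \<in> alg"
  unfolding alg_def
  by (induction rule: cspan.induct) (auto simp: star_add intro: cspan.intros \<Lambda>_star)

lemma alg_corner: "B \<in> alg \<Longrightarrow> one_on {..<d} * B = B" "B \<in> alg \<Longrightarrow> B * one_on {..<d} = B"
proof -
  have 1: "one_on {..<d} * B = B" if "B \<in> alg" for B
    using that unfolding alg_def
    by (induction rule: cspan.induct) (auto simp: \<Lambda>_corner distrib_left)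
  then show "B \<in> alg \<Longrightarrow> one_on {..<d} * B = B" .
  show "B \<in> alg \<Longrightarrow> B * one_on {..<d} = B" using 1[OF alg_star] by (metis star_mult star_one_on star_star)
qed

text \<open>This is the averaging map that carries a matrix to one commuting with the algebra \<open>alg\<close>.\<close>

definition expect :: "nat fmat \<Rightarrow> (nat \<times> nat) fmat \<Rightarrow> (nat \<times> nat) fmat" where
  "expect k P = (\<Sum>s<d. tens (\<Lambda> s) k * P * star (tens (\<Lambda> s) k))"

text \<open>Pushed in from the left, \<open>B\<close> expands \<open>B * \<Lambda> s\<close>; from
  the right, it expands \<open>star (\<Lambda> s) * B\<close>. Both expansions use the same entries
  of \<open>B\<close>, so the double sums agree after an exchange of the indices.\<close>

lemma expect_commutes:
  assumes k: "eproj k" and B: "B \<in> alg"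
  shows "tens B k * expect k P = expect k P * tens B k"
proof -
  have kk: "k * k = k" "star k = k" using k by (auto simp: eproj_def)
  define L where "L s = tens (\<Lambda> s) k" for s
  have left: "tens C k * L s = (\<Sum>m<d. scl (ent C m s) (L m))" if "C \<in> alg" "s < d" for C s
    using alg_times[OF that] by (simp add: L_def tens_mult kk tens_sum_left tens_scl_left)
  have right: "star (L s) * tens B k = (\<Sum>m<d. scl (ent B s m) (star (L m)))" if "s < d" for s
  proof -
    have "star (L s) * tens B k = star (tens (star B) k * L s)" by (simp add: star_mult tens_star kk)
    then show ?thesis using left[OF alg_star[OF B] that] by (simp add: star_sum)
  qed
  have "tens B k * expect k P = (\<Sum>s<d. tens B k * L s * P * star (L s))"
    by (simp add: expect_def L_def sum_distrib_left mult.assoc)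
  also have "\<dots> = (\<Sum>s<d. \<Sum>m<d. scl (ent B m s) (L m * P * star (L s)))"
    by (rule sum.cong) (auto simp: left[OF B] sum_distrib_right)
  also have "\<dots> = (\<Sum>m<d. \<Sum>s<d. scl (ent B m s) (L m * P * star (L s)))" by (rule sum.swap)
  also have "\<dots> = (\<Sum>m<d. L m * P * (star (L m) * tens B k))"
    by (rule sum.cong) (auto simp: right sum_distrib_left)
  also have "\<dots> = expect k P * tens B k"
    by (simp add: expect_def L_def sum_distrib_right mult.assoc)
  finally show ?thesis .
qed

text \<open>By \<open>\<Lambda>_casimir\<close>, \<open>P\<close> can be written as an average like
  \<open>expect k P\<close> but with \<open>P\<close> standing in front of both factors. The
  difference is a sum of commutators, each multiplied by a matrix of bounded norm.\<close>

lemma expect_close: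
  assumes k: "eproj k" and P: "P * tens (one_on {..<d}) k = P"
    and c: "\<And>s. s < d \<Longrightarrow> norm (tens (\<Lambda> s) k * P - P * tens (\<Lambda> s) k) \<le> \<delta>"
  shows "norm (expect k P - P) \<le> (\<Sum>s<d. norm1 (\<Lambda> s)) * \<delta>"
proof -
  have kk: "k * k = k" "star k = k" using k by (auto simp: eproj_def)
  have "P = (\<Sum>s<d. P * tens (\<Lambda> s) k * star (tens (\<Lambda> s) k))"
    using P by (simp add: \<Lambda>_casimir[symmetric] tens_sum_left sum_distrib_left tens_star tens_mult kk mult.assoc)
  then have "expect k P - P = (\<Sum>s<d. (tens (\<Lambda> s) k * P - P * tens (\<Lambda> s) k) * star (tens (\<Lambda> s) k))"
    by (simp add: expect_def left_diff_distrib sum_subtractf)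
  then have "norm (expect k P - P) \<le> (\<Sum>s<d. norm ((tens (\<Lambda> s) k * P - P * tens (\<Lambda> s) k) * star (tens (\<Lambda> s) k)))"
    by (simp add: norm_sum)
  also have "\<dots> \<le> (\<Sum>s<d. norm1 (\<Lambda> s) * \<delta>)"
  proof (rule sum_mono)
    fix s assume "s \<in> {..<d}"
    then have "norm1 (\<Lambda> s) * norm (tens (\<Lambda> s) k * P - P * tens (\<Lambda> s) k) \<le> norm1 (\<Lambda> s) * \<delta>"
      using c norm1_nonneg by (intro mult_left_mono) auto
    then show "norm ((tens (\<Lambda> s) k * P - P * tens (\<Lambda> s) k) * star (tens (\<Lambda> s) k)) \<le> norm1 (\<Lambda> s) * \<delta>"
      using opb_right[OF opb_star[OF opb_tens[OF k, of "\<Lambda> s"]], of "tens (\<Lambda> s) k * P - P * tens (\<Lambda> s) k"] by linarith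
  qed
  finally show ?thesis by (simp add: sum_distrib_right)
qed

text \<open>A column of \<open>d\<close> blocks. The source sits at position 0 of the first tensor
  factor, so that columns and square matrices have one type.\<close>

definition stack :: "(nat \<Rightarrow> nat fmat) \<Rightarrow> (nat \<times> nat) fmat" where
  "stack p = (\<Sum>l<d. tens (emat l 0) (p l))"

abbreviation (input) unit_of :: "nat \<Rightarrow> nat fmat" where "unit_of k \<equiv> one_on {..<k}"

text \<open>The isometry \<open>Vh\<close> is the polar part of the column \<open>V\<close>. Here
  \<open>\<delta>\<^sub>1\<close> and \<open>\<delta>\<^sub>2\<close> measure how well
  \<open>V\<close> intertwines the generators and the \<open>q s\<close>,
  \<open>\<delta>\<^sub>4\<close> is the isometry defect, and \<open>\<delta>\<^sub>3\<close> bounds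
  the resulting distance from \<open>V\<close> to \<open>Vh\<close>. The factor
  \<open>\<kappa>\<close> is the norm of the unit of size \<open>k\<close>, so the constants refer
  to the normalized trace.\<close>

lemma ex_banded_model:
  fixes k :: nat and p p' q x Y :: "nat \<Rightarrow> nat fmat"
  defines "u \<equiv> unit_of k" and "V \<equiv> stack p" and "V' \<equiv> stack p'" and "\<kappa> \<equiv> sqrt (real k)"
  defines "e \<equiv> tens (emat 0 0) u" and "K \<equiv> tens (one_on {..<d}) u"
  defines "X \<equiv> \<lambda>j. tens (emat 0 0) (x j)" and "L \<equiv> \<lambda>j. tens (Y j) u" and "Q \<equiv> \<lambda>s. tens (emat 0 0) (q s)"
  assumes k: "k > 0"
    and pu: "\<And>l. l < d \<Longrightarrow> u * p l = p l \<and> p l * u = p l"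
    and xR: "\<And>j. j < n \<Longrightarrow> opb R (x j)" and qC: "\<And>s. s < d \<Longrightarrow> opb C (q s)"
    and Ya: "\<And>j. j < n \<Longrightarrow> Y j \<in> alg \<and> norm1 (Y j) \<le> R' \<and> norm1 (star (Y j)) \<le> R'"
    and i1: "\<And>j. j < n \<Longrightarrow> norm (V * X j - L j * V) \<le> \<delta>\<^sub>1 * \<kappa>"
    and i2: "\<And>j. j < n \<Longrightarrow> norm (V * star (X j) - star (L j) * V) \<le> \<delta>\<^sub>1 * \<kappa>"
    and c1: "\<And>s. s < d \<Longrightarrow> norm (V * Q s - tens (star (\<Lambda> s)) u * V) \<le> \<delta>\<^sub>2 * \<kappa>"
    and c2: "\<And>s. s < d \<Longrightarrow> norm (V * star (Q s) - tens (\<Lambda> s) u * V) \<le> \<delta>\<^sub>2 * \<kappa>"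
    and b1: "norm (V - V') \<le> \<delta>\<^sub>4 * \<kappa>" and b2: "norm V \<le> 2 * \<kappa>"
    and b3: "norm (star V' * V - e) \<le> \<delta>\<^sub>4 * \<kappa>"
    and d3: "3 * \<delta>\<^sub>4 \<le> \<delta>\<^sub>3\<^sup>2" "\<delta>\<^sub>3 \<ge> 0" and C': "\<And>s. s < d \<Longrightarrow> norm1 (\<Lambda> s) \<le> C' \<and> norm1 (star (\<Lambda> s)) \<le> C'"
    and g: "bij_betw g ({..<d} \<times> {..<k}) {..<d * k}"
  shows "\<exists>Vh H U h. approximate_model K e n X L ((\<delta>\<^sub>1 + (R + R') * \<delta>\<^sub>3) * \<kappa>)
      ((\<Sum>s<d. norm1 (\<Lambda> s)) * (2 * (\<delta>\<^sub>2 + (C + C') * \<delta>\<^sub>3)) * \<kappa>) Vh H U \<and>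
      star U * H * U = dgm ({..<d} \<times> {..<k}) h \<and>
      opb (\<Sum>s<d. norm1 (\<Lambda> s) * norm1 (\<Lambda> s)) (star U * H * U) \<and>
      (\<forall>j<n. opb R' (star U * L j * U)) \<and>
      (\<forall>j<n. \<forall>a\<in>{..<d} \<times> {..<k}. \<forall>b\<in>{..<d} \<times> {..<k}.
         int d \<le> \<bar>int (g a) - int (g b)\<bar> \<longrightarrow> ent (star U * L j * U) a b = 0)"
proof -
  have uu: "eproj u" unfolding u_def by (rule eproj_one_on) simp
  have us: "u * u = u" "star u = u" using uu by (auto simp: eproj_def)
  have eI: "e = one_on ({0} \<times> {..<k})"
    unfolding e_def u_def by (subst one_on_times[symmetric]) (auto simp: one_on_def)
  have KI: "K = one_on ({..<d} \<times> {..<k})" unfolding K_def u_def by (simp add: one_on_times)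
  have ne: "norm e = \<kappa>"
  proof -
    have "(norm e)\<^sup>2 = real k" unfolding eI by (subst norm2_one_on) (auto simp: card_cartesian_product)
    then show ?thesis unfolding \<kappa>_def by (simp add: real_sqrt_unique)
  qed
  have \<kappa>0: "\<kappa> \<ge> 0" by (simp add: \<kappa>_def)
  have VK: "K * V = V"
  proof -
    have "one_on {..<d} * emat l 0 = emat l (0::nat)" if "l < d" for l
      using that by (intro fmat_eqI) (auto simp: ent_one_on_left)
    then show ?thesis unfolding K_def V_def stack_def sum_distrib_left
      by (intro sum.cong) (auto simp: tens_mult pu)
  qed
  have Ve: "V * e = V" unfolding V_def stack_def e_def sum_distrib_right
    by (intro sum.cong) (auto simp: tens_mult pu emat_times)
  have card: "card ({0::nat} \<times> {..<k}) \<le> card ({..<d} \<times> {..<k})" using d0 by (simp add: card_cartesian_product)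
  obtain Vh G where Vh: "K * Vh = Vh" "star Vh * Vh = e" "opb 1 G"
    "(norm (V - Vh))\<^sup>2 \<le> Re (tr (G * (star V * V - e)))"
  proof -
    have "finite ({0::nat} \<times> {..<k})" "{0::nat} \<times> {..<k} \<noteq> {}" "finite ({..<d} \<times> {..<k})" using k by auto
    from polar_isometry[OF this card VK[unfolded KI] Ve[unfolded eI]] show ?thesis
      using that unfolding eI KI by (elim exE conjE)
  qed
  have ee: "eproj e" unfolding eI by (rule eproj_one_on) simp
  have KK: "eproj K" unfolding KI by (rule eproj_one_on) simp
  have VVh: "norm (V - Vh) \<le> \<delta>\<^sub>3 * \<kappa>"
  proof -
    \<comment> \<open>No bound on \<open>star V * V - e\<close> itself is at hand. Replacing one
      factor by \<open>V'\<close> leaves a Cauchy-Schwarz term and the controlled product; they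
      contribute 2 and 1 to the 3 in
      \<open>3 * \<delta>\<^sub>4 \<le> \<delta>\<^sub>3\<^sup>2\<close>.\<close>
    have "Re (tr (G * (star V * V - e))) \<le> cmod (tr (G * (star (V - V') * V))) + cmod (tr (G * (star V' * V - e)))"
    proof -
      have "G * (star V * V - e) = G * (star (V - V') * V) + G * (star V' * V - e)"
        by (simp add: star_diff algebra_simps)
      then have "tr (G * (star V * V - e)) = tr (G * (star (V - V') * V)) + tr (G * (star V' * V - e))"
        by (simp add: tr_add)
      then show ?thesis
        using order_trans[OF complex_Re_le_cmod norm_triangle_ineq[of "tr (G * (star (V - V') * V))" "tr (G * (star V' * V - e))"]]
        by simp
    qed
    also have "\<dots> \<le> (2 * \<kappa>) * (\<delta>\<^sub>4 * \<kappa>) + (\<delta>\<^sub>4 * \<kappa>) * \<kappa>"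
    proof (rule add_mono)
      have "tr (G * (star (V - V') * V)) = tr (star (V - V') * (V * G))"
        using tr_comm[of G "star (V - V') * V"] by (simp add: mult.assoc)
      then have "cmod (tr (G * (star (V - V') * V))) \<le> norm (V * G) * norm (V - V')"
        using cmod_tr_le[of "V - V'" "V * G"] by simp
      also have "\<dots> \<le> (2 * \<kappa>) * (\<delta>\<^sub>4 * \<kappa>)"
        using opb_right[OF Vh(3), of V] b1 b2 \<kappa>0 by (intro mult_mono) auto
      finally show "cmod (tr (G * (star (V - V') * V))) \<le> (2 * \<kappa>) * (\<delta>\<^sub>4 * \<kappa>)" .
      have "G * (star V' * V - e) = G * (star V' * V - e) * e"
        using ee by (simp add: left_diff_distrib mult.assoc Ve eproj_def)
      then have "tr (G * (star V' * V - e)) = tr (G * (star V' * V - e) * e)" by simp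
      also have "\<dots> = tr (star (star (e * G)) * (star V' * V - e))"
        unfolding star_star using tr_comm[of "G * (star V' * V - e)" e] by (simp only: mult.assoc)
      finally have "cmod (tr (G * (star V' * V - e))) \<le> norm (star V' * V - e) * norm (star (e * G))"
        using cmod_tr_le[of "star (e * G)" "star V' * V - e"] by simp
      also have "\<dots> \<le> (\<delta>\<^sub>4 * \<kappa>) * \<kappa>"
        using opb_right[OF Vh(3), of e] b3 by (intro mult_mono) (auto simp: ne intro: order_trans[OF norm_ge_zero])
      finally show "cmod (tr (G * (star V' * V - e))) \<le> (\<delta>\<^sub>4 * \<kappa>) * \<kappa>" .
    qed
    also have "\<dots> = 3 * \<delta>\<^sub>4 * \<kappa>\<^sup>2" by (simp add: power2_eq_square algebra_simps)
    also have "\<dots> \<le> (\<delta>\<^sub>3 * \<kappa>)\<^sup>2" using d3(1) by (simp add: power_mult_distrib mult_right_mono)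
    finally have "(norm (V - Vh))\<^sup>2 \<le> (\<delta>\<^sub>3 * \<kappa>)\<^sup>2" using Vh(4) by linarith
    then show ?thesis using d3(2) \<kappa>0 by (simp add: power2_le_iff_abs_le)
  qed
  have oX: "opb R (X j)" if "j < n" for j unfolding X_def by (rule opb_tens_emat[OF xR[OF that]])
  have oQ: "opb C (Q s)" if "s < d" for s unfolding Q_def by (rule opb_tens_emat[OF qC[OF that]])
  \<comment> \<open>Passing from \<open>V\<close> to \<open>Vh\<close> costs the operator norms of
    both multipliers; hence the \<open>q s\<close> must be bounded on microstates.\<close>
  have perturb: "norm (Vh * A - B * Vh) \<le> (\<delta> + (a + b) * \<delta>\<^sub>3) * \<kappa>"
    if "norm (V * A - B * V) \<le> \<delta> * \<kappa>" "opb a A" "opb b B" for A B \<delta> a b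
  proof -
    have "norm ((Vh - V) * A) \<le> a * (\<delta>\<^sub>3 * \<kappa>)"
      using opb_right[OF that(2), of "Vh - V"] VVh opbD(1)[OF that(2)]
      by (intro order_trans[OF opb_right[OF that(2)] mult_left_mono]) (simp_all add: norm_minus_commute)
    moreover have "norm (B * (V - Vh)) \<le> b * (\<delta>\<^sub>3 * \<kappa>)"
      using VVh opbD(1)[OF that(3)] by (intro order_trans[OF opbD(2)[OF that(3)] mult_left_mono])
    moreover have "Vh * A - B * Vh = (Vh - V) * A + ((V * A - B * V) + B * (V - Vh))" by (simp add: algebra_simps)
    ultimately have "norm (Vh * A - B * Vh) \<le> a * (\<delta>\<^sub>3 * \<kappa>) + (\<delta> * \<kappa> + b * (\<delta>\<^sub>3 * \<kappa>))"
      using that(1) by - (rule norm_add3_le, assumption, assumption, assumption, assumption, simp)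
    then show ?thesis by (simp add: algebra_simps)
  qed
  have oL: "opb R' (L j)" "opb R' (star (L j))" if "j < n" for j
    using Ya[OF that] opb_mono[OF opb_tens[OF uu]] by (auto simp: L_def tens_star us)
  have m1: "norm (Vh * X j - L j * Vh) \<le> (\<delta>\<^sub>1 + (R + R') * \<delta>\<^sub>3) * \<kappa>" if "j < n" for j
    by (rule perturb[OF i1[OF that] oX[OF that] oL(1)[OF that]])
  have m2: "norm (Vh * star (X j) - star (L j) * Vh) \<le> (\<delta>\<^sub>1 + (R + R') * \<delta>\<^sub>3) * \<kappa>" if "j < n" for j
    by (rule perturb[OF i2[OF that] opb_star[OF oX[OF that]] oL(2)[OF that]])
  define P where "P = Vh * star Vh"
  define \<theta> where "\<theta> = (\<delta>\<^sub>2 + (C + C') * \<delta>\<^sub>3) * \<kappa>"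
  have oV: "opb 1 Vh" by (rule opb_partial_isometry) (simp add: Vh ee)
  have comm: "norm (tens (\<Lambda> s) u * P - P * tens (\<Lambda> s) u) \<le> 2 * \<theta>" if s: "s < d" for s
  proof -
    have o: "opb C' (tens (\<Lambda> s) u)" "opb C' (tens (star (\<Lambda> s)) u)"
      using C'[OF s] opb_mono[OF opb_tens[OF uu]] by auto
    have 1: "norm (Vh * Q s - tens (star (\<Lambda> s)) u * Vh) \<le> \<theta>"
      unfolding \<theta>_def by (rule perturb[OF c1[OF s] oQ[OF s] o(2)])
    have 2: "norm (Vh * star (Q s) - tens (\<Lambda> s) u * Vh) \<le> \<theta>"
      unfolding \<theta>_def by (rule perturb[OF c2[OF s] opb_star[OF oQ[OF s]] o(1)])
    \<comment> \<open>The intermediate product is \<open>Vh * star (Q s) * star Vh\<close>, reached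
      from one side by intertwining \<open>star (Q s)\<close> and from the other by the adjoint
      relation for \<open>Q s\<close>.\<close>
    have "tens (\<Lambda> s) u * P - P * tens (\<Lambda> s) u =
        - ((Vh * star (Q s) - tens (\<Lambda> s) u * Vh) * star Vh) + Vh * star (Vh * Q s - tens (star (\<Lambda> s)) u * Vh)"
      by (simp add: P_def star_diff star_mult tens_star us algebra_simps)
    then have "norm (tens (\<Lambda> s) u * P - P * tens (\<Lambda> s) u) \<le>
        norm ((Vh * star (Q s) - tens (\<Lambda> s) u * Vh) * star Vh) + norm (Vh * star (Vh * Q s - tens (star (\<Lambda> s)) u * Vh))"
      by (metis norm_minus_cancel norm_triangle_ineq)
    also have "\<dots> \<le> \<theta> + \<theta>"
      using opb_right[OF opb_star[OF oV], of "Vh * star (Q s) - tens (\<Lambda> s) u * Vh"] 2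
        opbD(2)[OF oV, of "star (Vh * Q s - tens (star (\<Lambda> s)) u * Vh)"] 1
      by (intro add_mono) (simp_all del: norm_star add: norm_star)
    finally show ?thesis by simp
  qed
  define H where "H = expect u P"
  have PK: "P * K = P"
  proof -
    have "star Vh * K = star Vh" using arg_cong[OF Vh(1), of star] KK by (simp add: star_mult eproj_def)
    then show ?thesis by (simp add: P_def mult.assoc)
  qed
  have HP: "norm (H - P) \<le> (\<Sum>s<d. norm1 (\<Lambda> s)) * (2 * (\<delta>\<^sub>2 + (C + C') * \<delta>\<^sub>3)) * \<kappa>"
  proof -
    have "norm (H - P) \<le> (\<Sum>s<d. norm1 (\<Lambda> s)) * (2 * \<theta>)"
      unfolding H_def by (rule expect_close[OF uu PK[unfolded K_def] comm])
    also have "\<dots> = (\<Sum>s<d. norm1 (\<Lambda> s)) * (2 * (\<delta>\<^sub>2 + (C + C') * \<delta>\<^sub>3)) * \<kappa>"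
      by (simp only: \<theta>_def mult.assoc)
    finally show ?thesis .
  qed
  have Hs: "star H = H" by (simp add: H_def expect_def star_sum star_mult P_def mult.assoc)
  have KH: "K * H = H"
  proof -
    have "K * tens (\<Lambda> s) u = tens (\<Lambda> s) u" if "s < d" for s using that by (simp add: K_def tens_mult us \<Lambda>_corner)
    then show ?thesis unfolding H_def expect_def sum_distrib_left by (intro sum.cong) (auto simp: mult.assoc[symmetric])
  qed
  have HK: "H * K = H" using arg_cong[OF KH, of star] Hs KK by (simp add: star_mult eproj_def)
  define I where "I = {..<d} \<times> {..<k}"
  \<comment> \<open>This basis has \<open>d\<close> elements for every \<open>k\<close>, so the
    bandwidth does not grow with \<open>k\<close>.\<close>
  define Bs where "Bs = map (\<lambda>s. tens (\<Lambda> s) u) [0..<d]"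
  have span: "tens B u \<in> cspan (set Bs)" if "B \<in> alg" for B
    using that unfolding alg_def
  proof (induction rule: cspan.induct)
    case (cspan_base x)
    then show ?case by (auto simp: Bs_def intro!: cspan.cspan_base)
  qed (auto simp: tens_add_left tens_scl_left intro: cspan.intros)
  have \<Lambda>alg: "\<Lambda> s \<in> alg" if "s < d" for s using that by (auto simp: alg_def intro: cspan_base)
  have setB: "set Bs = (\<lambda>s. tens (\<Lambda> s) u) ` {..<d}" by (auto simp: Bs_def)
  interpret sm: star_module I "(0, 0)" Bs H
  proof
    show "finite I" by (simp add: I_def)
    show "one_on I * H = H" using KH KI by (simp add: I_def)
    show "star H = H" by (rule Hs)
    have "tens (one_on {..<d}) u \<in> cspan (set Bs)" using \<Lambda>_one by (intro span) (simp add: alg_def)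
    then show "one_on I \<in> cspan (set Bs)" using KI by (simp add: K_def I_def)
    fix B assume "B \<in> set Bs"
    then obtain s where s: "s < d" "B = tens (\<Lambda> s) u" by (auto simp: setB)
    have "K * B = B" using s by (simp add: K_def tens_mult us \<Lambda>_corner)
    then show "one_on I * B = B" unfolding KI I_def .
    show "star B \<in> cspan (set Bs)" using s span[OF alg_star[OF \<Lambda>alg]] by (simp add: tens_star us)
    show "H * B = B * H" unfolding s(2) H_def by (rule expect_commutes[OF uu \<Lambda>alg[OF s(1)], symmetric])
    fix B' assume "B' \<in> set Bs"
    then obtain r where r: "r < d" "B' = tens (\<Lambda> r) u" by (auto simp: setB)
    have "\<Lambda> s * \<Lambda> r \<in> alg" unfolding \<Lambda>_mult[OF s(1) r(1)] unfolding alg_def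
      by (intro cspan_sum cspan_scl cspan_base) auto
    then show "B * B' \<in> cspan (set Bs)" using span by (simp add: s r tens_mult us)
  qed
  have "(0, 0) \<in> I" using d0 k by (simp add: I_def)
  moreover have "bij_betw g I {..<card I}" using g by (simp add: I_def card_cartesian_product)
  ultimately obtain U h where U: "star U * U = one_on I" "U * star U = one_on I" "one_on I * U = U" "U * one_on I = U"
    "star U * H * U = dgm I h"
    "\<forall>B\<in>cspan (set Bs). \<forall>i\<in>I. \<forall>j\<in>I. int (length Bs) \<le> \<bar>int (g i) - int (g j)\<bar> \<longrightarrow> ent (star U * B * U) i j = 0"
    using sm.block_diagonalization by blast
  have oU1: "opb 1 U" by (rule opb_partial_isometry) (use U(1) KK KI in \<open>simp add: I_def\<close>)
  note oU = oU1 opb_star[OF oU1]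
  have oP: "opb (1 * 1) P" unfolding P_def by (intro opb_mult oV opb_star)
  have "opb (\<Sum>s<d. norm1 (\<Lambda> s) * (1 * 1) * norm1 (\<Lambda> s)) H"
    unfolding H_def expect_def by (intro opb_sum opb_mult oP opb_star opb_tens[OF uu])
  then have "opb (1 * (\<Sum>s<d. norm1 (\<Lambda> s) * norm1 (\<Lambda> s)) * 1) (star U * H * U)"
    by (intro opb_mult oU) simp
  moreover have "opb R' (star U * L j * U)" if "j < n" for j
    using opb_mult[OF opb_mult[OF oU(2) oL(1)[OF that]] oU(1)] by simp
  moreover have "ent (star U * L j * U) a b = 0"
    if "j < n" "a \<in> I" "b \<in> I" "int d \<le> \<bar>int (g a) - int (g b)\<bar>" for j a b
  proof -
    have "L j \<in> cspan (set Bs)" unfolding L_def using span Ya[OF that(1)] by blast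
    moreover have "length Bs = d" by (simp add: Bs_def)
    ultimately show ?thesis using U(6) that by blast
  qed
  moreover have "approximate_model K e n X L ((\<delta>\<^sub>1 + (R + R') * \<delta>\<^sub>3) * \<kappa>)
      ((\<Sum>s<d. norm1 (\<Lambda> s)) * (2 * (\<delta>\<^sub>2 + (C + C') * \<delta>\<^sub>3)) * \<kappa>) Vh H U"
    unfolding approximate_model_def using Vh(1,2) m1 m2 HP KH HK U(1-4) KI by (simp add: P_def I_def)
  ultimately show ?thesis using U(5) unfolding I_def by (intro exI[of _ Vh] exI[of _ H] exI[of _ U] exI[of _ h]) simp
qed

end

section \<open>Noncommutative polynomials\<close>

datatype ncpoly = One | Var nat | Plus ncpoly ncpoly | Times ncpoly ncpoly | Scale complex ncpoly | Adj ncpoly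

fun pev :: "'a::complex_star_algebra \<Rightarrow> (nat \<Rightarrow> 'a) \<Rightarrow> ncpoly \<Rightarrow> 'a" where
  "pev e X One = e"
| "pev e X (Var i) = X i"
| "pev e X (Plus p q) = pev e X p + pev e X q"
| "pev e X (Times p q) = pev e X p * pev e X q"
| "pev e X (Scale c p) = scl c (pev e X p)"
| "pev e X (Adj p) = star (pev e X p)"

text \<open>Microstates are controlled on words only, so polynomials have to be brought to linear
  combinations of words.\<close>

fun expand :: "ncpoly \<Rightarrow> (complex \<times> word) list" where
  "expand One = [(1, [])]"
| "expand (Var i) = [(1, [(i, False)])]"
| "expand (Plus p q) = expand p @ expand q"
| "expand (Times p q) = concat (map (\<lambda>(c, u). map (\<lambda>(d, v). (c * d, u @ v)) (expand q)) (expand p))"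
| "expand (Scale c p) = map (\<lambda>(d, v). (c * d, v)) (expand p)"
| "expand (Adj p) = map (\<lambda>(d, v). (cnj d, rev (map (\<lambda>(i, s). (i, \<not> s)) v))) (expand p)"

definition letter :: "(nat \<Rightarrow> 'a::complex_star_algebra) \<Rightarrow> nat \<times> bool \<Rightarrow> 'a" where
  "letter X = (\<lambda>(i, s). if s then star (X i) else X i)"

definition weval :: "'a::complex_star_algebra \<Rightarrow> (nat \<Rightarrow> 'a) \<Rightarrow> word \<Rightarrow> 'a" where
  "weval e X w = foldr (\<lambda>l b. letter X l * b) w e"

text \<open>Covers \<open>id_bop\<close> for operators as well as \<open>one_on {..<k}\<close> for
  matrices, which is a unit only for the matrices of size \<open>k\<close>.\<close>

locale unital_family =
  fixes e :: "'a::complex_star_algebra" and X :: "nat \<Rightarrow> 'a"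
  assumes e_idem: "e * e = e" and e_star: "star e = e"
    and e_X: "e * X i = X i" and X_e: "X i * e = X i"
begin

lemma letter_e: "e * letter X l = letter X l" "letter X l * e = letter X l"
proof -
  have "star (X i) * e = star (X i)" "e * star (X i) = star (X i)" for i
    by (metis e_X e_star star_mult, metis X_e e_star star_mult)
  then show "e * letter X l = letter X l" "letter X l * e = letter X l"
    by (auto simp: letter_def e_X X_e split: prod.splits)
qed

lemma weval_e: "e * weval e X w = weval e X w" "weval e X w * e = weval e X w"
  by (cases w; simp add: weval_def e_idem mult.assoc[symmetric] letter_e)
     (induction w; simp add: weval_def e_idem mult.assoc)

lemma weval_append: "weval e X (u @ v) = weval e X u * weval e X v"
proof (induction u)
  case Nil
  then show ?case using weval_e(1)[of v] by (simp add: weval_def)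
next
  case (Cons l u)
  then show ?case by (simp add: weval_def mult.assoc)
qed

lemma weval_star: "weval e X (rev (map (\<lambda>(i, s). (i, \<not> s)) w)) = star (weval e X w)"
proof (induction w)
  case Nil
  then show ?case by (simp add: weval_def e_star)
next
  case (Cons l w)
  have "weval e X [(fst l, \<not> snd l)] = star (letter X l)"
    using letter_e(2)[of "(fst l, \<not> snd l)"] by (simp add: weval_def) (simp add: letter_def split: prod.splits)
  then show ?case using Cons by (simp add: weval_append case_prod_beta) (simp add: weval_def star_mult)
qed

lemma pev_expand: "pev e X p = (\<Sum>(c, w)\<leftarrow>expand p. scl c (weval e X w))"
proof (induction p)
  case One
  then show ?case by (simp add: weval_def)
next
  case (Var i)
  then show ?case using X_e by (simp add: weval_def letter_def)
next
  case (Times p q)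
  have 1: "(\<Sum>(c, w)\<leftarrow>map (\<lambda>(d, v). (c * d, u @ v)) ys. scl c (weval e X w)) =
      scl c (weval e X u) * (\<Sum>(c, w)\<leftarrow>ys. scl c (weval e X w))" for c u ys
    by (induction ys) (auto simp: weval_append distrib_left scl_add_right)
  have "(\<Sum>(c, w)\<leftarrow>concat (map (\<lambda>(c, u). map (\<lambda>(d, v). (c * d, u @ v)) ys) xs). scl c (weval e X w)) =
      (\<Sum>(c, w)\<leftarrow>xs. scl c (weval e X w)) * (\<Sum>(c, w)\<leftarrow>ys. scl c (weval e X w))" for xs ys
    by (induction xs) (auto simp: 1 distrib_right simp del: map_map)
  then show ?case using Times by simp
next
  case (Scale c p)
  have "(\<Sum>(c, w)\<leftarrow>map (\<lambda>(d, v). (c * d, v)) ys. scl c (weval e X w)) = scl c (\<Sum>(c, w)\<leftarrow>ys. scl c (weval e X w))" for ys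
    by (induction ys) (auto simp: scl_add_right)
  then show ?case using Scale by simp
next
  case (Adj p)
  have "(\<Sum>(c, w)\<leftarrow>map (\<lambda>(d, v). (cnj d, rev (map (\<lambda>(i, s). (i, \<not> s)) v))) ys. scl c (weval e X w)) =
      star (\<Sum>(c, w)\<leftarrow>ys. scl c (weval e X w))" for ys
    by (induction ys) (auto simp: star_add weval_star)
  then show ?case using Adj by simp
qed simp

lemma pev_e: "e * pev e X p = pev e X p" "pev e X p * e = pev e X p"
proof -
  have "e * (\<Sum>(c, w)\<leftarrow>ys. scl c (weval e X w)) = (\<Sum>(c, w)\<leftarrow>ys. scl c (weval e X w))"
    "(\<Sum>(c, w)\<leftarrow>ys. scl c (weval e X w)) * e = (\<Sum>(c, w)\<leftarrow>ys. scl c (weval e X w))" for ys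
    by (induction ys) (auto simp: distrib_left distrib_right weval_e)
  then show "e * pev e X p = pev e X p" "pev e X p * e = pev e X p" by (simp_all add: pev_expand)
qed

end

text \<open>Majorizes the operator norm of a polynomial at all tuples bounded by \<open>R\<close>,
  whatever the matrix size; the cutoff of the microstates enters through it.\<close>

fun bound :: "real \<Rightarrow> ncpoly \<Rightarrow> real" where
  "bound R One = 1"
| "bound R (Var i) = R"
| "bound R (Plus p q) = bound R p + bound R q"
| "bound R (Times p q) = bound R p * bound R q"
| "bound R (Scale c p) = cmod c * bound R p"
| "bound R (Adj p) = bound R p"

lemma opb_pev:
  assumes "eproj e" "\<And>i. opb R (X i)"
  shows "opb (bound R p) (pev e X p)"
  by (induction p) (auto intro: assms opb_eproj opb_add opb_mult opb_scl opb_star)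

section \<open>Bounded operators as a star algebra\<close>

text \<open>As an instance of \<open>complex_star_algebra\<close>, this type lets one evaluation
  function handle polynomials in operators and in matrices.\<close>

typedef (overloaded) 'h bop = "{a :: 'h::complex_hilbert_space \<Rightarrow> 'h. bounded_operator a}"
  morphisms op_of Bop
  using bounded_operator_id by blast

setup_lifting type_definition_bop

instantiation bop :: (complex_hilbert_space) complex_star_algebra
begin

lift_definition zero_bop :: "'a bop" is "\<lambda>v. 0" by (rule bounded_operator_zero)
lift_definition plus_bop :: "'a bop \<Rightarrow> 'a bop \<Rightarrow> 'a bop" is "\<lambda>a b v. a v + b v" by (rule bounded_operator_add)
lift_definition uminus_bop :: "'a bop \<Rightarrow> 'a bop" is "\<lambda>a v. (-1) *\<^sub>C a v" by (rule bounded_operator_scaleC)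
lift_definition minus_bop :: "'a bop \<Rightarrow> 'a bop \<Rightarrow> 'a bop" is "\<lambda>a b v. a v + (-1) *\<^sub>C b v"
  by (intro bounded_operator_add bounded_operator_scaleC)
lift_definition times_bop :: "'a bop \<Rightarrow> 'a bop \<Rightarrow> 'a bop" is "\<lambda>a b. a \<circ> b" by (rule bounded_operator_comp)
lift_definition scl_bop :: "complex \<Rightarrow> 'a bop \<Rightarrow> 'a bop" is "\<lambda>c a v. c *\<^sub>C a v" by (rule bounded_operator_scaleC)
lift_definition star_bop :: "'a bop \<Rightarrow> 'a bop" is adj by (rule adj_bounded)

instance
proof
  fix a b c :: "'a bop" and k l :: complex
  show "a + b + c = a + (b + c)" by transfer (simp add: add.assoc)
  show "a + b = b + a" by transfer (simp add: add.commute)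
  show "0 + a = a" by transfer simp
  show "- a + a = 0" by transfer (simp add: scaleC_minus1_left)
  show "a - b = a + - b" by transfer simp
  show "a * b * c = a * (b * c)" by transfer (simp add: comp_assoc)
  show "(a + b) * c = a * c + b * c" by transfer (simp add: fun_eq_iff)
  show "a * (b + c) = a * b + a * c" by transfer (simp add: fun_eq_iff bounded_operatorD(2))
  show "scl k (a + b) = scl k a + scl k b" by transfer (simp add: scaleC_add_right)
  show "scl (k + l) a = scl k a + scl l a" by transfer (simp add: scaleC_add_left)
  show "scl k (scl l a) = scl (k * l) a" by transfer (simp add: scaleC_scaleC)
  show "scl 1 a = a" by transfer simp
  show "scl k a * b = scl k (a * b)" by transfer (simp add: fun_eq_iff)
  show "a * scl k b = scl k (a * b)" by transfer (simp add: fun_eq_iff bounded_operatorD(3))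
  show "star (star a) = a" by transfer (rule adj_adj)
  show "star (a + b) = star a + star b" by transfer (rule adj_add)
  show "star (a * b) = star b * star a" by transfer (rule adj_comp)
  show "star (scl k a) = scl (cnj k) (star a)" by transfer (rule adj_scaleC)
qed

end

lift_definition id_bop :: "'h::complex_hilbert_space bop" is id by (rule bounded_operator_id)

lemma bop_eqI: "op_of a = op_of b \<Longrightarrow> a = b"
  by (simp add: op_of_inject)

lemma op_of_Bop: "bounded_operator a \<Longrightarrow> op_of (Bop a) = a"
  by (simp add: Bop_inverse)

definition bops :: "('h::complex_hilbert_space \<Rightarrow> 'h) set \<Rightarrow> 'h bop set" where
  "bops M = {a. op_of a \<in> M}"

lemma bops_closed:
  assumes "star_subalgebra M"
  shows "a \<in> bops M \<Longrightarrow> b \<in> bops M \<Longrightarrow> a + b \<in> bops M" "a \<in> bops M \<Longrightarrow> b \<in> bops M \<Longrightarrow> a * b \<in> bops M"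
    "a \<in> bops M \<Longrightarrow> scl c a \<in> bops M" "a \<in> bops M \<Longrightarrow> star a \<in> bops M" "0 \<in> bops M"
    "a \<in> bops M \<Longrightarrow> b \<in> bops M \<Longrightarrow> a - b \<in> bops M"
  unfolding bops_def mem_Collect_eq plus_bop.rep_eq times_bop.rep_eq scl_bop.rep_eq star_bop.rep_eq zero_bop.rep_eq minus_bop.rep_eq
  by (intro star_subalgebraD[OF assms]; assumption)+

lemma tracial_algebra_bops:
  assumes M: "star_subalgebra M" "id \<in> M" and tr: "tracial_state M \<tau>"
  shows "tracial_algebra (bops M) id_bop (\<lambda>a. \<tau> (op_of a))"
proof
  note t = tracial_stateD[OF tr]
  fix x y :: "'a bop" and c
  show "x \<in> bops M \<Longrightarrow> y \<in> bops M \<Longrightarrow> x + y \<in> bops M" by (rule bops_closed[OF M(1)])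
  show "x \<in> bops M \<Longrightarrow> y \<in> bops M \<Longrightarrow> x * y \<in> bops M" by (rule bops_closed[OF M(1)])
  show "x \<in> bops M \<Longrightarrow> scl c x \<in> bops M" by (rule bops_closed[OF M(1)])
  show "x \<in> bops M \<Longrightarrow> star x \<in> bops M" by (rule bops_closed[OF M(1)])
  show "id_bop \<in> bops M" using M(2) by (simp add: bops_def id_bop.rep_eq)
  show "id_bop * x = x" by transfer simp
  show "x * id_bop = x" by transfer simp
  show "\<tau> (op_of id_bop) = 1" using t(3) by (simp add: id_bop.rep_eq)
  assume x: "x \<in> bops M"
  then have xM: "op_of x \<in> M" by (simp add: bops_def)
  show "\<tau> (op_of (scl c x)) = c * \<tau> (op_of x)"
    unfolding scl_bop.rep_eq using t(2)[rule_format, OF xM] .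
  show "\<tau> (op_of (star x * x)) \<in> \<real>\<^sub>\<ge>\<^sub>0"
    unfolding times_bop.rep_eq star_bop.rep_eq using bspec[OF t(4) xM] .
  show "x = 0" if "\<tau> (op_of (star x * x)) = 0"
  proof (rule bop_eqI)
    show "op_of x = op_of 0"
      using bspec[OF t(6) xM] that unfolding times_bop.rep_eq star_bop.rep_eq zero_bop.rep_eq by (rule mp)
  qed
  assume y: "y \<in> bops M"
  then have yM: "op_of y \<in> M" by (simp add: bops_def)
  show "\<tau> (op_of (x + y)) = \<tau> (op_of x) + \<tau> (op_of y)"
    unfolding plus_bop.rep_eq using bspec[OF bspec[OF t(1) xM] yM] .
  show "\<tau> (op_of (x * y)) = \<tau> (op_of (y * x))"
    unfolding times_bop.rep_eq using bspec[OF bspec[OF t(5) xM] yM] .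
qed

section \<open>Dense star algebras: polynomials in the generators, and unions of finite-dimensional
  algebras\<close>

lemma n2_dense_bops:
  fixes M :: "('h::complex_hilbert_space \<Rightarrow> 'h) set"
  assumes M: "star_subalgebra M" "id \<in> M" and tr: "tracial_state M \<tau>"
    and A: "star_subalgebra A" "id \<in> A" "A \<subseteq> M" "M \<subseteq> commutant (commutant A)"
  shows "tracial_algebra.n2_dense (bops M) (\<lambda>a. \<tau> (op_of a)) (bops A)"
proof -
  interpret ta: tracial_algebra "bops M" id_bop "\<lambda>a. \<tau> (op_of a)"
    by (rule tracial_algebra_bops[OF M tr])
  have "\<exists>p\<in>bops A. \<forall>(b, c)\<in>F. ta.n2 (b * (p - a) * c) < \<epsilon>"
    if a: "a \<in> bops M" and F: "F \<subseteq> bops M \<times> bops M" "finite F" and \<epsilon>: "\<epsilon> > 0" for a F \<epsilon>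
  proof -
    have aM: "op_of a \<in> M" using a by (simp add: bops_def)
    define F' where "F' = map_prod op_of op_of ` F"
    have F': "finite F'" "F' \<subseteq> M \<times> M" using F by (auto simp: F'_def bops_def)
    obtain p where p: "p \<in> A" "\<forall>(b, d)\<in>F'. cmod (\<tau> (adj (b \<circ> (\<lambda>v. p v + (-1) *\<^sub>C op_of a v) \<circ> d) \<circ>
        (b \<circ> (\<lambda>v. p v + (-1) *\<^sub>C op_of a v) \<circ> d))) < \<epsilon>"
      using trace_approximation[OF M(1) tr A(1-3) aM subsetD[OF A(4) aM] F' \<epsilon>] by (elim bexE)
    have pb: "bounded_operator p" by (rule star_subalgebraD(1)[OF A(1) p(1)])
    have "ta.n2 (b * (Bop p - a) * c) < \<epsilon>" if bc: "(b, c) \<in> F" for b c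
    proof -
      have "(op_of b, op_of c) \<in> F'" unfolding F'_def by (rule image_eqI[OF _ bc]) simp
      from bspec[OF p(2) this]
      have "cmod (\<tau> (op_of (star (b * (Bop p - a) * c) * (b * (Bop p - a) * c)))) < \<epsilon>"
        unfolding times_bop.rep_eq star_bop.rep_eq minus_bop.rep_eq op_of_Bop[OF pb] prod.case .
      then show ?thesis unfolding ta.n2_def using complex_Re_le_cmod le_less_trans by blast
    qed
    moreover have "Bop p \<in> bops A" using p(1) by (simp add: bops_def op_of_Bop[OF pb])
    ultimately show ?thesis by blast
  qed
  moreover have "bops A \<subseteq> bops M" using A(3) by (auto simp: bops_def)
  ultimately show ?thesis unfolding ta.n2_dense_def by blast
qed

lemma star_subalgebra_op_of:
  assumes "0 \<in> S" "\<And>a b. a \<in> S \<Longrightarrow> b \<in> S \<Longrightarrow> a + b \<in> S" "\<And>a b. a \<in> S \<Longrightarrow> b \<in> S \<Longrightarrow> a * b \<in> S"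
    "\<And>a c. a \<in> S \<Longrightarrow> scl c a \<in> S" "\<And>a. a \<in> S \<Longrightarrow> star a \<in> S"
  shows "star_subalgebra (op_of ` S)" "bops (op_of ` S) = S"
proof -
  show "bops (op_of ` S) = S" by (auto simp: bops_def op_of_inject)
  show "star_subalgebra (op_of ` S)"
    unfolding star_subalgebra_def
  proof (intro conjI ballI allI)
    show "(\<lambda>v. 0) \<in> op_of ` S" unfolding zero_bop.rep_eq[symmetric] by (rule imageI[OF assms(1)])
    fix a assume "a \<in> op_of ` S"
    then obtain x where x: "x \<in> S" "a = op_of x" by blast
    show "bounded_operator a" using op_of[of x] x by simp
    show "adj a \<in> op_of ` S" unfolding x(2) star_bop.rep_eq[symmetric] by (intro imageI assms x)
    show "(\<lambda>v. c *\<^sub>C a v) \<in> op_of ` S" for c unfolding x(2) scl_bop.rep_eq[symmetric] by (intro imageI assms x)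
    fix b assume "b \<in> op_of ` S"
    then obtain y where y: "y \<in> S" "b = op_of y" by blast
    show "(\<lambda>v. a v + b v) \<in> op_of ` S" unfolding x(2) y(2) plus_bop.rep_eq[symmetric] by (intro imageI assms x y)
    show "a \<circ> b \<in> op_of ` S" unfolding x(2) y(2) times_bop.rep_eq[symmetric] by (intro imageI assms x y)
  qed
qed

text \<open>The value 0 beyond the list makes every polynomial meaningful. As \<open>mfam\<close>
  follows the same rule, words with a letter out of range vanish for operators and matrices
  alike.\<close>

definition family :: "('h::complex_hilbert_space \<Rightarrow> 'h) list \<Rightarrow> nat \<Rightarrow> 'h bop" where
  "family xs i = (if i < length xs then Bop (xs ! i) else 0)"

text \<open>The values of polynomials form a unital star algebra that contains the generators, so
  its bicommutant contains \<open>M\<close> and ultrastrong density applies.\<close>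

lemma polynomials_n2_dense:
  fixes M :: "('h::complex_hilbert_space \<Rightarrow> 'h) set"
  assumes M: "von_neumann_algebra M" and tr: "tracial_state M \<tau>" and xs: "generating_family M xs"
  shows "tracial_algebra.n2_dense (bops M) (\<lambda>a. \<tau> (op_of a)) (range (pev id_bop (family xs)))"
proof -
  note Ms = von_neumann_star_subalgebra[OF M]
  define S where "S = range (pev id_bop (family xs))"
  have cl: "a + b \<in> S" "a * b \<in> S" "scl c a \<in> S" "star a \<in> S" if ab: "a \<in> S" "b \<in> S" for a b c
  proof -
    obtain p q where "a = pev id_bop (family xs) p" "b = pev id_bop (family xs) q" using ab by (auto simp: S_def)
    then have "a + b = pev id_bop (family xs) (Plus p q)" "a * b = pev id_bop (family xs) (Times p q)"
      "scl c a = pev id_bop (family xs) (Scale c p)" "star a = pev id_bop (family xs) (Adj p)" by simp_all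
    then show "a + b \<in> S" "a * b \<in> S" "scl c a \<in> S" "star a \<in> S" unfolding S_def by blast+
  qed
  have "pev id_bop (family xs) One \<in> S" unfolding S_def by blast
  then have idS: "id_bop \<in> S" by simp
  have zS: "0 \<in> S" using cl(3)[OF idS idS, of 0] by simp
  have SA1: "star_subalgebra (op_of ` S)" by (rule star_subalgebra_op_of) (blast intro: zS cl idS)+
  have SA2: "bops (op_of ` S) = S" by (rule star_subalgebra_op_of) (blast intro: zS cl idS)+
  note SA = SA1 SA2
  have idA: "id \<in> op_of ` S" using imageI[OF idS, of op_of] by (simp add: id_bop.rep_eq)
  have xM: "xs ! i \<in> M" if "i < length xs" for i using xs that by (auto simp: generating_family_def)
  have xb: "bounded_operator (xs ! i)" if "i < length xs" for i using star_subalgebraD(1)[OF Ms(1) xM[OF that]] .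
  have "pev id_bop (family xs) p \<in> bops M" for p
  proof (induction p)
    case One
    show ?case using Ms(2) by (simp add: bops_def id_bop.rep_eq)
  next
    case (Var i)
    show ?case using xM xb bops_closed(5)[OF Ms(1)] by (simp add: family_def) (simp add: bops_def op_of_Bop)
  qed (simp_all add: bops_closed[OF Ms(1)])
  then have AM: "op_of ` S \<subseteq> M" by (auto simp: S_def bops_def)
  have "set xs \<subseteq> op_of ` S"
  proof
    fix x assume "x \<in> set xs"
    then obtain i where i: "i < length xs" "x = xs ! i" by (auto simp: in_set_conv_nth)
    have "pev id_bop (family xs) (Var i) \<in> S" unfolding S_def by blast
    moreover have "op_of (pev id_bop (family xs) (Var i)) = x" using i xb by (simp add: family_def op_of_Bop)
    ultimately show "x \<in> op_of ` S" by blast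
  qed
  from hull_subset_bicommutant[OF SA(1) this]
  have "M \<subseteq> commutant (commutant (op_of ` S))" using xs by (simp add: generating_family_def)
  from n2_dense_bops[OF Ms tr SA(1) idA AM this]
  have "tracial_algebra.n2_dense (bops M) (\<lambda>a. \<tau> (op_of a)) S" unfolding SA(2) .
  then show ?thesis unfolding S_def .
qed

text \<open>The algebras \<open>N i\<close> need not contain the identity; adding its multiples
  gives finite-dimensional unital star algebras \<open>U i\<close>. The bicommutant of their union
  contains \<open>M\<close>, so the \<open>x j\<close> have approximants in the union, and these
  finitely many elements lie in one \<open>U i\<close>.\<close>

lemma finite_dim_approximation:
  fixes M :: "('h::complex_hilbert_space \<Rightarrow> 'h) set" and x :: "nat \<Rightarrow> 'h bop"
  assumes M: "von_neumann_algebra M" "hyperfinite M" and tr: "tracial_state M \<tau>"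
    and x: "\<And>j. j < n \<Longrightarrow> x j \<in> bops M" and \<delta>: "\<delta> > 0"
  shows "\<exists>vs y. set vs \<subseteq> bops M \<and> id_bop \<in> cspan (set vs) \<and>
    (\<forall>a\<in>cspan (set vs). \<forall>b\<in>cspan (set vs). a * b \<in> cspan (set vs)) \<and>
    (\<forall>a\<in>cspan (set vs). star a \<in> cspan (set vs)) \<and>
    (\<forall>j<n. y j \<in> cspan (set vs) \<and> Re (\<tau> (op_of (star (x j - y j) * (x j - y j)))) < \<delta>)"
proof -
  note Ms = von_neumann_star_subalgebra[OF M(1)]
  interpret ta: tracial_algebra "bops M" id_bop "\<lambda>a. \<tau> (op_of a)"
    by (rule tracial_algebra_bops[OF Ms tr])
  have idl [simp]: "id_bop * a = a" "a * id_bop = a" for a :: "'h bop"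
    by (transfer, simp)+
  obtain N where N: "\<And>i. star_subalgebra (N i)" "\<And>i. finite_dim (N i)" "\<And>i. N i \<subseteq> N (Suc i)"
    "von_neumann_algebra hull (\<Union>i. N i) = M"
    using M(2) unfolding hyperfinite_def by auto
  have NM: "N i \<subseteq> M" for i using N(4) hull_subset[of "\<Union>i. N i" von_neumann_algebra] by blast
  have mono: "N i \<subseteq> N j" if "i \<le> j" for i j using lift_Suc_mono_le[of N] N(3) that by blast
  define U where "U i = {a + scl c id_bop | a c. a \<in> bops (N i)}" for i
  note bc = bops_closed[OF N(1)]
  have Uc: "a + b \<in> U i" "a * b \<in> U i" "scl c a \<in> U i" "star a \<in> U i"
    if ab: "a \<in> U i" "b \<in> U i" for a b c i
  proof -
    obtain a' s b' t where ab': "a' \<in> bops (N i)" "a = a' + scl s id_bop" "b' \<in> bops (N i)" "b = b' + scl t id_bop"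
      using ab by (auto simp: U_def)
    have I: "z \<in> U i" if "z = w + scl k id_bop" "w \<in> bops (N i)" for z w k using that by (auto simp: U_def)
    show "a + b \<in> U i" by (rule I[of _ "a' + b'" "s + t"]) (use ab' in \<open>auto simp: scl_add_left intro!: bc\<close>)
    show "a * b \<in> U i"
      by (rule I[of _ "a' * b' + scl t a' + scl s b'" "s * t"])
         (use ab' in \<open>auto simp: algebra_simps scl_add_right intro!: bc\<close>)
    show "scl c a \<in> U i" by (rule I[of _ "scl c a'" "c * s"]) (use ab' in \<open>auto simp: scl_add_right intro!: bc\<close>)
    show "star a \<in> U i" by (rule I[of _ "star a'" "cnj s"]) (use ab' in \<open>auto simp: star_add intro!: bc\<close>)
  qed
  have U0: "bops (N i) \<subseteq> U i" "id_bop \<in> U i" for i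
  proof -
    have "a = a + scl 0 id_bop" for a :: "'h bop" by simp
    then show "bops (N i) \<subseteq> U i" unfolding U_def by blast
    have "id_bop = 0 + scl 1 id_bop" by simp
    then show "id_bop \<in> U i" unfolding U_def using bc(5)[of i] by blast
  qed
  have Umono: "U i \<subseteq> U j" if "i \<le> j" for i j using mono[OF that] by (auto simp: U_def bops_def)
  have UM: "U i \<subseteq> bops M" for i
  proof
    fix z assume "z \<in> U i"
    then obtain a c where a: "a \<in> bops (N i)" "z = a + scl c id_bop" by (auto simp: U_def)
    have "a \<in> bops M" using a(1) NM[of i] by (auto simp: bops_def)
    then show "z \<in> bops M" unfolding a(2) by (intro ta.M_add ta.M_scl ta.M_one)
  qed
  define S where "S = (\<Union>i. U i)"
  have two: "\<exists>i. a \<in> U i \<and> b \<in> U i" if ab: "a \<in> S" "b \<in> S" for a b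
  proof -
    obtain i j where "a \<in> U i" "b \<in> U j" using ab by (auto simp: S_def)
    then show ?thesis using Umono[of i "max i j"] Umono[of j "max i j"] by auto
  qed
  have Sc: "a + b \<in> S" "a * b \<in> S" "scl c a \<in> S" "star a \<in> S" if ab: "a \<in> S" "b \<in> S" for a b c
  proof -
    obtain i where i: "a \<in> U i" "b \<in> U i" using two[OF ab] by blast
    have "U i \<subseteq> S" by (auto simp: S_def)
    then show "a + b \<in> S" "a * b \<in> S" "scl c a \<in> S" "star a \<in> S" using Uc[OF i] by auto
  qed
  have idS: "id_bop \<in> S" using U0(2) by (auto simp: S_def)
  have zS: "0 \<in> S" using Sc(3)[OF idS idS, of 0] by simp
  have SA1: "star_subalgebra (op_of ` S)" by (rule star_subalgebra_op_of) (blast intro: zS Sc idS)+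
  have SA2: "bops (op_of ` S) = S" by (rule star_subalgebra_op_of) (blast intro: zS Sc idS)+
  note SA = SA1 SA2
  have idA: "id \<in> op_of ` S" using imageI[OF idS, of op_of] by (simp add: id_bop.rep_eq)
  have AM: "op_of ` S \<subseteq> M" using UM by (auto simp: S_def bops_def)
  have "(\<Union>i. N i) \<subseteq> op_of ` S"
  proof
    fix a assume "a \<in> (\<Union>i. N i)"
    then obtain i where i: "a \<in> N i" by blast
    have o: "op_of (Bop a) = a" by (rule op_of_Bop[OF star_subalgebraD(1)[OF N(1) i]])
    then have "Bop a \<in> bops (N i)" using i by (simp add: bops_def)
    then have "Bop a \<in> S" using U0(1)[of i] unfolding S_def by blast
    then show "a \<in> op_of ` S" using o by (metis imageI)
  qed
  from hull_subset_bicommutant[OF SA(1) this]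
  have "M \<subseteq> commutant (commutant (op_of ` S))" by (simp add: N(4))
  from n2_dense_bops[OF Ms tr SA(1) idA AM this]
  have dense: "ta.n2_dense S" unfolding SA(2) .
  have "\<exists>y\<in>S. ta.n2 (y - x j) < \<delta>" if j: "j < n" for j
  proof -
    have F: "{(id_bop, id_bop)} \<subseteq> bops M \<times> bops M" using ta.M_one by simp
    have "\<exists>p\<in>S. \<forall>(b, c)\<in>{(id_bop, id_bop)}. ta.n2 (b * (p - x j) * c) < \<delta>"
      using dense x[OF j] F \<delta> unfolding ta.n2_dense_def by blast
    then show ?thesis by simp
  qed
  then obtain y where y: "\<And>j. j < n \<Longrightarrow> y j \<in> S" "\<And>j. j < n \<Longrightarrow> ta.n2 (y j - x j) < \<delta>" by metis
  have "\<exists>i. \<forall>j<n. y j \<in> U i"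
  proof -
    have "\<exists>i. y j \<in> U i" if "j < n" for j using y(1)[OF that] by (auto simp: S_def)
    then obtain ix where ix: "\<And>j. j < n \<Longrightarrow> y j \<in> U (ix j)" by metis
    \<comment> \<open>The sum of the indices dominates each of them, and the sequence
      increases.\<close>
    have "y j \<in> U (\<Sum>j<n. ix j)" if "j < n" for j
      using ix[OF that] Umono[of "ix j" "\<Sum>j<n. ix j"] member_le_sum[of j "{..<n}" ix] that by auto
    then show ?thesis by blast
  qed
  then obtain i where i: "\<And>j. j < n \<Longrightarrow> y j \<in> U i" by blast
  obtain F where F: "finite F" "N i = {\<lambda>v. \<Sum>b\<in>F. c b *\<^sub>C b v | c. True}" using N(2)[of i] unfolding finite_dim_def by blast
  have FN: "b \<in> N i" if "b \<in> F" for b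
  proof -
    \<comment> \<open>Coefficients concentrated at \<open>b\<close> show that the spanning set
      itself lies in \<open>N i\<close>.\<close>
    have "(\<lambda>v. \<Sum>b'\<in>F. (if b' = b then 1 else 0) *\<^sub>C b' v) = b"
    proof
      fix v
      have "(\<Sum>b'\<in>F. (if b' = b then 1 else 0) *\<^sub>C b' v) = (\<Sum>b'\<in>F. if b' = b then b v else 0)"
        by (rule sum.cong) auto
      then show "(\<Sum>b'\<in>F. (if b' = b then 1 else 0) *\<^sub>C b' v) = b v" using F(1) that by simp
    qed
    then show ?thesis unfolding F(2) mem_Collect_eq by (intro exI[of _ "\<lambda>b'. if b' = b then 1 else 0"]) simp
  qed
  have Fb: "op_of (Bop b) = b" if "b \<in> F" for b by (rule op_of_Bop[OF star_subalgebraD(1)[OF N(1) FN[OF that]]])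
  obtain fs where fs: "set fs = F" using finite_list[OF F(1)] by blast
  define vs where "vs = id_bop # map Bop fs"
  have UV: "U i = cspan (set vs)"
  proof
    show "cspan (set vs) \<subseteq> U i"
    proof
      fix a assume "a \<in> cspan (set vs)"
      then show "a \<in> U i"
      proof induction
        case (cspan_base a)
        then show ?case using U0[of i] fs FN Fb by (auto simp: vs_def bops_def)
      qed (use Uc U0(1)[of i] bc(5) in blast)+
    qed
    show "U i \<subseteq> cspan (set vs)"
    proof
      fix z assume "z \<in> U i"
      then obtain a c where a: "a \<in> bops (N i)" "z = a + scl c id_bop" by (auto simp: U_def)
      obtain k where k: "op_of a = (\<lambda>v. \<Sum>b\<in>F. k b *\<^sub>C b v)" using a(1) unfolding bops_def F(2) by auto
      have os: "op_of (\<Sum>b\<in>G. scl (k b) (Bop b)) = (\<lambda>v. \<Sum>b\<in>G. k b *\<^sub>C b v)" if "G \<subseteq> F" for G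
        using finite_subset[OF that F(1)] that
        by (induction G rule: finite_induct) (auto simp: zero_bop.rep_eq plus_bop.rep_eq scl_bop.rep_eq Fb)
      have "a = (\<Sum>b\<in>F. scl (k b) (Bop b))" by (rule bop_eqI) (simp add: k os)
      also have "\<dots> \<in> cspan (set vs)" using fs by (intro cspan_sum cspan_scl cspan_base) (auto simp: vs_def)
      finally have aV: "a \<in> cspan (set vs)" .
      have idV: "id_bop \<in> cspan (set vs)" by (rule cspan_base) (simp add: vs_def)
      show "z \<in> cspan (set vs)" unfolding a(2) by (rule cspan_add[OF aV cspan_scl[OF idV]])
    qed
  qed
  have "Re (\<tau> (op_of (star (x j - y j) * (x j - y j)))) < \<delta>" if "j < n" for j
  proof -
    have m: "y j - x j \<in> bops M" using i[OF that] UM x[OF that] by (intro ta.form.S_diff) auto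
    have "ta.n2 (scl (-1) (y j - x j)) = ta.n2 (y j - x j)" by (simp add: ta.n2_scl[OF m])
    moreover have "scl (-1) (y j - x j) = x j - y j" by (simp add: scl_minus_left)
    ultimately show ?thesis using y(2)[OF that] by (simp add: ta.n2_def)
  qed
  moreover have "set vs \<subseteq> bops M" using UM[of i] cspan_base[of _ "set vs"] unfolding UV by blast
  ultimately show ?thesis using U0(2)[of i] Uc[of _ i] i unfolding UV
    by (intro exI[of _ vs] exI[of _ y] conjI) auto
qed

section \<open>Matrices as finitely supported matrices\<close>

definition fm :: "complex mat \<Rightarrow> nat fmat" where
  "fm A = Abs_fmat (\<lambda>i j. if i < dim_row A \<and> j < dim_col A then A $$ (i, j) else 0)"

lemma ent_fm: "ent (fm A) i j = (if i < dim_row A \<and> j < dim_col A then A $$ (i, j) else 0)"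
proof -
  have "finite {(i, j). (if i < dim_row A \<and> j < dim_col A then A $$ (i, j) else 0) \<noteq> 0}"
    by (rule finite_subset[of _ "{..<dim_row A} \<times> {..<dim_col A}"]) (auto split: if_splits)
  then show ?thesis unfolding fm_def by (subst Abs_fmat_inverse) auto
qed

lemma idx_fm: "A \<in> carrier_mat k k \<Longrightarrow> idx (fm A) \<subseteq> {..<k}"
  by (auto simp: idx_def ent_fm split: if_splits)

lemma fm_inject: "A \<in> carrier_mat k k \<Longrightarrow> B \<in> carrier_mat k k \<Longrightarrow> fm A = fm B \<Longrightarrow> A = B"
proof (rule eq_matI)
  fix i j
  assume AB: "A \<in> carrier_mat k k" "B \<in> carrier_mat k k" "fm A = fm B" and ij: "i < dim_row B" "j < dim_col B"
  have "ent (fm A) i j = ent (fm B) i j" by (simp only: AB(3))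
  then show "A $$ (i, j) = B $$ (i, j)" using AB(1,2) ij by (simp add: ent_fm)
qed auto

lemma fm_mult: "A \<in> carrier_mat k k \<Longrightarrow> B \<in> carrier_mat k k \<Longrightarrow> fm (A * B) = fm A * fm B"
proof (rule fmat_eqI)
  fix i j
  assume A: "A \<in> carrier_mat k k" and B: "B \<in> carrier_mat k k"
  have e: "ent (fm A * fm B) i j = (\<Sum>l<k. ent (fm A) i l * ent (fm B) l j)"
    by (rule ent_times) (use idx_fm[OF A] in auto)
  show "ent (fm (A * B)) i j = ent (fm A * fm B) i j"
  proof (cases "i < k \<and> j < k")
    case True
    then show ?thesis unfolding e using A B by (auto simp: ent_fm scalar_prod_def atLeast0LessThan)
  next
    case False
    then show ?thesis unfolding e using A B by (auto simp: ent_fm intro!: sum.neutral[symmetric])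
  qed
qed

lemma adjoint_index:
  assumes "A \<in> carrier_mat k k" "i < k" "j < k"
  shows "mat_adjoint A $$ (i, j) = cnj (A $$ (j, i))"
  using assms unfolding mat_adjoint_def by (simp add: mat_of_rows_def conjugate_vec_def)

lemma adjoint_carrier: "A \<in> carrier_mat k k \<Longrightarrow> mat_adjoint A \<in> carrier_mat k k"
  by (auto simp: mat_adjoint_def)

lemma fm_adjoint: "A \<in> carrier_mat k k \<Longrightarrow> fm (mat_adjoint A) = star (fm A)"
  by (rule fmat_eqI) (use adjoint_carrier[of A k] in \<open>auto simp: ent_fm adjoint_index\<close>)

lemma fm_one: "fm (1\<^sub>m k) = one_on {..<k}"
  by (rule fmat_eqI) (auto simp: ent_fm ent_one_on)

lemma fm_minus: "A \<in> carrier_mat k k \<Longrightarrow> B \<in> carrier_mat k k \<Longrightarrow> fm (A - B) = fm A - fm B"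
  by (rule fmat_eqI) (auto simp: ent_fm)

lemma fm_corner: "A \<in> carrier_mat k k \<Longrightarrow> one_on {..<k} * fm A = fm A" "A \<in> carrier_mat k k \<Longrightarrow> fm A * one_on {..<k} = fm A"
  by (auto intro!: fmat_eqI simp: ent_one_on_left ent_one_on_right ent_fm)

lemma ntrace_fm: "A \<in> carrier_mat k k \<Longrightarrow> ntrace A = tr (fm A) / of_nat k"
proof -
  assume A: "A \<in> carrier_mat k k"
  have "tr (fm A) = (\<Sum>i<k. ent (fm A) i i)" by (rule tr_eq) (use A in \<open>auto simp: ent_fm split: if_splits\<close>)
  then show ?thesis using A by (simp add: ntrace_def ent_fm)
qed

lemma ex_fm:
  assumes "one_on {..<k} * W = W" "W * one_on {..<k} = W"
  shows "\<exists>A\<in>carrier_mat k k. fm A = W"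
proof (rule bexI)
  let ?A = "mat k k (\<lambda>(i, j). ent W i j)"
  show "?A \<in> carrier_mat k k" by simp
  show "fm ?A = W"
  proof (rule fmat_eqI)
    fix i j
    have "ent W i j = ent (one_on {..<k} * (W * one_on {..<k})) i j" using assms by simp
    also have "\<dots> = (if i < k \<and> j < k then ent W i j else 0)" by (simp add: ent_one_on_left ent_one_on_right)
    finally show "ent (fm ?A) i j = ent W i j" by (auto simp: ent_fm)
  qed
qed

text \<open>The supremum in \<open>mat_opnorm\<close> yields a bound only once its set is known to
  be bounded above, which row sums of moduli show. Scaling carries the bound from the unit ball to
  all vectors.\<close>

lemma mat_opnorm_apply:
  assumes A: "A \<in> carrier_mat k k" and R: "mat_opnorm A \<le> R" and v: "v \<in> carrier_vec k"
  shows "vec_norm2 (A *\<^sub>v v) \<le> R * vec_norm2 v"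
proof -
  define S where "S = {v \<in> carrier_vec (dim_col A). vec_norm2 v \<le> 1}"
  have nn: "vec_norm2 w \<ge> 0" for w by (simp add: vec_norm2_def sum_nonneg)
  have hom: "vec_norm2 (complex_of_real c \<cdot>\<^sub>v w) = \<bar>c\<bar> * vec_norm2 w" for c w
  proof -
    have "(\<Sum>i<dim_vec w. (cmod (vec_index (complex_of_real c \<cdot>\<^sub>v w) i))\<^sup>2) = c\<^sup>2 * (\<Sum>i<dim_vec w. (cmod (vec_index w i))\<^sup>2)"
      unfolding sum_distrib_left by (rule sum.cong) (auto simp: norm_mult power_mult_distrib)
    then show ?thesis by (simp add: vec_norm2_def real_sqrt_mult)
  qed
  have bdd: "bdd_above ((\<lambda>v. vec_norm2 (A *\<^sub>v v)) ` S)"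
  proof (rule bdd_aboveI2)
    fix w assume w: "w \<in> S"
    then have wd: "dim_vec w = k" "vec_norm2 w \<le> 1" using A by (auto simp: S_def)
    have w1: "cmod (vec_index w j) \<le> 1" if "j < k" for j
    proof -
      have "(cmod (vec_index w j))\<^sup>2 \<le> (\<Sum>i<k. (cmod (vec_index w i))\<^sup>2)"
        using member_le_sum[of j "{..<k}" "\<lambda>i. (cmod (vec_index w i))\<^sup>2"] that by simp
      also have "\<dots> \<le> 1"
      proof -
        have "sqrt (\<Sum>i<k. (cmod (vec_index w i))\<^sup>2) \<le> 1" using wd by (simp add: vec_norm2_def)
        then show ?thesis by simp
      qed
      finally have "(cmod (vec_index w j))\<^sup>2 \<le> 1\<^sup>2" by simp
      then show ?thesis by (rule power2_le_imp_le) simp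
    qed
    show "vec_norm2 (A *\<^sub>v w) \<le> sqrt (\<Sum>i<k. (\<Sum>j<k. cmod (A $$ (i, j)))\<^sup>2)"
      unfolding vec_norm2_def
    proof (rule real_sqrt_le_mono)
      have d: "dim_vec (A *\<^sub>v w) = k" using A by simp
      show "(\<Sum>i<dim_vec (A *\<^sub>v w). (cmod (vec_index (A *\<^sub>v w) i))\<^sup>2) \<le> (\<Sum>i<k. (\<Sum>j<k. cmod (A $$ (i, j)))\<^sup>2)"
        unfolding d
      proof (rule sum_mono, rule power_mono)
        fix i assume i: "i \<in> {..<k}"
        have "vec_index (A *\<^sub>v w) i = (\<Sum>j<k. A $$ (i, j) * vec_index w j)"
          using A wd i by (auto simp: scalar_prod_def atLeast0LessThan)
        also have "cmod \<dots> \<le> (\<Sum>j<k. cmod (A $$ (i, j)) * cmod (vec_index w j))"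
          by (rule order_trans[OF norm_sum]) (simp add: norm_mult)
        also have "\<dots> \<le> (\<Sum>j<k. cmod (A $$ (i, j)))"
          by (rule sum_mono, rule mult_left_le) (use w1 in auto)
        finally show "cmod (vec_index (A *\<^sub>v w) i) \<le> (\<Sum>j<k. cmod (A $$ (i, j)))" .
      qed simp
    qed
  qed
  show ?thesis
  proof (cases "vec_norm2 v = 0")
    case True
    have "(\<Sum>i<k. (cmod (vec_index v i))\<^sup>2) = 0" using True v by (simp add: vec_norm2_def)
    then have "vec_index v i = 0" if "i < k" for i using that by (simp add: sum_nonneg_eq_0_iff)
    then have "v = 0\<^sub>v k" using v by (intro eq_vecI) auto
    then have "A *\<^sub>v v = 0\<^sub>v k" using A by (intro eq_vecI) (auto simp: scalar_prod_def)
    then show ?thesis using True by (simp add: vec_norm2_def)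
  next
    case False
    define c where "c = vec_norm2 v"
    have c: "c > 0" using False nn[of v] by (simp add: c_def)
    define w where "w = complex_of_real (1 / c) \<cdot>\<^sub>v v"
    have "vec_norm2 w = 1" unfolding w_def hom using c by (simp add: c_def[symmetric])
    moreover have "w \<in> carrier_vec (dim_col A)" using v A by (simp add: w_def)
    ultimately have "w \<in> S" by (simp add: S_def)
    then have "vec_norm2 (A *\<^sub>v w) \<le> mat_opnorm A"
      unfolding mat_opnorm_def S_def[symmetric] by (rule cSUP_upper[OF _ bdd])
    moreover have "A *\<^sub>v w = complex_of_real (1 / c) \<cdot>\<^sub>v (A *\<^sub>v v)"
      unfolding w_def using A v by (rule mult_mat_vec)
    ultimately have "vec_norm2 (complex_of_real (1 / c) \<cdot>\<^sub>v (A *\<^sub>v v)) \<le> R" using R by simp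
    then have "1 / c * vec_norm2 (A *\<^sub>v v) \<le> R" unfolding hom using c by simp
    then show ?thesis using c by (simp add: c_def[symmetric] field_simps)
  qed
qed

text \<open>The squared norm is a sum over columns, to each of which the bound for vectors
  applies.\<close>

lemma opb_fm:
  assumes A: "A \<in> carrier_mat k k" and R: "mat_opnorm A \<le> R" "R \<ge> 0"
  shows "opb R (fm A)"
  unfolding opb_def
proof (intro conjI allI R)
  fix X
  define J where "J = {..<k} \<union> idx X"
  have J: "finite J" "idx X \<subseteq> J" "{..<k} \<subseteq> J" by (auto simp: J_def)
  have e: "ent (fm A * X) i b = (if i < k then \<Sum>l<k. A $$ (i, l) * ent X l b else 0)" for i b
  proof -
    have "ent (fm A * X) i b = (\<Sum>l<k. ent (fm A) i l * ent X l b)"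
      by (rule ent_times) (use idx_fm[OF A] in auto)
    also have "\<dots> = (\<Sum>l<k. if i < k then A $$ (i, l) * ent X l b else 0)"
      by (rule sum.cong) (use A in \<open>auto simp: ent_fm\<close>)
    finally show ?thesis by simp
  qed
  have iJ: "idx (fm A * X) \<subseteq> J"
  proof
    fix t assume "t \<in> idx (fm A * X)"
    then obtain s where "ent (fm A * X) s t \<noteq> 0 \<or> ent (fm A * X) t s \<noteq> 0" by (auto simp: idx_def)
    moreover have "s < k \<and> t \<in> idx X" if n: "ent (fm A * X) s t \<noteq> 0" for s t
    proof -
      have "s < k" "(\<Sum>l<k. A $$ (s, l) * ent X l t) \<noteq> 0" using n unfolding e by (auto split: if_splits)
      then obtain l where "A $$ (s, l) * ent X l t \<noteq> 0" by (meson sum.neutral)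
      then show ?thesis using \<open>s < k\<close> by (auto dest: ent_idx)
    qed
    ultimately show "t \<in> J" by (auto simp: J_def)
  qed
  have col: "(\<Sum>i\<in>J. (cmod (ent (fm A * X) i b))\<^sup>2) \<le> R\<^sup>2 * (\<Sum>i\<in>J. (cmod (ent X i b))\<^sup>2)" for b
  proof -
    define v where "v = vec k (\<lambda>l. ent X l b)"
    have v: "v \<in> carrier_vec k" by (simp add: v_def)
    have "(\<Sum>i\<in>J. (cmod (ent (fm A * X) i b))\<^sup>2) = (\<Sum>i<k. (cmod (ent (fm A * X) i b))\<^sup>2)"
      by (rule sum.mono_neutral_right[OF J(1,3)]) (auto simp: e)
    also have "\<dots> = (\<Sum>i<k. (cmod (vec_index (A *\<^sub>v v) i))\<^sup>2)"
      by (rule sum.cong) (use A in \<open>auto simp: e v_def scalar_prod_def atLeast0LessThan\<close>)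
    also have "\<dots> = (vec_norm2 (A *\<^sub>v v))\<^sup>2" using A by (simp add: vec_norm2_def sum_nonneg)
    also have "\<dots> \<le> (R * vec_norm2 v)\<^sup>2"
      by (rule power_mono[OF mat_opnorm_apply[OF A R(1) v]]) (simp add: vec_norm2_def sum_nonneg)
    also have "\<dots> = R\<^sup>2 * (\<Sum>i<k. (cmod (ent X i b))\<^sup>2)"
      by (simp add: vec_norm2_def sum_nonneg power_mult_distrib v_def)
    also have "\<dots> \<le> R\<^sup>2 * (\<Sum>i\<in>J. (cmod (ent X i b))\<^sup>2)"
      by (intro mult_left_mono sum_mono2 J) auto
    finally show ?thesis .
  qed
  have "(norm (fm A * X))\<^sup>2 = (\<Sum>b\<in>J. \<Sum>i\<in>J. (cmod (ent (fm A * X) i b))\<^sup>2)"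
    unfolding norm2_ent[OF J(1) iJ] by (rule sum.swap)
  also have "\<dots> \<le> (\<Sum>b\<in>J. R\<^sup>2 * (\<Sum>i\<in>J. (cmod (ent X i b))\<^sup>2))" by (rule sum_mono[OF col])
  also have "\<dots> = R\<^sup>2 * (\<Sum>b\<in>J. \<Sum>i\<in>J. (cmod (ent X i b))\<^sup>2)" by (simp add: sum_distrib_left)
  also have "(\<Sum>b\<in>J. \<Sum>i\<in>J. (cmod (ent X i b))\<^sup>2) = (norm X)\<^sup>2" unfolding norm2_ent[OF J(1,2)] by (rule sum.swap)
  finally have "(norm (fm A * X))\<^sup>2 \<le> (R * norm X)\<^sup>2" by (simp add: power_mult_distrib)
  then show "norm (fm A * X) \<le> R * norm X" using R(2) by (simp add: power2_le_iff_abs_le)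
qed

section \<open>Microstates and moments\<close>

definition mfam :: "complex mat list \<Rightarrow> nat \<Rightarrow> nat fmat" where
  "mfam As i = (if i < length As then fm (As ! i) else 0)"

lemma unital_family_mfam:
  assumes "As \<in> mat_tuples n k"
  shows "unital_family (one_on {..<k}) (mfam As)"
proof
  have c: "As ! i \<in> carrier_mat k k" if "i < length As" for i using assms that by (auto simp: mat_tuples_def)
  show "one_on {..<k} * one_on {..<k} = one_on {..<k}" by (rule one_on_idem) simp
  show "star (one_on {..<k}) = one_on {..<k}" by simp
  show "one_on {..<k} * mfam As i = mfam As i" "mfam As i * one_on {..<k} = mfam As i" for i
    using fm_corner[OF c] by (simp_all add: mfam_def)
qed

lemma id_bop_unit [simp]: "id_bop * a = a" "a * id_bop = a"
  by (transfer, simp)+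

lemma unital_family_bop: "unital_family (id_bop :: 'h::complex_hilbert_space bop) X"
  by unfold_locales (simp_all, transfer, rule adj_id)

lemma weval_zero: "(i, s) \<in> set w \<Longrightarrow> X i = 0 \<Longrightarrow> weval e X w = 0"
  by (induction w) (auto simp: weval_def letter_def)

lemma weval_mat_word:
  assumes As: "As \<in> mat_tuples n k" and w: "\<forall>(i, s)\<in>set w. i < n"
  shows "mat_word k As w \<in> carrier_mat k k \<and> fm (mat_word k As w) = weval (one_on {..<k}) (mfam As) w"
  using w
proof (induction w)
  case Nil
  then show ?case by (simp add: mat_word_def weval_def fm_one)
next
  case (Cons l w)
  obtain i s where l: "l = (i, s)" by (cases l)
  have i: "i < n" "i < length As" "As ! i \<in> carrier_mat k k" using Cons.prems As by (auto simp: l mat_tuples_def)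
  have IH: "mat_word k As w \<in> carrier_mat k k" "fm (mat_word k As w) = weval (one_on {..<k}) (mfam As) w"
    using Cons by auto
  have e: "mat_word k As (l # w) = (if s then mat_adjoint (As ! i) else As ! i) * mat_word k As w"
    by (simp add: mat_word_def l)
  have "letter (mfam As) l = (if s then star (fm (As ! i)) else fm (As ! i))"
    using i by (simp add: l letter_def mfam_def)
  then have "weval (one_on {..<k}) (mfam As) (l # w) =
      (if s then star (fm (As ! i)) else fm (As ! i)) * weval (one_on {..<k}) (mfam As) w"
    by (simp add: weval_def)
  then show ?case unfolding e
    using i IH adjoint_carrier[OF i(3)] by (auto simp: fm_mult[of _ k] fm_adjoint)
qed

lemma weval_op_word:
  assumes xb: "\<And>i. i < length xs \<Longrightarrow> bounded_operator (xs ! i)" and w: "\<forall>(i, s)\<in>set w. i < length xs"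
  shows "op_of (weval id_bop (family xs) w) = op_word xs w"
  using w
proof (induction w)
  case Nil
  then show ?case by (simp add: op_word_def weval_def id_bop.rep_eq)
next
  case (Cons l w)
  obtain i s where l: "l = (i, s)" by (cases l)
  have i: "i < length xs" using Cons.prems l by auto
  have "op_of (letter (family xs) l) = (if s then adj (xs ! i) else xs ! i)"
    using i by (simp add: l letter_def family_def star_bop.rep_eq op_of_Bop[OF xb])
  then show ?case using Cons by (simp add: weval_def op_word_def l times_bop.rep_eq)
qed

lemma microstates_mono:
  assumes "m \<le> m'" "\<epsilon>' \<le> \<epsilon>"
  shows "microstates \<tau> R xs m' k \<epsilon>' \<subseteq> microstates \<tau> R xs m k \<epsilon>"
  using assms by (fastforce simp: microstates_def words_def)

text \<open>After expansion into words the error is at most \<open>\<epsilon>\<close> times the sum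
  \<open>S\<close> of the moduli of the coefficients. The empty word is not among
  \<open>words\<close>, but its trace is 1 on both sides; words with a letter out of range vanish on
  both sides.\<close>

lemma moment_transfer:
  fixes M :: "('h::complex_hilbert_space \<Rightarrow> 'h) set"
  assumes M: "star_subalgebra M" "id \<in> M" and tr: "tracial_state M \<tau>" and xs: "set xs \<subseteq> M" and \<eta>: "\<eta> > 0"
  shows "\<exists>m\<ge>1. \<exists>\<epsilon>>0. \<forall>k\<ge>1. \<forall>As\<in>microstates \<tau> R xs m k \<epsilon>.
    cmod (tr (pev (one_on {..<k}) (mfam As) p) / of_nat k - \<tau> (op_of (pev id_bop (family xs) p))) < \<eta>"
proof -
  interpret ta: tracial_algebra "bops M" id_bop "\<lambda>a. \<tau> (op_of a)" by (rule tracial_algebra_bops[OF M tr])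
  interpret ub: unital_family "id_bop :: 'h bop" "family xs" by (rule unital_family_bop)
  have xM: "xs ! i \<in> M" if "i < length xs" for i using xs that by auto
  have xb: "bounded_operator (xs ! i)" if "i < length xs" for i using star_subalgebraD(1)[OF M(1) xM[OF that]] .
  have fM: "family xs i \<in> bops M" for i
    using xM xb ta.M_zero by (simp add: family_def) (simp add: bops_def op_of_Bop)
  have wM: "weval id_bop (family xs) w \<in> bops M" for w
    by (induction w) (auto simp: weval_def letter_def ta.M_one intro!: ta.M_mult ta.M_star fM)
  define S where "S = (\<Sum>(c, w)\<leftarrow>expand p. cmod c)"
  \<comment> \<open>The successor makes \<open>m\<close> at least 1 and larger than the length of
    every word that occurs.\<close>
  define m where "m = Suc (\<Sum>(c, w)\<leftarrow>expand p. length w)"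
  \<comment> \<open>The summand 1 covers \<open>S = 0\<close> and keeps the final inequality
    strict.\<close>
  define \<epsilon> where "\<epsilon> = \<eta> / (S + 1)"
  have nn: "(\<Sum>(c, w)\<leftarrow>ys. cmod c) \<ge> 0" for ys :: "(complex \<times> word) list" by (induction ys) auto
  have S0: "S \<ge> 0" unfolding S_def by (rule nn)
  have \<epsilon>: "\<epsilon> > 0" using \<eta> S0 by (simp add: \<epsilon>_def)
  have lenw: "length w < m" if "(c, w) \<in> set (expand p)" for c w
  proof -
    have "length w \<le> (\<Sum>(c, w)\<leftarrow>ys. length w)" if "(c, w) \<in> set ys" for ys :: "(complex \<times> word) list"
      using that by (induction ys) auto
    then show ?thesis using that by (auto simp: m_def less_Suc_eq_le)
  qed
  have "cmod (tr (pev (one_on {..<k}) (mfam As) p) / of_nat k - \<tau> (op_of (pev id_bop (family xs) p))) < \<eta>"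
    if k: "k \<ge> 1" and As: "As \<in> microstates \<tau> R xs m k \<epsilon>" for k As
  proof -
    have At: "As \<in> mat_tuples (length xs) k" using As by (simp add: microstates_def)
    interpret um: unital_family "one_on {..<k}" "mfam As" by (rule unital_family_mfam[OF At])
    define D where "D w = tr (weval (one_on {..<k}) (mfam As) w) / of_nat k - \<tau> (op_of (weval id_bop (family xs) w))" for w
    have D: "cmod (D w) \<le> \<epsilon>" if "length w < m" for w
    proof (cases "\<forall>(i, s)\<in>set w. i < length xs")
      case True
      note mw = weval_mat_word[OF At True] and ow = weval_op_word[OF xb True]
      show ?thesis
      proof (cases "w = []")
        case True
        have "tr (one_on {..<k}) / of_nat k = 1" using k by (simp add: tr_one_on)
        then show ?thesis using ta.\<tau>_one \<epsilon> by (simp add: D_def True weval_def)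
      next
        case False
        then have "w \<in> words (length xs) m" using True that by (auto simp: words_def Suc_le_eq)
        then have "cmod (ntrace (mat_word k As w) - \<tau> (op_word xs w)) < \<epsilon>" using As by (simp add: microstates_def)
        then show ?thesis using mw ntrace_fm[of "mat_word k As w" k] by (simp add: D_def ow)
      qed
    next
      case False
      then obtain i s where iw: "(i, s) \<in> set w" "\<not> i < length xs" by auto
      have "\<not> i < length As" using iw At by (simp add: mat_tuples_def)
      then have "weval (one_on {..<k}) (mfam As) w = 0" "weval id_bop (family xs) w = 0"
        using iw by (auto intro: weval_zero simp: mfam_def family_def)
      moreover have "\<tau> (op_of (0 :: 'h bop)) = 0" using ta.\<tau>_scl[OF ta.M_one, of 0] by simp
      ultimately show ?thesis using \<epsilon> by (simp add: D_def)
    qed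
    have "tr (\<Sum>(c, w)\<leftarrow>ys. scl c (weval (one_on {..<k}) (mfam As) w)) / of_nat k
        - \<tau> (op_of (\<Sum>(c, w)\<leftarrow>ys. scl c (weval id_bop (family xs) w))) = (\<Sum>(c, w)\<leftarrow>ys. c * D w)" for ys
    proof (induction ys)
      case Nil
      have "\<tau> (op_of (0 :: 'h bop)) = 0" using ta.\<tau>_scl[OF ta.M_one, of 0] by simp
      then show ?case by simp
    next
      case (Cons y ys)
      have sM: "(\<Sum>(c, w)\<leftarrow>ys. scl c (weval id_bop (family xs) w)) \<in> bops M" for ys
        by (induction ys) (auto simp: ta.M_zero intro!: ta.M_add ta.M_scl wM)
      show ?case
        using Cons by (cases y) (simp add: tr_add tr_scl ta.\<tau>_add ta.\<tau>_scl wM sM ta.M_scl D_def add_divide_distrib algebra_simps)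
    qed
    then have e: "tr (pev (one_on {..<k}) (mfam As) p) / of_nat k - \<tau> (op_of (pev id_bop (family xs) p)) =
        (\<Sum>(c, w)\<leftarrow>expand p. c * D w)"
      by (simp add: um.pev_expand ub.pev_expand)
    have "cmod (\<Sum>(c, w)\<leftarrow>ys. c * D w) \<le> \<epsilon> * (\<Sum>(c, w)\<leftarrow>ys. cmod c)"
      if "\<And>c w. (c, w) \<in> set ys \<Longrightarrow> length w < m" for ys
      using that
    proof (induction ys)
      case (Cons y ys)
      obtain c w where y: "y = (c, w)" by (cases y)
      have "length w < m" using Cons.prems[of c w] by (simp add: y)
      from mult_left_mono[OF D[OF this] norm_ge_zero[of c]]
      have "cmod (c * D w) \<le> \<epsilon> * cmod c" by (simp add: norm_mult mult.commute)
      moreover have "cmod (\<Sum>(c, w)\<leftarrow>ys. c * D w) \<le> \<epsilon> * (\<Sum>(c, w)\<leftarrow>ys. cmod c)" by (rule Cons.IH) (use Cons.prems in auto)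
      ultimately show ?case using norm_triangle_ineq[of "c * D w" "\<Sum>(c, w)\<leftarrow>ys. c * D w"]
        by (simp add: y distrib_left)
    qed simp
    from this[of "expand p"] have "cmod (\<Sum>(c, w)\<leftarrow>expand p. c * D w) \<le> \<epsilon> * S" using lenw by (simp add: S_def)
    also have "\<dots> < \<eta>" using \<eta> S0 by (simp add: \<epsilon>_def field_simps)
    finally show ?thesis by (simp add: e)
  qed
  then show ?thesis using \<epsilon> by (intro exI[of _ m] conjI exI[of _ \<epsilon>] allI impI ballI) (auto simp: m_def)
qed

text \<open>Finitely many conditions hold together for the longest words and the smallest tolerance
  among those they demand.\<close>

lemma moments_transfer:
  fixes M :: "('h::complex_hilbert_space \<Rightarrow> 'h) set"
  assumes M: "star_subalgebra M" "id \<in> M" and tr: "tracial_state M \<tau>" and xs: "set xs \<subseteq> M"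
    and F: "finite F" "\<And>p b. (p, b) \<in> F \<Longrightarrow> Re (\<tau> (op_of (pev id_bop (family xs) p))) < b"
  shows "\<exists>m\<ge>1. \<exists>\<epsilon>>0. \<forall>k\<ge>1. \<forall>As\<in>microstates \<tau> R xs m k \<epsilon>. \<forall>(p, b)\<in>F.
    Re (tr (pev (one_on {..<k}) (mfam As) p)) < b * real k"
  using F
proof (induction F rule: finite_induct)
  case empty
  show ?case by (intro exI[of _ 1] conjI exI[of _ "1::real"]) auto
next
  case (insert pb F)
  obtain p b where pb: "pb = (p, b)" by (cases pb)
  have 1: "Re (\<tau> (op_of (pev id_bop (family xs) p))) < b" by (rule insert.prems) (simp add: pb)
  have "\<exists>m\<ge>1. \<exists>\<epsilon>>0. \<forall>k\<ge>1. \<forall>As\<in>microstates \<tau> R xs m k \<epsilon>. \<forall>(p, b)\<in>F.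
    Re (tr (pev (one_on {..<k}) (mfam As) p)) < b * real k"
    by (rule insert.IH) (rule insert.prems, simp)
  then obtain m \<epsilon> where m: "m \<ge> 1" "\<epsilon> > 0" and mF: "\<And>k As p b. k \<ge> 1 \<Longrightarrow> As \<in> microstates \<tau> R xs m k \<epsilon> \<Longrightarrow> (p, b) \<in> F \<Longrightarrow>
    Re (tr (pev (one_on {..<k}) (mfam As) p)) < b * real k" by fast
  \<comment> \<open>The gap in the strict inequality for \<open>\<tau>\<close> is the accuracy
    demanded of the moment.\<close>
  obtain m' \<epsilon>' where m': "m' \<ge> 1" "\<epsilon>' > 0" and mp: "\<And>k As. k \<ge> 1 \<Longrightarrow> As \<in> microstates \<tau> R xs m' k \<epsilon>' \<Longrightarrow>
    cmod (tr (pev (one_on {..<k}) (mfam As) p) / of_nat k - \<tau> (op_of (pev id_bop (family xs) p))) <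
      b - Re (\<tau> (op_of (pev id_bop (family xs) p)))"
    using moment_transfer[OF M tr xs, of "b - Re (\<tau> (op_of (pev id_bop (family xs) p)))" R p] 1 by auto
  show ?case
  proof (intro exI[of _ "max m m'"] conjI exI[of _ "min \<epsilon> \<epsilon>'"] allI impI ballI)
    fix k As q assume k: "1 \<le> k" and As: "As \<in> microstates \<tau> R xs (max m m') k (min \<epsilon> \<epsilon>')" and q: "q \<in> insert pb F"
    have A1: "As \<in> microstates \<tau> R xs m k \<epsilon>" "As \<in> microstates \<tau> R xs m' k \<epsilon>'"
      by (rule subsetD[OF microstates_mono As]; simp)+
    show "case q of (p, b) \<Rightarrow> Re (tr (pev (one_on {..<k}) (mfam As) p)) < b * real k"
    proof (cases "q = pb")
      case True
      let ?z = "tr (pev (one_on {..<k}) (mfam As) p)"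
      have "Re (?z / of_nat k - \<tau> (op_of (pev id_bop (family xs) p))) < b - Re (\<tau> (op_of (pev id_bop (family xs) p)))"
        using mp[OF k A1(2)] complex_Re_le_cmod le_less_trans by blast
      then have "Re ?z / real k < b" by simp
      then show ?thesis using k by (simp add: True pb field_simps)
    next
      case False
      then show ?thesis using q mF[OF k A1(1), of "fst q" "snd q"] by (simp add: case_prod_beta)
    qed
  qed (use m m' in auto)
qed

text \<open>\<open>ncpoly\<close> has no zero, so the empty sum is
  \<open>Scale 0 One\<close>.\<close>

fun psum :: "(nat \<Rightarrow> ncpoly) \<Rightarrow> nat \<Rightarrow> ncpoly" where
  "psum f 0 = Scale 0 One"
| "psum f (Suc n) = Plus (psum f n) (f n)"

lemma pev_psum: "pev e X (psum f n) = (\<Sum>l<n. pev e X (f l))"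
  by (induction n) auto

section \<open>Counting cells\<close>

text \<open>Centres of balls have to be microstates, so a representative is picked from each
  nonempty fibre of the code \<open>f\<close>; its ball contains the fibre. The empty set has
  covering number 1 by convention, whence the nonempty \<open>D\<close>.\<close>

lemma orbit_covering_number_le:
  assumes D: "finite D" "D \<noteq> {}" "\<And>As. As \<in> \<Gamma> \<Longrightarrow> f As \<in> D"
    and ball: "\<And>As Bs. As \<in> \<Gamma> \<Longrightarrow> Bs \<in> \<Gamma> \<Longrightarrow> f As = f Bs \<Longrightarrow> As \<in> orbit_ball k Bs \<omega>"
  shows "orbit_covering_number k \<Gamma> \<omega> \<le> card D"
proof (cases "\<Gamma> = {}")
  case True
  have "card D > 0" using D by (simp add: card_gt_0_iff)
  then show ?thesis using True by (simp add: orbit_covering_number_def)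
next
  case False
  define s where "s d = (SOME As. As \<in> \<Gamma> \<and> f As = d)" for d
  have s: "s (f As) \<in> \<Gamma> \<and> f (s (f As)) = f As" if "As \<in> \<Gamma>" for As
    unfolding s_def by (rule someI_ex) (use that in blast)
  define C where "C = s ` f ` \<Gamma>"
  have fD: "f ` \<Gamma> \<subseteq> D" using D(3) by auto
  have C: "C \<subseteq> \<Gamma>" "finite C" using s finite_subset[OF fD D(1)] by (auto simp: C_def)
  have "card C \<le> card (f ` \<Gamma>)" unfolding C_def by (rule card_image_le) (rule finite_subset[OF fD D(1)])
  also have "\<dots> \<le> card D" by (rule card_mono[OF D(1) fD])
  finally have cC: "card C \<le> card D" .
  have "\<Gamma> \<subseteq> (\<Union>B\<in>C. orbit_ball k B \<omega>)"
  proof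
    fix As assume As: "As \<in> \<Gamma>"
    have "As \<in> orbit_ball k (s (f As)) \<omega>" using s[OF As] As by (intro ball) auto
    then show "As \<in> (\<Union>B\<in>C. orbit_ball k B \<omega>)" using As by (auto simp: C_def)
  qed
  then have "(LEAST N. \<exists>C. C \<subseteq> \<Gamma> \<and> finite C \<and> card C = N \<and> \<Gamma> \<subseteq> (\<Union>B\<in>C. orbit_ball k B \<omega>)) \<le> card C"
    using C by (intro Least_le exI[of _ C]) auto
  then show ?thesis using False cC by (simp add: orbit_covering_number_def)
qed

definition cell :: "real \<Rightarrow> complex \<Rightarrow> int \<times> int" where
  "cell \<theta> z = (\<lfloor>Re z / \<theta>\<rfloor>, \<lfloor>Im z / \<theta>\<rfloor>)"

lemma floor_eq_dist:
  fixes x y \<theta> :: real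
  shows "\<lfloor>x / \<theta>\<rfloor> = \<lfloor>y / \<theta>\<rfloor> \<Longrightarrow> \<theta> > 0 \<Longrightarrow> \<bar>x - y\<bar> \<le> \<theta>"
proof -
  assume f: "\<lfloor>x / \<theta>\<rfloor> = \<lfloor>y / \<theta>\<rfloor>" and t: "\<theta> > 0"
  have "real_of_int \<lfloor>x / \<theta>\<rfloor> = real_of_int \<lfloor>y / \<theta>\<rfloor>" using f by simp
  then have "\<bar>x / \<theta> - y / \<theta>\<bar> \<le> 1" 
    using of_int_floor_le[of "x / \<theta>"] of_int_floor_le[of "y / \<theta>"]
      real_of_int_floor_add_one_gt[of "x / \<theta>"] real_of_int_floor_add_one_gt[of "y / \<theta>"] by linarith
  then have "\<bar>(x - y) / \<theta>\<bar> \<le> 1" by (simp add: diff_divide_distrib)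
  then show ?thesis using t by (simp add: abs_divide)
qed

lemma cell_eq_dist: "cell \<theta> z = cell \<theta> w \<Longrightarrow> \<theta> > 0 \<Longrightarrow> cmod (z - w) \<le> 2 * \<theta>"
  using floor_eq_dist[of "Re z" \<theta> "Re w"] floor_eq_dist[of "Im z" \<theta> "Im w"] cmod_le[of "z - w"]
  by (simp add: cell_def)

definition cells :: "real \<Rightarrow> real \<Rightarrow> (int \<times> int) set" where
  "cells \<theta> c = {- \<lceil>c / \<theta>\<rceil> - 1..\<lceil>c / \<theta>\<rceil>} \<times> {- \<lceil>c / \<theta>\<rceil> - 1..\<lceil>c / \<theta>\<rceil>}"

lemma cell_in_cells:
  assumes "\<theta> > 0" "cmod z \<le> c" shows "cell \<theta> z \<in> cells \<theta> c"
proof -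
  have f: "\<lfloor>x / \<theta>\<rfloor> \<in> {- \<lceil>c / \<theta>\<rceil> - 1..\<lceil>c / \<theta>\<rceil>}" if "\<bar>x\<bar> \<le> c" for x
  proof -
    have "x / \<theta> \<le> c / \<theta>" "- (c / \<theta>) \<le> x / \<theta>" using that assms(1) by (auto simp: field_simps)
    then show ?thesis by (simp add: le_floor_iff floor_le_iff) linarith
  qed
  show ?thesis unfolding cell_def cells_def
    using f[of "Re z"] f[of "Im z"] assms(2) abs_Re_le_cmod[of z] abs_Im_le_cmod[of z] by auto
qed

text \<open>Every row meets the band in at most \<open>2 * d\<close> places, as \<open>g\<close> is
  injective. Growth linear in \<open>N\<close>, against \<open>N\<^sup>2\<close> entries of a full
  matrix, makes the final count exponential in \<open>k\<close> only.\<close>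

lemma band_card_le:
  assumes g: "bij_betw g I {..<N}"
  shows "finite I" "card {(a, b). a \<in> I \<and> b \<in> I \<and> \<bar>int (g a) - int (g b)\<bar> < int d} \<le> N * (2 * d)"
proof -
  show I: "finite I" using g bij_betw_finite by blast
  have "card {b \<in> I. \<bar>int (g a) - int (g b)\<bar> < int d} \<le> 2 * d" for a
  proof -
    have "inj_on (\<lambda>b. int (g b)) {b \<in> I. \<bar>int (g a) - int (g b)\<bar> < int d}"
      using g by (auto simp: inj_on_def bij_betw_def)
    then have "card {b \<in> I. \<bar>int (g a) - int (g b)\<bar> < int d} \<le> card {int (g a) - int d<..<int (g a) + int d}"
      by (rule card_inj_on_le) auto
    then show ?thesis by simp
  qed
  moreover have "{(a, b). a \<in> I \<and> b \<in> I \<and> \<bar>int (g a) - int (g b)\<bar> < int d} =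
      (SIGMA a:I. {b \<in> I. \<bar>int (g a) - int (g b)\<bar> < int d})" by auto
  ultimately have "card {(a, b). a \<in> I \<and> b \<in> I \<and> \<bar>int (g a) - int (g b)\<bar> < int d} \<le> (\<Sum>a\<in>I. 2 * d)"
    using I by (simp add: card_SigmaI sum_mono del: sum_constant)
  also have "\<dots> = N * (2 * d)" using bij_betw_same_card[OF g] by simp
  finally show "card {(a, b). a \<in> I \<and> b \<in> I \<and> \<bar>int (g a) - int (g b)\<bar> < int d} \<le> N * (2 * d)" .
qed

lemma banded_norm_le:
  assumes g: "bij_betw g I {..<N}" and idx: "idx B \<subseteq> I"
    and band: "\<And>a b. a \<in> I \<Longrightarrow> b \<in> I \<Longrightarrow> int d \<le> \<bar>int (g a) - int (g b)\<bar> \<Longrightarrow> ent B a b = 0"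
    and small: "\<And>a b. a \<in> I \<Longrightarrow> b \<in> I \<Longrightarrow> \<bar>int (g a) - int (g b)\<bar> < int d \<Longrightarrow> cmod (ent B a b) \<le> c"
  shows "(norm B)\<^sup>2 \<le> real (N * (2 * d)) * c\<^sup>2"
proof -
  have I: "finite I" by (rule band_card_le(1)[OF g])
  let ?T = "{(a, b). a \<in> I \<and> b \<in> I \<and> \<bar>int (g a) - int (g b)\<bar> < int d}"
  have T: "?T \<subseteq> I \<times> I" by auto
  have "(norm B)\<^sup>2 = (\<Sum>t\<in>I \<times> I. (cmod (ent B (fst t) (snd t)))\<^sup>2)"
    unfolding norm2_ent[OF I idx] by (simp add: sum.cartesian_product case_prod_beta)
  also have "\<dots> = (\<Sum>t\<in>?T. (cmod (ent B (fst t) (snd t)))\<^sup>2)"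
  proof (rule sum.mono_neutral_right[OF _ T], rule_tac [2] ballI)
    fix t assume t: "t \<in> I \<times> I - ?T"
    obtain a b where ab: "t = (a, b)" by (cases t)
    have "ent B a b = 0" by (rule band) (use t ab in auto)
    then show "(cmod (ent B (fst t) (snd t)))\<^sup>2 = 0" by (simp add: ab)
  qed (use I in simp)
  also have "\<dots> \<le> (\<Sum>t\<in>?T. c\<^sup>2)"
    by (rule sum_mono) (use small in \<open>auto intro!: power_mono\<close>)
  also have "\<dots> = real (card ?T) * c\<^sup>2" by simp
  also have "\<dots> \<le> real (N * (2 * d)) * c\<^sup>2"
    using band_card_le(2)[OF g, of d] by (intro mult_right_mono) (auto simp del: of_nat_mult)
  finally show ?thesis .
qed

section \<open>Columns of blocks and their intertwining defects\<close>

context regular_matrices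
begin

lemma stack_diff: "stack p - stack q = stack (\<lambda>l. p l - q l)"
  by (simp add: stack_def tens_diff_right sum_subtractf)

lemma star_stack_times: "star (stack p) * stack q = tens (emat 0 0) (\<Sum>l<d. star (p l) * q l)"
proof -
  have "star (stack p) * stack q = (\<Sum>l<d. \<Sum>m<d. tens (emat 0 l * emat m 0) (star (p l) * q m))"
    by (simp add: stack_def star_sum tens_star sum_product tens_mult)
  also have "\<dots> = (\<Sum>l<d. \<Sum>m<d. if m = l then tens (emat 0 0) (star (p l) * q l) else 0)"
    by (intro sum.cong) (auto simp: emat_times)
  finally show ?thesis by (simp add: tens_sum_right)
qed

lemma norm_stack: "(norm (stack p))\<^sup>2 = (\<Sum>l<d. (norm (p l))\<^sup>2)"
proof -
  have "complex_of_real ((norm (stack p))\<^sup>2) = (\<Sum>l<d. complex_of_real ((norm (p l))\<^sup>2))"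
    unfolding tr_star_self[symmetric] star_stack_times tr_tens by (simp add: tr_emat tr_sum)
  then show ?thesis by (metis of_real_eq_iff of_real_sum)
qed

text \<open>Since \<open>Y\<close> acts on the column through its own entries, block
  \<open>l\<close> of the difference has the form of the defect bounded in
  \<open>intertwining_defect_le\<close>.\<close>

lemma stack_intertwine:
  assumes Y: "one_on {..<d} * Y = Y" and u: "\<And>l. l < d \<Longrightarrow> u * p l = p l"
  shows "stack p * tens (emat 0 0) x - tens Y u * stack p = stack (\<lambda>l. p l * x - (\<Sum>m<d. scl (ent Y l m) (p m)))"
proof -
  have c: "Y * emat m 0 = (\<Sum>l<d. scl (ent Y l m) (emat l 0))" for m
  proof -
    have "Y * emat m 0 = one_on {..<d} * (Y * emat m 0)" using Y by (simp add: mult.assoc[symmetric])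
    also have "\<dots> = (\<Sum>l<d. emat l l * Y * emat m 0)" by (simp add: one_on_def sum_distrib_right mult.assoc)
    finally show ?thesis by (simp add: emat_sandwich)
  qed
  have "tens Y u * stack p = (\<Sum>m<d. tens (Y * emat m 0) (p m))"
    unfolding stack_def sum_distrib_left by (rule sum.cong) (auto simp: tens_mult u)
  also have "\<dots> = (\<Sum>m<d. \<Sum>l<d. tens (emat l 0) (scl (ent Y l m) (p m)))"
    by (simp add: c tens_sum_left tens_scl_left tens_scl_right)
  also have "\<dots> = (\<Sum>l<d. tens (emat l 0) (\<Sum>m<d. scl (ent Y l m) (p m)))"
    by (subst sum.swap) (simp add: tens_sum_right)
  finally have 1: "tens Y u * stack p = stack (\<lambda>l. \<Sum>m<d. scl (ent Y l m) (p m))" by (simp add: stack_def)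
  have 2: "stack p * tens (emat 0 0) x = stack (\<lambda>l. p l * x)"
    by (simp add: stack_def sum_distrib_right tens_mult emat_times)
  show ?thesis by (simp add: 1 2 stack_diff)
qed

end

section \<open>Covering microstates of hyperfinite algebras\<close>

definition lmat :: "nat \<Rightarrow> (nat \<Rightarrow> nat \<Rightarrow> complex) \<Rightarrow> nat fmat" where
  "lmat d k = Abs_fmat (\<lambda>l m. if l < d \<and> m < d then k l m else 0)"

lemma ent_lmat: "ent (lmat d k) l m = (if l < d \<and> m < d then k l m else 0)"
proof -
  have "finite {(l, m). (if l < d \<and> m < d then k l m else 0) \<noteq> 0}"
    by (rule finite_subset[of _ "{..<d} \<times> {..<d}"]) (auto split: if_splits)
  then show ?thesis unfolding lmat_def by (subst Abs_fmat_inverse) auto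
qed

lemma lmat_mult: "lmat d j * lmat d k = lmat d (\<lambda>l s. \<Sum>m<d. j l m * k m s)"
proof (rule fmat_eqI)
  fix a b
  have "idx (lmat d j) \<subseteq> {..<d}" by (auto simp: idx_def ent_lmat split: if_splits)
  then have "ent (lmat d j * lmat d k) a b = (\<Sum>m<d. ent (lmat d j) a m * ent (lmat d k) m b)"
    by (intro ent_times) auto
  also have "\<dots> = ent (lmat d (\<lambda>l s. \<Sum>m<d. j l m * k m s)) a b" by (auto simp: ent_lmat)
  finally show "ent (lmat d j * lmat d k) a b = ent (lmat d (\<lambda>l s. \<Sum>m<d. j l m * k m s)) a b" .
qed

lemma lmat_cong: "(\<And>l m. l < d \<Longrightarrow> m < d \<Longrightarrow> j l m = k l m) \<Longrightarrow> lmat d j = lmat d k"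
  by (rule fmat_eqI) (simp add: ent_lmat)

context tracial_algebra
begin

lemma \<tau>_sum:
  fixes n :: nat
  shows "(\<And>i. i < n \<Longrightarrow> f i \<in> M) \<Longrightarrow> \<tau> (\<Sum>i<n. f i) = (\<Sum>i<n. \<tau> (f i))"
proof (induction n)
  case 0
  show ?case using \<tau>_scl[OF M_one, of 0] by simp
next
  case (Suc n)
  then have "(\<Sum>i<n. f i) \<in> M" by (intro form.S_sum) auto
  then show ?case using Suc by (simp add: \<tau>_add)
qed

text \<open>The coefficients of \<open>regular_basis\<close>, collected into matrices, so that
  products, adjoints and the Casimir identity pass from the algebra to matrices. The identity for
  \<open>star (as ! l) * b\<close> is the one that the polynomials have to imitate on
  microstates.\<close>

lemma regular_representation:
  assumes N: "N = cspan (set vs)" "set vs \<subseteq> M" "e \<in> N"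
    and Nm: "\<And>x y. x \<in> N \<Longrightarrow> y \<in> N \<Longrightarrow> x * y \<in> N" and Ns: "\<And>x. x \<in> N \<Longrightarrow> star x \<in> N"
  obtains as and LM :: "'a \<Rightarrow> nat fmat" where "set as \<subseteq> N"
    and "regular_matrices (length as) (\<lambda>s. LM (as ! s))"
    and "\<And>b. b \<in> N \<Longrightarrow> LM b \<in> cspan ((\<lambda>s. LM (as ! s)) ` {..<length as})"
    and "\<And>b. b \<in> N \<Longrightarrow> star (LM b) = LM (star b)"
    and "\<And>b l. b \<in> N \<Longrightarrow> l < length as \<Longrightarrow>
      star (as ! l) * b = (\<Sum>m<length as. scl (ent (LM b) l m) (star (as ! m)))"
    and "(\<Sum>l<length as. as ! l * star (as ! l)) = e"
proof -
  obtain as lam where as: "N = cspan (set as)"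
    and col: "\<And>b s. b \<in> N \<Longrightarrow> s < length as \<Longrightarrow> b * as ! s = (\<Sum>m<length as. scl (lam b m s) (as ! m))"
    and row: "\<And>b l. b \<in> N \<Longrightarrow> l < length as \<Longrightarrow> star (as ! l) * b = (\<Sum>m<length as. scl (lam b l m) (star (as ! m)))"
    and lmult: "\<And>b c l s. b \<in> N \<Longrightarrow> c \<in> N \<Longrightarrow> l < length as \<Longrightarrow> s < length as \<Longrightarrow>
      lam (b * c) l s = (\<Sum>m<length as. lam b l m * lam c m s)"
    and lstar: "\<And>b l m. b \<in> N \<Longrightarrow> l < length as \<Longrightarrow> m < length as \<Longrightarrow> lam (star b) l m = cnj (lam b m l)"
    and ladd: "\<And>b c l m. b \<in> N \<Longrightarrow> c \<in> N \<Longrightarrow> l < length as \<Longrightarrow> m < length as \<Longrightarrow> lam (b + c) l m = lam b l m + lam c l m"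
    and lscl: "\<And>b c l m. b \<in> N \<Longrightarrow> l < length as \<Longrightarrow> m < length as \<Longrightarrow> lam (scl c b) l m = c * lam b l m"
    and lone: "\<And>l m. l < length as \<Longrightarrow> m < length as \<Longrightarrow> lam e l m = (if l = m then 1 else 0)"
    and one: "(\<Sum>l<length as. as ! l * star (as ! l)) = e"
    using regular_basis[OF N Nm Ns] by blast
  define d where "d = length as"
  define LM where "LM b = lmat d (lam b)" for b
  have asN: "as ! s \<in> N" if "s < d" for s using that unfolding as d_def by (intro cspan_base) auto
  have Nlin: "0 \<in> N" "\<And>x y. x \<in> N \<Longrightarrow> y \<in> N \<Longrightarrow> x + y \<in> N" "\<And>x c. x \<in> N \<Longrightarrow> scl c x \<in> N"
    unfolding as by (auto intro: cspan.intros)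
  have LMm: "LM b * LM c = LM (b * c)" if "b \<in> N" "c \<in> N" for b c
    unfolding LM_def lmat_mult by (rule lmat_cong) (use lmult that in \<open>simp add: d_def\<close>)
  have LMs: "star (LM b) = LM (star b)" if "b \<in> N" for b
    by (rule fmat_eqI) (use lstar[OF that] in \<open>simp add: LM_def ent_lmat d_def\<close>)
  have LMa: "LM (b + c) = LM b + LM c" if "b \<in> N" "c \<in> N" for b c
    by (rule fmat_eqI) (use ladd[OF that] in \<open>simp add: LM_def ent_lmat d_def\<close>)
  have LMc: "LM (scl c b) = scl c (LM b)" if "b \<in> N" for b c
    by (rule fmat_eqI) (use lscl[OF that] in \<open>simp add: LM_def ent_lmat d_def\<close>)
  have LM0: "LM 0 = 0" using LMc[OF Nlin(1), of 0] by simp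
  have LMsum: "LM (\<Sum>m<n. f m) = (\<Sum>m<n. LM (f m))" if "\<And>m. m < n \<Longrightarrow> f m \<in> N" for f and n :: nat
    using that
  proof (induction n)
    case (Suc n)
    have "(\<Sum>m<n. f m) \<in> N" unfolding as by (rule cspan_sum) (use Suc.prems as in auto)
    then show ?case using Suc by (simp add: LMa)
  qed (simp add: LM0)
  have LMe: "LM e = one_on {..<d}"
    by (rule fmat_eqI) (use lone in \<open>auto simp: LM_def ent_lmat ent_one_on d_def\<close>)
  have span: "LM b \<in> cspan ((\<lambda>s. LM (as ! s)) ` {..<d})" if "b \<in> N" for b
    using that unfolding as
  proof (induction rule: cspan.induct)
    case cspan_zero
    show ?case by (simp add: LM0 cspan.cspan_zero)
  next
    case (cspan_base x)
    then obtain s where "s < d" "x = as ! s" by (auto simp: in_set_conv_nth d_def)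
    then show ?case by (auto intro: cspan.cspan_base)
  next
    case (cspan_add x y)
    then show ?case using LMa[of x y] as by (simp add: cspan.cspan_add)
  next
    case (cspan_scl x c)
    then show ?case using LMc[of x c] as by (simp add: cspan.cspan_scl)
  qed
  have "regular_matrices d (\<lambda>s. LM (as ! s))"
  proof
    \<comment> \<open>Otherwise the unit would be an empty sum, against
      \<open>\<tau> e = 1\<close>.\<close>
    show "d > 0"
    proof (rule ccontr)
      assume "\<not> 0 < d"
      then have "e = 0" using one by (simp add: d_def)
      then show False using \<tau>_one \<tau>_scl[OF M_one, of 0] by simp
    qed
    show "one_on {..<d} \<in> cspan ((\<lambda>s. LM (as ! s)) ` {..<d})" using span[OF N(3)] LMe by simp
    have "(\<Sum>s<d. LM (as ! s) * star (LM (as ! s))) = (\<Sum>s<d. LM (as ! s * star (as ! s)))"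
      by (rule sum.cong) (use LMm LMs Ns asN in auto)
    also have "\<dots> = LM (\<Sum>s<d. as ! s * star (as ! s))" by (rule LMsum[symmetric]) (use Nm Ns asN in auto)
    finally show "(\<Sum>s<d. LM (as ! s) * star (LM (as ! s))) = one_on {..<d}" using one LMe by (simp add: d_def)
    fix s assume s: "s < d"
    show "one_on {..<d} * LM (as ! s) = LM (as ! s)"
      using LMm[OF N(3) asN[OF s]] LMe one_left[of "as ! s"] asN[OF s] form.cspan_S[OF N(2)] N(1) by auto
    show "star (LM (as ! s)) \<in> cspan ((\<lambda>s. LM (as ! s)) ` {..<d})"
      using span[OF Ns[OF asN[OF s]]] LMs[OF asN[OF s]] by simp
    fix r assume r: "r < d"
    have "LM (as ! s) * LM (as ! r) = LM (\<Sum>m<d. scl (lam (as ! s) m r) (as ! m))"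
      using LMm[OF asN[OF s] asN[OF r]] col[OF asN[OF s], of r] r by (simp add: d_def)
    also have "\<dots> = (\<Sum>m<d. LM (scl (lam (as ! s) m r) (as ! m)))" by (rule LMsum) (use Nlin asN in auto)
    also have "\<dots> = (\<Sum>m<d. scl (ent (LM (as ! s)) m r) (LM (as ! m)))"
      by (rule sum.cong) (use LMc asN r in \<open>auto simp: LM_def ent_lmat\<close>)
    finally show "LM (as ! s) * LM (as ! r) = (\<Sum>m<d. scl (ent (LM (as ! s)) m r) (LM (as ! m)))" .
  qed
  moreover have "star (as ! l) * b = (\<Sum>m<d. scl (ent (LM b) l m) (star (as ! m)))" if "b \<in> N" "l < d" for b l
    using row[OF that(1), of l] that(2) by (simp add: d_def LM_def ent_lmat)
  moreover have "set as \<subseteq> N" unfolding as by (auto intro: cspan_base)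
  ultimately show ?thesis using that[of as LM] span LMs one unfolding d_def by blast
qed

end

text \<open>The unitary between two models lives in the corner of \<open>tens (emat 0 0) u\<close>
  among matrices indexed by pairs; this leads back to matrices of size \<open>k\<close>.\<close>

lemma corner_compress:
  assumes "tens (emat a a) u * W = W" "W * tens (emat a a) u = W" and u: "u * u = u"
  shows "\<exists>w. W = tens (emat a a) w \<and> u * w = w \<and> w * u = w"
proof -
  define w0 where "w0 = Abs_fmat (\<lambda>i j. ent W (a, i) (a, j))"
  have ew: "ent w0 i j = ent W (a, i) (a, j)" for i j
  proof -
    have "finite {(i, j). ent W (a, i) (a, j) \<noteq> 0}"
      by (rule finite_support_subset[of "snd ` idx W"]) (force dest: ent_idx)+
    then show ?thesis unfolding w0_def by (subst Abs_fmat_inverse) auto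
  qed
  have z: "ent W (x, i) (y, j) = 0" if "x \<noteq> a \<or> y \<noteq> a" for x y i j
  proof -
    have l: "ent (tens (emat a a) u * C) (x, i) t = 0" if "x \<noteq> a" for C t
      unfolding ent_times0 by (rule sum.neutral) (use that in auto)
    have r: "ent (C * tens (emat a a) u) t (y, j) = 0" if "y \<noteq> a" for C t
      unfolding ent_times0 by (rule sum.neutral) (use that in auto)
    show ?thesis using that l[of W "(y, j)"] r[of W "(x, i)"] assms(1,2) by auto
  qed
  have W0: "W = tens (emat a a) w0"
    by (rule fmat_eqI) (use z in \<open>auto simp: ew\<close>)
  have "W = tens (emat a a) u * W * tens (emat a a) u" using assms by simp
  then have "W = tens (emat a a) (u * w0 * u)" by (simp add: W0 tens_mult emat_times)
  moreover have "u * (u * w0 * u) = u * w0 * u" "u * w0 * u * u = u * w0 * u"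
    by (simp_all add: mult.assoc u) (simp add: mult.assoc[symmetric] u)
  ultimately show ?thesis by blast
qed

lemma tens_emat_inject: "tens (emat a a) x = tens (emat a a) y \<Longrightarrow> x = y"
proof (rule fmat_eqI)
  fix i j
  assume "tens (emat a a) x = tens (emat a a) y"
  from arg_cong[OF this, of "\<lambda>A. ent A (a, i) (a, j)"] show "ent x i j = ent y i j" by simp
qed

text \<open>\<open>tuple_norm2\<close> uses the normalized trace, which cancels the factor
  \<open>sqrt (real k)\<close>, and the sum over the generators gives
  \<open>real n * \<beta>\<^sup>2\<close>. The unitary that the ball asks for is the adjoint of
  \<open>w\<close>, because \<open>As\<close> is compared with
  \<open>star W * Bs * W\<close>.\<close>

lemma orbit_ball_of_conjugacy:
  fixes k :: nat
  defines "u \<equiv> one_on {..<k}" and "e \<equiv> tens (emat 0 0) (one_on {..<k}) :: (nat \<times> nat) fmat"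
  assumes k: "k > 0" and As: "As \<in> mat_tuples n k" and Bs: "Bs \<in> mat_tuples n k"
    and W: "e * W = W" "W * e = W" "star W * W = e" "W * star W = e"
    and close: "\<And>j. j < n \<Longrightarrow> norm (tens (emat 0 0) (mfam As j) - star W * tens (emat 0 0) (mfam Bs j) * W) \<le> \<beta> * sqrt (real k)"
    and \<beta>: "real n * \<beta>\<^sup>2 < \<omega>\<^sup>2" "\<omega> > 0"
  shows "As \<in> orbit_ball k Bs \<omega>"
proof -
  have uu: "u * u = u" "star u = u" by (simp_all add: u_def one_on_idem)
  obtain w where w: "W = tens (emat 0 0) w" "u * w = w" "w * u = w"
    using corner_compress[of 0 u W] W(1,2) uu(1) unfolding e_def u_def by auto
  have ww: "star w * w = u" "w * star w = u"
    using W(3,4) unfolding w(1) e_def u_def[symmetric]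
    by (auto simp: tens_star tens_mult emat_times intro: tens_emat_inject)
  have "u * star w = star w" "star w * u = star w"
    using arg_cong[OF w(3), of star] arg_cong[OF w(2), of star] by (auto simp: star_mult uu)
  then obtain C where C: "C \<in> carrier_mat k k" "fm C = star w" using ex_fm[of k "star w"] unfolding u_def by auto
  have Ca: "mat_adjoint C \<in> carrier_mat k k" "fm (mat_adjoint C) = w" using C by (auto simp: adjoint_carrier fm_adjoint)
  have CU: "C \<in> unitary_group k"
  proof -
    have "fm (C * mat_adjoint C) = fm (1\<^sub>m k)" "fm (mat_adjoint C * C) = fm (1\<^sub>m k)"
      using C Ca ww by (simp_all add: fm_mult[of _ k] fm_one u_def)
    then have "C * mat_adjoint C = 1\<^sub>m k" "mat_adjoint C * C = 1\<^sub>m k"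
      using C Ca by (auto intro: fm_inject[of _ k])
    then show ?thesis using C by (simp add: unitary_group_def)
  qed
  have len: "length As = n" "length Bs = n" using As Bs by (auto simp: mat_tuples_def)
  define D where "D j = As ! j - C * Bs ! j * mat_adjoint C" for j
  have Dj: "Re (ntrace (mat_adjoint (D j) * D j)) \<le> \<beta>\<^sup>2" if j: "j < n" for j
  proof -
    have c: "As ! j \<in> carrier_mat k k" "Bs ! j \<in> carrier_mat k k" using As Bs j by (auto simp: mat_tuples_def)
    have Dc: "D j \<in> carrier_mat k k"
      unfolding D_def by (rule minus_carrier_mat, rule mult_carrier_mat, rule mult_carrier_mat) (use c C Ca in auto)
    have fD: "fm (D j) = mfam As j - star w * mfam Bs j * w"
      using c C Ca j len by (simp add: D_def fm_minus[of _ k] fm_mult[of _ k] mfam_def mult.assoc)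
    have "ntrace (mat_adjoint (D j) * D j) = tr (star (fm (D j)) * fm (D j)) / of_nat k"
      using Dc adjoint_carrier[OF Dc] by (simp add: ntrace_fm[of _ k] fm_mult[of _ k] fm_adjoint)
    then have n: "Re (ntrace (mat_adjoint (D j) * D j)) = (norm (fm (D j)))\<^sup>2 / real k"
      by (simp add: norm2_tr)
    have "norm (fm (D j)) = norm (tens (emat 0 0 :: nat fmat) (fm (D j)))" by (simp add: norm_tens)
    also have "\<dots> \<le> \<beta> * sqrt (real k)"
      using close[OF j] by (simp add: fD w(1) tens_star tens_mult emat_times tens_diff_right)
    finally have "(norm (fm (D j)))\<^sup>2 \<le> (\<beta> * sqrt (real k))\<^sup>2" by (rule power_mono) simp
    then show ?thesis using k by (simp add: n power_mult_distrib divide_le_eq)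
  qed
  have "(\<Sum>A\<leftarrow>map2 (\<lambda>A B. A - C * B * mat_adjoint C) As Bs. Re (ntrace (mat_adjoint A * A))) =
      (\<Sum>j<n. Re (ntrace (mat_adjoint (D j) * D j)))"
    by (subst sum_list_sum_nth) (simp add: len D_def atLeast0LessThan)
  also have "\<dots> \<le> (\<Sum>j<n. \<beta>\<^sup>2)" by (rule sum_mono) (use Dj in auto)
  also have "\<dots> < \<omega>\<^sup>2" using \<beta>(1) by simp
  finally have "sqrt (\<Sum>A\<leftarrow>map2 (\<lambda>A B. A - C * B * mat_adjoint C) As Bs. Re (ntrace (mat_adjoint A * A))) < sqrt (\<omega>\<^sup>2)"
    by (rule real_sqrt_less_mono)
  then have "tuple_norm2 (map2 (\<lambda>A B. A - C * B * mat_adjoint C) As Bs) < \<omega>"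
    using \<beta>(2) by (simp add: tuple_norm2_def)
  then show ?thesis using As CU len by (auto simp: orbit_ball_def)
qed

context regular_matrices
begin

text \<open>The code of a microstate records the rounded entries, within the band, of the
  \<open>n + 1\<close> matrices \<open>star U * L j * U\<close> and \<open>star U * H * U\<close>;
  this is the exponent. Equal codes make these matrices agree up to
  \<open>\<sigma> * \<kappa>\<close>, so \<open>approximate_models_conjugate\<close> applies. The
  condition on \<open>\<theta>\<close> comes from at most \<open>2 * d\<^sup>2 * k\<close> entries,
  each with error at most \<open>2 * \<theta>\<close>.\<close>

lemma covering_number_of_models:
  fixes k n :: nat and Y :: "nat \<Rightarrow> nat fmat"
  defines "u \<equiv> one_on {..<k}" and "\<kappa> \<equiv> sqrt (real k)"
  defines "e \<equiv> tens (emat 0 0) (one_on {..<k}) :: (nat \<times> nat) fmat"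
    and "K \<equiv> tens (one_on {..<d}) (one_on {..<k}) :: (nat \<times> nat) fmat"
    and "L \<equiv> \<lambda>j. tens (Y j) (one_on {..<k})"
  assumes k: "k > 0" and \<Gamma>: "\<Gamma> \<subseteq> mat_tuples n k"
    and xR: "\<And>As j. As \<in> \<Gamma> \<Longrightarrow> j < n \<Longrightarrow> opb R (mfam As j)"
    and Y: "\<And>j. j < n \<Longrightarrow> Y j \<in> alg"
    and g: "bij_betw g ({..<d} \<times> {..<k}) {..<d * k}"
    and model: "\<And>As. As \<in> \<Gamma> \<Longrightarrow> \<exists>V H U h.
      approximate_model K e n (\<lambda>j. tens (emat 0 0) (mfam As j)) L (\<gamma> * \<kappa>) (\<eta> * \<kappa>) V H U \<and>
      star U * H * U = dgm ({..<d} \<times> {..<k}) h \<and> opb S (star U * H * U) \<and> (\<forall>j<n. opb R' (star U * L j * U)) \<and>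
      (\<forall>j<n. \<forall>a\<in>{..<d} \<times> {..<k}. \<forall>b\<in>{..<d} \<times> {..<k}.
         int d \<le> \<bar>int (g a) - int (g b)\<bar> \<longrightarrow> ent (star U * L j * U) a b = 0)"
    and S0: "S \<ge> 0" "R' \<ge> 0" and \<theta>: "\<theta> > 0" "8 * (real d)\<^sup>2 * \<theta>\<^sup>2 \<le> \<sigma>\<^sup>2" "\<sigma> \<ge> 0"
    and \<beta>: "2 * \<gamma> + \<sigma> + 2 * R * sqrt (2 * \<eta> + \<sigma>) \<le> \<beta>" "real n * \<beta>\<^sup>2 < \<omega>\<^sup>2" "\<omega> > 0"
  shows "orbit_covering_number k \<Gamma> \<omega> \<le> card (cells \<theta> (S + R')) ^ ((n + 1) * (d * k * (2 * d)))"
proof -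
  define I where "I = {..<d} \<times> {..<k}"
  have I: "finite I" and gI: "bij_betw g I {..<d * k}" using g by (auto simp: I_def)
  have uu: "u * u = u" "star u = u" by (simp_all add: u_def one_on_idem)
  have KI: "K = one_on I" by (simp add: K_def I_def one_on_times)
  have eI: "e = one_on ({0} \<times> {..<k})"
    unfolding e_def by (subst one_on_times[symmetric]) (auto simp: one_on_def)
  have ne: "norm e = \<kappa>"
  proof -
    have "(norm e)\<^sup>2 = real k" unfolding eI by (subst norm2_one_on) (auto simp: card_cartesian_product)
    then show ?thesis unfolding \<kappa>_def by (simp add: real_sqrt_unique)
  qed
  have \<kappa>0: "\<kappa> \<ge> 0" by (simp add: \<kappa>_def)
  have "\<forall>As. \<exists>m. As \<in> \<Gamma> \<longrightarrow> (case m of (V, H, U) \<Rightarrow>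
      approximate_model K e n (\<lambda>j. tens (emat 0 0) (mfam As j)) L (\<gamma> * \<kappa>) (\<eta> * \<kappa>) V H U \<and>
      (\<exists>h. star U * H * U = dgm I h) \<and> opb S (star U * H * U) \<and> (\<forall>j<n. opb R' (star U * L j * U)) \<and>
      (\<forall>j<n. \<forall>a\<in>I. \<forall>b\<in>I. int d \<le> \<bar>int (g a) - int (g b)\<bar> \<longrightarrow> ent (star U * L j * U) a b = 0))"
  proof
    fix As
    show "\<exists>m. As \<in> \<Gamma> \<longrightarrow> (case m of (V, H, U) \<Rightarrow>
      approximate_model K e n (\<lambda>j. tens (emat 0 0) (mfam As j)) L (\<gamma> * \<kappa>) (\<eta> * \<kappa>) V H U \<and>
      (\<exists>h. star U * H * U = dgm I h) \<and> opb S (star U * H * U) \<and> (\<forall>j<n. opb R' (star U * L j * U)) \<and>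
      (\<forall>j<n. \<forall>a\<in>I. \<forall>b\<in>I. int d \<le> \<bar>int (g a) - int (g b)\<bar> \<longrightarrow> ent (star U * L j * U) a b = 0))"
    proof (cases "As \<in> \<Gamma>")
      case True
      from model[OF True] obtain V H U h where
        "approximate_model K e n (\<lambda>j. tens (emat 0 0) (mfam As j)) L (\<gamma> * \<kappa>) (\<eta> * \<kappa>) V H U \<and>
         star U * H * U = dgm ({..<d} \<times> {..<k}) h \<and> opb S (star U * H * U) \<and> (\<forall>j<n. opb R' (star U * L j * U)) \<and>
         (\<forall>j<n. \<forall>a\<in>{..<d} \<times> {..<k}. \<forall>b\<in>{..<d} \<times> {..<k}.
         int d \<le> \<bar>int (g a) - int (g b)\<bar> \<longrightarrow> ent (star U * L j * U) a b = 0)"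
        by (elim exE)
      then show ?thesis unfolding I_def by (intro exI[of _ "(V, H, U)"]) auto
    qed simp
  qed
  from choice[OF this] obtain mo where mo: "\<forall>As. As \<in> \<Gamma> \<longrightarrow> (case mo As of (V, H, U) \<Rightarrow>
      approximate_model K e n (\<lambda>j. tens (emat 0 0) (mfam As j)) L (\<gamma> * \<kappa>) (\<eta> * \<kappa>) V H U \<and>
      (\<exists>h. star U * H * U = dgm I h) \<and> opb S (star U * H * U) \<and> (\<forall>j<n. opb R' (star U * L j * U)) \<and>
      (\<forall>j<n. \<forall>a\<in>I. \<forall>b\<in>I. int d \<le> \<bar>int (g a) - int (g b)\<bar> \<longrightarrow> ent (star U * L j * U) a b = 0))"
    by (elim exE)
  define V H U where "V As = fst (mo As)" and "H As = fst (snd (mo As))" and "U As = snd (snd (mo As))" for As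
  \<comment> \<open>Slot \<open>n\<close> holds the averaged projection, the slots below it the
    generators.\<close>
  define T where "T As j = (if j < n then star (U As) * L j * U As else star (U As) * H As * U As)" for As j
  have mo': "approximate_model K e n (\<lambda>j. tens (emat 0 0) (mfam As j)) L (\<gamma> * \<kappa>) (\<eta> * \<kappa>) (V As) (H As) (U As) \<and>
      (\<exists>h. star (U As) * H As * U As = dgm I h) \<and> opb S (star (U As) * H As * U As) \<and>
      (\<forall>j<n. opb R' (star (U As) * L j * U As)) \<and>
      (\<forall>j<n. \<forall>a\<in>I. \<forall>b\<in>I. int d \<le> \<bar>int (g a) - int (g b)\<bar> \<longrightarrow> ent (star (U As) * L j * U As) a b = 0)"
    if "As \<in> \<Gamma>" for As
    using mo[rule_format, OF that] by (simp add: case_prod_beta V_def H_def U_def)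
  have Tb: "opb (S + R') (T As j)" if "As \<in> \<Gamma>" for As j
    using mo'[OF that] S0 by (auto simp: T_def intro: opb_mono)
  have Tband: "ent (T As j) a b = 0"
    if t: "As \<in> \<Gamma>" "a \<in> I" "b \<in> I" "int d \<le> \<bar>int (g a) - int (g b)\<bar>" for As j a b
  proof (cases "j < n")
    case True
    then show ?thesis using mo'[OF t(1)] t(2-4) by (simp add: T_def)
  next
    case False
    \<comment> \<open>This matrix is diagonal, hence inside the band because \<open>d\<close> is
      positive.\<close>
    obtain h where "star (U As) * H As * U As = dgm I h" using mo'[OF t(1)] by (elim conjE exE)
    moreover have "a \<noteq> b" using t(4) d0 by auto
    ultimately show ?thesis using False by (simp add: T_def ent_dgm[OF I])
  qed
  have Tidx: "idx (T As j) \<subseteq> I" if "As \<in> \<Gamma>" for As j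
  proof -
    have UK: "U As * K = U As" using mo'[OF that] by (simp add: approximate_model_def)
    have KU: "K * star (U As) = star (U As)" using arg_cong[OF UK, of star] by (simp add: star_mult KI)
    have "K * T As j = T As j" "T As j * K = T As j"
      unfolding T_def by (auto simp: mult.assoc UK) (simp_all add: mult.assoc[symmetric] KU)
    then have "ent (T As j) a b = (if a \<in> I \<and> b \<in> I then ent (T As j) a b else 0)" for a b
      using ent_one_on_left[OF I, of "T As j" a b] ent_one_on_right[OF I, of "T As j" a b] by (auto simp: KI)
    then show ?thesis unfolding idx_def by (auto, metis+)
  qed
  define B where "B = {(a, b). a \<in> I \<and> b \<in> I \<and> \<bar>int (g a) - int (g b)\<bar> < int d}"
  define J where "J = {..n} \<times> B"
  have fB: "finite B" by (rule finite_subset[of _ "I \<times> I"]) (use I in \<open>auto simp: B_def\<close>)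
  have cB: "card B \<le> d * k * (2 * d)" unfolding B_def by (rule band_card_le(2)[OF gI])
  have fJ: "finite J" and cJ: "card J \<le> (n + 1) * (d * k * (2 * d))"
    using fB cB by (auto simp: J_def card_cartesian_product simp del: mult_Suc)
  define code where "code As = (\<lambda>t\<in>J. cell \<theta> (ent (T As (fst t)) (fst (snd t)) (snd (snd t))))" for As
  have fc: "finite (cells \<theta> (S + R'))" by (simp add: cells_def)
  have cin: "cell \<theta> (ent (T As j) a b) \<in> cells \<theta> (S + R')" if "As \<in> \<Gamma>" for As j a b
    by (rule cell_in_cells[OF \<theta>(1) cmod_ent_le[OF Tb[OF that]]])
  have c1: "card (cells \<theta> (S + R')) \<ge> 1"
  proof -
    have "cell \<theta> 0 \<in> cells \<theta> (S + R')" by (rule cell_in_cells[OF \<theta>(1)]) (use S0 in simp)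
    then have "cells \<theta> (S + R') \<noteq> {}" by blast
    then show ?thesis using fc by (simp add: Suc_le_eq card_gt_0_iff)
  qed
  have "orbit_covering_number k \<Gamma> \<omega> \<le> card (J \<rightarrow>\<^sub>E cells \<theta> (S + R'))"
  proof (rule orbit_covering_number_le[where f = code])
    show "finite (J \<rightarrow>\<^sub>E cells \<theta> (S + R'))" by (rule finite_PiE[OF fJ]) (rule fc)
    have "cells \<theta> (S + R') \<noteq> {}" using c1 by auto
    then show "J \<rightarrow>\<^sub>E cells \<theta> (S + R') \<noteq> {}" by (simp add: PiE_eq_empty_iff)
    show "code As \<in> J \<rightarrow>\<^sub>E cells \<theta> (S + R')" if "As \<in> \<Gamma>" for As
      unfolding code_def using cin[OF that] by auto
    fix As Bs assume As: "As \<in> \<Gamma>" and Bs: "Bs \<in> \<Gamma>" and eq: "code As = code Bs"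
    have close: "norm (T As j - T Bs j) \<le> \<sigma> * \<kappa>" if j: "j \<le> n" for j
    proof -
      have "(norm (T As j - T Bs j))\<^sup>2 \<le> real (d * k * (2 * d)) * (2 * \<theta>)\<^sup>2"
      proof (rule banded_norm_le[OF gI])
        show "idx (T As j - T Bs j) \<subseteq> I"
        proof
          fix t assume "t \<in> idx (T As j - T Bs j)"
          then obtain s where "ent (T As j - T Bs j) s t \<noteq> 0 \<or> ent (T As j - T Bs j) t s \<noteq> 0"
            unfolding idx_def by blast
          then have "ent (T As j) s t \<noteq> 0 \<or> ent (T As j) t s \<noteq> 0 \<or>
              ent (T Bs j) s t \<noteq> 0 \<or> ent (T Bs j) t s \<noteq> 0" by auto
          then have "t \<in> idx (T As j) \<or> t \<in> idx (T Bs j)" unfolding idx_def by blast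
          then show "t \<in> I" using Tidx[OF As, of j] Tidx[OF Bs, of j] by blast
        qed
        show "ent (T As j - T Bs j) a b = 0" if "a \<in> I" "b \<in> I" "int d \<le> \<bar>int (g a) - int (g b)\<bar>" for a b
          using Tband[OF As that] Tband[OF Bs that] by simp
        show "cmod (ent (T As j - T Bs j) a b) \<le> 2 * \<theta>" if "a \<in> I" "b \<in> I" "\<bar>int (g a) - int (g b)\<bar> < int d" for a b
        proof -
          have "(j, a, b) \<in> J" using that j by (simp add: J_def B_def)
          then have "cell \<theta> (ent (T As j) a b) = cell \<theta> (ent (T Bs j) a b)"
            using fun_cong[OF eq, of "(j, a, b)"] by (simp add: code_def)
          then show ?thesis using cell_eq_dist[OF _ \<theta>(1)] by simp
        qed
      qed
      also have "\<dots> = (8 * (real d)\<^sup>2 * \<theta>\<^sup>2) * real k" by (simp add: power2_eq_square)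
      also have "\<dots> \<le> \<sigma>\<^sup>2 * real k" using \<theta>(2) by (rule mult_right_mono) simp
      also have "\<dots> = (\<sigma> * \<kappa>)\<^sup>2" by (simp add: \<kappa>_def power_mult_distrib)
      finally show ?thesis using \<theta>(3) \<kappa>0 by (simp add: power2_le_iff_abs_le)
    qed
    have AB: "As \<in> mat_tuples n k" "Bs \<in> mat_tuples n k" using As Bs \<Gamma> by auto
    have crn: "e * tens (emat 0 0) (mfam Cs j) = tens (emat 0 0) (mfam Cs j)"
      "tens (emat 0 0) (mfam Cs j) * e = tens (emat 0 0) (mfam Cs j)" if "Cs \<in> mat_tuples n k" for Cs j
    proof -
      interpret um: unital_family "one_on {..<k}" "mfam Cs" by (rule unital_family_mfam[OF that])
      show "e * tens (emat 0 0) (mfam Cs j) = tens (emat 0 0) (mfam Cs j)"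
        "tens (emat 0 0) (mfam Cs j) * e = tens (emat 0 0) (mfam Cs j)"
        by (simp_all add: e_def tens_mult emat_times um.e_X um.X_e)
    qed
    have "\<exists>W. e * W = W \<and> W * e = W \<and> star W * W = e \<and> W * star W = e \<and>
      (\<forall>j<n. norm (tens (emat 0 0) (mfam As j) - star W * tens (emat 0 0) (mfam Bs j) * W) \<le>
        2 * (\<gamma> * \<kappa>) + \<sigma> * \<kappa> + 2 * R * sqrt (norm e * (2 * (\<eta> * \<kappa>) + \<sigma> * \<kappa>)))"
    proof (rule approximate_models_conjugate[where K = K and Y = L and I = "{0} \<times> {..<k}"])
      show "eproj K" unfolding KI by (rule eproj_one_on[OF I])
      show "finite ({0::nat} \<times> {..<k})" by simp
      show "{0::nat} \<times> {..<k} \<noteq> {}" using k by auto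
      show "e = one_on ({0} \<times> {..<k})" by (rule eI)
      show "approximate_model K e n (\<lambda>j. tens (emat 0 0) (mfam As j)) L (\<gamma> * \<kappa>) (\<eta> * \<kappa>) (V As) (H As) (U As)"
        using mo'[OF As] by (rule conjunct1)
      show "approximate_model K e n (\<lambda>j. tens (emat 0 0) (mfam Bs j)) L (\<gamma> * \<kappa>) (\<eta> * \<kappa>) (V Bs) (H Bs) (U Bs)"
        using mo'[OF Bs] by (rule conjunct1)
      show "norm (star (U As) * H As * U As - star (U Bs) * H Bs * U Bs) \<le> \<sigma> * \<kappa>"
        using close[of n] by (simp add: T_def)
      fix j assume j: "j < n"
      show "e * tens (emat 0 0) (mfam As j) = tens (emat 0 0) (mfam As j) \<and>
        tens (emat 0 0) (mfam As j) * e = tens (emat 0 0) (mfam As j) \<and>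
        e * tens (emat 0 0) (mfam Bs j) = tens (emat 0 0) (mfam Bs j) \<and>
        tens (emat 0 0) (mfam Bs j) * e = tens (emat 0 0) (mfam Bs j)" using crn AB by blast
      show "opb R (tens (emat 0 0) (mfam As j)) \<and> opb R (tens (emat 0 0) (mfam Bs j))"
        using xR[OF As j] xR[OF Bs j] by (simp add: opb_tens_emat)
      show "K * L j = L j \<and> L j * K = L j"
        using alg_corner[OF Y[OF j]] uu by (simp add: K_def L_def tens_mult u_def)
      show "norm (star (U As) * L j * U As - star (U Bs) * L j * U Bs) \<le> \<sigma> * \<kappa>"
        using close[of j] j by (simp add: T_def)
    qed
    then obtain W where W: "e * W = W" "W * e = W" "star W * W = e" "W * star W = e"
      and Wc: "\<forall>j<n. norm (tens (emat 0 0) (mfam As j) - star W * tens (emat 0 0) (mfam Bs j) * W) \<le>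
        2 * (\<gamma> * \<kappa>) + \<sigma> * \<kappa> + 2 * R * sqrt (norm e * (2 * (\<eta> * \<kappa>) + \<sigma> * \<kappa>))" by (elim exE conjE)
    \<comment> \<open>As \<open>norm e = \<kappa>\<close>, the square root yields a factor
      \<open>\<kappa>\<close> like the other terms, and the whole bound is proportional to
      \<open>\<kappa>\<close>.\<close>
    have "norm e * (2 * (\<eta> * \<kappa>) + \<sigma> * \<kappa>) = \<kappa>\<^sup>2 * (2 * \<eta> + \<sigma>)" by (simp add: ne power2_eq_square algebra_simps)
    then have "sqrt (norm e * (2 * (\<eta> * \<kappa>) + \<sigma> * \<kappa>)) = \<kappa> * sqrt (2 * \<eta> + \<sigma>)" using \<kappa>0 by (simp add: real_sqrt_mult)
    then have "2 * (\<gamma> * \<kappa>) + \<sigma> * \<kappa> + 2 * R * sqrt (norm e * (2 * (\<eta> * \<kappa>) + \<sigma> * \<kappa>)) =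
        (2 * \<gamma> + \<sigma> + 2 * R * sqrt (2 * \<eta> + \<sigma>)) * \<kappa>" by (simp add: algebra_simps)
    also have "\<dots> \<le> \<beta> * \<kappa>" using \<beta>(1) \<kappa>0 by (rule mult_right_mono)
    finally have "norm (tens (emat 0 0) (mfam As j) - star W * tens (emat 0 0) (mfam Bs j) * W) \<le> \<beta> * sqrt (real k)"
      if "j < n" for j using Wc[rule_format, OF that] by (simp add: \<kappa>_def)
    with k AB W[unfolded e_def] show "As \<in> orbit_ball k Bs \<omega>"
      by (rule orbit_ball_of_conjugacy[OF _ _ _ _ _ _ _ _ \<beta>(2,3)])
  qed
  also have "card (J \<rightarrow>\<^sub>E cells \<theta> (S + R')) = card (cells \<theta> (S + R')) ^ card J" by (simp add: card_PiE fJ)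
  also have "\<dots> \<le> card (cells \<theta> (S + R')) ^ ((n + 1) * (d * k * (2 * d)))"
    by (rule power_increasing[OF cJ c1])
  finally show ?thesis .
qed

end

text \<open>Traces of such polynomials are squared 2-norms; in this shape estimates for operators
  become conditions on moments that microstates inherit.\<close>

definition psq :: "ncpoly \<Rightarrow> ncpoly" where "psq p = Times (Adj p) p"

lemma Re_tr_psq: "Re (tr (pev u X (psq p))) = (norm (pev u X p))\<^sup>2"
  by (simp add: psq_def norm2_tr)

lemma Re_tr_psum_psq: "Re (tr (pev u X (psum (\<lambda>l. psq (f l)) d))) = (\<Sum>l<d. (norm (pev u X (f l)))\<^sup>2)"
  by (simp add: pev_psum tr_sum Re_tr_psq)

lemma norm_less_of_square: "(norm x)\<^sup>2 < a\<^sup>2 * real k \<Longrightarrow> a \<ge> 0 \<Longrightarrow> norm x \<le> a * sqrt (real k)"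
proof -
  assume "(norm x)\<^sup>2 < a\<^sup>2 * real k" "a \<ge> 0"
  then have "(norm x)\<^sup>2 \<le> (a * sqrt (real k))\<^sup>2" by (simp add: power_mult_distrib)
  then show ?thesis using \<open>a \<ge> 0\<close> by (simp add: power2_le_iff_abs_le)
qed

text \<open>Each constant absorbs the bounds of the objects that precede it:
  \<open>\<delta>\<^sub>1\<close> determines the finite-dimensional algebra and with it
  \<open>d\<close>, \<open>S\<^sub>1\<close>, \<open>C'\<close> and \<open>R'\<close>;
  \<open>\<delta>\<^sub>2\<close> determines the polynomials for \<open>q\<close> and with them
  \<open>C\<close>; \<open>\<delta>\<^sub>3\<close> and \<open>\<delta>\<^sub>4\<close> determine
  those for \<open>p\<close> and \<open>p'\<close>. The estimates are strict inequalities for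
  finitely many traces of polynomials, so microstates of some length and tolerance satisfy them for
  every \<open>k\<close>.\<close>

lemma covering_number_linear:
  fixes M :: "('h::complex_hilbert_space \<Rightarrow> 'h) set"
  assumes M: "von_neumann_algebra M" "hyperfinite M" and trM: "tracial_state M \<tau>"
    and xs: "generating_family M xs" and R: "R > 0" and \<omega>: "\<omega> > 0"
  shows "\<exists>m\<ge>1. \<exists>\<epsilon>>0. \<exists>C. \<forall>k\<ge>1. ln (real (orbit_covering_number k (microstates \<tau> R xs m k \<epsilon>) \<omega>)) \<le> C * real k"
proof -
  note Ms = von_neumann_star_subalgebra[OF M(1)]
  interpret ta: tracial_algebra "bops M" id_bop "\<lambda>a. \<tau> (op_of a)" by (rule tracial_algebra_bops[OF Ms trM])
  define n where "n = length xs"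
  define X where "X = family xs"
  define A where "A = range (pev id_bop X)"
  have dense: "ta.n2_dense A" unfolding A_def X_def by (rule polynomials_n2_dense[OF M(1) trM xs])
  have AM: "A \<subseteq> bops M" using dense by (simp add: ta.n2_dense_def)
  have pM: "pev id_bop X p \<in> bops M" for p using AM A_def by blast
  have xM: "X j \<in> bops M" for j using pM[of "Var j"] by simp
  \<comment> \<open>The accuracy per generator, small enough for
    \<open>real n * \<beta>\<^sup>2 < \<omega>\<^sup>2\<close>.\<close>
  define \<beta> where "\<beta> = \<omega> / (real n + 1)"
  have \<beta>0: "\<beta> > 0" using \<omega> by (simp add: \<beta>_def)
  have n\<beta>: "real n * \<beta>\<^sup>2 < \<omega>\<^sup>2"
  proof -
    have "real n * \<beta>\<^sup>2 < (real n + 1)\<^sup>2 * \<beta>\<^sup>2"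
      using \<beta>0 by (intro mult_strict_right_mono) (auto simp: power2_eq_square algebra_simps add_strict_increasing)
    also have "\<dots> = \<omega>\<^sup>2" by (simp add: \<beta>_def power_mult_distrib[symmetric] add_eq_0_iff_both_eq_0)
    finally show ?thesis .
  qed
  define \<delta>\<^sub>1 where "\<delta>\<^sub>1 = \<beta> / 8"
  have \<delta>10: "\<delta>\<^sub>1 > 0" using \<beta>0 by (simp add: \<delta>\<^sub>1_def)
  obtain vs y where vs: "set vs \<subseteq> bops M" "id_bop \<in> cspan (set vs)"
    "\<forall>a\<in>cspan (set vs). \<forall>b\<in>cspan (set vs). a * b \<in> cspan (set vs)"
    "\<forall>a\<in>cspan (set vs). star a \<in> cspan (set vs)"
    "\<forall>j<n. y j \<in> cspan (set vs) \<and> Re (\<tau> (op_of (star (X j - y j) * (X j - y j)))) < \<delta>\<^sub>1\<^sup>2 / 4"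
    using finite_dim_approximation[OF M trM, of n X "\<delta>\<^sub>1\<^sup>2 / 4"] xM \<delta>10 by auto
  define N where "N = cspan (set vs)"
  have Nm: "a * b \<in> N" if "a \<in> N" "b \<in> N" for a b using vs(3) that by (auto simp: N_def)
  have Ns: "star a \<in> N" if "a \<in> N" for a using vs(4) that by (auto simp: N_def)
  have yN: "y j \<in> N" if "j < n" for j using vs(5) that by (auto simp: N_def)
  have NM: "N \<subseteq> bops M" unfolding N_def by (rule ta.form.cspan_S[OF vs(1)])
  obtain as LM where as: "set as \<subseteq> N" and reg: "regular_matrices (length as) (\<lambda>s. LM (as ! s))"
    and LMspan: "\<And>b. b \<in> N \<Longrightarrow> LM b \<in> cspan ((\<lambda>s. LM (as ! s)) ` {..<length as})"
    and LMs: "\<And>b. b \<in> N \<Longrightarrow> star (LM b) = LM (star b)"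
    and row: "\<And>b l. b \<in> N \<Longrightarrow> l < length as \<Longrightarrow>
      star (as ! l) * b = (\<Sum>m<length as. scl (ent (LM b) l m) (star (as ! m)))"
    and one: "(\<Sum>l<length as. as ! l * star (as ! l)) = id_bop"
    using ta.regular_representation[OF N_def vs(1) vs(2)[folded N_def] Nm Ns] by blast
  define d where "d = length as"
  define \<Lambda> where "\<Lambda> s = LM (as ! s)" for s
  interpret rm: regular_matrices d \<Lambda> using reg unfolding d_def \<Lambda>_def .
  have aN: "as ! l \<in> N" if "l < d" for l using as that by (auto simp: d_def)
  have aM: "as ! l \<in> bops M" if "l < d" for l using aN[OF that] NM by blast
  have LMalg: "LM b \<in> rm.alg" if "b \<in> N" for b using LMspan[OF that, folded d_def \<Lambda>_def] unfolding rm.alg_def .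
  \<comment> \<open>The sum of the \<open>as ! l * star (as ! l)\<close> is the unit, so the
    hypothesis of \<open>fine_approximation\<close> on the generators reduces to closeness in the
    2-norm.\<close>
  have suma: "(\<Sum>l<d. ta.n2 (star (as ! l) * z)) = ta.n2 z" if z: "z \<in> bops M" for z
  proof -
    have m: "star z * (as ! l * star (as ! l) * z) \<in> bops M" if "l < d" for l
      by (intro ta.M_mult ta.M_star z aM[OF that])
    have "(\<Sum>l<d. complex_of_real (ta.n2 (star (as ! l) * z))) = (\<Sum>l<d. \<tau> (op_of (star z * (as ! l * star (as ! l) * z))))"
    proof (rule sum.cong)
      fix l assume "l \<in> {..<d}"
      then have "star (as ! l) * z \<in> bops M" using z aM by (intro ta.M_mult ta.M_star) auto
      from ta.\<tau>_star_self[OF this]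
      show "complex_of_real (ta.n2 (star (as ! l) * z)) = \<tau> (op_of (star z * (as ! l * star (as ! l) * z)))"
        by (simp add: star_mult mult.assoc)
    qed simp
    also have "\<dots> = \<tau> (op_of (\<Sum>l<d. star z * (as ! l * star (as ! l) * z)))" by (rule ta.\<tau>_sum[symmetric]) (rule m)
    also have "(\<Sum>l<d. star z * (as ! l * star (as ! l) * z)) = star z * ((\<Sum>l<d. as ! l * star (as ! l)) * z)"
      by (simp add: sum_distrib_left sum_distrib_right)
    also have "\<dots> = star z * z" using one by (simp add: d_def)
    finally have "complex_of_real (\<Sum>l<d. ta.n2 (star (as ! l) * z)) = complex_of_real (ta.n2 z)"
      using ta.\<tau>_star_self[OF z] by simp
    then show ?thesis using of_real_eq_iff by blast
  qed
  define S\<^sub>1 where "S\<^sub>1 = (\<Sum>s<d. norm1 (\<Lambda> s))"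
  define C' where "C' = (\<Sum>s<d. norm1 (\<Lambda> s) + norm1 (star (\<Lambda> s)))"
  define R' where "R' = (\<Sum>j<n. norm1 (LM (y j)) + norm1 (star (LM (y j))))"
  have nn: "S\<^sub>1 \<ge> 0" "C' \<ge> 0" "R' \<ge> 0" by (auto simp: S\<^sub>1_def C'_def R'_def norm1_nonneg intro!: sum_nonneg add_nonneg_nonneg)
  have C'b: "norm1 (\<Lambda> s) \<le> C' \<and> norm1 (star (\<Lambda> s)) \<le> C'" if "s < d" for s
  proof -
    have "norm1 (\<Lambda> s) + norm1 (star (\<Lambda> s)) \<le> C'" unfolding C'_def
      by (rule member_le_sum[of s]) (use that in \<open>auto simp: norm1_nonneg\<close>)
    then show ?thesis using norm1_nonneg[of "\<Lambda> s"] norm1_nonneg[of "star (\<Lambda> s)"] by linarith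
  qed
  have R'b: "norm1 (LM (y j)) \<le> R' \<and> norm1 (star (LM (y j))) \<le> R'" if "j < n" for j
  proof -
    have "norm1 (LM (y j)) + norm1 (star (LM (y j))) \<le> R'" unfolding R'_def
      by (rule member_le_sum[of j]) (use that in \<open>auto simp: norm1_nonneg\<close>)
    then show ?thesis using norm1_nonneg[of "LM (y j)"] norm1_nonneg[of "star (LM (y j))"] by linarith
  qed
  \<comment> \<open>This is the budget for \<open>2 * \<eta> + \<sigma>\<close>; it makes
    \<open>2 * R * sqrt t\<close> equal to \<open>\<beta> / 4\<close>.\<close>
  define t where "t = (\<beta> / (8 * R))\<^sup>2"
  have t0: "t > 0" using \<beta>0 R by (simp add: t_def)
  have sqt: "2 * R * sqrt t \<le> \<beta> / 4" using \<beta>0 R by (simp add: t_def)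
  \<comment> \<open>\<open>\<beta> / 8\<close> is for the linear term of the final bound, and
    \<open>t / 2\<close> leaves the other half of \<open>t\<close> to
    \<open>2 * \<eta>\<close>.\<close>
  define \<sigma> where "\<sigma> = min (\<beta> / 8) (t / 2)"
  have \<sigma>0: "\<sigma> > 0" using \<beta>0 t0 by (simp add: \<sigma>_def)
  \<comment> \<open>Its share of \<open>2 * \<eta>\<close> is
    \<open>4 * S\<^sub>1 * \<delta>\<^sub>2\<close>, at most \<open>t / 4\<close>. The summand 1
    guards the division.\<close>
  define \<delta>\<^sub>2 where "\<delta>\<^sub>2 = t / (16 * (S\<^sub>1 + 1))"
  have \<delta>20: "\<delta>\<^sub>2 > 0" using t0 nn by (simp add: \<delta>\<^sub>2_def)
  obtain q where q: "\<And>s. s < d \<Longrightarrow> q s \<in> A"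
    "\<And>s. s < d \<Longrightarrow> (\<Sum>m<d. ta.n2 (star (as ! m) * (q s - star (as ! s)))) < \<delta>\<^sub>2\<^sup>2 / 4"
    "\<And>s. s < d \<Longrightarrow> (\<Sum>m<d. ta.n2 (star (as ! m) * (star (q s) - as ! s))) < \<delta>\<^sub>2\<^sup>2 / 4"
    by (rule ta.coarse_approximation[OF dense NM, of d "\<lambda>l. as ! l" "\<delta>\<^sub>2\<^sup>2 / 4"]) (use aN \<delta>20 in auto)
  have "\<forall>s. \<exists>p. s < d \<longrightarrow> q s = pev id_bop X p" using q(1) by (auto simp: A_def)
  from choice[OF this] obtain Qp where Qp: "\<And>s. s < d \<Longrightarrow> q s = pev id_bop X (Qp s)" by blast
  define C where "C = (\<Sum>s<d. bound R (Qp s))"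
  have b0: "bound R p \<ge> 0" for p using R by (induction p) auto
  have C0: "C \<ge> 0" by (simp add: C_def b0 sum_nonneg)
  \<comment> \<open>Chosen after \<open>C\<close> is known: it leaves at most \<open>t / 4\<close>
    for the rest of \<open>2 * \<eta>\<close> and keeps \<open>(R + R') * \<delta>\<^sub>3\<close>
    at most \<open>\<beta> / 16\<close>.\<close>
  define \<delta>\<^sub>3 where "\<delta>\<^sub>3 = min t \<beta> / (16 * ((S\<^sub>1 + 1) * (C + C' + R + R' + 1)))"
  define D where "D = (S\<^sub>1 + 1) * (C + C' + R + R' + 1)"
  have D: "D > 0" "S\<^sub>1 * (C + C') \<le> D" "R + R' \<le> D"
  proof -
    have "0 < C + C' + R + R' + 1" using nn C0 R by simp
    then show "D > 0" using nn by (simp add: D_def)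
    have "S\<^sub>1 * (C + C') \<le> (S\<^sub>1 + 1) * (C + C' + R + R' + 1)" by (intro mult_mono) (use nn C0 R in auto)
    then show "S\<^sub>1 * (C + C') \<le> D" by (simp add: D_def)
    have "1 * (R + R') \<le> (S\<^sub>1 + 1) * (C + C' + R + R' + 1)" by (intro mult_mono) (use nn C0 R in auto)
    then show "R + R' \<le> D" by (simp add: D_def)
  qed
  have \<delta>3e: "\<delta>\<^sub>3 = min t \<beta> / (16 * D)" by (simp add: \<delta>\<^sub>3_def D_def)
  have \<delta>30: "\<delta>\<^sub>3 > 0" using t0 \<beta>0 D(1) by (simp add: \<delta>3e)
  have D\<delta>: "D * \<delta>\<^sub>3 = min t \<beta> / 16" using D(1) by (simp add: \<delta>3e)
  have b1: "(R + R') * \<delta>\<^sub>3 \<le> \<beta> / 16"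
  proof -
    have "(R + R') * \<delta>\<^sub>3 \<le> D * \<delta>\<^sub>3" using D(3) \<delta>30 by (intro mult_right_mono) auto
    also have "\<dots> \<le> \<beta> / 16" unfolding D\<delta> by simp
    finally show ?thesis .
  qed
  have b2: "S\<^sub>1 * (C + C') * \<delta>\<^sub>3 \<le> t / 16"
  proof -
    have "S\<^sub>1 * (C + C') * \<delta>\<^sub>3 \<le> D * \<delta>\<^sub>3" using D(2) \<delta>30 by (intro mult_right_mono) auto
    also have "\<dots> \<le> t / 16" unfolding D\<delta> by simp
    finally show ?thesis .
  qed
  have b3: "S\<^sub>1 * \<delta>\<^sub>2 \<le> t / 16"
  proof -
    have "S\<^sub>1 * \<delta>\<^sub>2 \<le> (S\<^sub>1 + 1) * \<delta>\<^sub>2" using \<delta>20 by (intro mult_right_mono) auto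
    also have "\<dots> = t / 16" using nn by (simp add: \<delta>\<^sub>2_def divide_eq_eq)
    finally show ?thesis .
  qed
  define \<gamma> where "\<gamma> = \<delta>\<^sub>1 + (R + R') * \<delta>\<^sub>3"
  define \<eta> where "\<eta> = S\<^sub>1 * (2 * (\<delta>\<^sub>2 + (C + C') * \<delta>\<^sub>3))"
  have \<eta>t: "2 * \<eta> + \<sigma> \<le> t"
  proof -
    have "\<eta> = 2 * (S\<^sub>1 * \<delta>\<^sub>2) + 2 * (S\<^sub>1 * (C + C') * \<delta>\<^sub>3)" by (simp add: \<eta>_def algebra_simps)
    moreover have "\<sigma> \<le> t / 2" by (simp add: \<sigma>_def)
    ultimately show ?thesis using b2 b3 by linarith
  qed
  \<comment> \<open>The three summands are at most \<open>3 * \<beta> / 8\<close>,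
    \<open>\<beta> / 8\<close> and \<open>\<beta> / 4\<close>.\<close>
  have final: "2 * \<gamma> + \<sigma> + 2 * R * sqrt (2 * \<eta> + \<sigma>) \<le> \<beta>"
  proof -
    have "2 * R * sqrt (2 * \<eta> + \<sigma>) \<le> 2 * R * sqrt t" using \<eta>t R by (intro mult_left_mono real_sqrt_le_mono) auto
    moreover have "\<sigma> \<le> \<beta> / 8" by (simp add: \<sigma>_def)
    ultimately show ?thesis using sqt b1 \<beta>0 by (simp add: \<gamma>_def \<delta>\<^sub>1_def)
  qed
  \<comment> \<open>The largest value that \<open>ex_banded_model\<close> admits for this
    \<open>\<delta>\<^sub>3\<close>.\<close>
  define \<delta>\<^sub>4 where "\<delta>\<^sub>4 = \<delta>\<^sub>3\<^sup>2 / 3"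
  have \<delta>40: "\<delta>\<^sub>4 > 0" using \<delta>30 by (simp add: \<delta>\<^sub>4_def)
  \<comment> \<open>The first component is a tag for a generator, its adjoint, \<open>q s\<close>
    and its adjoint. \<open>yy\<close> is the element of \<open>N\<close> that each approximates,
    and \<open>dd\<close> its tolerance.\<close>
  define I :: "(nat \<times> nat) set" where "I = {0, 1} \<times> {..<n} \<union> {2, 3} \<times> {..<d}"
  define xp where "xp i = (if fst i = 0 then Var (snd i) else if fst i = 1 then Adj (Var (snd i))
    else if fst i = 2 then Qp (snd i) else Adj (Qp (snd i)))" for i :: "nat \<times> nat"
  define yy where "yy i = (if fst i = 0 then y (snd i) else if fst i = 1 then star (y (snd i))
    else if fst i = 2 then star (as ! snd i) else as ! snd i)" for i :: "nat \<times> nat"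
  define dd where "dd i = (if fst i \<le> 1 then \<delta>\<^sub>1 else \<delta>\<^sub>2)" for i :: "nat \<times> nat"
  have I: "finite I" by (simp add: I_def)
  have yyN: "yy i \<in> N" if "i \<in> I" for i using that yN aN Ns by (auto simp: I_def yy_def)
  have "4 * (\<Sum>l<d. ta.n2 (star (as ! l) * (pev id_bop X (xp i) - yy i))) < (dd i)\<^sup>2" if i: "i \<in> I" for i
  proof -
    have yM: "y j \<in> bops M" if "j < n" for j using yN[OF that] NM by blast
    have n2y: "ta.n2 (X j - y j) < \<delta>\<^sub>1\<^sup>2 / 4" if "j < n" for j using vs(5) that by (simp add: ta.n2_def)
    obtain c j where ij: "i = (c, j)" by (cases i)
    consider "c = 0" "j < n" | "c = 1" "j < n" | "c = 2" "j < d" | "c = 3" "j < d" using i by (auto simp: I_def ij)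
    then show ?thesis
    proof cases
      case 1
      then show ?thesis using suma[OF ta.form.S_diff[OF xM yM], of j j] n2y[of j]
        by (simp add: ij xp_def yy_def dd_def)
    next
      case 2
      have m: "X j - y j \<in> bops M" by (intro ta.form.S_diff xM yM 2)
      have "ta.n2 (star (X j) - star (y j)) = ta.n2 (X j - y j)" using ta.n2_star[OF m] by (simp add: star_diff)
      then show ?thesis using 2 suma[of "star (X j) - star (y j)"] n2y[of j] ta.M_star[OF m]
        by (simp add: ij xp_def yy_def dd_def star_diff)
    next
      case 3
      then show ?thesis using q(2)[of j] by (simp add: ij xp_def yy_def dd_def Qp)
    next
      case 4
      then show ?thesis using q(3)[of j] by (simp add: ij xp_def yy_def dd_def Qp)
    qed
  qed
  note bd = this
  obtain p p' where p: "\<And>l. l < d \<Longrightarrow> p l \<in> A" "\<And>l. l < d \<Longrightarrow> p' l \<in> A"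
    and pI: "\<And>i. i \<in> I \<Longrightarrow> (\<Sum>l<d. ta.n2 (p l * pev id_bop X (xp i) - (\<Sum>m<d. scl (ent (LM (yy i)) l m) (p m)))) < (dd i)\<^sup>2"
    and p1: "(\<Sum>l<d. ta.n2 (p l - p' l)) < \<delta>\<^sub>4\<^sup>2" and p2: "(\<Sum>l<d. ta.n2 (p l)) < 4"
    and p3: "ta.n2 ((\<Sum>l<d. star (p' l) * p l) - id_bop) < \<delta>\<^sub>4\<^sup>2"
  proof (rule ta.fine_approximation[OF dense, of d "\<lambda>l. as ! l" I yy "\<lambda>i. ent (LM (yy i))" "\<lambda>i. pev id_bop X (xp i)" "\<lambda>i. (dd i)\<^sup>2" "\<delta>\<^sub>4\<^sup>2"])
    show "\<And>l. l < d \<Longrightarrow> as ! l \<in> bops M" by (rule aM)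
    show "(\<Sum>l<d. as ! l * star (as ! l)) = id_bop" using one by (simp add: d_def)
    show "\<And>i l. i \<in> I \<Longrightarrow> l < d \<Longrightarrow> star (as ! l) * yy i = (\<Sum>m<d. scl (ent (LM (yy i)) l m) (star (as ! m)))"
      using row[OF yyN] by (simp add: d_def)
    show "\<And>i. i \<in> I \<Longrightarrow> pev id_bop X (xp i) \<in> bops M" by (rule pM)
    show "\<And>i. i \<in> I \<Longrightarrow> yy i \<in> bops M" using yyN NM by blast
    show "finite I" by (rule I)
    show "\<delta>\<^sub>4\<^sup>2 > 0" using \<delta>40 by simp
  qed (use bd that in auto)
  have "\<forall>l. \<exists>r. l < d \<longrightarrow> p l = pev id_bop X r" "\<forall>l. \<exists>r. l < d \<longrightarrow> p' l = pev id_bop X r" using p by (auto simp: A_def)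
  then obtain Pp Pp' where Pp: "\<And>l. l < d \<Longrightarrow> p l = pev id_bop X (Pp l)" "\<And>l. l < d \<Longrightarrow> p' l = pev id_bop X (Pp' l)"
    by metis
  define Dp where "Dp i l = Plus (Times (Pp l) (xp i)) (Scale (-1) (psum (\<lambda>m. Scale (ent (LM (yy i)) l m) (Pp m)) d))" for i l
  define E1 where "E1 l = Plus (Pp l) (Scale (-1) (Pp' l))" for l
  define E3 where "E3 = Plus (psum (\<lambda>l. Times (Adj (Pp' l)) (Pp l)) d) (Scale (-1) One)"
  \<comment> \<open>Each pair consists of a polynomial whose trace is a squared 2-norm or a sum of
    such, and its bound; the bound 4 becomes \<open>2 * sqrt (real k)\<close> for the norm of the
    column.\<close>
  define F where "F = (\<lambda>i. (psum (\<lambda>l. psq (Dp i l)) d, (dd i)\<^sup>2)) ` I \<union>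
    {(psum (\<lambda>l. psq (E1 l)) d, \<delta>\<^sub>4\<^sup>2), (psum (\<lambda>l. psq (Pp l)) d, 4), (psq E3, \<delta>\<^sub>4\<^sup>2)}"
  have finF: "finite F" using I by (simp add: F_def)
  have psq: "Re (\<tau> (op_of (pev id_bop X (psum (\<lambda>l. psq (f l)) d)))) = (\<Sum>l<d. ta.n2 (pev id_bop X (f l)))" for f
  proof -
    have "\<tau> (op_of (\<Sum>l<d. pev id_bop X (psq (f l)))) = (\<Sum>l<d. \<tau> (op_of (pev id_bop X (psq (f l)))))"
      by (rule ta.\<tau>_sum) (rule pM)
    then show ?thesis by (simp add: pev_psum psq_def ta.n2_def)
  qed
  have Fb: "Re (\<tau> (op_of (pev id_bop (family xs) r))) < b" if "(r, b) \<in> F" for r b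
  proof -
    have "(r, b) \<in> (\<lambda>i. (psum (\<lambda>l. psq (Dp i l)) d, (dd i)\<^sup>2)) ` I \<or> (r, b) = (psum (\<lambda>l. psq (E1 l)) d, \<delta>\<^sub>4\<^sup>2) \<or>
      (r, b) = (psum (\<lambda>l. psq (Pp l)) d, 4) \<or> (r, b) = (psq E3, \<delta>\<^sub>4\<^sup>2)" using that by (auto simp: F_def)
    then show ?thesis
    proof (elim disjE)
      assume "(r, b) \<in> (\<lambda>i. (psum (\<lambda>l. psq (Dp i l)) d, (dd i)\<^sup>2)) ` I"
      then obtain i where i: "i \<in> I" "r = psum (\<lambda>l. psq (Dp i l)) d" "b = (dd i)\<^sup>2" by auto
      have "(\<Sum>l<d. ta.n2 (pev id_bop X (Dp i l))) = (\<Sum>l<d. ta.n2 (p l * pev id_bop X (xp i) - (\<Sum>m<d. scl (ent (LM (yy i)) l m) (p m))))"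
        by (rule sum.cong) (auto simp: Dp_def pev_psum Pp scl_minus_left)
      then show ?thesis using pI[OF i(1)] psq[of "Dp i"] by (simp add: i(2,3) X_def)
    next
      assume e: "(r, b) = (psum (\<lambda>l. psq (E1 l)) d, \<delta>\<^sub>4\<^sup>2)"
      have "(\<Sum>l<d. ta.n2 (pev id_bop X (E1 l))) = (\<Sum>l<d. ta.n2 (p l - p' l))"
        by (rule sum.cong) (auto simp: E1_def Pp scl_minus_left)
      then show ?thesis using p1 psq[of E1] e by (simp add: X_def)
    next
      assume e: "(r, b) = (psum (\<lambda>l. psq (Pp l)) d, 4)"
      have "(\<Sum>l<d. ta.n2 (pev id_bop X (Pp l))) = (\<Sum>l<d. ta.n2 (p l))" by (rule sum.cong) (auto simp: Pp)
      then show ?thesis using p2 psq[of Pp] e by (simp add: X_def)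
    next
      assume e: "(r, b) = (psq E3, \<delta>\<^sub>4\<^sup>2)"
      have "pev id_bop X E3 = (\<Sum>l<d. star (p' l) * p l) - id_bop" by (simp add: E3_def pev_psum Pp scl_minus_left)
      then show ?thesis using p3 e by (simp add: psq_def ta.n2_def X_def)
    qed
  qed
  have xsM: "set xs \<subseteq> M" using xs by (simp add: generating_family_def)
  have "\<exists>m\<ge>1. \<exists>\<epsilon>>0. \<forall>k\<ge>1. \<forall>As\<in>microstates \<tau> R xs m k \<epsilon>. \<forall>(p, b)\<in>F.
    Re (tr (pev (one_on {..<k}) (mfam As) p)) < b * real k"
    by (rule moments_transfer[OF Ms trM xsM finF]) (rule Fb)
  then obtain m \<epsilon> where m: "m \<ge> 1" and \<epsilon>: "\<epsilon> > 0" and mom: "\<forall>k\<ge>1. \<forall>As\<in>microstates \<tau> R xs m k \<epsilon>. \<forall>(p, b)\<in>F.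
    Re (tr (pev (one_on {..<k}) (mfam As) p)) < b * real k" by (elim exE conjE)
  \<comment> \<open>Makes \<open>8 * (real d)\<^sup>2 * \<theta>\<^sup>2\<close> equal to
    \<open>\<sigma>\<^sup>2 / 2\<close>.\<close>
  define \<theta> where "\<theta> = \<sigma> / (4 * real d)"
  have d0: "d > 0" by (rule rm.d0)
  have \<theta>: "\<theta> > 0" "8 * (real d)\<^sup>2 * \<theta>\<^sup>2 \<le> \<sigma>\<^sup>2"
  proof -
    show "\<theta> > 0" using \<sigma>0 d0 by (simp add: \<theta>_def)
    have *: "real d * \<theta> = \<sigma> / 4" using d0 by (simp add: \<theta>_def)
    have "8 * (real d * \<theta>)\<^sup>2 = \<sigma>\<^sup>2 / 2" unfolding * by (simp add: power_divide)
    moreover have "8 * (real d)\<^sup>2 * \<theta>\<^sup>2 = 8 * (real d * \<theta>)\<^sup>2" by (simp add: power_mult_distrib)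
    moreover have "\<sigma>\<^sup>2 / 2 \<le> \<sigma>\<^sup>2" by simp
    ultimately show "8 * (real d)\<^sup>2 * \<theta>\<^sup>2 \<le> \<sigma>\<^sup>2" by linarith
  qed
  define S where "S = (\<Sum>s<d. norm1 (\<Lambda> s) * norm1 (\<Lambda> s))"
  have S0: "S \<ge> 0" by (simp add: S_def sum_nonneg)
  \<comment> \<open>The exponent \<open>(n + 1) * (d * k * (2 * d))\<close> without its factor
    \<open>k\<close>, times the logarithm of the number of cells.\<close>
  define Cf where "Cf = ((real n + 1) * (2 * real d * real d)) * ln (real (card (cells \<theta> (S + R'))))"
  have "ln (real (orbit_covering_number k (microstates \<tau> R xs m k \<epsilon>) \<omega>)) \<le> Cf * real k" if k: "k \<ge> 1" for k
  proof -
    define u where "u = one_on {..<k}"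
    have uu: "eproj u" unfolding u_def by (rule eproj_one_on) simp
    have us: "u * u = u" "star u = u" using uu by (auto simp: eproj_def)
    let ?E = "\<lambda>z. tens (emat 0 0 :: nat fmat) (z :: nat fmat)"
    define \<Gamma> where "\<Gamma> = microstates \<tau> R xs m k \<epsilon>"
    have \<Gamma>t: "\<Gamma> \<subseteq> mat_tuples n k" by (auto simp: \<Gamma>_def microstates_def n_def)
    have momF: "Re (tr (pev u (mfam As) r)) < b * real k" if "As \<in> \<Gamma>" "(r, b) \<in> F" for As r b
      using mom[rule_format, OF k that(1)[unfolded \<Gamma>_def] that(2)] by (simp add: u_def)
    have xR: "opb R (mfam As j)" if As: "As \<in> \<Gamma>" for As j
    proof (cases "j < length As")
      case True
      have "As ! j \<in> set As" using True by simp
      then have "As ! j \<in> carrier_mat k k" "mat_opnorm (As ! j) \<le> R" using As by (auto simp: \<Gamma>_def microstates_def mat_tuples_def)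
      then show ?thesis using True R by (simp add: mfam_def opb_fm)
    next
      case False
      moreover have "opb R 0" by (rule opb_mono[OF opb_zero]) (use R in simp)
      ultimately show ?thesis by (simp add: mfam_def)
    qed
    have "card ({..<d} \<times> {..<k}) = d * k" by (simp add: card_cartesian_product)
    then obtain g where g: "bij_betw g ({..<d} \<times> {..<k}) {..<d * k}"
      using bij_betw_card[of "{..<d} \<times> {..<k}"] by auto
    have model: "\<exists>V H U h. approximate_model (tens (one_on {..<d}) u) (?E u) n (\<lambda>j. ?E (mfam As j)) (\<lambda>j. tens (LM (y j)) u)
        (\<gamma> * sqrt (real k)) (\<eta> * sqrt (real k)) V H U \<and>
      star U * H * U = dgm ({..<d} \<times> {..<k}) h \<and> opb S (star U * H * U) \<and>
      (\<forall>j<n. opb R' (star U * tens (LM (y j)) u * U)) \<and>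
      (\<forall>j<n. \<forall>a\<in>{..<d} \<times> {..<k}. \<forall>b\<in>{..<d} \<times> {..<k}.
         int d \<le> \<bar>int (g a) - int (g b)\<bar> \<longrightarrow> ent (star U * tens (LM (y j)) u * U) a b = 0)"
      if As: "As \<in> \<Gamma>" for As
    proof -
      interpret um: unital_family u "mfam As"
        unfolding u_def by (rule unital_family_mfam) (use As \<Gamma>t in blast)
      define P P' Q where "P l = pev u (mfam As) (Pp l)" and "P' l = pev u (mfam As) (Pp' l)"
        and "Q s = pev u (mfam As) (Qp s)" for l s
      have tw: "norm (rm.stack P * ?E (pev u (mfam As) (xp i)) - tens (LM (yy i)) u * rm.stack P) \<le> dd i * sqrt (real k)"
        if i: "i \<in> I" for i
      proof (rule norm_less_of_square)
        have "rm.stack P * ?E (pev u (mfam As) (xp i)) - tens (LM (yy i)) u * rm.stack P =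
            rm.stack (\<lambda>l. P l * pev u (mfam As) (xp i) - (\<Sum>m<d. scl (ent (LM (yy i)) l m) (P m)))"
          by (rule rm.stack_intertwine) (simp_all add: rm.alg_corner[OF LMalg[OF yyN[OF i]]] P_def um.pev_e)
        also have "\<dots> = rm.stack (\<lambda>l. pev u (mfam As) (Dp i l))"
          by (simp add: Dp_def P_def pev_psum scl_minus_left)
        finally have "(norm (rm.stack P * ?E (pev u (mfam As) (xp i)) - tens (LM (yy i)) u * rm.stack P))\<^sup>2 =
            Re (tr (pev u (mfam As) (psum (\<lambda>l. psq (Dp i l)) d)))" by (simp add: rm.norm_stack Re_tr_psum_psq)
        also have "\<dots> < (dd i)\<^sup>2 * real k" by (rule momF[OF As]) (use i in \<open>auto simp: F_def\<close>)
        finally show "(norm (rm.stack P * ?E (pev u (mfam As) (xp i)) - tens (LM (yy i)) u * rm.stack P))\<^sup>2 < (dd i)\<^sup>2 * real k" .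
        show "dd i \<ge> 0" using \<delta>10 \<delta>20 by (simp add: dd_def)
      qed
      have "\<exists>Vh H U h. approximate_model (tens (one_on {..<d}) u) (?E u) n (\<lambda>j. ?E (mfam As j)) (\<lambda>j. tens (LM (y j)) u)
          ((\<delta>\<^sub>1 + (R + R') * \<delta>\<^sub>3) * sqrt (real k))
          ((\<Sum>s<d. norm1 (\<Lambda> s)) * (2 * (\<delta>\<^sub>2 + (C + C') * \<delta>\<^sub>3)) * sqrt (real k)) Vh H U \<and>
        star U * H * U = dgm ({..<d} \<times> {..<k}) h \<and>
        opb (\<Sum>s<d. norm1 (\<Lambda> s) * norm1 (\<Lambda> s)) (star U * H * U) \<and>
        (\<forall>j<n. opb R' (star U * tens (LM (y j)) u * U)) \<and>
        (\<forall>j<n. \<forall>a\<in>{..<d} \<times> {..<k}. \<forall>b\<in>{..<d} \<times> {..<k}.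
           int d \<le> \<bar>int (g a) - int (g b)\<bar> \<longrightarrow> ent (star U * tens (LM (y j)) u * U) a b = 0)"
        unfolding u_def
      proof (rule rm.ex_banded_model[where p = P and p' = P' and q = Q and \<delta>\<^sub>4 = \<delta>\<^sub>4], unfold u_def[symmetric])
        show "k > 0" using k by simp
        show "u * P l = P l \<and> P l * u = P l" for l by (simp add: P_def um.pev_e)
        show "opb R (mfam As j)" for j by (rule xR[OF As])
        show "opb C (Q s)" if "s < d" for s
        proof (rule opb_mono)
          show "opb (bound R (Qp s)) (Q s)" unfolding Q_def by (rule opb_pev[OF uu xR[OF As]])
          show "bound R (Qp s) \<le> C" unfolding C_def by (rule member_le_sum[of s]) (use that b0 in auto)
        qed
        show "LM (y j) \<in> rm.alg \<and> norm1 (LM (y j)) \<le> R' \<and> norm1 (star (LM (y j))) \<le> R'" if "j < n" for j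
          using LMalg[OF yN[OF that]] R'b[OF that] by simp
        show "norm (rm.stack P * ?E (mfam As j) - tens (LM (y j)) u * rm.stack P) \<le> \<delta>\<^sub>1 * sqrt (real k)" if "j < n" for j
          using tw[of "(0, j)"] that by (simp add: I_def xp_def yy_def dd_def)
        show "norm (rm.stack P * star (?E (mfam As j)) - star (tens (LM (y j)) u) * rm.stack P) \<le> \<delta>\<^sub>1 * sqrt (real k)" if "j < n" for j
          using tw[of "(1, j)"] that by (simp add: I_def xp_def yy_def dd_def tens_star us LMs yN)
        show "norm (rm.stack P * ?E (Q s) - tens (star (\<Lambda> s)) u * rm.stack P) \<le> \<delta>\<^sub>2 * sqrt (real k)" if "s < d" for s
          using tw[of "(2, s)"] that by (simp add: I_def xp_def yy_def dd_def Q_def \<Lambda>_def LMs aN)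
        show "norm (rm.stack P * star (?E (Q s)) - tens (\<Lambda> s) u * rm.stack P) \<le> \<delta>\<^sub>2 * sqrt (real k)" if "s < d" for s
          using tw[of "(3, s)"] that by (simp add: I_def xp_def yy_def dd_def Q_def \<Lambda>_def tens_star)
        show "norm (rm.stack P - rm.stack P') \<le> \<delta>\<^sub>4 * sqrt (real k)"
        proof (rule norm_less_of_square)
          have "(norm (rm.stack P - rm.stack P'))\<^sup>2 = Re (tr (pev u (mfam As) (psum (\<lambda>l. psq (E1 l)) d)))"
            by (simp add: rm.stack_diff rm.norm_stack Re_tr_psum_psq E1_def P_def P'_def scl_minus_left)
          then show "(norm (rm.stack P - rm.stack P'))\<^sup>2 < \<delta>\<^sub>4\<^sup>2 * real k" using momF[OF As, of _ "\<delta>\<^sub>4\<^sup>2"] by (simp add: F_def)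
          show "\<delta>\<^sub>4 \<ge> 0" using \<delta>40 by simp
        qed
        show "norm (rm.stack P) \<le> 2 * sqrt (real k)"
        proof (rule norm_less_of_square)
          have "(norm (rm.stack P))\<^sup>2 = Re (tr (pev u (mfam As) (psum (\<lambda>l. psq (Pp l)) d)))"
            by (simp add: rm.norm_stack Re_tr_psum_psq P_def)
          then show "(norm (rm.stack P))\<^sup>2 < 2\<^sup>2 * real k"
            using momF[OF As, of "psum (\<lambda>l. psq (Pp l)) d" 4] by (simp add: F_def)
        qed simp
        show "norm (star (rm.stack P') * rm.stack P - ?E u) \<le> \<delta>\<^sub>4 * sqrt (real k)"
        proof (rule norm_less_of_square)
          have "star (rm.stack P') * rm.stack P - ?E u = ?E (pev u (mfam As) E3)"
            by (simp add: rm.star_stack_times E3_def pev_psum P_def P'_def tens_diff_right scl_minus_left)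
          then have "(norm (star (rm.stack P') * rm.stack P - ?E u))\<^sup>2 = Re (tr (pev u (mfam As) (psq E3)))"
            by (simp add: norm_tens Re_tr_psq)
          then show "(norm (star (rm.stack P') * rm.stack P - ?E u))\<^sup>2 < \<delta>\<^sub>4\<^sup>2 * real k"
            using momF[OF As, of "psq E3" "\<delta>\<^sub>4\<^sup>2"] by (simp add: F_def)
          show "\<delta>\<^sub>4 \<ge> 0" using \<delta>40 by simp
        qed
        show "3 * \<delta>\<^sub>4 \<le> \<delta>\<^sub>3\<^sup>2" by (simp add: \<delta>\<^sub>4_def)
        show "\<delta>\<^sub>3 \<ge> 0" using \<delta>30 by simp
        show "norm1 (\<Lambda> s) \<le> C' \<and> norm1 (star (\<Lambda> s)) \<le> C'" if "s < d" for s by (rule C'b[OF that])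
        show "bij_betw g ({..<d} \<times> {..<k}) {..<d * k}" by (rule g)
      qed
      then show ?thesis unfolding \<gamma>_def \<eta>_def S_def S\<^sub>1_def .
    qed
    have "orbit_covering_number k \<Gamma> \<omega> \<le> card (cells \<theta> (S + R')) ^ ((n + 1) * (d * k * (2 * d)))"
    proof (rule rm.covering_number_of_models[where Y = "\<lambda>j. LM (y j)" and g = g])
      show "k > 0" using k by simp
      show "\<Gamma> \<subseteq> mat_tuples n k" by (rule \<Gamma>t)
      show "opb R (mfam As j)" if "As \<in> \<Gamma>" for As j by (rule xR[OF that])
      show "LM (y j) \<in> rm.alg" if "j < n" for j by (rule LMalg[OF yN[OF that]])
      show "S \<ge> 0" "R' \<ge> 0" by (rule S0, rule nn)
      show "\<theta> > 0" "8 * (real d)\<^sup>2 * \<theta>\<^sup>2 \<le> \<sigma>\<^sup>2" by (rule \<theta>)+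
      show "\<sigma> \<ge> 0" using \<sigma>0 by simp
      show "bij_betw g ({..<d} \<times> {..<k}) {..<d * k}" by (rule g)
    qed (use model final n\<beta> \<omega> in \<open>auto simp: u_def\<close>)
    then have le: "real (orbit_covering_number k \<Gamma> \<omega>) \<le> real (card (cells \<theta> (S + R'))) ^ ((n + 1) * (d * k * (2 * d)))"
      by (metis of_nat_le_iff of_nat_power)
    have fc: "finite (cells \<theta> (S + R'))" by (simp add: cells_def)
    have "cell \<theta> 0 \<in> cells \<theta> (S + R')" by (rule cell_in_cells[OF \<theta>(1)]) (use S0 nn in simp)
    then have c1: "real (card (cells \<theta> (S + R'))) \<ge> 1" using fc by (metis One_nat_def Suc_leI card_gt_0_iff empty_iff of_nat_1 of_nat_le_iff)
    have "ln (real (orbit_covering_number k \<Gamma> \<omega>)) \<le> ln (real (card (cells \<theta> (S + R'))) ^ ((n + 1) * (d * k * (2 * d))))"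
    \<comment> \<open>\<open>ln_mono\<close> asks for a positive argument, so the value 0 is treated
      apart.\<close>
    proof (cases "orbit_covering_number k \<Gamma> \<omega> = 0")
      case True
      then show ?thesis using c1 by (simp add: ln_realpow)
    next
      case False
      then show ?thesis using le by (simp add: ln_mono)
    qed
    also have "\<dots> = real ((n + 1) * (d * k * (2 * d))) * ln (real (card (cells \<theta> (S + R'))))"
      by (rule ln_realpow)
    also have "\<dots> = Cf * real k" by (simp add: Cf_def algebra_simps)
    finally show ?thesis by (simp add: \<Gamma>_def)
  qed
  then show ?thesis using m \<epsilon> by blast
qed

theorem theorem2:
  fixes M :: "('h::complex_hilbert_space \<Rightarrow> 'h) set"
    and \<tau> :: "('h \<Rightarrow> 'h) \<Rightarrow> complex"
  assumes "von_neumann_algebra M"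
    and "hyperfinite M"
    and "tracial_state M \<tau>"
    and "finitely_generated M"
  shows "upper_free_orbit_dimension M \<tau> = 0"
proof (rule antisym)
  have "orbit_dim_R \<tau> xs \<omega> R \<le> 0" if xs: "generating_family M xs" and \<omega>: "0 < \<omega>" "\<omega> < 1" and R: "R > 0" for xs \<omega> R
  proof -
    obtain m \<epsilon> C where m: "m \<ge> 1" "\<epsilon> > 0"
      and C: "\<And>k. k \<ge> 1 \<Longrightarrow> ln (real (orbit_covering_number k (microstates \<tau> R xs m k \<epsilon>) \<omega>)) \<le> C * real k"
      using covering_number_linear[OF assms(1-3) xs R \<omega>(1)] by blast
    let ?f = "\<lambda>k. ln (real (orbit_covering_number k (microstates \<tau> R xs m k \<epsilon>) \<omega>)) / (- (real k)\<^sup>2 * ln \<omega>)"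
    have lnw: "- ln \<omega> > 0" using \<omega> by simp
    have le: "?f k \<le> (C / (- ln \<omega>)) / real k" if k: "k \<ge> 1" for k
    proof -
      have "?f k \<le> (C * real k) / (- (real k)\<^sup>2 * ln \<omega>)"
        using C[OF k] lnw by (intro divide_right_mono) (simp_all add: mult_nonneg_nonpos)
      also have "\<dots> = (C / (- ln \<omega>)) / real k" using k lnw by (simp add: power2_eq_square field_simps)
      finally show ?thesis .
    qed
    have "(\<lambda>k. (C / (- ln \<omega>)) / real k) \<longlonglongrightarrow> 0" by (rule lim_const_over_n)
    then have "(\<lambda>k. ereal ((C / (- ln \<omega>)) / real k)) \<longlonglongrightarrow> ereal 0" by (simp only: lim_ereal)
    then have "limsup (\<lambda>k. ereal ((C / (- ln \<omega>)) / real k)) = ereal 0"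
      by (intro lim_imp_Limsup) simp
    moreover have "limsup (\<lambda>k. ereal (?f k)) \<le> limsup (\<lambda>k. ereal ((C / (- ln \<omega>)) / real k))"
    proof (rule Limsup_mono)
      \<comment> \<open>The bound is known from \<open>k = 1\<close> on, and a limsup needs no
        more.\<close>
      show "\<forall>\<^sub>F k in sequentially. ereal (?f k) \<le> ereal ((C / (- ln \<omega>)) / real k)"
        using le eventually_sequentially by (metis (no_types, lifting) ereal_less_eq(3))
    qed
    ultimately have "limsup (\<lambda>k. ereal (?f k)) \<le> 0" unfolding zero_ereal_def by (metis (no_types))
    moreover have "(m, \<epsilon>) \<in> {1..} \<times> {0<..}" using m by simp
    \<comment> \<open>An infimum is bounded by its value at the single pair found above.\<close>
    ultimately show ?thesis unfolding orbit_dim_R_def by (intro INF_lower2[of "(m, \<epsilon>)"]) auto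
  qed
  then show "upper_free_orbit_dimension M \<tau> \<le> 0"
    unfolding upper_free_orbit_dimension_def upper_orbit_dim_def orbit_dim_def
    by (intro SUP_least) auto
  \<comment> \<open>Finite generation is used here: over an empty set of families the supremum would
    be the least extended real.\<close>
  obtain xs where xs: "generating_family M xs" using assms(4) by (auto simp: finitely_generated_def)
  \<comment> \<open>One value of \<open>\<omega>\<close> and one of \<open>R\<close> suffice for a
    lower bound of the suprema.\<close>
  have "0 \<le> orbit_dim_R \<tau> xs (1/2) 1"
    unfolding orbit_dim_R_def
  proof (rule INF_greatest, clarify)
    fix m :: nat and \<epsilon> :: real
    \<comment> \<open>Natural numbers have nonnegative logarithms, 0 included by the default value
      of \<open>ln\<close> there, so every quotient is nonnegative.\<close>
    have "ln (real j) \<ge> 0" for j :: nat by (cases "j = 0") auto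
    moreover have "- (real k)\<^sup>2 * ln (1/2) \<ge> 0" for k by (simp add: mult_nonneg_nonpos ln_div)
    ultimately have "0 \<le> ereal (ln (real (orbit_covering_number k (microstates \<tau> 1 xs m k \<epsilon>) (1/2))) / (- (real k)\<^sup>2 * ln (1/2)))" for k
      by (simp only: ereal_less_eq(5) divide_nonneg_nonneg)
    then have "limsup (\<lambda>k. 0::ereal) \<le> limsup (\<lambda>k. ereal (ln (real (orbit_covering_number k (microstates \<tau> 1 xs m k \<epsilon>) (1/2)))
        / (- (real k)\<^sup>2 * ln (1/2))))"
      by (intro Limsup_mono) simp
    then show "0 \<le> limsup (\<lambda>k. ereal (ln (real (orbit_covering_number k (microstates \<tau> 1 xs m k \<epsilon>) (1/2)))
        / (- (real k)\<^sup>2 * ln (1/2))))"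
      by (simp add: Limsup_const)
  qed
  also have "\<dots> \<le> orbit_dim \<tau> xs (1/2)" unfolding orbit_dim_def by (rule SUP_upper) simp
  also have "\<dots> \<le> upper_orbit_dim \<tau> xs" unfolding upper_orbit_dim_def by (rule SUP_upper) simp
  also have "\<dots> \<le> upper_free_orbit_dimension M \<tau>"
    unfolding upper_free_orbit_dimension_def using xs by (intro SUP_upper) simp
  finally show "0 \<le> upper_free_orbit_dimension M \<tau>" .
qed

end
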